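(* Suppose $c^2<1$ and $\beta<\beta_*=2\sqrt{1-c^2}$. Let $\varphi\in\mathscr G(\beta,c)$ and $\vec\varphi=(\varphi,-c\varphi)$. Suppose there exists $\vec\psi\in H^2(\mathbb R)\times H^2(\mathbb R)$ with $\partial_x\vec\psi\in L^1(\mathbb R)\times L^1(\mathbb R)$ such that 1. $\langle Q'(\vec\varphi),\partial_x\vec\psi\rangle=0$, and 2. $\langle H\partial_x\vec\psi,\partial_x\vec\psi\rangle<0$. Then the orbit $\mathcal O_{\vec\varphi}$ is $\mathscr X$-unstable.
   Context: Setting: - $p\ge2$, and $f\in C^2(\mathbb R)$ is homogeneous of degree $p$, i.e. $f(\lambda s)=\lambda^pf(s)$ for $\lambda>0$. - $F(s)=\int_0^sf$, assumed to take a positive value somewhere. - $\mathscr X=H^2(\mathbb R)\times L^2(\mathbb R)$. - Evolution system: $u_t=v_x$, $v_t=(u+\beta u_{xx}+u_{xxxx}-f(u))_x$. Ground states: - $I(u)=\int u_{xx}^2-\beta u_x^2+(1-c^2)u^2$ and $K(u)=(p+1)\int F(u)$. - $m(\beta,c)=\inf\{I/K^{2/(p+1)}:u\in H^2,K(u)>0\}$. - $\mathscr G(\beta,c)=\{\varphi\in H^2:I(\varphi)=K(\varphi)=m^{(p+1)/(p-1)}\}$. These are solutions of $(1-c^2)\varphi+\beta\varphi''+\varphi''''=f(\varphi)$. Functionals and the operator $H$: - $E(u,v)=\int\frac12(u_{xx}^2-\beta u_x^2+u^2+v^2)-F(u)$ and $Q(u,v)=\int uv$, so that $Q'(\vec\varphi)=(-c\varphi,\varphi)$.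 - Pairings $\langle\cdot,\cdot\rangle$ are $L^2\times L^2$ pairings. - $H=E''(\vec\varphi)+cQ''(\vec\varphi)$, given by $$\langle H(u_1,v_1),(u_2,v_2)\rangle=\int(u_1''''+\beta u_1''+(1-c^2)u_1-f'(\varphi)u_1)u_2+(cu_1+v_1)(cu_2+v_2)\,dx.$$ Orbits and instability: - $\tau_r\vec w=\vec w(\cdot+r)$ and $\mathcal O_{\vec\varphi}=\{\tau_r\vec\varphi:r\in\mathbb R\}$. - A set $S\subseteq\mathscr X$ is $\mathscr X$-stable if for every $\epsilon>0$ there is $\delta>0$ such that $\inf_{\vec\psi\in S}\|\vec w_0-\vec\psi\|_{\mathscr X}<\delta$ implies: the solution with data $\vec w_0$ exists for all $t>0$ and $\sup_{t>0}\inf_{\vec\psi\in S}\|\vec w(t)-\vec\psi\|_{\mathscr X}<\epsilon$. - $S$ is $\mathscr X$-unstable otherwise.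
   Formalization: The first component of ∂ₓψ is additionally assumed to lie in H²(ℝ), since for ψ only in H²×H² the pairing ⟨H∂ₓψ,∂ₓψ⟩ (with its fourth-derivative term) is undefined; it is read as the integrated-by-parts quadratic form. *)

theory Defs
  imports "HOL-Analysis.Analysis"
begin

type_synonym rfun = "real \<Rightarrow> real"
type_synonym state = "rfun \<times> rfun"

definition test_fun :: "rfun \<Rightarrow> bool" where
  "test_fun \<psi> \<longleftrightarrow> (\<forall>k x. (deriv ^^ k) \<psi> differentiable (at x))
                    \<and> (\<exists>R. \<forall>x. R < \<bar>x\<bar> \<longrightarrow> \<psi> x = 0)"

definition L2 :: "rfun \<Rightarrow> bool" where
  "L2 u \<longleftrightarrow> u \<in> borel_measurable lborel \<and> integrable lborel (\<lambda>x. (u x)^2)"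

definition L1 :: "rfun \<Rightarrow> bool" where
  "L1 u \<longleftrightarrow> integrable lborel u"

definition has_weak_deriv :: "rfun \<Rightarrow> rfun \<Rightarrow> bool" where
  "has_weak_deriv u g \<longleftrightarrow>
     (\<forall>\<psi>. test_fun \<psi> \<longrightarrow> (\<integral>x. u x * deriv \<psi> x \<partial>lborel) = - (\<integral>x. g x * \<psi> x \<partial>lborel))"

text \<open>A chosen L2 representative of the weak derivative (unique a.e.).\<close>
definition wd :: "rfun \<Rightarrow> rfun" where
  "wd u = (SOME g. L2 g \<and> has_weak_deriv u g)"

definition H1 :: "rfun \<Rightarrow> bool" where
  "H1 u \<longleftrightarrow> L2 u \<and> (\<exists>g. L2 g \<and> has_weak_deriv u g)"

definition H2 :: "rfun \<Rightarrow> bool" where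
  "H2 u \<longleftrightarrow> H1 u \<and> H1 (wd u)"

definition inX :: "state \<Rightarrow> bool" where
  "inX w \<longleftrightarrow> H2 (fst w) \<and> L2 (snd w)"

definition H2norm_sq :: "rfun \<Rightarrow> real" where
  "H2norm_sq u = (\<integral>x. (u x)^2 + (wd u x)^2 + (wd (wd u) x)^2 \<partial>lborel)"

definition L2norm_sq :: "rfun \<Rightarrow> real" where
  "L2norm_sq u = (\<integral>x. (u x)^2 \<partial>lborel)"

definition Xdist :: "state \<Rightarrow> state \<Rightarrow> real" where
  "Xdist w z = sqrt (H2norm_sq (\<lambda>x. fst w x - fst z x) + L2norm_sq (\<lambda>x. snd w x - snd z x))"

text \<open>Solution on [0,T) of u_t = v_x, v_t = (u + beta u_xx + u_xxxx - f(u))_x with data w0: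
  continuous into X, and the equations hold in the distributional sense in x
  (tested against test functions, differentiated in t).\<close>
definition is_solution :: "rfun \<Rightarrow> real \<Rightarrow> state \<Rightarrow> real \<Rightarrow> (real \<Rightarrow> state) \<Rightarrow> bool" where
  "is_solution f \<beta> w0 T w \<longleftrightarrow>
     (\<forall>t\<in>{0..<T}. inX (w t)) \<and>
     (\<forall>t\<in>{0..<T}. ((\<lambda>s. Xdist (w s) (w t)) \<longlongrightarrow> 0) (at t within {0..<T})) \<and>
     Xdist (w 0) w0 = 0 \<and>
     (\<forall>\<psi>. test_fun \<psi> \<longrightarrow> (\<forall>t\<in>{0..<T}.
        ((\<lambda>s. \<integral>x. fst (w s) x * \<psi> x \<partial>lborel) has_real_derivative
           (- (\<integral>x. snd (w t) x * deriv \<psi> x \<partial>lborel))) (at t within {0..<T}) \<and>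
        ((\<lambda>s. \<integral>x. snd (w s) x * \<psi> x \<partial>lborel) has_real_derivative
           (- (\<integral>x. (fst (w t) x + \<beta> * wd (wd (fst (w t))) x - f (fst (w t) x)) * deriv \<psi> x \<partial>lborel)
            - (\<integral>x. wd (wd (fst (w t))) x * (deriv ^^ 3) \<psi> x \<partial>lborel))) (at t within {0..<T})))"

definition global_solution :: "rfun \<Rightarrow> real \<Rightarrow> state \<Rightarrow> (real \<Rightarrow> state) \<Rightarrow> bool" where
  "global_solution f \<beta> w0 w \<longleftrightarrow> (\<forall>T>0. is_solution f \<beta> w0 T w)"

definition X_stable :: "rfun \<Rightarrow> real \<Rightarrow> state set \<Rightarrow> bool" where
  "X_stable f \<beta> S \<longleftrightarrow>
     (\<forall>\<epsilon>>0. \<exists>\<delta>>0. \<forall>w0. inX w0 \<and> (INF z\<in>S. Xdist w0 z) < \<delta> \<longrightarrow>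
        (\<exists>w. global_solution f \<beta> w0 w \<and>
             (\<exists>\<eta><\<epsilon>. \<forall>t>0. (INF z\<in>S. Xdist (w t) z) \<le> \<eta>)))"

definition shift :: "real \<Rightarrow> state \<Rightarrow> state" where
  "shift r w = ((\<lambda>x. fst w (x + r)), (\<lambda>x. snd w (x + r)))"

definition orbit :: "state \<Rightarrow> state set" where
  "orbit w = range (\<lambda>r. shift r w)"

definition C2 :: "rfun \<Rightarrow> bool" where
  "C2 f \<longleftrightarrow> (\<exists>f1 f2. (\<forall>x. (f has_real_derivative f1 x) (at x)) \<and>
                       (\<forall>x. (f1 has_real_derivative f2 x) (at x)) \<and> continuous_on UNIV f2)"

definition Fprim :: "rfun \<Rightarrow> real \<Rightarrow> real" where
  "Fprim f s = (if 0 \<le> s then integral {0..s} f else - integral {s..0} f)"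

definition Ifun :: "real \<Rightarrow> real \<Rightarrow> rfun \<Rightarrow> real" where
  "Ifun \<beta> c u = (\<integral>x. (wd (wd u) x)^2 - \<beta> * (wd u x)^2 + (1 - c^2) * (u x)^2 \<partial>lborel)"

definition Kfun :: "rfun \<Rightarrow> real \<Rightarrow> rfun \<Rightarrow> real" where
  "Kfun f p u = (p + 1) * (\<integral>x. Fprim f (u x) \<partial>lborel)"

definition mval :: "rfun \<Rightarrow> real \<Rightarrow> real \<Rightarrow> real \<Rightarrow> real" where
  "mval f p \<beta> c = Inf {Ifun \<beta> c u / (Kfun f p u) powr (2 / (p + 1)) | u. H2 u \<and> Kfun f p u > 0}"

definition ground_states :: "rfun \<Rightarrow> real \<Rightarrow> real \<Rightarrow> real \<Rightarrow> rfun set" where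
  "ground_states f p \<beta> c = {\<phi>. H2 \<phi> \<and>
      Ifun \<beta> c \<phi> = mval f p \<beta> c powr ((p + 1) / (p - 1)) \<and>
      Kfun f p \<phi> = mval f p \<beta> c powr ((p + 1) / (p - 1))}"

text \<open>Quadratic form of H = E''(phi) + c Q''(phi) at (u,v), written in its
  integrated-by-parts (form) version: <H(u,v),(u,v)>.\<close>
definition Hform :: "rfun \<Rightarrow> real \<Rightarrow> real \<Rightarrow> rfun \<Rightarrow> rfun \<Rightarrow> rfun \<Rightarrow> real" where
  "Hform f \<beta> c \<phi> u v = (\<integral>x. (wd (wd u) x)^2 - \<beta> * (wd u x)^2 + (1 - c^2) * (u x)^2
        - deriv f (\<phi> x) * (u x)^2 + (c * u x + v x)^2 \<partial>lborel)"

end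

theory Submission
  imports Defs
begin

text \<open>The action \<open>S = E + cQ\<close> has the ground state as a minimiser on the level set \<open>K = K(\<phi>)\<close>. Let
  \<open>y = \<partial>\<^sub>x\<psi>\<close>. If \<open>w\<close> is close to the orbit and \<open>S(w) < S(\<phi>)\<close>, the line \<open>s \<mapsto> w + s y\<close> (with \<open>y\<close> suitably
  translated) meets that level set for some small \<open>s\<close>, because \<open>y\<close> cannot be tangent to it; since \<open>S\<close> is
  concave along the line, \<open>\<bar>\<langle>S'(w), y\<rangle>\<bar>\<close> is bounded below by the deficit \<open>S(\<phi>) - S(w)\<close>. On the other hand
  \<open>A(t)\<close>, the pairing of a solution with the translate by \<open>r(t)\<close> of \<open>(\<psi>\<^sub>2, \<psi>\<^sub>1)\<close>, is bounded as long as the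
  solution stays close to the orbit. Choosing \<open>r(t)\<close> as a critical point of the pairing in the translation
  parameter gives \<open>A' = - \<langle>S'(w), y\<rangle>\<close>, with no contribution of \<open>r'\<close>. As \<open>S\<close> is conserved, \<open>A\<close> would grow
  linearly if data \<open>\<phi> + s y\<close> led to a solution close to the orbit for all times.

  Solutions are only distributional, so conservation of \<open>S\<close> has to be derived: it holds up to commutators for
  the mollified solution, and these vanish in the limit.\<close>

section \<open>Square integrable functions on the line\<close>

text \<open>Stability, assumed for contradiction, itself supplies the global solution, so no
  existence or uniqueness theory is called upon. What is known of the solution is continuity in time
  with values in H^2 x L^2 and the tested equations, and this shapes the proof. The given direction
  is replaced by test functions, because the pairing A can be differentiated in time only against
  such. The translation parameter is merely shown to move at most linearly near each time; since A
  is critical in it, this motion costs only the square of the time increment. The slope of the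
  action is bounded below in absolute value, not in sign: the mean value theorem evaluates it at a
  single time, so that is enough. That \<open>y\<close> is not tangent to the level set of K comes
  from minimality: along a tangent direction K changes to second order only, and the inequality
  \<open>I \<ge> m K^(2/(p+1))\<close> then forces a non-negative second variation. Zeros in the
  translation parameter are found by the intermediate value theorem with an explicit slope, which
  also yields the rate at which they move.\<close>

definition ip :: "rfun \<Rightarrow> rfun \<Rightarrow> real" where
  "ip u v = (\<integral>x. u x * v x \<partial>lborel)"

text \<open>Functions are not identified almost everywhere, so this is a seminorm. It is 0 for a
  function that is not square integrable, by the default value of the Bochner integral; hence the
  \<open>L2\<close> hypotheses in the estimates.\<close>

definition nrm :: "rfun \<Rightarrow> real" where
  "nrm u = sqrt (\<integral>x. (u x)^2 \<partial>lborel)"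

lemma L2_meas: "L2 u \<Longrightarrow> u \<in> borel_measurable borel"
  by (simp add: L2_def)

lemma L2_sq_integrable: "L2 u \<Longrightarrow> integrable lborel (\<lambda>x. (u x)^2)"
  by (simp add: L2_def)

lemma L2_mult_integrable:
  assumes "L2 u" "L2 v"
  shows "integrable lborel (\<lambda>x. u x * v x)"
proof (rule Bochner_Integration.integrable_bound)
  show "integrable lborel (\<lambda>x. (u x)^2 + (v x)^2)"
    using assms by (auto simp: L2_def)
  show "(\<lambda>x. u x * v x) \<in> borel_measurable lborel"
    using assms by (auto simp: L2_def)
  have "\<bar>a * b\<bar> \<le> a\<^sup>2 + b\<^sup>2" for a b :: real
  proof -
    have "2 * (\<bar>a\<bar> * \<bar>b\<bar>) \<le> a\<^sup>2 + b\<^sup>2"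
      using sum_squares_bound[of "\<bar>a\<bar>" "\<bar>b\<bar>"] by simp
    moreover have "0 \<le> \<bar>a\<bar> * \<bar>b\<bar>" by simp
    ultimately show ?thesis unfolding abs_mult by linarith
  qed
  then show "AE x in lborel. norm (u x * v x) \<le> norm ((u x)^2 + (v x)^2)"
    by (simp add: abs_mult)
qed

lemma L2_abs_mult_integrable:
  "L2 u \<Longrightarrow> L2 v \<Longrightarrow> integrable lborel (\<lambda>x. \<bar>u x\<bar> * \<bar>v x\<bar>)"
  using integrable_abs[OF L2_mult_integrable[of u v]] by (simp add: abs_mult)

lemma L2_add: assumes "L2 u" "L2 v" shows "L2 (\<lambda>x. u x + v x)"
proof -
  have "integrable lborel (\<lambda>x. (u x)^2 + 2 * (u x * v x) + (v x)^2)"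
    using assms L2_mult_integrable[OF assms] by (auto simp: L2_def)
  then have "integrable lborel (\<lambda>x. (u x + v x)^2)"
    by (simp add: power2_sum algebra_simps)
  then show ?thesis using assms by (auto simp: L2_def)
qed

lemma L2_scale: "L2 u \<Longrightarrow> L2 (\<lambda>x. a * u x)"
  by (auto simp: L2_def power_mult_distrib)

lemma L2_minus: "L2 u \<Longrightarrow> L2 (\<lambda>x. - u x)"
  by (auto simp: L2_def)

lemma L2_diff: "L2 u \<Longrightarrow> L2 v \<Longrightarrow> L2 (\<lambda>x. u x - v x)"
  using L2_add[of u "\<lambda>x. - v x"] L2_minus[of v] by simp

lemma L2_zero: "L2 (\<lambda>x. 0)"
  by (simp add: L2_def)

lemma L2_abs: "L2 u \<Longrightarrow> L2 (\<lambda>x. \<bar>u x\<bar>)"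
  by (auto simp: L2_def)

lemmas L2_intros = L2_add L2_diff L2_scale L2_minus L2_zero L2_abs

lemma L2_bound:
  assumes "L2 v" "u \<in> borel_measurable borel" "AE x in lborel. \<bar>u x\<bar> \<le> C * \<bar>v x\<bar>"
  shows "L2 u"
proof -
  have "integrable lborel (\<lambda>x. (u x)^2)"
  proof (rule Bochner_Integration.integrable_bound)
    show "integrable lborel (\<lambda>x. C^2 * (v x)^2)" using assms by (auto simp: L2_def)
    show "AE x in lborel. norm ((u x)\<^sup>2) \<le> norm (C\<^sup>2 * (v x)\<^sup>2)"
      using assms(3)
    proof eventually_elim
      case (elim x)
      have "(\<bar>u x\<bar>)\<^sup>2 \<le> (C * \<bar>v x\<bar>)\<^sup>2" by (rule power_mono[OF elim]) simp
      then show ?case by (simp add: power_mult_distrib)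
    qed
  qed (use assms in auto)
  then show ?thesis using assms by (auto simp: L2_def)
qed

lemma L2_mult_bounded:
  assumes "L2 v" "b \<in> borel_measurable borel" "\<And>x. \<bar>b x\<bar> \<le> C"
  shows "L2 (\<lambda>x. b x * v x)"
  by (rule L2_bound[OF assms(1), where C = C])
     (use assms in \<open>auto simp: L2_def abs_mult intro!: mult_right_mono\<close>)

lemma nrm_nonneg[simp]: "0 \<le> nrm u"
  by (simp add: nrm_def)

lemma nrm_sq: "(nrm u)^2 = (\<integral>x. (u x)^2 \<partial>lborel)"
  by (simp add: nrm_def)

lemma nrm_sq_ip: "(nrm u)^2 = ip u u"
  by (simp add: nrm_def ip_def power2_eq_square)

lemma ip_add_left: "L2 u \<Longrightarrow> L2 v \<Longrightarrow> L2 w \<Longrightarrow> ip (\<lambda>x. u x + v x) w = ip u w + ip v w"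
  by (simp add: ip_def distrib_right L2_mult_integrable)

lemma ip_diff_left: "L2 u \<Longrightarrow> L2 v \<Longrightarrow> L2 w \<Longrightarrow> ip (\<lambda>x. u x - v x) w = ip u w - ip v w"
  by (simp add: ip_def left_diff_distrib L2_mult_integrable)

lemma ip_scale_left: "ip (\<lambda>x. a * u x) w = a * ip u w"
  by (simp add: ip_def mult.assoc)

lemma ip_minus_left: "ip (\<lambda>x. - u x) w = - ip u w"
  by (simp add: ip_def)

lemma ip_commute: "ip u v = ip v u"
  by (simp add: ip_def mult.commute)

lemma ip_add_right: "L2 u \<Longrightarrow> L2 v \<Longrightarrow> L2 w \<Longrightarrow> ip w (\<lambda>x. u x + v x) = ip w u + ip w v"
  by (simp add: ip_commute[of w] ip_add_left)

lemma ip_diff_right: "L2 u \<Longrightarrow> L2 v \<Longrightarrow> L2 w \<Longrightarrow> ip w (\<lambda>x. u x - v x) = ip w u - ip w v"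
  by (simp add: ip_commute[of w] ip_diff_left)

lemma ip_scale_right: "ip w (\<lambda>x. a * u x) = a * ip w u"
  by (simp add: ip_commute[of w] ip_scale_left)

lemma ip_minus_right: "ip w (\<lambda>x. - u x) = - ip w u"
  by (simp add: ip_commute[of w] ip_minus_left)

lemmas ip_simps = ip_add_left ip_add_right ip_diff_left ip_diff_right ip_scale_left
  ip_scale_right ip_minus_left ip_minus_right

lemma ip_self_nonneg: "0 \<le> ip u u"
  by (simp add: ip_def)

lemma Cauchy_Schwarz_ip:
  assumes "L2 u" "L2 v"
  shows "\<bar>ip u v\<bar> \<le> nrm u * nrm v"
proof -
  have q: "0 \<le> ip u u - 2 * t * ip u v + t^2 * ip v v" for t
  proof -
    have "0 \<le> ip (\<lambda>x. u x - t * v x) (\<lambda>x. u x - t * v x)" by (rule ip_self_nonneg)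
    also have "\<dots> = ip u u - 2 * t * ip u v + t^2 * ip v v"
      using assms by (simp add: ip_simps L2_intros ip_commute[of v u] power2_eq_square algebra_simps)
    finally show ?thesis .
  qed
  have "(ip u v)^2 \<le> ip u u * ip v v"
  proof (cases "ip v v = 0")
    case True
    have "ip u v = 0"
    proof (rule ccontr)
      assume nz: "ip u v \<noteq> 0"
      \<comment> \<open>With \<open>ip v v = 0\<close> the quadratic is affine in \<open>t\<close>;
        this \<open>t\<close> makes it equal to -1.\<close>
      have "0 \<le> ip u u - 2 * ((ip u u + 1) / (2 * ip u v)) * ip u v"
        using q[of "(ip u u + 1) / (2 * ip u v)"] True by simp
      then show False using nz by simp
    qed
    then show ?thesis by (simp add: True)
  next
    case False
    then have pos: "ip v v > 0" using ip_self_nonneg[of v] by simp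
    have "0 \<le> ip u u - 2 * (ip u v / ip v v) * ip u v + (ip u v / ip v v)^2 * ip v v" by (rule q)
    also have "\<dots> = ip u u - (ip u v)^2 / ip v v"
      using pos by (simp add: power2_eq_square field_simps)
    finally show ?thesis using pos by (simp add: field_simps)
  qed
  then have "(ip u v)^2 \<le> (nrm u * nrm v)^2"
    by (simp add: power_mult_distrib nrm_sq_ip)
  then show ?thesis
    by (metis abs_le_square_iff abs_of_nonneg mult_nonneg_nonneg nrm_nonneg)
qed

lemma nrm_triangle:
  assumes "L2 u" "L2 v"
  shows "nrm (\<lambda>x. u x + v x) \<le> nrm u + nrm v"
proof -
  have "(nrm (\<lambda>x. u x + v x))^2 = (nrm u)^2 + 2 * ip u v + (nrm v)^2"
    using assms by (simp add: nrm_sq_ip ip_simps L2_intros ip_commute[of v u])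
  also have "\<dots> \<le> (nrm u)^2 + 2 * (nrm u * nrm v) + (nrm v)^2"
    using Cauchy_Schwarz_ip[OF assms] by simp
  also have "\<dots> = (nrm u + nrm v)^2" by (simp add: power2_sum)
  finally show ?thesis by (rule power2_le_imp_le) simp
qed

lemma nrm_scale: "nrm (\<lambda>x. a * u x) = \<bar>a\<bar> * nrm u"
  by (simp add: nrm_def power_mult_distrib real_sqrt_mult)

lemma nrm_minus: "nrm (\<lambda>x. - u x) = nrm u"
  by (simp add: nrm_def)

lemma nrm_zero[simp]: "nrm (\<lambda>x. 0) = 0"
  by (simp add: nrm_def)

lemma nrm_diff_commute: "nrm (\<lambda>x. u x - v x) = nrm (\<lambda>x. v x - u x)"
  by (simp add: nrm_def power2_commute)

lemma nrm_diff_le: "L2 u \<Longrightarrow> L2 v \<Longrightarrow> nrm (\<lambda>x. u x - v x) \<le> nrm u + nrm v"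
  using nrm_triangle[of u "\<lambda>x. - v x"] by (simp add: L2_intros nrm_minus)

lemma nrm_diff_triangle:
  assumes "L2 u" "L2 v" "L2 w"
  shows "nrm (\<lambda>x. u x - w x) \<le> nrm (\<lambda>x. u x - v x) + nrm (\<lambda>x. v x - w x)"
  using nrm_triangle[of "\<lambda>x. u x - v x" "\<lambda>x. v x - w x"] assms by (simp add: L2_intros)

lemma nrm_le_diff:
  assumes "L2 u" "L2 v"
  shows "nrm u \<le> nrm v + nrm (\<lambda>x. u x - v x)"
  using nrm_triangle[of v "\<lambda>x. u x - v x"] assms by (simp add: L2_intros)

lemma nrm_diff_abs:
  assumes "L2 u" "L2 v"
  shows "\<bar>nrm u - nrm v\<bar> \<le> nrm (\<lambda>x. u x - v x)"
  using nrm_le_diff[OF assms] nrm_le_diff[OF assms(2,1)] by (simp add: nrm_diff_commute[of v u])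

lemma nrm_mono_AE:
  assumes "L2 v" "u \<in> borel_measurable borel" "AE x in lborel. \<bar>u x\<bar> \<le> \<bar>v x\<bar>"
  shows "nrm u \<le> nrm v"
proof -
  have "L2 u" using L2_bound[OF assms(1,2), of 1] assms(3) by simp
  then show ?thesis unfolding nrm_def
    using assms by (intro real_sqrt_le_mono integral_mono_AE)
      (auto simp: L2_def abs_le_square_iff)
qed

lemma nrm_bound_AE:
  assumes "L2 v" "u \<in> borel_measurable borel" "AE x in lborel. \<bar>u x\<bar> \<le> C * \<bar>v x\<bar>" "0 \<le> C"
  shows "nrm u \<le> C * nrm v"
  using nrm_mono_AE[OF L2_scale[OF assms(1), of C] assms(2)] assms(3,4)
  by (simp add: nrm_scale abs_mult)

lemma nrm_eq_0_AE:
  assumes "L2 u" "nrm u = 0" shows "AE x in lborel. u x = 0"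
proof -
  have "(\<integral>x. (u x)^2 \<partial>lborel) = 0" using assms(2) by (simp add: nrm_def)
  then have "AE x in lborel. (u x)^2 = 0"
    using integral_nonneg_eq_0_iff_AE[of lborel "\<lambda>x. (u x)^2"] assms(1) by (simp add: L2_def)
  then show ?thesis by simp
qed

section \<open>Invariance under translation and reflection\<close>

lemma lborel_integral_shift:
  fixes h :: rfun
  shows "(\<integral>x. h (x + r) \<partial>lborel) = (\<integral>x. h x \<partial>lborel)"
  using lborel_integral_real_affine[of 1 h r] by (simp add: add.commute)

lemma lborel_integrable_shift:
  fixes h :: rfun
  shows "integrable lborel h \<Longrightarrow> integrable lborel (\<lambda>x. h (x + r))"
  using lborel_integrable_real_affine[of h 1 r] by (simp add: add.commute)

lemma lborel_AE_shift:
  assumes "AE x in lborel. P x"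
  shows "AE x::real in lborel. P (x + r)"
proof -
  have "AE x in distr lborel borel ((+) r). P x"
    unfolding lborel_distr_plus by (rule assms)
  from AE_distrD[OF _ this] show ?thesis
    by (simp add: add.commute)
qed

lemma lborel_integral_reflect:
  fixes h :: rfun
  shows "(\<integral>x. h (r - x) \<partial>lborel) = (\<integral>x. h x \<partial>lborel)"
  using lborel_integral_real_affine[of "-1" h r] by simp

lemma lborel_integrable_reflect:
  fixes h :: rfun
  shows "integrable lborel h \<Longrightarrow> integrable lborel (\<lambda>x. h (r - x))"
  using lborel_integrable_real_affine[of h "-1" r] by simp

lemma L2_shift: "L2 u \<Longrightarrow> L2 (\<lambda>x. u (x + r))"
  unfolding L2_def using lborel_integrable_shift[of "\<lambda>x. (u x)^2" r] by auto

lemma L2_reflect: "L2 u \<Longrightarrow> L2 (\<lambda>x. u (r - x))"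
  unfolding L2_def using lborel_integrable_reflect[of "\<lambda>x. (u x)^2" r] by auto

lemma nrm_shift: "nrm (\<lambda>x. u (x + r)) = nrm u"
  unfolding nrm_def using lborel_integral_shift[of "\<lambda>x. (u x)^2" r] by simp

lemma ip_shift: "ip (\<lambda>x. u (x + r)) (\<lambda>x. v (x + r)) = ip u v"
  unfolding ip_def using lborel_integral_shift[of "\<lambda>x. u x * v x" r] by simp

lemma ip_tendsto:
  assumes "\<And>n. L2 (g n)" "\<And>n. L2 (h n)" "L2 u" "L2 v"
    and "((\<lambda>n. nrm (\<lambda>x. g n x - u x)) \<longlongrightarrow> 0) F"
    and "((\<lambda>n. nrm (\<lambda>x. h n x - v x)) \<longlongrightarrow> 0) F"
  shows "((\<lambda>n. ip (g n) (h n)) \<longlongrightarrow> ip u v) F"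
proof -
  have lim: "((\<lambda>n. nrm (\<lambda>x. g n x - u x) * nrm (\<lambda>x. h n x - v x) + nrm (\<lambda>x. g n x - u x) * nrm v
      + nrm u * nrm (\<lambda>x. h n x - v x)) \<longlongrightarrow> 0 * 0 + 0 * nrm v + nrm u * 0) F"
    by (intro tendsto_intros assms)
  have bd: "norm (ip (g n) (h n) - ip u v) \<le>
     nrm (\<lambda>x. g n x - u x) * nrm (\<lambda>x. h n x - v x) + nrm (\<lambda>x. g n x - u x) * nrm v
      + nrm u * nrm (\<lambda>x. h n x - v x)" for n
  proof -
    have "ip (g n) (h n) - ip u v = ip (\<lambda>x. g n x - u x) (\<lambda>x. h n x - v x)
        + ip (\<lambda>x. g n x - u x) v + ip u (\<lambda>x. h n x - v x)"
      using assms(1-4) by (simp add: ip_simps L2_intros)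
    then show ?thesis
      using Cauchy_Schwarz_ip[of "\<lambda>x. g n x - u x" "\<lambda>x. h n x - v x"]
        Cauchy_Schwarz_ip[of "\<lambda>x. g n x - u x" v] Cauchy_Schwarz_ip[of u "\<lambda>x. h n x - v x"] assms(1-4)
      by (simp add: L2_intros)
  qed
  have "((\<lambda>n. ip (g n) (h n) - ip u v) \<longlongrightarrow> 0) F"
    by (rule Lim_null_comparison[OF always_eventually[OF allI[OF bd]]]) (use lim in simp)
  then show ?thesis by (rule LIM_zero_cancel)
qed

lemma ip_tendsto_left:
  assumes "\<And>n. L2 (g n)" "L2 u" "L2 v" "((\<lambda>n. nrm (\<lambda>x. g n x - u x)) \<longlongrightarrow> 0) F"
  shows "((\<lambda>n. ip (g n) v) \<longlongrightarrow> ip u v) F"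
  by (rule ip_tendsto[OF assms(1) assms(3) assms(2,3,4)]) simp

lemma nrm_tendsto:
  assumes "\<And>n. L2 (g n)" "L2 u" "((\<lambda>n. nrm (\<lambda>x. g n x - u x)) \<longlongrightarrow> 0) F"
  shows "((\<lambda>n. nrm (g n)) \<longlongrightarrow> nrm u) F"
proof -
  have "((\<lambda>n. nrm (g n) - nrm u) \<longlongrightarrow> 0) F"
    by (rule Lim_null_comparison[OF always_eventually assms(3)]) (simp add: nrm_diff_abs assms(1,2))
  then show ?thesis by (rule LIM_zero_cancel)
qed

section \<open>Test functions and convolution\<close>

text \<open>The iterates \<open>(deriv ^^ k) f\<close> add derivatives on the outside; this
  recursion differentiates the argument first, so that closure under sums, products and affine
  substitutions is an induction using the rules for a single derivative.\<close>

primrec diff_n :: "nat \<Rightarrow> rfun \<Rightarrow> bool" where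
  "diff_n 0 f = (\<forall>x. f differentiable (at x))"
| "diff_n (Suc n) f = ((\<forall>x. f differentiable (at x)) \<and> diff_n n (deriv f))"

definition smooth :: "rfun \<Rightarrow> bool" where
  "smooth f \<longleftrightarrow> (\<forall>k x. (deriv ^^ k) f differentiable (at x))"

lemma smooth_iff_diff_n: "smooth f \<longleftrightarrow> (\<forall>n. diff_n n f)"
proof -
  have *: "diff_n n f \<longleftrightarrow> (\<forall>k\<le>n. \<forall>x. (deriv ^^ k) f differentiable (at x))" for n f
  proof (induction n arbitrary: f)
    case (Suc n)
    have "(\<forall>k\<le>Suc n. \<forall>x. (deriv ^^ k) f differentiable (at x)) \<longleftrightarrow>
       (\<forall>x. f differentiable (at x)) \<and> (\<forall>k\<le>n. \<forall>x. (deriv ^^ k) (deriv f) differentiable (at x))"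
      (is "?L \<longleftrightarrow> ?R")
    proof
      assume L: ?L
      show ?R
      proof (intro conjI allI impI)
        show "f differentiable (at x)" for x using L[rule_format, of 0 x] by simp
        show "(deriv ^^ k) (deriv f) differentiable (at x)" if "k \<le> n" for k x
          using L[rule_format, of "Suc k" x] that by (simp add: funpow_Suc_right del: funpow.simps)
      qed
    next
      assume R: ?R
      show ?L
      proof (intro allI impI)
        fix k x assume k: "k \<le> Suc n"
        show "(deriv ^^ k) f differentiable (at x)"
        proof (cases k)
          case 0 then show ?thesis using R by simp
        next
          case (Suc m) then show ?thesis using R k by (simp add: funpow_Suc_right del: funpow.simps)
        qed
      qed
    qed
    then show ?case using Suc.IH[of "deriv f"] by simp
  qed simp
  show ?thesis unfolding smooth_def * by blast
qed

lemma diff_n_differentiable: "diff_n n f \<Longrightarrow> f differentiable (at x)"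
  by (cases n) auto

lemma diff_n_SucD: "diff_n (Suc n) f \<Longrightarrow> diff_n n f"
  by (induction n arbitrary: f) auto

lemma DERIV_deriv_diff: "f differentiable (at x) \<Longrightarrow> (f has_real_derivative deriv f x) (at x)"
  by (simp add: DERIV_deriv_iff_real_differentiable)

lemma diff_n_add: "diff_n n f \<Longrightarrow> diff_n n g \<Longrightarrow> diff_n n (\<lambda>x. f x + g x)"
proof (induction n arbitrary: f g)
  case (Suc n)
  have "deriv (\<lambda>x. f x + g x) = (\<lambda>x. deriv f x + deriv g x)"
    using Suc.prems by (intro ext DERIV_imp_deriv DERIV_add DERIV_deriv_diff) auto
  then show ?case using Suc by simp
qed simp

lemma diff_n_mult: "diff_n n f \<Longrightarrow> diff_n n g \<Longrightarrow> diff_n n (\<lambda>x. f x * g x)"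
proof (induction n arbitrary: f g)
  case (Suc n)
  have "deriv (\<lambda>x. f x * g x) = (\<lambda>x. deriv f x * g x + deriv g x * f x)"
    using Suc.prems by (intro ext DERIV_imp_deriv DERIV_mult DERIV_deriv_diff) auto
  moreover have "diff_n n (\<lambda>x. deriv f x * g x + deriv g x * f x)"
    using Suc.prems
    by (intro diff_n_add Suc.IH diff_n_SucD[of n f] diff_n_SucD[of n g]) simp_all
  ultimately show ?case using Suc.prems by simp
qed simp

lemma diff_n_const: "diff_n n (\<lambda>x. a)"
proof (induction n arbitrary: a)
  case (Suc n)
  have "deriv (\<lambda>x::real. a) = (\<lambda>x. 0)" by (intro ext) simp
  then show ?case using Suc[of 0] by simp
qed simp

lemma deriv_affine:
  assumes "\<And>x. f differentiable (at (x::real))"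
  shows "((\<lambda>x. f (a * x + b)) has_real_derivative a * deriv f (a * x + b)) (at x)"
proof -
  have "((\<lambda>x. f (a * x + b)) has_real_derivative deriv f (a * x + b) * a) (at x)"
    by (rule DERIV_chain2[of f]) (auto intro!: derivative_eq_intros DERIV_deriv_diff assms)
  then show ?thesis by (simp add: mult.commute)
qed

lemma diff_n_affine: "diff_n n f \<Longrightarrow> diff_n n (\<lambda>x. f (a * x + b))"
proof (induction n arbitrary: f)
  case 0
  then show ?case using deriv_affine[of f a b] by (auto simp: real_differentiable_def)
next
  case (Suc n)
  have d: "((\<lambda>x. f (a * x + b)) has_real_derivative a * deriv f (a * x + b)) (at x)" for x
    using Suc.prems by (intro deriv_affine) auto
  then have "deriv (\<lambda>x. f (a * x + b)) = (\<lambda>x. a * deriv f (a * x + b))"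
    by (intro ext DERIV_imp_deriv)
  then show ?case using Suc d by (auto simp: real_differentiable_def intro!: diff_n_mult diff_n_const)
qed

lemma smooth_add: "smooth f \<Longrightarrow> smooth g \<Longrightarrow> smooth (\<lambda>x. f x + g x)"
  by (simp add: smooth_iff_diff_n diff_n_add)
lemma smooth_mult: "smooth f \<Longrightarrow> smooth g \<Longrightarrow> smooth (\<lambda>x. f x * g x)"
  by (simp add: smooth_iff_diff_n diff_n_mult)
lemma smooth_const: "smooth (\<lambda>x. a)"
  by (simp add: smooth_iff_diff_n diff_n_const)
lemma smooth_affine: "smooth f \<Longrightarrow> smooth (\<lambda>x. f (a * x + b))"
  by (simp add: smooth_iff_diff_n diff_n_affine)
lemma smooth_deriv: "smooth f \<Longrightarrow> smooth (deriv f)"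
  by (metis diff_n.simps(2) smooth_iff_diff_n)
lemma smooth_DERIV: "smooth f \<Longrightarrow> (f has_real_derivative deriv f x) (at x)"
  by (metis DERIV_deriv_diff diff_n_differentiable smooth_iff_diff_n)
lemma smooth_continuous: "smooth f \<Longrightarrow> continuous_on A f"
  by (meson DERIV_isCont continuous_at_imp_continuous_on smooth_DERIV)

lemma test_fun_iff: "test_fun \<psi> \<longleftrightarrow> smooth \<psi> \<and> (\<exists>R. \<forall>x. R < \<bar>x\<bar> \<longrightarrow> \<psi> x = 0)"
  by (simp add: test_fun_def smooth_def)

lemma test_smooth: "test_fun \<psi> \<Longrightarrow> smooth \<psi>"
  by (simp add: test_fun_iff)
lemmas test_DERIV = smooth_DERIV[OF test_smooth]

section \<open>Closure properties and bounds of test functions\<close>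

lemma test_add: assumes "test_fun f" "test_fun g" shows "test_fun (\<lambda>x. f x + g x)"
proof -
  obtain R S where "\<And>x. R < \<bar>x\<bar> \<Longrightarrow> f x = 0" "\<And>x. S < \<bar>x\<bar> \<Longrightarrow> g x = 0"
    using assms unfolding test_fun_iff by blast
  then have "\<forall>x. max R S < \<bar>x\<bar> \<longrightarrow> f x + g x = 0" by simp
  then show ?thesis using assms smooth_add unfolding test_fun_iff by blast
qed

lemma test_mult: assumes "test_fun f" "smooth g" shows "test_fun (\<lambda>x. f x * g x)"
proof -
  obtain R where "\<And>x. R < \<bar>x\<bar> \<Longrightarrow> f x = 0"
    using assms unfolding test_fun_iff by blast
  then have "\<forall>x. R < \<bar>x\<bar> \<longrightarrow> f x * g x = 0" by simp
  then show ?thesis using assms smooth_mult unfolding test_fun_iff by blast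
qed

lemma test_scale: "test_fun f \<Longrightarrow> test_fun (\<lambda>x. a * f x)"
  using test_mult[of f "\<lambda>x. a"] smooth_const[of a] by (simp add: mult.commute)

lemma test_affine: assumes "test_fun f" "a \<noteq> 0" shows "test_fun (\<lambda>x. f (a * x + b))"
proof -
  obtain R where R: "\<And>x. R < \<bar>x\<bar> \<Longrightarrow> f x = 0"
    using assms unfolding test_fun_iff by blast
  have "f (a * x + b) = 0" if "(\<bar>R\<bar> + \<bar>b\<bar>) / \<bar>a\<bar> < \<bar>x\<bar>" for x
  proof (rule R)
    have "\<bar>R\<bar> + \<bar>b\<bar> < \<bar>a * x\<bar>" using that assms(2) by (simp add: abs_mult field_simps)
    then show "R < \<bar>a * x + b\<bar>" by linarith
  qed
  then show ?thesis using assms smooth_affine unfolding test_fun_iff by blast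
qed

lemma test_shift: "test_fun f \<Longrightarrow> test_fun (\<lambda>x. f (x + r))"
  using test_affine[of f 1 r] by simp
lemma test_reflect: "test_fun f \<Longrightarrow> test_fun (\<lambda>x. f (r - x))"
  using test_affine[of f "-1" r] by simp

lemma deriv_shift:
  "test_fun f \<Longrightarrow> deriv (\<lambda>x. f (x + r)) = (\<lambda>x. deriv f (x + r))"
  using deriv_affine[of f 1 r] by (intro ext DERIV_imp_deriv) (auto simp: test_fun_iff smooth_def dest: spec[of _ 0])

lemma deriv_reflect:
  "test_fun f \<Longrightarrow> deriv (\<lambda>x. f (r - x)) = (\<lambda>x. - deriv f (r - x))"
  using deriv_affine[of f "-1" r] by (intro ext DERIV_imp_deriv) (auto simp: test_fun_iff smooth_def dest: spec[of _ 0])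

lemma DERIV_zero_outside:
  assumes "\<And>x. R < \<bar>x\<bar> \<Longrightarrow> f x = (0::real)" "(f has_real_derivative D) (at x)" "R < \<bar>x\<bar>"
  shows "D = 0"
proof -
  have "open {y::real. R < \<bar>y\<bar>}" by (intro open_Collect_less continuous_intros)
  then have "\<forall>\<^sub>F y in nhds x. y \<in> {y. R < \<bar>y\<bar>}" using assms(3) by (intro eventually_nhds_in_open) auto
  then have "\<forall>\<^sub>F y in nhds x. f y = 0" by eventually_elim (use assms(1) in auto)
  then have "((\<lambda>y. 0) has_real_derivative D) (at x)"
    using assms(2) by (subst (asm) DERIV_cong_ev[OF refl _ refl, of _ "\<lambda>_. 0"]) auto
  then show ?thesis using DERIV_unique[OF _ DERIV_const] by blast
qed

lemma test_deriv: assumes "test_fun f" shows "test_fun (deriv f)"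
proof -
  obtain R where R: "\<And>x. R < \<bar>x\<bar> \<Longrightarrow> f x = 0"
    using assms unfolding test_fun_iff by blast
  have "\<forall>x. R < \<bar>x\<bar> \<longrightarrow> deriv f x = 0"
    using DERIV_zero_outside[OF R test_DERIV[OF assms]] by blast
  then show ?thesis using assms smooth_deriv unfolding test_fun_iff by blast
qed

lemma test_deriv_n: "test_fun f \<Longrightarrow> test_fun ((deriv ^^ k) f)"
  by (induction k) (auto intro: test_deriv)

lemma test_continuous: "test_fun f \<Longrightarrow> continuous_on A f"
  using smooth_continuous test_smooth by blast

lemma test_meas: "test_fun f \<Longrightarrow> f \<in> borel_measurable borel"
  using test_continuous[of f UNIV] by (simp add: borel_measurable_continuous_onI)

lemma continuous_cs_bounded:
  fixes f :: rfun
  assumes "continuous_on UNIV f" "\<And>x. R < \<bar>x\<bar> \<Longrightarrow> f x = 0"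
  obtains C where "C \<ge> 0" "\<And>x. \<bar>f x\<bar> \<le> C * indicator {-\<bar>R\<bar>..\<bar>R\<bar>} x"
proof -
  have "compact (f ` {-\<bar>R\<bar>..\<bar>R\<bar>})"
    using assms by (intro compact_continuous_image) (auto intro: continuous_on_subset)
  then have "bounded (f ` {-\<bar>R\<bar>..\<bar>R\<bar>})" by (rule compact_imp_bounded)
  then obtain C where C: "\<And>x. x \<in> {-\<bar>R\<bar>..\<bar>R\<bar>} \<Longrightarrow> \<bar>f x\<bar> \<le> C"
    unfolding bounded_iff by fastforce
  show thesis
  proof (rule that[of "\<bar>C\<bar>"])
    show "\<bar>f x\<bar> \<le> \<bar>C\<bar> * indicator {-\<bar>R\<bar>..\<bar>R\<bar>} x" for x
    proof (cases "x \<in> {-\<bar>R\<bar>..\<bar>R\<bar>}")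
      case True then show ?thesis using C[of x] by simp
    next
      case False then have "R < \<bar>x\<bar>" by auto
      then show ?thesis using assms(2) by simp
    qed
  qed simp
qed

lemma test_bound:
  assumes "test_fun f"
  obtains C R where "C \<ge> 0" "R \<ge> 0" "\<And>x. \<bar>f x\<bar> \<le> C * indicator {-R..R} x"
proof -
  obtain R where "\<And>x. R < \<bar>x\<bar> \<Longrightarrow> f x = 0"
    using assms unfolding test_fun_iff by blast
  from continuous_cs_bounded[OF test_continuous[OF assms] this] that show thesis
    by (metis abs_ge_zero)
qed

lemma test_bounded:
  assumes "test_fun f" obtains C where "C \<ge> 0" "\<And>x. \<bar>f x\<bar> \<le> C"
proof -
  obtain C R where C: "C \<ge> 0" "R \<ge> 0" "\<And>x. \<bar>f x\<bar> \<le> C * indicator {-R..R} x" using test_bound[OF assms] by blast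
  have "\<bar>f x\<bar> \<le> C" for x using C(1) C(3)[of x] by (cases "x \<in> {-R..R}") simp_all
  then show thesis using that C(1) by blast
qed

lemma L2_indicator: "L2 (indicator {a..b::real})"
proof -
  have "(\<lambda>x. (indicator {a..b} x :: real)^2) = indicator {a..b}"
    by (auto simp: indicator_def)
  moreover have "integrable lborel (indicator {a..b} :: rfun)"
    by (simp add: integrable_indicator_iff emeasure_lborel_Icc_eq)
  ultimately show ?thesis unfolding L2_def by simp
qed

lemma test_integrable: assumes "test_fun f" shows "integrable lborel f"
proof -
  obtain C R where C: "C \<ge> 0" "R \<ge> 0" "\<And>x. \<bar>f x\<bar> \<le> C * indicator {-R..R} x" using test_bound[OF assms] by blast
  show ?thesis
    by (rule Bochner_Integration.integrable_bound[where f = "\<lambda>x. C * indicator {-R..R} x"])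
       (use C test_meas[OF assms] in auto)
qed

lemma test_L2: assumes "test_fun f" shows "L2 f"
proof -
  obtain C R where C: "C \<ge> 0" "R \<ge> 0" "\<And>x. \<bar>f x\<bar> \<le> C * indicator {-R..R} x" using test_bound[OF assms] by blast
  show ?thesis
    by (rule L2_bound[OF L2_indicator, of _ C "-R" R]) (use C test_meas[OF assms] in auto)
qed

section \<open>Taylor estimates with explicit constants\<close>

lemma lipschitz_of_deriv_bound:
  fixes f :: rfun
  assumes "\<And>x. x \<in> S \<Longrightarrow> (f has_real_derivative f' x) (at x within S)" "\<And>x. x \<in> S \<Longrightarrow> \<bar>f' x\<bar> \<le> C"
    "convex S" "x \<in> S" "y \<in> S"
  shows "\<bar>f x - f y\<bar> \<le> C * \<bar>x - y\<bar>"
  using field_differentiable_bound[OF assms(3), of f f' C y x] assms by (auto simp: abs_minus_commute)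

text \<open>The mean value estimate for \<open>f\<close> minus its tangent line at \<open>x\<close>.
  Only a Lipschitz bound of \<open>f'\<close> about \<open>x\<close> enters, so \<open>f'\<close>
  may fail to be differentiable; the price is \<open>C\<close> where a second derivative would give
  \<open>C / 2\<close>.\<close>

lemma second_order_bound:
  fixes f :: rfun
  assumes S: "convex S" "x \<in> S" "y \<in> S"
    and d1: "\<And>x. x \<in> S \<Longrightarrow> (f has_real_derivative f' x) (at x within S)"
    and lip: "\<And>z. z \<in> S \<Longrightarrow> \<bar>f' z - f' x\<bar> \<le> C * \<bar>z - x\<bar>" and C: "C \<ge> 0"
  shows "\<bar>f y - f x - (y - x) * f' x\<bar> \<le> C * (y - x)^2"
proof -
  \<comment> \<open>On this ball the derivative of \<open>f\<close> minus its tangent line is at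
    most \<open>C * \<bar>y - x\<bar>\<close>.\<close>
  let ?T = "S \<inter> cball x \<bar>y - x\<bar>"
  have "\<bar>(f y - y * f' x) - (f x - x * f' x)\<bar> \<le> (C * \<bar>y - x\<bar>) * \<bar>y - x\<bar>"
  proof (rule lipschitz_of_deriv_bound[where S = ?T and f' = "\<lambda>z. f' z - f' x"])
    show "((\<lambda>y. f y - y * f' x) has_real_derivative f' z - f' x) (at z within ?T)" if "z \<in> ?T" for z
      using DERIV_subset[OF d1, of z ?T] that by (auto intro!: derivative_eq_intros)
    show "\<bar>f' z - f' x\<bar> \<le> C * \<bar>y - x\<bar>" if "z \<in> ?T" for z
    proof -
      have "C * \<bar>z - x\<bar> \<le> C * \<bar>y - x\<bar>" using that C by (intro mult_left_mono) (auto simp: dist_real_def)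
      then show ?thesis using lip[of z] that by auto
    qed
  qed (use S in \<open>auto intro: convex_Int simp: dist_real_def abs_minus_commute\<close>)
  then show ?thesis by (simp add: algebra_simps power2_eq_square abs_mult_self_eq)
qed

text \<open>The indicator makes the remainder square integrable in \<open>x\<close>, so that
  Cauchy-Schwarz can carry a difference quotient through a pairing. With
  \<open>\<bar>h\<bar> \<le> 1\<close>, enlarging the support by 1 takes care of the shifted
  argument.\<close>

lemma test_taylor2:
  assumes "test_fun f"
  obtains C R where "C \<ge> 0" "\<And>x h. \<bar>h\<bar> \<le> 1 \<Longrightarrow>
     \<bar>f (x + h) - f x - h * deriv f x\<bar> \<le> C * h^2 * indicator {-R..R} x"
proof -
  obtain R where R: "\<And>x. R < \<bar>x\<bar> \<Longrightarrow> f x = 0"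
    using assms unfolding test_fun_iff by blast
  have R': "deriv f x = 0" if "R < \<bar>x\<bar>" for x
    using DERIV_zero_outside[OF R test_DERIV[OF assms] that] .
  obtain C where C: "C \<ge> 0" "\<And>x. \<bar>deriv (deriv f) x\<bar> \<le> C"
    using test_bounded[OF test_deriv[OF test_deriv[OF assms]]] by blast
  have b: "\<bar>f (x + h) - f x - h * deriv f x\<bar> \<le> C * h^2" for x h
  proof -
    have "\<bar>f (x + h) - f x - (x + h - x) * deriv f x\<bar> \<le> C * (x + h - x)^2"
    proof (rule second_order_bound[where S = UNIV])
      show "\<bar>deriv f z - deriv f x\<bar> \<le> C * \<bar>z - x\<bar>" for z
        by (rule lipschitz_of_deriv_bound[where S = UNIV and f' = "deriv (deriv f)"])
           (use C test_DERIV[OF test_deriv[OF assms]] in auto)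
    qed (use C test_DERIV[OF assms] in auto)
    then show ?thesis by simp
  qed
  show thesis
  proof (rule that[of C "R + 1"])
    fix x h :: real assume h: "\<bar>h\<bar> \<le> 1"
    show "\<bar>f (x + h) - f x - h * deriv f x\<bar> \<le> C * h^2 * indicator {-(R+1)..R+1} x"
    proof (cases "x \<in> {-(R+1)..R+1}")
      case True then show ?thesis using b by simp
    next
      case False
      then have "R < \<bar>x\<bar>" "R < \<bar>x + h\<bar>" using h by auto
      then show ?thesis using R R' C(1) by simp
    qed
  qed (use C in auto)
qed

section \<open>Convolution with a test function\<close>

definition conv :: "rfun \<Rightarrow> rfun \<Rightarrow> rfun" where
  "conv \<kappa> u x = (\<integral>y. \<kappa> (x - y) * u y \<partial>lborel)"

lemma conv_ip: "conv \<kappa> u x = ip u (\<lambda>y. \<kappa> (x - y))"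
  by (simp add: conv_def ip_def mult.commute)

lemma DERIV_quadI:
  fixes f :: rfun
  assumes "\<And>h. \<bar>h\<bar> \<le> 1 \<Longrightarrow> \<bar>f (x + h) - f x - h * D\<bar> \<le> K * h^2"
  shows "(f has_real_derivative D) (at x)"
proof -
  have K: "0 \<le> K" using order_trans[OF abs_ge_zero assms[of 1]] by simp
  have "\<exists>d>0. \<forall>y\<in>UNIV. norm (y - x) < d \<longrightarrow> norm (f y - f x - D * (y - x)) \<le> e * norm (y - x)"
    if e: "e > 0" for e
  proof (intro exI[of _ "min 1 (e / (K + 1))"] conjI ballI impI)
    show "min 1 (e / (K + 1)) > 0" using e K by simp
    fix y assume y: "norm (y - x) < min 1 (e / (K + 1))"
    have "\<bar>f (x + (y - x)) - f x - (y - x) * D\<bar> \<le> K * (y - x)^2"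
      using y by (intro assms) auto
    also have "\<dots> = K * \<bar>y - x\<bar> * \<bar>y - x\<bar>" by (simp add: power2_eq_square abs_mult_self_eq mult.assoc)
    also have "\<dots> \<le> e * \<bar>y - x\<bar>"
    proof (rule mult_right_mono)
      have "\<bar>y - x\<bar> * (K + 1) < e" using y K by (simp add: field_simps)
      then show "K * \<bar>y - x\<bar> \<le> e" by (simp add: algebra_simps)
    qed simp
    finally show "norm (f y - f x - D * (y - x)) \<le> e * norm (y - x)" by (simp add: mult.commute)
  qed
  then have "(f has_derivative (\<lambda>h. D * h)) (at x within UNIV)"
    unfolding has_derivative_within_alt by (auto intro: bounded_linear_mult_right)
  then show ?thesis by (simp add: has_field_derivative_def)
qed

text \<open>Differentiation under the integral by Cauchy-Schwarz: the Taylor remainder of the kernel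
  has L2 norm of order \<open>h^2\<close>.\<close>

lemma conv_DERIV:
  assumes k: "test_fun \<kappa>" and u: "L2 u"
  shows "(conv \<kappa> u has_real_derivative conv (deriv \<kappa>) u x) (at x)"
proof -
  obtain C R where C: "C \<ge> 0" "\<And>x h. \<bar>h\<bar> \<le> 1 \<Longrightarrow>
     \<bar>\<kappa> (x + h) - \<kappa> x - h * deriv \<kappa> x\<bar> \<le> C * h^2 * indicator {-R..R} x"
    using test_taylor2[OF k] by blast
  let ?I = "\<lambda>y. indicator {-R..R} (x - y) :: real"
  have I: "L2 ?I" by (rule L2_reflect[OF L2_indicator])
  have k1: "L2 (\<lambda>y. \<kappa> (z - y))" "L2 (\<lambda>y. deriv \<kappa> (z - y))" for z
    by (intro L2_reflect test_L2 k test_deriv)+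
  show ?thesis
  proof (rule DERIV_quadI[where K = "C * nrm ?I * nrm u"])
    fix h :: real assume h: "\<bar>h\<bar> \<le> 1"
    let ?w = "\<lambda>y. \<kappa> (x + h - y) - \<kappa> (x - y) - h * deriv \<kappa> (x - y)"
    have w: "L2 ?w" by (intro L2_intros k1)
    have "conv \<kappa> u (x + h) - conv \<kappa> u x - h * conv (deriv \<kappa>) u x = ip u ?w"
      unfolding conv_ip using k1 u by (simp add: ip_simps L2_intros)
    then have 1: "\<bar>conv \<kappa> u (x + h) - conv \<kappa> u x - h * conv (deriv \<kappa>) u x\<bar> \<le> nrm u * nrm ?w"
      using Cauchy_Schwarz_ip[OF u w] by simp
    have 2: "nrm ?w \<le> (C * h^2) * nrm ?I"
    proof (rule nrm_bound_AE[OF I])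
      show "AE y in lborel. \<bar>?w y\<bar> \<le> C * h\<^sup>2 * \<bar>?I y\<bar>"
        using C(2)[OF h, of "x - _"] by (intro AE_I2) (simp add: algebra_simps)
    qed (use w C(1) in \<open>auto simp: L2_def\<close>)
    show "\<bar>conv \<kappa> u (x + h) - conv \<kappa> u x - h * conv (deriv \<kappa>) u x\<bar> \<le> C * nrm ?I * nrm u * h\<^sup>2"
      using order_trans[OF 1 mult_left_mono[OF 2 nrm_nonneg]] by (simp add: algebra_simps)
  qed
qed

lemma conv_deriv: "test_fun \<kappa> \<Longrightarrow> L2 u \<Longrightarrow> deriv (conv \<kappa> u) = conv (deriv \<kappa>) u"
  by (intro ext DERIV_imp_deriv conv_DERIV)

lemma conv_deriv_n: "test_fun \<kappa> \<Longrightarrow> L2 u \<Longrightarrow> (deriv ^^ k) (conv \<kappa> u) = conv ((deriv ^^ k) \<kappa>) u"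
  by (induction k) (auto simp: conv_deriv test_deriv_n)

lemma conv_smooth: "test_fun \<kappa> \<Longrightarrow> L2 u \<Longrightarrow> smooth (conv \<kappa> u)"
  unfolding smooth_def
  by (simp add: conv_deriv_n real_differentiable_def) (blast intro: conv_DERIV test_deriv_n)

lemma conv_compact_support:
  assumes "\<And>x. R < \<bar>x\<bar> \<Longrightarrow> \<kappa> x = 0" "\<And>x. S < \<bar>x\<bar> \<Longrightarrow> u x = 0" "R + S < \<bar>x\<bar>"
  shows "conv \<kappa> u x = 0"
proof -
  have "\<kappa> (x - y) * u y = 0" for y
  proof (cases "S < \<bar>y\<bar>")
    case True then show ?thesis using assms(2) by simp
  next
    case False then have "R < \<bar>x - y\<bar>" using assms(3) by linarith
    then show ?thesis using assms(1) by simp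
  qed
  then have "(\<lambda>y. \<kappa> (x - y) * u y) = (\<lambda>y. 0)" by (intro ext)
  then show ?thesis unfolding conv_def by simp
qed

lemma conv_test:
  assumes "test_fun \<kappa>" "test_fun \<theta>" shows "test_fun (conv \<kappa> \<theta>)"
proof -
  obtain R where R: "\<And>x. R < \<bar>x\<bar> \<Longrightarrow> \<kappa> x = 0" using assms(1) unfolding test_fun_iff by blast
  obtain S where S: "\<And>x. S < \<bar>x\<bar> \<Longrightarrow> \<theta> x = 0" using assms(2) unfolding test_fun_iff by blast
  have "\<forall>x. R + S < \<bar>x\<bar> \<longrightarrow> conv \<kappa> \<theta> x = 0" using conv_compact_support[of R \<kappa> S \<theta>] R S by blast
  then show ?thesis unfolding test_fun_iff using conv_smooth[OF assms(1) test_L2[OF assms(2)]] by blast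
qed

lemma integrable_conv_pair1:
  fixes K b :: rfun
  assumes K: "integrable lborel K" and b: "integrable lborel b"
  shows "integrable (lborel \<Otimes>\<^sub>M lborel) (\<lambda>(x, y). K (x - y) * b x)"
proof -
  have [measurable]: "K \<in> borel_measurable borel" "b \<in> borel_measurable borel"
    using assms by (auto dest: borel_measurable_integrable)
  show ?thesis
  proof (rule lborel_pair.Fubini_integrable)
    have "(\<integral>y. norm (K (x - y) * b x) \<partial>lborel) = (\<integral>y. \<bar>K y\<bar> \<partial>lborel) * \<bar>b x\<bar>" for x
      using lborel_integral_reflect[of "\<lambda>y. \<bar>K y\<bar>" x] by (simp add: abs_mult)
    then show "integrable lborel (\<lambda>x. \<integral>y. norm (case (x, y) of (x, y) \<Rightarrow> K (x - y) * b x) \<partial>lborel)"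
      using b by simp
    show "AE x in lborel. integrable lborel (\<lambda>y. case (x, y) of (x, y) \<Rightarrow> K (x - y) * b x)"
      using lborel_integrable_reflect[OF K] by simp
  qed measurable
qed

lemma integrable_conv_pair2:
  fixes K b :: rfun
  assumes K: "integrable lborel K" and b: "integrable lborel b"
  shows "integrable (lborel \<Otimes>\<^sub>M lborel) (\<lambda>(x, y). K (x - y) * b y)"
proof -
  have "integrable (lborel \<Otimes>\<^sub>M lborel) (\<lambda>(x, y). K (- (x - y)) * b x)"
    using integrable_conv_pair1[of "\<lambda>z. K (- z)" b] lborel_integrable_reflect[OF K, of 0] b by simp
  from lborel_pair.integrable_product_swap[OF this] show ?thesis by (simp add: case_prod_beta)
qed

lemma test_abs_integrable: "test_fun \<kappa> \<Longrightarrow> integrable lborel (\<lambda>x. \<bar>\<kappa> x\<bar>)"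
  using test_integrable by (intro integrable_abs)

lemma conv_meas: "test_fun \<kappa> \<Longrightarrow> L2 u \<Longrightarrow> conv \<kappa> u \<in> borel_measurable borel"
  using conv_smooth smooth_continuous by (intro borel_measurable_continuous_onI) blast

text \<open>Cauchy-Schwarz after splitting \<open>\<bar>\<kappa>\<bar>\<close> into two square
  roots, with \<open>u\<close> attached to one of them. Integrated in \<open>x\<close>, it becomes
  Young's inequality for an L1 kernel acting on L2.\<close>

lemma conv_sq_le:
  assumes k: "test_fun \<kappa>" and u: "L2 u"
  shows "(conv \<kappa> u x)^2 \<le> (\<integral>z. \<bar>\<kappa> z\<bar> \<partial>lborel) * (\<integral>y. \<bar>\<kappa> (x - y)\<bar> * (u y)^2 \<partial>lborel)"
proof -
  have [measurable]: "\<kappa> \<in> borel_measurable borel" "u \<in> borel_measurable borel"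
    using test_meas[OF k] L2_meas[OF u] by auto
  obtain C where C: "C \<ge> 0" "\<And>x. \<bar>\<kappa> x\<bar> \<le> C" using test_bounded[OF k] by blast
  let ?a = "\<lambda>y. sqrt \<bar>\<kappa> (x - y)\<bar>" and ?b = "\<lambda>y. sqrt \<bar>\<kappa> (x - y)\<bar> * \<bar>u y\<bar>"
  have a: "L2 ?a" unfolding L2_def
    using lborel_integrable_reflect[OF test_abs_integrable[OF k], of x] by simp
  have b: "L2 ?b"
    by (rule L2_mult_bounded[OF L2_abs[OF u], where C = "sqrt C"]) (use C in auto)
  have "\<bar>conv \<kappa> u x\<bar> \<le> (\<integral>y. norm (\<kappa> (x - y) * u y) \<partial>lborel)"
    unfolding conv_def using integral_norm_bound[of lborel "\<lambda>y. \<kappa> (x - y) * u y"] by simp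
  also have "\<dots> = ip ?a ?b"
    unfolding ip_def
    by (intro Bochner_Integration.integral_cong refl) (simp add: abs_mult flip: mult.assoc)
  also have "\<dots> \<le> nrm ?a * nrm ?b" using Cauchy_Schwarz_ip[OF a b] by simp
  finally have "\<bar>conv \<kappa> u x\<bar>^2 \<le> (nrm ?a * nrm ?b)^2" by (intro power_mono) auto
  also have "\<dots> = (\<integral>y. \<bar>\<kappa> (x - y)\<bar> \<partial>lborel) * (\<integral>y. \<bar>\<kappa> (x - y)\<bar> * (u y)^2 \<partial>lborel)"
    by (simp add: power_mult_distrib nrm_sq)
  finally show ?thesis using lborel_integral_reflect[of "\<lambda>y. \<bar>\<kappa> y\<bar>" x] by simp
qed

lemma
  assumes k: "test_fun \<kappa>" and u: "L2 u"
  shows conv_L2: "L2 (conv \<kappa> u)"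
    and Young_conv: "nrm (conv \<kappa> u) \<le> (\<integral>z. \<bar>\<kappa> z\<bar> \<partial>lborel) * nrm u"
proof -
  let ?N = "\<integral>z. \<bar>\<kappa> z\<bar> \<partial>lborel"
  have N: "?N \<ge> 0" by simp
  have P: "integrable (lborel \<Otimes>\<^sub>M lborel) (\<lambda>(x, y). \<bar>\<kappa> (x - y)\<bar> * (u y)^2)"
    by (rule integrable_conv_pair2[OF test_abs_integrable[OF k] L2_sq_integrable[OF u]])
  have I: "integrable lborel (\<lambda>x. ?N * (\<integral>y. \<bar>\<kappa> (x - y)\<bar> * (u y)^2 \<partial>lborel))"
    using lborel_pair.integrable_fst[OF P] by simp
  have "integrable lborel (\<lambda>x. (conv \<kappa> u x)^2)"
    by (rule Bochner_Integration.integrable_bound[OF I])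
       (use conv_meas[OF k u] in measurable, use conv_sq_le[OF k u] in \<open>auto intro: order_trans[OF _ abs_ge_self]\<close>)
  then show L: "L2 (conv \<kappa> u)" using conv_meas[OF k u] by (simp add: L2_def)
  have "(nrm (conv \<kappa> u))^2 \<le> (\<integral>x. ?N * (\<integral>y. \<bar>\<kappa> (x - y)\<bar> * (u y)^2 \<partial>lborel) \<partial>lborel)"
    unfolding nrm_sq using L by (intro integral_mono I conv_sq_le[OF k u]) (simp add: L2_def)
  also have "\<dots> = ?N * (\<integral>y. (\<integral>x. \<bar>\<kappa> (x - y)\<bar> * (u y)^2 \<partial>lborel) \<partial>lborel)"
    using lborel_pair.Fubini_integral[OF P] by simp
  also have "(\<lambda>y. (\<integral>x. \<bar>\<kappa> (x - y)\<bar> * (u y)^2 \<partial>lborel)) = (\<lambda>y. ?N * (u y)^2)"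
  proof
    fix y
    show "(\<integral>x. \<bar>\<kappa> (x - y)\<bar> * (u y)^2 \<partial>lborel) = ?N * (u y)^2"
      using lborel_integral_shift[of "\<lambda>x. \<bar>\<kappa> x\<bar>" "- y"] by simp
  qed
  also have "?N * (\<integral>y. ?N * (u y)^2 \<partial>lborel) = (?N * nrm u)^2"
    by (simp add: power_mult_distrib nrm_sq) (simp add: power2_eq_square)
  finally show "nrm (conv \<kappa> u) \<le> ?N * nrm u"
    by (rule power2_le_imp_le) simp
qed

lemma conv_adjoint:
  assumes k: "test_fun \<kappa>" and u: "L2 u" and t: "L2 \<theta>"
  shows "ip (conv \<kappa> u) \<theta> = ip u (conv (\<lambda>z. \<kappa> (- z)) \<theta>)"
proof -
  have [measurable]: "\<kappa> \<in> borel_measurable borel" "u \<in> borel_measurable borel" "\<theta> \<in> borel_measurable borel"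
    using test_meas[OF k] L2_meas u t by auto
  have P: "integrable (lborel \<Otimes>\<^sub>M lborel) (\<lambda>(x, y). \<kappa> (x - y) * u y * \<theta> x)"
  proof (rule Bochner_Integration.integrable_bound)
    \<comment> \<open>The product of \<open>u y\<close> and \<open>\<theta> x\<close> is dominated
      by the sum of their squares, and each square times the kernel is integrable on the
      plane.\<close>
    show "integrable (lborel \<Otimes>\<^sub>M lborel) (\<lambda>z. (case z of (x, y) \<Rightarrow> \<bar>\<kappa> (x - y)\<bar> * (u y)^2)
        + (case z of (x, y) \<Rightarrow> \<bar>\<kappa> (x - y)\<bar> * (\<theta> x)^2))"
      by (intro Bochner_Integration.integrable_add integrable_conv_pair1 integrable_conv_pair2
          test_abs_integrable L2_sq_integrable assms)
    have "\<bar>a * b * c\<bar> \<le> \<bar>a\<bar> * b\<^sup>2 + \<bar>a\<bar> * c\<^sup>2" for a b c :: real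
    proof -
      have "2 * (\<bar>b\<bar> * \<bar>c\<bar>) \<le> b\<^sup>2 + c\<^sup>2" using sum_squares_bound[of "\<bar>b\<bar>" "\<bar>c\<bar>"] by simp
      moreover have "0 \<le> \<bar>b\<bar> * \<bar>c\<bar>" by simp
      ultimately have "\<bar>b\<bar> * \<bar>c\<bar> \<le> b\<^sup>2 + c\<^sup>2" by linarith
      then have "\<bar>a\<bar> * (\<bar>b\<bar> * \<bar>c\<bar>) \<le> \<bar>a\<bar> * (b\<^sup>2 + c\<^sup>2)" by (intro mult_left_mono) auto
      then show ?thesis by (simp add: abs_mult algebra_simps)
    qed
    then show "AE z in lborel \<Otimes>\<^sub>M lborel. norm (case z of (x, y) \<Rightarrow> \<kappa> (x - y) * u y * \<theta> x)
      \<le> norm ((case z of (x, y) \<Rightarrow> \<bar>\<kappa> (x - y)\<bar> * (u y)^2) + (case z of (x, y) \<Rightarrow> \<bar>\<kappa> (x - y)\<bar> * (\<theta> x)^2))"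
      by (auto intro!: AE_I2 order_trans[OF _ abs_ge_self])
  qed measurable
  have "ip (conv \<kappa> u) \<theta> = (\<integral>x. (\<integral>y. \<kappa> (x - y) * u y * \<theta> x \<partial>lborel) \<partial>lborel)"
    by (simp add: ip_def conv_def)
  also have "\<dots> = (\<integral>y. (\<integral>x. \<kappa> (x - y) * u y * \<theta> x \<partial>lborel) \<partial>lborel)"
    using lborel_pair.Fubini_integral[OF P] by simp
  also have "\<dots> = (\<integral>y. u y * (\<integral>x. \<kappa> (x - y) * \<theta> x \<partial>lborel) \<partial>lborel)"
    by (intro Bochner_Integration.integral_cong refl)
       (simp add: ac_simps flip: integral_mult_right_zero)
  also have "\<dots> = ip u (conv (\<lambda>z. \<kappa> (- z)) \<theta>)" by (simp add: ip_def conv_def)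
  finally show ?thesis .
qed

section \<open>Mollifiers and cut-offs\<close>

text \<open>The powers of \<open>1 / x\<close> are included because the family is then closed under
  differentiation, and the smoothness of all its members, in particular of
  \<open>exp (- (1 / x))\<close> extended by 0, follows from one induction.\<close>

definition flat :: "nat \<Rightarrow> rfun" where
  "flat k x = (if 0 < x then exp (- (1 / x)) * (1 / x) ^ k else 0)"

lemma flat_limit: "((\<lambda>h. exp (- (1 / h)) * (1 / h) ^ k) \<longlongrightarrow> 0) (at_right (0::real))"
  using filterlim_compose[OF tendsto_power_div_exp_0[of k] filterlim_inverse_at_top_right]
  by (simp add: exp_minus divide_inverse mult.commute)

lemma flat_DERIV:
  "(flat k has_real_derivative (- real k) * flat (k + 1) x + flat (k + 2) x) (at x)"
proof -
  consider "x < 0" | "x = 0" | "x > 0" by linarith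
  then show ?thesis
  proof cases
    case 1
    have "\<forall>\<^sub>F y in nhds x. y \<in> {..<0}" using 1 by (intro eventually_nhds_in_open) auto
    then have "\<forall>\<^sub>F y in nhds x. flat k y = 0" by eventually_elim (simp add: flat_def)
    then have "(flat k has_real_derivative 0) (at x)"
      by (subst DERIV_cong_ev[OF refl _ refl, of _ "\<lambda>_. 0"]) auto
    then show ?thesis using 1 by (simp add: flat_def)
  next
    case 2
    have l: "((\<lambda>h. (flat k (0 + h) - flat k 0) / h) \<longlongrightarrow> 0) (at_left 0)"
      by (rule tendsto_eventually) (simp add: flat_def eventually_at_left_field, intro exI[of _ "-1"], simp)
    \<comment> \<open>The right difference quotient at 0 is the next member of the family.\<close>
    have r: "((\<lambda>h. (flat k (0 + h) - flat k 0) / h) \<longlongrightarrow> 0) (at_right 0)"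
    proof (rule Lim_transform_eventually[OF flat_limit[of "Suc k"]])
      show "\<forall>\<^sub>F h in at_right 0. exp (- (1 / h)) * (1 / h) ^ Suc k = (flat k (0 + h) - flat k 0) / h"
        unfolding eventually_at_right_field by (intro exI[of _ 1]) (simp add: flat_def)
    qed
    have "(flat k has_real_derivative 0) (at 0)"
      unfolding DERIV_def using filterlim_split_at[OF l r] by simp
    then show ?thesis using 2 by (simp add: flat_def)
  next
    case 3
    have "((\<lambda>x. exp (- (1 / x)) * (1 / x) ^ k) has_real_derivative
       (exp (- (1 / x)) * (1 / x\<^sup>2)) * (1 / x) ^ k + (real k * (1 / x) ^ (k - 1) * (- (1 / x\<^sup>2))) * exp (- (1 / x))) (at x)"
      using 3 by (auto intro!: derivative_eq_intros simp: power2_eq_square)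
    also have "(exp (- (1 / x)) * (1 / x\<^sup>2)) * (1 / x) ^ k + (real k * (1 / x) ^ (k - 1) * (- (1 / x\<^sup>2))) * exp (- (1 / x))
      = (- real k) * flat (k + 1) x + flat (k + 2) x"
      using 3 by (cases k) (simp_all add: flat_def power2_eq_square field_simps)
    finally have d: "((\<lambda>x. exp (- (1 / x)) * (1 / x) ^ k) has_real_derivative
       (- real k) * flat (k + 1) x + flat (k + 2) x) (at x)" .
    have "\<forall>\<^sub>F y in nhds x. y \<in> {0<..}" using 3 by (intro eventually_nhds_in_open) auto
    then have "\<forall>\<^sub>F y in nhds x. flat k y = exp (- (1 / y)) * (1 / y) ^ k"
      by eventually_elim (simp add: flat_def)
    then show ?thesis using d by (subst DERIV_cong_ev[OF refl _ refl]) auto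
  qed
qed

lemma flat_smooth: "smooth (flat k)"
proof -
  have "diff_n n (flat k)" for n
  proof (induction n arbitrary: k)
    case 0 then show ?case using flat_DERIV by (auto simp: real_differentiable_def)
  next
    case (Suc n)
    have "deriv (flat k) = (\<lambda>x. (- real k) * flat (k + 1) x + flat (k + 2) x)"
      by (intro ext DERIV_imp_deriv flat_DERIV)
    moreover have "diff_n n (\<lambda>x. (- real k) * flat (k + 1) x + flat (k + 2) x)"
      using diff_n_add[OF diff_n_mult[OF diff_n_const Suc] Suc] .
    ultimately show ?case using flat_DERIV by (auto simp: real_differentiable_def)
  qed
  then show ?thesis by (simp add: smooth_iff_diff_n)
qed

definition bump :: rfun where "bump x = flat 0 (1 + x) * flat 0 (1 - x)"

lemma bump_nonneg: "0 \<le> bump x"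
  by (simp add: bump_def flat_def)

lemma bump_support: "1 < \<bar>x\<bar> \<Longrightarrow> bump x = 0"
  by (auto simp: bump_def flat_def)

lemma bump_test: "test_fun bump"
proof -
  have "smooth bump" unfolding bump_def
    using smooth_mult[OF smooth_affine[OF flat_smooth, of 0 1 1] smooth_affine[OF flat_smooth, of 0 "-1" 1]]
    by (simp add: add.commute)
  then show ?thesis using bump_support unfolding test_fun_iff by blast
qed

text \<open>Positivity in quantitative form: it gives a positive integral, by which
  \<open>mol\<close> is normalised, and a positive value at 0, by which the cut-off function
  is.\<close>

lemma bump_lower: "exp (-4::real) * indicator {-1/2..1/2} x \<le> bump x"
proof (cases "x \<in> {-1/2..1/2}")
  case True
  have "exp (-2) * exp (-2) \<le> flat 0 (1 + x) * flat 0 (1 - x)"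
  proof (intro mult_mono)
    show "exp (-2) \<le> flat 0 (1 + x)" "exp (-2) \<le> flat 0 (1 - x)"
      using True by (auto simp: flat_def field_simps)
  qed (auto simp: flat_def)
  then show ?thesis using True by (simp add: bump_def flip: exp_add)
next
  case False then show ?thesis using bump_nonneg by simp
qed

lemma bump_0: "0 < bump 0"
  using bump_lower[of 0] by (simp, smt (verit) exp_gt_zero)

lemma bump_integral_pos: "0 < (\<integral>x. bump x \<partial>lborel)"
proof -
  have "0 < (\<integral>x. exp (-4::real) * indicator {-1/2..1/2} (x::real) \<partial>lborel)" by simp
  also have "\<dots> \<le> (\<integral>x. bump x \<partial>lborel)"
    by (rule integral_mono[OF _ test_integrable[OF bump_test] bump_lower])
       (simp add: integrable_indicator_iff emeasure_lborel_Icc_eq)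
  finally show ?thesis .
qed

text \<open>The scale is \<open>n + 1\<close> instead of \<open>n\<close>, so that index 0 is a
  mollifier as well.\<close>

definition mol :: "nat \<Rightarrow> rfun" where
  "mol n x = (real n + 1) * (bump ((real n + 1) * x) / (\<integral>x. bump x \<partial>lborel))"

lemma mol_test: "test_fun (mol n)"
proof -
  have "test_fun (\<lambda>x. ((real n + 1) / (\<integral>x. bump x \<partial>lborel)) * bump ((real n + 1) * x + 0))"
    by (intro test_scale test_affine bump_test) auto
  then show ?thesis by (simp add: mol_def[abs_def])
qed

lemma mol_nonneg: "0 \<le> mol n x"
  using bump_integral_pos bump_nonneg by (simp add: mol_def)

lemma mol_support: "1 / (real n + 1) < \<bar>x\<bar> \<Longrightarrow> mol n x = 0"
proof -
  assume "1 / (real n + 1) < \<bar>x\<bar>"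
  then have "1 < \<bar>(real n + 1) * x\<bar>" by (simp add: abs_mult field_simps)
  then show ?thesis by (simp add: mol_def bump_support)
qed

lemma mol_integral: "(\<integral>x. mol n x \<partial>lborel) = 1"
  using lborel_integral_real_affine[of "real n + 1" bump 0] bump_integral_pos
  by (auto simp: mol_def)

lemma mol_abs_integral: "(\<integral>x. \<bar>mol n x\<bar> \<partial>lborel) = 1"
  by (simp add: abs_of_nonneg[OF mol_nonneg] mol_integral)

lemma L2_cc:
  fixes g :: rfun
  assumes "continuous_on UNIV g" "\<And>x. R < \<bar>x\<bar> \<Longrightarrow> g x = 0"
  shows "L2 g"
proof -
  obtain C where "C \<ge> 0" "\<And>x. \<bar>g x\<bar> \<le> C * indicator {-\<bar>R\<bar>..\<bar>R\<bar>} x"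
    using continuous_cs_bounded[OF assms] by blast
  then show ?thesis
    by (intro L2_bound[OF L2_indicator, of _ C "-\<bar>R\<bar>" "\<bar>R\<bar>"])
       (use assms(1) in \<open>auto intro: borel_measurable_continuous_onI\<close>)
qed

text \<open>By uniform continuity the error is uniformly small, and it lives within radius
  \<open>\<bar>R\<bar> + 1\<close> because the mollifiers are supported in \<open>[-1, 1]\<close>;
  hence it is small in L2. The interval of uniform continuity is wider by 1 once more, to contain
  the points averaged over.\<close>

lemma mol_conv_cc:
  fixes g :: rfun
  assumes g: "continuous_on UNIV g" "\<And>x. R < \<bar>x\<bar> \<Longrightarrow> g x = 0"
  shows "(\<lambda>n. nrm (\<lambda>x. conv (mol n) g x - g x)) \<longlonglongrightarrow> 0"
proof (rule LIMSEQ_I)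
  fix e :: real assume e: "e > 0"
  have L: "L2 g" by (rule L2_cc[OF g])
  let ?I = "indicator {-\<bar>R\<bar>-1..\<bar>R\<bar>+1} :: rfun"
  let ?e = "e / (nrm ?I + 1)"
  have e': "?e > 0" using e by (simp add: add_nonneg_pos)
  have "uniformly_continuous_on {-\<bar>R\<bar>-2..\<bar>R\<bar>+2} g"
    by (intro compact_uniformly_continuous) (auto intro: continuous_on_subset[OF g(1)])
  then obtain d where d: "d > 0" "\<And>x y. x \<in> {-\<bar>R\<bar>-2..\<bar>R\<bar>+2} \<Longrightarrow> y \<in> {-\<bar>R\<bar>-2..\<bar>R\<bar>+2} \<Longrightarrow> dist y x < d \<Longrightarrow> dist (g y) (g x) < ?e"
    using e' unfolding uniformly_continuous_on_def by metis
  obtain N :: nat where N: "1 / d < real N" using reals_Archimedean2 by blast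
  show "\<exists>no. \<forall>n\<ge>no. norm (nrm (\<lambda>x. conv (mol n) g x - g x) - 0) < e"
  proof (intro exI allI impI)
    fix n assume n: "n \<ge> N"
    have nd: "1 / (real n + 1) < d"
    proof -
      have "1 / d < real n + 1" using N n by linarith
      then show ?thesis using d(1) by (simp add: field_simps)
    qed
    have n1: "1 / (real n + 1) \<le> 1" by simp
    have b: "\<bar>conv (mol n) g x - g x\<bar> \<le> ?e * ?I x" for x
    proof (cases "x \<in> {-\<bar>R\<bar>-1..\<bar>R\<bar>+1}")
      case False
      then have "\<bar>R\<bar> + 1 < \<bar>x\<bar>" by auto
      then have x: "1 / (real n + 1) + \<bar>R\<bar> < \<bar>x\<bar>" using n1 by linarith
      have "conv (mol n) g x = 0"
        by (rule conv_compact_support[OF mol_support _ x]) (use g(2) in auto)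
      moreover have "R < \<bar>x\<bar>" using False by auto
      then have "g x = 0" by (rule g(2))
      ultimately show ?thesis using False by simp
    next
      case True
      have i1: "integrable lborel (\<lambda>y. mol n (x - y) * g y)"
        by (intro L2_mult_integrable L2_reflect test_L2 mol_test L)
      have i2: "integrable lborel (\<lambda>y. mol n (x - y))"
        by (intro lborel_integrable_reflect test_integrable mol_test)
      have m1: "(\<integral>y. mol n (x - y) \<partial>lborel) = 1"
        using lborel_integral_reflect[of "mol n" x] mol_integral by simp
      have "conv (mol n) g x - g x = (\<integral>y. mol n (x - y) * g y - mol n (x - y) * g x \<partial>lborel)"
        unfolding conv_def using i1 i2 m1 by simp
      also have "\<bar>\<dots>\<bar> \<le> (\<integral>y. ?e * mol n (x - y) \<partial>lborel)"
      proof -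
        have "\<bar>mol n (x - y) * g y - mol n (x - y) * g x\<bar> \<le> ?e * mol n (x - y)" for y
        proof (cases "1 / (real n + 1) < \<bar>x - y\<bar>")
          case True then show ?thesis by (simp add: mol_support)
        next
          case False
          then have xy: "\<bar>x - y\<bar> \<le> 1" "\<bar>x - y\<bar> < d" using n1 nd by linarith+
          have "-\<bar>R\<bar>-2 \<le> y" "y \<le> \<bar>R\<bar>+2" using True xy by (simp_all, linarith+)
          then have "y \<in> {-\<bar>R\<bar>-2..\<bar>R\<bar>+2}" "x \<in> {-\<bar>R\<bar>-2..\<bar>R\<bar>+2}" "dist y x < d"
            using True xy by (auto simp: dist_real_def)
          then have "\<bar>g y - g x\<bar> \<le> ?e" using d(2)[of x y] by (auto simp: dist_real_def)
          then have "mol n (x - y) * \<bar>g y - g x\<bar> \<le> mol n (x - y) * ?e"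
            using mol_nonneg by (intro mult_left_mono)
          moreover have "\<bar>mol n (x - y) * g y - mol n (x - y) * g x\<bar> = mol n (x - y) * \<bar>g y - g x\<bar>"
            using mol_nonneg[of n "x - y"] by (simp add: abs_mult flip: right_diff_distrib)
          ultimately show ?thesis by (simp add: mult.commute)
        qed
        then show ?thesis
          using i1 i2 by (intro order_trans[OF integral_abs_bound] integral_mono) auto
      qed
      finally show ?thesis using True m1 by simp
    qed
    have "nrm (\<lambda>x. conv (mol n) g x - g x) \<le> ?e * nrm ?I"
    proof (rule nrm_bound_AE[OF L2_indicator])
      show "(\<lambda>x. conv (mol n) g x - g x) \<in> borel_measurable borel"
        using conv_meas[OF mol_test L] L2_meas[OF L] by measurable
    qed (use b e' in auto)
    also have "\<dots> < e"
    proof -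
      have "a / (b + 1) * b < a" if "a > 0" "b \<ge> 0" for a b :: real
        using that by (simp add: field_simps)
      from this[OF e nrm_nonneg] show ?thesis .
    qed
    finally show "norm (nrm (\<lambda>x. conv (mol n) g x - g x) - 0) < e" by simp
  qed
qed

lemma L2_dominated_convergence:
  assumes h: "\<And>n. h n \<in> borel_measurable borel" and u: "u \<in> borel_measurable borel" and b: "L2 b"
    and lim: "AE x in lborel. (\<lambda>n. h n x) \<longlonglongrightarrow> u x"
    and bd: "\<And>n. AE x in lborel. \<bar>h n x\<bar> \<le> b x"
  shows "(\<lambda>n. nrm (\<lambda>x. h n x - u x)) \<longlonglongrightarrow> 0"
proof -
  have bd': "AE x in lborel. \<forall>n. \<bar>h n x\<bar> \<le> b x" using bd by (simp add: AE_all_countable)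
  have ub: "AE x in lborel. \<bar>u x\<bar> \<le> b x"
    using lim bd'
  proof eventually_elim
    case (elim x)
    show ?case by (rule tendsto_upperbound[OF tendsto_rabs[OF elim(1)]]) (use elim in auto)
  qed
  have "(\<lambda>n. \<integral>x. (h n x - u x)^2 \<partial>lborel) \<longlonglongrightarrow> (\<integral>x. 0 \<partial>(lborel :: real measure))"
  proof (rule integral_dominated_convergence[where w = "\<lambda>x. 4 * (b x)^2"])
    show "AE x in lborel. (\<lambda>n. (h n x - u x)\<^sup>2) \<longlonglongrightarrow> 0"
      using lim
    proof eventually_elim
      case (elim x)
      have "(\<lambda>n. (h n x - u x)\<^sup>2) \<longlonglongrightarrow> (u x - u x)^2" by (intro tendsto_intros elim)
      then show ?case by simp
    qed
    show "AE x in lborel. norm ((h n x - u x)\<^sup>2) \<le> 4 * (b x)\<^sup>2" for n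
      using bd' ub
    proof eventually_elim
      case (elim x)
      have "\<bar>h n x - u x\<bar> \<le> 2 * b x" using elim(1)[rule_format, of n] elim(2) by linarith
      then have "\<bar>h n x - u x\<bar>^2 \<le> (2 * b x)^2" by (intro power_mono) auto
      then show ?case by (simp add: power_mult_distrib)
    qed
  qed (use h u b in \<open>auto simp: L2_def\<close>)
  then have "(\<lambda>n. sqrt (\<integral>x. (h n x - u x)^2 \<partial>lborel)) \<longlonglongrightarrow> sqrt 0"
    by (intro tendsto_real_sqrt) simp
  then show ?thesis by (simp add: nrm_def)
qed

section \<open>Density of continuous functions of bounded support, and of mollifications\<close>

definition clampf :: "real \<Rightarrow> rfun" where "clampf k x = max (- k) (min k x)"
definition tent :: "real \<Rightarrow> rfun" where "tent k x = max 0 (min 1 (k + 1 - \<bar>x\<bar>))"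

text \<open>Clamping the values at \<open>k\<close> and cutting off near radius \<open>k\<close>
  changes \<open>u\<close> little in L2. Measurability supplies continuous functions converging to
  \<open>u\<close> almost everywhere, about whose size nothing is known; the same clamp and cut-off
  applied to them provides a dominating function, hence convergence in L2.\<close>

lemma L2_approx_cc:
  assumes u: "L2 u" and e: "e > 0"
  obtains g R where "continuous_on UNIV g" "\<And>x. R < \<bar>x\<bar> \<Longrightarrow> g x = 0" "nrm (\<lambda>x. u x - g x) < e"
proof -
  have um: "u \<in> borel_measurable borel" by (rule L2_meas[OF u])
  have tc: "continuous_on A (tent k)" for k A
    unfolding tent_def[abs_def] by (intro continuous_intros)
  have cc: "continuous_on A (clampf k)" for k A
    unfolding clampf_def[abs_def] by (intro continuous_intros)
  have [measurable]: "tent k \<in> borel_measurable borel" "clampf k \<in> borel_measurable borel" for k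
    using tc cc by (auto intro: borel_measurable_continuous_onI)
  let ?v = "\<lambda>k x. clampf (real k) (u x) * tent (real k) x"
  have "(\<lambda>k. nrm (\<lambda>x. ?v k x - u x)) \<longlonglongrightarrow> 0"
  proof (rule L2_dominated_convergence[OF _ um L2_abs[OF u]])
    show "AE x in lborel. (\<lambda>k. ?v k x) \<longlonglongrightarrow> u x"
    proof (rule AE_I2)
      fix x
      obtain N :: nat where N: "\<bar>x\<bar> + \<bar>u x\<bar> < real N" using reals_Archimedean2 by blast
      have "\<forall>\<^sub>F k in sequentially. ?v k x = u x"
        using eventually_ge_at_top[of N]
      proof eventually_elim
        case (elim k)
        then have "\<bar>x\<bar> + \<bar>u x\<bar> < real k" using N by linarith
        then show ?case by (simp add: clampf_def tent_def)
      qed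
      then show "(\<lambda>k. ?v k x) \<longlonglongrightarrow> u x" by (rule tendsto_eventually)
    qed
    show "AE x in lborel. \<bar>?v k x\<bar> \<le> \<bar>u x\<bar>" for k
    proof (rule AE_I2)
      fix x
      have "\<bar>clampf (real k) (u x)\<bar> * \<bar>tent (real k) x\<bar> \<le> \<bar>u x\<bar> * 1"
        by (intro mult_mono) (auto simp: clampf_def tent_def)
      then show "\<bar>?v k x\<bar> \<le> \<bar>u x\<bar>" by (simp add: abs_mult)
    qed
  qed (use um in measurable)
  then have "\<forall>\<^sub>F k in sequentially. nrm (\<lambda>x. ?v k x - u x) < e / 2"
    by (rule order_tendstoD) (use e in simp)
  then obtain k where k: "nrm (\<lambda>x. ?v k x - u x) < e / 2"
    by (meson eventually_sequentially order_refl)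
  have "u \<in> borel_measurable (lebesgue_on UNIV)"
    using measurable_completion[of u lborel borel] um by (simp add: lebesgue_on_UNIV_eq)
  then have "u measurable_on UNIV" by (subst measurable_on_iff_borel_measurable) auto
  then obtain N g where N: "negligible N" "\<And>n. continuous_on UNIV (g n)"
    "\<And>x. x \<notin> N \<Longrightarrow> (\<lambda>n. g n x) \<longlonglongrightarrow> u x"
    unfolding measurable_on_def by auto
  let ?g = "\<lambda>n x. clampf (real k) (g n x) * tent (real k) x"
  have gc: "continuous_on UNIV (?g n)" for n
    by (intro continuous_intros tc continuous_on_compose2[OF cc[of UNIV] N(2)]) auto
  have gs: "?g n x = 0" if "real k + 1 < \<bar>x\<bar>" for n x using that by (simp add: tent_def)
  have vL: "L2 (?v k)"
  proof (rule L2_bound[OF u])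
    show "AE x in lborel. \<bar>?v k x\<bar> \<le> 1 * \<bar>u x\<bar>"
    proof (rule AE_I2)
      fix x
      have "\<bar>clampf (real k) (u x)\<bar> * \<bar>tent (real k) x\<bar> \<le> \<bar>u x\<bar> * 1"
        by (intro mult_mono) (auto simp: clampf_def tent_def)
      then show "\<bar>?v k x\<bar> \<le> 1 * \<bar>u x\<bar>" by (simp add: abs_mult)
    qed
  qed (use um in measurable)
  have "(\<lambda>n. nrm (\<lambda>x. ?g n x - ?v k x)) \<longlonglongrightarrow> 0"
  proof (rule L2_dominated_convergence)
    show "?g n \<in> borel_measurable borel" for n by (rule borel_measurable_continuous_onI[OF gc])
    show "L2 (\<lambda>x. real k * indicator {-real k - 1..real k + 1} x)" by (intro L2_scale L2_indicator)
    have "N \<in> null_sets lebesgue" using N(1) by (simp add: negligible_iff_null_sets)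
    then have "AE x in lebesgue. x \<notin> N" by (rule AE_not_in)
    then have "AE x in lborel. x \<notin> N" by (simp add: AE_completion_iff)
    then show "AE x in lborel. (\<lambda>n. ?g n x) \<longlonglongrightarrow> ?v k x"
    proof eventually_elim
      case (elim x)
      show ?case
        by (intro tendsto_intros continuous_on_tendsto_compose[OF cc[of UNIV k] N(3)[OF elim]]) auto
    qed
    show "AE x in lborel. \<bar>?g n x\<bar> \<le> real k * indicator {-real k - 1..real k + 1} x" for n
    proof (rule AE_I2)
      fix x
      have "\<bar>clampf (real k) (g n x)\<bar> * \<bar>tent (real k) x\<bar> \<le> real k * indicator {-real k - 1..real k + 1} x"
        by (intro mult_mono) (auto simp: clampf_def tent_def indicator_def)
      then show "\<bar>?g n x\<bar> \<le> real k * indicator {-real k - 1..real k + 1} x" by (simp add: abs_mult)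
    qed
  qed (use um in measurable)
  then have "\<forall>\<^sub>F n in sequentially. nrm (\<lambda>x. ?g n x - ?v k x) < e / 2"
    by (rule order_tendstoD) (use e in simp)
  then obtain n where n: "nrm (\<lambda>x. ?g n x - ?v k x) < e / 2"
    by (meson eventually_sequentially order_refl)
  have "nrm (\<lambda>x. u x - ?g n x) \<le> nrm (\<lambda>x. u x - ?v k x) + nrm (\<lambda>x. ?v k x - ?g n x)"
    by (rule nrm_diff_triangle[OF u vL L2_cc[OF gc gs]])
  also have "\<dots> < e" using k n nrm_diff_commute[of u "?v k"] nrm_diff_commute[of "?v k" "?g n"] by linarith
  finally show thesis using that[OF gc gs] by blast
qed

lemma conv_diff: "test_fun \<kappa> \<Longrightarrow> L2 u \<Longrightarrow> L2 v \<Longrightarrow> conv \<kappa> (\<lambda>x. u x - v x) = (\<lambda>x. conv \<kappa> u x - conv \<kappa> v x)"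
  by (intro ext) (simp add: conv_ip ip_diff_left test_L2 L2_reflect)

lemma conv_add: "test_fun \<kappa> \<Longrightarrow> L2 u \<Longrightarrow> L2 v \<Longrightarrow> conv \<kappa> (\<lambda>x. u x + v x) = (\<lambda>x. conv \<kappa> u x + conv \<kappa> v x)"
  by (intro ext) (simp add: conv_ip ip_add_left test_L2 L2_reflect)

lemma conv_scale: "conv \<kappa> (\<lambda>x. a * u x) = (\<lambda>x. a * conv \<kappa> u x)"
  by (intro ext) (simp add: conv_ip ip_scale_left)

lemma Young_mol: "L2 u \<Longrightarrow> nrm (conv (mol n) u) \<le> nrm u"
  using Young_conv[OF mol_test[of n], of u] by (simp add: mol_abs_integral)

text \<open>Convolution with a mollifier does not increase the L2 norm, so convergence on a dense
  set extends to all of L2.\<close>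

lemma mol_conv_tendsto:
  assumes u: "L2 u"
  shows "(\<lambda>n. nrm (\<lambda>x. conv (mol n) u x - u x)) \<longlonglongrightarrow> 0"
proof (rule LIMSEQ_I)
  fix e :: real assume e: "e > 0"
  obtain g R where g: "continuous_on UNIV g" "\<And>x. R < \<bar>x\<bar> \<Longrightarrow> g x = 0" "nrm (\<lambda>x. u x - g x) < e / 3"
    using L2_approx_cc[OF u, of "e / 3"] e by auto
  have L: "L2 g" by (rule L2_cc[OF g(1,2)])
  have "\<forall>\<^sub>F n in sequentially. nrm (\<lambda>x. conv (mol n) g x - g x) < e / 3"
    by (rule order_tendstoD(2)[OF mol_conv_cc[OF g(1,2)]]) (use e in auto)
  then obtain N where N: "\<And>n. n \<ge> N \<Longrightarrow> nrm (\<lambda>x. conv (mol n) g x - g x) < e / 3"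
    by (auto simp: eventually_sequentially)
  show "\<exists>no. \<forall>n\<ge>no. norm (nrm (\<lambda>x. conv (mol n) u x - u x) - 0) < e"
  proof (intro exI allI impI)
    fix n assume n: "n \<ge> N"
    have cu: "L2 (conv (mol n) u)" and cg: "L2 (conv (mol n) g)"
      by (intro conv_L2 mol_test u L)+
    have "nrm (\<lambda>x. conv (mol n) u x - conv (mol n) g x) \<le> nrm (\<lambda>x. u x - g x)"
      using Young_mol[OF L2_diff[OF u L], of n] by (simp add: conv_diff[OF mol_test u L])
    then have "nrm (\<lambda>x. conv (mol n) u x - u x) < e / 3 + e / 3 + e / 3"
      using nrm_diff_triangle[OF cu cg u] nrm_diff_triangle[OF cg L u] N[OF n] g(3)
      by (simp add: nrm_diff_commute[of g u])
    then show "norm (nrm (\<lambda>x. conv (mol n) u x - u x) - 0) < e" by simp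
  qed
qed

lemma deriv_n_lin:
  "smooth f \<Longrightarrow> smooth g \<Longrightarrow>
   (deriv ^^ j) (\<lambda>x. a * f x + g x) = (\<lambda>x. a * (deriv ^^ j) f x + (deriv ^^ j) g x)"
proof (induction j arbitrary: f g)
  case (Suc j)
  have "deriv (\<lambda>x. a * f x + g x) = (\<lambda>x. a * deriv f x + deriv g x)"
    by (intro ext DERIV_imp_deriv DERIV_add DERIV_cmult smooth_DERIV Suc.prems)
  then show ?case using Suc.IH[OF Suc.prems[THEN smooth_deriv]]
    by (simp add: funpow_Suc_right del: funpow.simps)
qed simp

text \<open>A general \<open>\<zeta>\<close> with limit factor \<open>\<zeta> 0\<close> is the form
  that passes the induction: differentiating the product produces an expression of the same kind
  with \<open>deriv \<zeta>\<close> in place of \<open>\<zeta>\<close>, which converges by induction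
  and is then killed by its factor \<open>1 / (n + 1)\<close>.\<close>

lemma cutoff_tendsto:
  assumes "test_fun \<zeta>" "smooth h" "\<And>i. i \<le> j \<Longrightarrow> L2 ((deriv ^^ i) h)"
  shows "(\<lambda>n. nrm (\<lambda>x. (deriv ^^ j) (\<lambda>x. \<zeta> (x / (real n + 1)) * h x) x - \<zeta> 0 * (deriv ^^ j) h x)) \<longlonglongrightarrow> 0"
  using assms
proof (induction j arbitrary: \<zeta> h)
  case 0
  obtain C where C: "C \<ge> 0" "\<And>x. \<bar>\<zeta> x\<bar> \<le> C" using test_bounded[OF 0(1)] by blast
  have h: "L2 h" using 0(3)[of 0] by simp
  have [measurable]: "\<zeta> \<in> borel_measurable borel" "h \<in> borel_measurable borel"
    using test_meas[OF 0(1)] L2_meas[OF h] by auto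
  have "(\<lambda>n. nrm (\<lambda>x. \<zeta> (x / (real n + 1)) * h x - \<zeta> 0 * h x)) \<longlonglongrightarrow> 0"
  proof (rule L2_dominated_convergence[where b = "\<lambda>x. C * \<bar>h x\<bar>"])
    show "AE x in lborel. (\<lambda>n. \<zeta> (x / (real n + 1)) * h x) \<longlonglongrightarrow> \<zeta> 0 * h x"
    proof (rule AE_I2)
      fix x :: real
      have "(\<lambda>n. x * inverse (real (Suc n))) \<longlonglongrightarrow> x * 0"
        by (intro tendsto_mult tendsto_const LIMSEQ_inverse_real_of_nat)
      then have "(\<lambda>n. x / (real n + 1)) \<longlonglongrightarrow> 0" by (simp add: divide_inverse add.commute)
      then have "(\<lambda>n. \<zeta> (x / (real n + 1))) \<longlonglongrightarrow> \<zeta> 0"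
        by (intro continuous_on_tendsto_compose[OF test_continuous[OF 0(1), of UNIV]]) auto
      then show "(\<lambda>n. \<zeta> (x / (real n + 1)) * h x) \<longlonglongrightarrow> \<zeta> 0 * h x" by (intro tendsto_intros)
    qed
    show "AE x in lborel. \<bar>\<zeta> (x / (real n + 1)) * h x\<bar> \<le> C * \<bar>h x\<bar>" for n
      using C by (auto simp: abs_mult intro!: AE_I2 mult_right_mono)
  qed (measurable, intro L2_intros h)
  then show ?case by simp
next
  case (Suc j)
  have d\<zeta>: "test_fun (deriv \<zeta>)" and dh: "smooth (deriv h)"
    using Suc.prems by (auto intro: test_deriv smooth_deriv)
  have L1: "L2 ((deriv ^^ i) h)" if "i \<le> j" for i using Suc.prems(3)[of i] that by simp
  have L2: "L2 ((deriv ^^ i) (deriv h))" if "i \<le> j" for i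
    using Suc.prems(3)[of "Suc i"] that by (simp add: funpow_Suc_right del: funpow.simps)
  let ?A = "\<lambda>n. (deriv ^^ j) (\<lambda>x. deriv \<zeta> (x / (real n + 1)) * h x)"
  let ?B = "\<lambda>n. (deriv ^^ j) (\<lambda>x. \<zeta> (x / (real n + 1)) * deriv h x)"
  have tA: "test_fun (\<lambda>x. deriv \<zeta> (x / (real n + 1)) * h x)" for n
    using test_mult[OF test_affine[OF d\<zeta>, of "1 / (real n + 1)" 0] Suc.prems(2)] by simp
  have tB: "test_fun (\<lambda>x. \<zeta> (x / (real n + 1)) * deriv h x)" for n
    using test_mult[OF test_affine[OF Suc.prems(1), of "1 / (real n + 1)" 0] dh] by simp
  have LA: "L2 (?A n)" and LB: "L2 (?B n)" for n
    using test_L2[OF test_deriv_n[OF tA]] test_L2[OF test_deriv_n[OF tB]] by auto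
  have A: "(\<lambda>n. nrm (\<lambda>x. ?A n x - deriv \<zeta> 0 * (deriv ^^ j) h x)) \<longlonglongrightarrow> 0"
    by (rule Suc.IH[OF d\<zeta> Suc.prems(2) L1])
  have B: "(\<lambda>n. nrm (\<lambda>x. ?B n x - \<zeta> 0 * (deriv ^^ j) (deriv h) x)) \<longlonglongrightarrow> 0"
    by (rule Suc.IH[OF Suc.prems(1) dh L2])
  have eq: "(deriv ^^ Suc j) (\<lambda>x. \<zeta> (x / (real n + 1)) * h x) = (\<lambda>x. (1 / (real n + 1)) * ?A n x + ?B n x)" for n
  proof -
    have "((\<lambda>x. \<zeta> ((1 / (real n + 1)) * x + 0) * h x) has_real_derivative
        ((1 / (real n + 1)) * deriv \<zeta> ((1 / (real n + 1)) * x + 0)) * h x + deriv h x * \<zeta> ((1 / (real n + 1)) * x + 0)) (at x)" for x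
      by (rule DERIV_mult[OF deriv_affine smooth_DERIV[OF Suc.prems(2)]])
         (metis Suc.prems(1) diff_n_differentiable smooth_iff_diff_n test_smooth)
    then have "deriv (\<lambda>x. \<zeta> (x / (real n + 1)) * h x) =
       (\<lambda>x. (1 / (real n + 1)) * (deriv \<zeta> (x / (real n + 1)) * h x) + \<zeta> (x / (real n + 1)) * deriv h x)"
      by (intro ext DERIV_imp_deriv) (simp add: mult.commute mult.left_commute)
    then show ?thesis
      using deriv_n_lin[OF test_smooth[OF tA] test_smooth[OF tB], of j "1 / (real n + 1)" n n]
      by (simp add: funpow_Suc_right del: funpow.simps)
  qed
  have "(\<lambda>n. nrm (?A n)) \<longlonglongrightarrow> nrm (\<lambda>x. deriv \<zeta> 0 * (deriv ^^ j) h x)"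
    by (rule nrm_tendsto[OF LA L2_scale[OF L1] A]) simp
  then have lim: "(\<lambda>n. inverse (real (Suc n)) * nrm (?A n) + nrm (\<lambda>x. ?B n x - \<zeta> 0 * (deriv ^^ j) (deriv h) x))
     \<longlonglongrightarrow> 0 * nrm (\<lambda>x. deriv \<zeta> 0 * (deriv ^^ j) h x) + 0"
    by (intro tendsto_intros LIMSEQ_inverse_real_of_nat B)
  have bd: "norm (nrm (\<lambda>x. (deriv ^^ Suc j) (\<lambda>x. \<zeta> (x / (real n + 1)) * h x) x - \<zeta> 0 * (deriv ^^ Suc j) h x))
      \<le> inverse (real (Suc n)) * nrm (?A n) + nrm (\<lambda>x. ?B n x - \<zeta> 0 * (deriv ^^ j) (deriv h) x)" for n
  proof -
    have "nrm (\<lambda>x. (1 / (real n + 1)) * ?A n x + (?B n x - \<zeta> 0 * (deriv ^^ j) (deriv h) x))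
      \<le> nrm (\<lambda>x. (1 / (real n + 1)) * ?A n x) + nrm (\<lambda>x. ?B n x - \<zeta> 0 * (deriv ^^ j) (deriv h) x)"
      by (rule nrm_triangle) (intro L2_intros LA LB L2 order_refl)+
    then show ?thesis
      unfolding eq nrm_scale
      by (simp add: funpow_Suc_right inverse_eq_divide add.commute add_diff_eq del: funpow.simps)
  qed
  show ?case
    by (rule Lim_null_comparison[OF always_eventually[OF allI[OF bd]]]) (use lim in simp)
qed

section \<open>Weak derivatives\<close>

lemma weak_deriv_ip: "has_weak_deriv u g \<longleftrightarrow> (\<forall>\<psi>. test_fun \<psi> \<longrightarrow> ip u (deriv \<psi>) = - ip g \<psi>)"
  by (simp add: has_weak_deriv_def ip_def)

lemma conv_weak_deriv:
  assumes "has_weak_deriv u g" "test_fun \<kappa>"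
  shows "conv (deriv \<kappa>) u = conv \<kappa> g"
proof
  fix x
  have "ip u (deriv (\<lambda>y. \<kappa> (x - y))) = - ip g (\<lambda>y. \<kappa> (x - y))"
    using assms test_reflect weak_deriv_ip by blast
  then show "conv (deriv \<kappa>) u x = conv \<kappa> g x"
    by (simp add: conv_ip deriv_reflect[OF assms(2)] ip_minus_right)
qed

text \<open>\<open>U j\<close> plays the \<open>j\<close>-th weak derivative of \<open>U 0\<close>.
  Mollification turns the weak derivatives into true ones and a wide cut-off makes the support
  bounded; one test function serves all orders at once.\<close>

lemma test_dense:
  assumes L: "\<And>j. j \<le> k \<Longrightarrow> L2 (U j)"
    and D: "\<And>j. j < k \<Longrightarrow> has_weak_deriv (U j) (U (Suc j))"
    and e: "e > 0"
  shows "\<exists>g. test_fun g \<and> (\<forall>j\<le>k. nrm (\<lambda>x. (deriv ^^ j) g x - U j x) < e)"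
proof -
  have L0: "L2 (U 0)" using L by simp
  have *: "conv ((deriv ^^ j) \<kappa>) (U i) = conv \<kappa> (U (i + j))" if "i + j \<le> k" "test_fun \<kappa>" for i j \<kappa>
    using that
  proof (induction j arbitrary: i)
    case (Suc j)
    have "conv ((deriv ^^ Suc j) \<kappa>) (U i) = conv (deriv ((deriv ^^ j) \<kappa>)) (U i)" by simp
    also have "\<dots> = conv ((deriv ^^ j) \<kappa>) (U (Suc i))"
      using Suc.prems by (intro conv_weak_deriv D test_deriv_n) auto
    also have "\<dots> = conv \<kappa> (U (i + Suc j))" using Suc.IH[of "Suc i"] Suc.prems by simp
    finally show ?case .
  qed simp
  have dn: "(deriv ^^ j) (conv (mol n) (U 0)) = conv (mol n) (U j)" if "j \<le> k" for j n
    using *[of 0 j "mol n"] that by (simp add: conv_deriv_n mol_test L0)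
  have ev1: "\<forall>\<^sub>F n in sequentially. \<forall>j\<in>{..k}. nrm (\<lambda>x. conv (mol n) (U j) x - U j x) < e / 2"
    by (intro eventually_ball_finite ballI order_tendstoD(2)[OF mol_conv_tendsto] L) (use e in auto)
  then obtain n where n: "\<And>j. j \<le> k \<Longrightarrow> nrm (\<lambda>x. conv (mol n) (U j) x - U j x) < e / 2"
    using eventually_happens'[OF sequentially_bot ev1] by auto
  let ?h = "conv (mol n) (U 0)"
  have sh: "smooth ?h" by (intro conv_smooth mol_test L0)
  have Lh: "L2 ((deriv ^^ j) ?h)" if "j \<le> k" for j
    using that by (simp add: dn conv_L2 mol_test L)
  define \<zeta> where "\<zeta> = (\<lambda>x. inverse (bump 0) * bump x)"
  have \<zeta>: "test_fun \<zeta>" "\<zeta> 0 = 1"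
    using bump_0 by (simp_all add: \<zeta>_def test_scale bump_test)
  have lim: "(\<lambda>m. nrm (\<lambda>x. (deriv ^^ j) (\<lambda>x. \<zeta> (x / (real m + 1)) * ?h x) x - (deriv ^^ j) ?h x)) \<longlonglongrightarrow> 0"
    if j: "j \<le> k" for j
    using cutoff_tendsto[OF \<zeta>(1) sh Lh, of j] j \<zeta>(2) by simp
  have ev2: "\<forall>\<^sub>F m in sequentially. \<forall>j\<in>{..k}. nrm (\<lambda>x. (deriv ^^ j) (\<lambda>x. \<zeta> (x / (real m + 1)) * ?h x) x - (deriv ^^ j) ?h x) < e / 2"
    by (intro eventually_ball_finite ballI order_tendstoD(2)[OF lim]) (use e in auto)
  then obtain m where m: "\<And>j. j \<le> k \<Longrightarrow> nrm (\<lambda>x. (deriv ^^ j) (\<lambda>x. \<zeta> (x / (real m + 1)) * ?h x) x - (deriv ^^ j) ?h x) < e / 2"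
    using eventually_happens'[OF sequentially_bot ev2] by auto
  let ?g = "\<lambda>x. \<zeta> (x / (real m + 1)) * ?h x"
  have tg: "test_fun ?g"
    using test_mult[OF test_affine[OF \<zeta>(1), of "1 / (real m + 1)" 0] sh] by simp
  have "nrm (\<lambda>x. (deriv ^^ j) ?g x - U j x) < e" if j: "j \<le> k" for j
    using nrm_diff_triangle[OF test_L2[OF test_deriv_n[OF tg]] Lh[OF j] L[OF j], of j] m[OF j] n[OF j]
    by (simp add: dn[OF j])
  then show ?thesis using tg by blast
qed

lemma test_seq:
  assumes L: "\<And>j. j \<le> k \<Longrightarrow> L2 (U j)"
    and D: "\<And>j. j < k \<Longrightarrow> has_weak_deriv (U j) (U (Suc j))"
  obtains g :: "nat \<Rightarrow> rfun" where "\<And>n. test_fun (g n)"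
    "\<And>j. j \<le> k \<Longrightarrow> (\<lambda>n. nrm (\<lambda>x. (deriv ^^ j) (g n) x - U j x)) \<longlonglongrightarrow> 0"
proof -
  have "\<forall>n. \<exists>g. test_fun g \<and> (\<forall>j\<le>k. nrm (\<lambda>x. (deriv ^^ j) g x - U j x) < inverse (real (Suc n)))"
    by (intro allI test_dense assms) auto
  then obtain g where g: "\<And>n. test_fun (g n)" "\<And>n j. j \<le> k \<Longrightarrow> nrm (\<lambda>x. (deriv ^^ j) (g n) x - U j x) < inverse (real (Suc n))"
    by metis
  have "(\<lambda>n. nrm (\<lambda>x. (deriv ^^ j) (g n) x - U j x)) \<longlonglongrightarrow> 0" if "j \<le> k" for j
  proof (rule Lim_null_comparison[OF always_eventually[OF allI] LIMSEQ_inverse_real_of_nat])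
    show "norm (nrm (\<lambda>x. (deriv ^^ j) (g n) x - U j x)) \<le> inverse (real (Suc n))" for n
      using g(2)[OF that, of n] by simp
  qed
  then show thesis using that g(1) by blast
qed

lemma L2_seq:
  assumes "L2 u"
  obtains g where "\<And>n::nat. test_fun (g n)" "(\<lambda>n. nrm (\<lambda>x. g n x - u x)) \<longlonglongrightarrow> 0"
proof -
  obtain g where g: "\<And>n::nat. test_fun (g n)"
    "\<And>j::nat. j \<le> 0 \<Longrightarrow> (\<lambda>n. nrm (\<lambda>x. (deriv ^^ j) (g n) x - u x)) \<longlonglongrightarrow> 0"
    using test_seq[of 0 "\<lambda>_. u"] assms by blast
  from that[OF g(1)] g(2)[of 0] show thesis by simp
qed

text \<open>The derivative is an argument in place of the chosen \<open>wd u\<close>: closure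
  properties then hold for explicit formulas, whereas \<open>wd\<close> is determined only almost
  everywhere and respects sums or translations only in that sense.\<close>

definition W1 :: "rfun \<Rightarrow> rfun \<Rightarrow> bool" where
  "W1 u u1 \<longleftrightarrow> L2 u \<and> L2 u1 \<and> has_weak_deriv u u1"

lemma W1D: "W1 u u1 \<Longrightarrow> L2 u" "W1 u u1 \<Longrightarrow> L2 u1" "W1 u u1 \<Longrightarrow> has_weak_deriv u u1"
  by (auto simp: W1_def)

lemma W1_seq:
  assumes "W1 u u1"
  obtains g where "\<And>n::nat. test_fun (g n)" "(\<lambda>n. nrm (\<lambda>x. g n x - u x)) \<longlonglongrightarrow> 0"
    "(\<lambda>n. nrm (\<lambda>x. deriv (g n) x - u1 x)) \<longlonglongrightarrow> 0"
proof -
  let ?U = "\<lambda>j::nat. if j = 0 then u else u1"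
  obtain g where g: "\<And>n::nat. test_fun (g n)"
    "\<And>j. j \<le> 1 \<Longrightarrow> (\<lambda>n. nrm (\<lambda>x. (deriv ^^ j) (g n) x - ?U j x)) \<longlonglongrightarrow> 0"
  proof -
    have "L2 (?U j)" for j using assms by (simp add: W1_def)
    moreover have "has_weak_deriv (?U j) (?U (Suc j))" if "j < 1" for j
      using assms that by (simp add: W1_def)
    ultimately show thesis using test_seq[of 1 ?U] that by blast
  qed
  from g(2)[of 0] g(2)[of 1] show thesis by (intro that[OF g(1)]) simp_all
qed

text \<open>\<open>g\<close> is tested against test functions approximating \<open>g\<close> itself.
  In this way bounds obtained from the weak formulation, uniform in the test function, become bounds
  in norm.\<close>

lemma nrm_dual:
  assumes g: "L2 g" and b: "\<And>\<theta>. test_fun \<theta> \<Longrightarrow> \<bar>ip g \<theta>\<bar> \<le> C * nrm \<theta>" and C: "C \<ge> 0"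
  shows "nrm g \<le> C"
proof -
  obtain h where h: "\<And>n::nat. test_fun (h n)" "(\<lambda>n. nrm (\<lambda>x. h n x - g x)) \<longlonglongrightarrow> 0"
    using L2_seq[OF g] by blast
  have Lh: "L2 (h n)" for n by (rule test_L2[OF h(1)])
  have "(\<lambda>n. ip (h n) g) \<longlonglongrightarrow> ip g g" by (rule ip_tendsto_left[OF Lh g g h(2)])
  moreover have "(\<lambda>n. C * nrm (h n)) \<longlonglongrightarrow> C * nrm g"
    by (intro tendsto_intros nrm_tendsto[OF Lh g h(2)])
  moreover have "ip (h n) g \<le> C * nrm (h n)" for n
    using b[OF h(1), of n] by (simp add: ip_commute)
  ultimately have "ip g g \<le> C * nrm g" by (intro LIMSEQ_le) auto
  then have "nrm g * nrm g \<le> C * nrm g" by (simp add: nrm_sq_ip[symmetric] power2_eq_square)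
  then show ?thesis using nrm_nonneg[of g] C by (cases "nrm g = 0") (auto simp: mult_le_cancel_right)
qed

lemma weak_deriv_unique:
  assumes "has_weak_deriv u g" "has_weak_deriv u g'" "L2 g" "L2 g'"
  shows "AE x in lborel. g x = g' x"
proof -
  have "nrm (\<lambda>x. g x - g' x) \<le> 0"
  proof (rule nrm_dual)
    fix \<theta> assume t: "test_fun \<theta>"
    have "ip g \<theta> = ip g' \<theta>" using assms(1,2) t unfolding weak_deriv_ip by (metis neg_equal_iff_equal)
    then show "\<bar>ip (\<lambda>x. g x - g' x) \<theta>\<bar> \<le> 0 * nrm \<theta>" using assms t by (simp add: ip_diff_left test_L2)
  qed (use assms in \<open>auto intro: L2_diff\<close>)
  then have "nrm (\<lambda>x. g x - g' x) = 0" using nrm_nonneg by (rule antisym)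
  from nrm_eq_0_AE[OF L2_diff[OF assms(3,4)] this] show ?thesis by simp
qed

lemma cs_continuous_integrable:
  fixes g :: rfun
  assumes "continuous_on UNIV g" "\<And>x. R < \<bar>x\<bar> \<Longrightarrow> g x = 0"
  shows "integrable lborel g"
proof -
  obtain C where "C \<ge> 0" "\<And>x. \<bar>g x\<bar> \<le> C * indicator {-\<bar>R\<bar>..\<bar>R\<bar>} x"
    using continuous_cs_bounded[OF assms] by blast
  note C = this
  show ?thesis
  proof (rule Bochner_Integration.integrable_bound)
    show "integrable lborel (\<lambda>x. C * indicator {-\<bar>R\<bar>..\<bar>R\<bar>} x)"
      by (intro Bochner_Integration.integrable_mult_right)
         (simp add: integrable_indicator_iff emeasure_lborel_Icc_eq)
    show "g \<in> borel_measurable lborel"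
      using borel_measurable_continuous_onI[OF assms(1)] by simp
    show "AE x in lborel. norm (g x) \<le> norm (C * indicator {-\<bar>R\<bar>..\<bar>R\<bar>} x)"
      using C by (intro AE_I2) simp
  qed
qed

lemma integral_deriv_cs:
  fixes G :: rfun
  assumes d: "\<And>x. (G has_real_derivative G' x) (at x)" and c: "continuous_on UNIV G'"
    and s: "\<And>x. R < \<bar>x\<bar> \<Longrightarrow> G x = 0"
  shows "(\<integral>x. G' x \<partial>lborel) = 0"
proof -
  let ?S = "\<bar>R\<bar> + 1"
  have z: "G' x = 0" if "R < \<bar>x\<bar>" for x by (rule DERIV_zero_outside[OF s d that])
  have "(\<integral>x. G' x * indicator {-?S..?S} x \<partial>lborel) = G ?S - G (-?S)"
    by (rule integral_FTC_Icc_real) (use d c in \<open>auto simp: continuous_on_eq_continuous_at\<close>)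
  also have "\<dots> = 0" using s by simp
  also have "(\<lambda>x. G' x * indicator {-?S..?S} x) = G'"
  proof
    fix x
    show "G' x * indicator {-?S..?S} x = G' x"
    proof (cases "x \<in> {-?S..?S}")
      case False
      then have "R < \<bar>x\<bar>" by auto
      then show ?thesis using z by simp
    qed simp
  qed
  finally show ?thesis .
qed

lemma C1_weak_deriv:
  assumes d: "\<And>x. (h has_real_derivative h' x) (at x)" and c: "continuous_on UNIV h'"
  shows "has_weak_deriv h h'"
  unfolding has_weak_deriv_def
proof (intro allI impI)
  fix \<psi> assume t: "test_fun \<psi>"
  obtain R where R: "\<And>x. R < \<bar>x\<bar> \<Longrightarrow> \<psi> x = 0" using t unfolding test_fun_iff by blast
  have R': "deriv \<psi> x = 0" if "R < \<bar>x\<bar>" for x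
    by (rule DERIV_zero_outside[OF R test_DERIV[OF t] that])
  have hc: "continuous_on UNIV h" using d by (meson DERIV_isCont continuous_at_imp_continuous_on)
  have i: "integrable lborel (\<lambda>x. h x * deriv \<psi> x)" "integrable lborel (\<lambda>x. h' x * \<psi> x)"
    by (rule cs_continuous_integrable[where R = R];
        use R R' hc c test_continuous[OF t] test_continuous[OF test_deriv[OF t]] in \<open>auto intro: continuous_intros\<close>)+
  have "(\<integral>x. h' x * \<psi> x + deriv \<psi> x * h x \<partial>lborel) = 0"
  proof (rule integral_deriv_cs[where R = R and G = "\<lambda>x. h x * \<psi> x"])
    show "((\<lambda>x. h x * \<psi> x) has_real_derivative h' x * \<psi> x + deriv \<psi> x * h x) (at x)" for x
      by (rule DERIV_mult[OF d test_DERIV[OF t]])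
    show "continuous_on UNIV (\<lambda>x. h' x * \<psi> x + deriv \<psi> x * h x)"
      using test_continuous[OF t] test_continuous[OF test_deriv[OF t]] c hc by (intro continuous_intros) auto
  qed (use R in simp)
  then show "(\<integral>x. h x * deriv \<psi> x \<partial>lborel) = - (\<integral>x. h' x * \<psi> x \<partial>lborel)"
    using i by (simp add: mult.commute)
qed

lemma W1_test: "test_fun g \<Longrightarrow> W1 g (deriv g)"
  unfolding W1_def by (auto intro!: test_L2 test_deriv C1_weak_deriv test_DERIV test_continuous)

lemma W1_conv: "test_fun \<kappa> \<Longrightarrow> L2 u \<Longrightarrow> W1 (conv \<kappa> u) (conv (deriv \<kappa>) u)"
  unfolding W1_def
  by (auto intro!: conv_L2 C1_weak_deriv conv_DERIV test_deriv smooth_continuous conv_smooth)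

lemma W1_add: "W1 u u1 \<Longrightarrow> W1 v v1 \<Longrightarrow> W1 (\<lambda>x. u x + v x) (\<lambda>x. u1 x + v1 x)"
  unfolding W1_def weak_deriv_ip
  by (auto intro!: L2_intros simp: ip_add_left test_L2 test_deriv)

lemma W1_scale: "W1 u u1 \<Longrightarrow> W1 (\<lambda>x. a * u x) (\<lambda>x. a * u1 x)"
  unfolding W1_def weak_deriv_ip
  by (auto intro!: L2_intros simp: ip_scale_left)

lemma W1_diff: "W1 u u1 \<Longrightarrow> W1 v v1 \<Longrightarrow> W1 (\<lambda>x. u x - v x) (\<lambda>x. u1 x - v1 x)"
  using W1_add[OF _ W1_scale[of v v1 "-1"], of u u1] by simp

lemma W1_shift: assumes "W1 u u1" shows "W1 (\<lambda>x. u (x + r)) (\<lambda>x. u1 (x + r))"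
proof -
  have "ip (\<lambda>x. u (x + r)) (deriv \<psi>) = - ip (\<lambda>x. u1 (x + r)) \<psi>" if t: "test_fun \<psi>" for \<psi>
  proof -
    have "ip u (deriv (\<lambda>x. \<psi> (x + - r))) = - ip u1 (\<lambda>x. \<psi> (x + - r))"
      using assms test_shift[OF t] unfolding W1_def weak_deriv_ip by blast
    then have "ip u (\<lambda>x. deriv \<psi> (x + - r)) = - ip u1 (\<lambda>x. \<psi> (x + - r))"
      unfolding deriv_shift[OF t] .
    then show ?thesis
      using ip_shift[of u r "\<lambda>x. deriv \<psi> (x + - r)"] ip_shift[of u1 r "\<lambda>x. \<psi> (x + - r)"]
      by simp
  qed
  then show ?thesis using assms by (auto simp: W1_def weak_deriv_ip L2_shift)
qed

lemma ip_cong_AE: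
  assumes "AE x in lborel. u x = v x" "L2 u" "L2 v" "L2 w"
  shows "ip u w = ip v w"
  unfolding ip_def
  by (rule integral_cong_AE) (use assms in \<open>auto simp: L2_def\<close>)

lemma W1_cong:
  assumes "W1 u u1" "AE x in lborel. u x = v x" "AE x in lborel. u1 x = v1 x" "L2 v" "L2 v1"
  shows "W1 v v1"
proof -
  have "ip v (deriv \<psi>) = - ip v1 \<psi>" if t: "test_fun \<psi>" for \<psi>
    using assms ip_cong_AE[OF assms(2) _ assms(4) test_L2[OF test_deriv[OF t]]]
      ip_cong_AE[OF assms(3) _ assms(5) test_L2[OF t]] t
    by (auto simp: W1_def weak_deriv_ip)
  then show ?thesis using assms by (auto simp: W1_def weak_deriv_ip)
qed

section \<open>Explicit weak derivatives and the spaces \<open>H1\<close> and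
  \<open>H2\<close>\<close>

lemma H1_iff: "H1 u \<longleftrightarrow> (\<exists>g. W1 u g)"
  by (auto simp: H1_def W1_def)

lemma W1_wd: "H1 u \<Longrightarrow> W1 u (wd u)"
  unfolding H1_def W1_def wd_def
  by (metis (mono_tags, lifting) someI_ex)

lemma W1_wd_AE: assumes "W1 u g" shows "AE x in lborel. wd u x = g x"
proof -
  have "W1 u (wd u)" using assms H1_iff W1_wd by blast
  then show ?thesis using assms by (intro weak_deriv_unique[of u]) (auto simp: W1_def)
qed

definition W2 :: "rfun \<Rightarrow> rfun \<Rightarrow> rfun \<Rightarrow> bool" where
  "W2 u u1 u2 \<longleftrightarrow> W1 u u1 \<and> W1 u1 u2"

lemma W2D: "W2 u u1 u2 \<Longrightarrow> W1 u u1" "W2 u u1 u2 \<Longrightarrow> W1 u1 u2"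
  "W2 u u1 u2 \<Longrightarrow> L2 u" "W2 u u1 u2 \<Longrightarrow> L2 u1" "W2 u u1 u2 \<Longrightarrow> L2 u2"
  by (auto simp: W2_def W1_def)

lemma W2_wd: "H2 u \<Longrightarrow> W2 u (wd u) (wd (wd u))"
  by (simp add: H2_def W2_def W1_wd)

lemma W2_H2:
  assumes "W2 u u1 u2"
  shows "H2 u" "AE x in lborel. wd u x = u1 x" "AE x in lborel. wd (wd u) x = u2 x"
proof -
  have a: "AE x in lborel. wd u x = u1 x" using W1_wd_AE assms W2_def by blast
  have b: "W1 u (wd u)" using assms H1_iff W1_wd W2_def by blast
  have c: "W1 (wd u) u2"
    by (rule W1_cong[of u1 u2]) (use assms a b in \<open>auto simp: W2_def W1_def\<close>)
  show "H2 u" unfolding H2_def using b c H1_iff by blast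
  show "AE x in lborel. wd u x = u1 x" by (rule a)
  show "AE x in lborel. wd (wd u) x = u2 x" by (rule W1_wd_AE[OF c])
qed

lemma W2_add: "W2 u u1 u2 \<Longrightarrow> W2 v v1 v2 \<Longrightarrow> W2 (\<lambda>x. u x + v x) (\<lambda>x. u1 x + v1 x) (\<lambda>x. u2 x + v2 x)"
  by (simp add: W2_def W1_add)
lemma W2_diff: "W2 u u1 u2 \<Longrightarrow> W2 v v1 v2 \<Longrightarrow> W2 (\<lambda>x. u x - v x) (\<lambda>x. u1 x - v1 x) (\<lambda>x. u2 x - v2 x)"
  by (simp add: W2_def W1_diff)
lemma W2_scale: "W2 u u1 u2 \<Longrightarrow> W2 (\<lambda>x. a * u x) (\<lambda>x. a * u1 x) (\<lambda>x. a * u2 x)"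
  by (simp add: W2_def W1_scale)
lemma W2_shift: "W2 u u1 u2 \<Longrightarrow> W2 (\<lambda>x. u (x + r)) (\<lambda>x. u1 (x + r)) (\<lambda>x. u2 (x + r))"
  by (simp add: W2_def W1_shift)
lemma W2_test: "test_fun g \<Longrightarrow> W2 g (deriv g) (deriv (deriv g))"
  by (simp add: W2_def W1_test test_deriv)

text \<open>Approximating \<open>b\<close> by test functions reduces this to the definition of the
  weak derivative of \<open>a\<close>; no boundary term at infinity arises.\<close>

lemma W1_ip_parts:
  assumes "W1 a a1" "W1 b b1"
  shows "ip a b1 = - ip a1 b"
proof -
  obtain g where g: "\<And>n::nat. test_fun (g n)" "(\<lambda>n. nrm (\<lambda>x. g n x - b x)) \<longlonglongrightarrow> 0"
    "(\<lambda>n. nrm (\<lambda>x. deriv (g n) x - b1 x)) \<longlonglongrightarrow> 0"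
    using W1_seq[OF assms(2)] by blast
  have L: "L2 a" "L2 a1" "L2 b" "L2 b1" using assms by (auto simp: W1_def)
  have 1: "(\<lambda>n. ip (deriv (g n)) a) \<longlonglongrightarrow> ip b1 a"
    by (rule ip_tendsto_left[OF _ L(4) L(1) g(3)]) (intro test_L2 test_deriv g)
  have 2: "(\<lambda>n. ip (g n) a1) \<longlonglongrightarrow> ip b a1"
    by (rule ip_tendsto_left[OF _ L(3) L(2) g(2)]) (intro test_L2 g)
  have "ip (deriv (g n)) a = - ip (g n) a1" for n
    using assms(1) g(1)[of n] by (auto simp: W1_def weak_deriv_ip ip_commute)
  then have "(\<lambda>n. - ip (g n) a1) \<longlonglongrightarrow> ip b1 a" using 1 by simp
  then have "ip b1 a = - ip b a1" using tendsto_minus[OF 2] by (rule LIMSEQ_unique)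
  then show ?thesis by (simp add: ip_commute)
qed

text \<open>The Sobolev inequality on the line: \<open>(g x)^2\<close> is the integral of
  \<open>2 * g * deriv g\<close> from a point beyond the support up to \<open>x\<close>.\<close>

lemma test_sup_bound:
  assumes t: "test_fun g"
  shows "\<bar>g x\<bar> \<le> nrm g + nrm (deriv g)"
proof -
  obtain R where R: "\<And>x. R < \<bar>x\<bar> \<Longrightarrow> g x = 0" using t unfolding test_fun_iff by blast
  let ?S = "\<bar>R\<bar> + \<bar>x\<bar> + 1"
  have L: "L2 g" "L2 (deriv g)" using t by (auto intro: test_L2 test_deriv)
  have i: "integrable lborel (\<lambda>y. 2 * (\<bar>g y\<bar> * \<bar>deriv g y\<bar>))"
    using L2_abs_mult_integrable[OF L] by simp
  have "(\<integral>y. (2 * (deriv g y * g y)) * indicator {-?S..x} y \<partial>lborel) = (g x)^2 - (g (-?S))^2"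
  proof (rule integral_FTC_Icc_real)
    show "((\<lambda>x. (g x)^2) has_real_derivative 2 * (deriv g y * g y)) (at y)" for y
      using DERIV_mult[OF test_DERIV[OF t] test_DERIV[OF t], of y] by (simp add: power2_eq_square mult.commute)
    show "isCont (\<lambda>y. 2 * (deriv g y * g y)) y" for y
      using test_continuous[OF t, of UNIV] test_continuous[OF test_deriv[OF t], of UNIV]
      by (auto simp: continuous_on_eq_continuous_at intro!: continuous_intros)
  qed auto
  also have "g (-?S) = 0" by (rule R) auto
  finally have "(g x)^2 = (\<integral>y. (2 * (deriv g y * g y)) * indicator {-?S..x} y \<partial>lborel)" by simp
  also have "\<dots> \<le> (\<integral>y. 2 * (\<bar>g y\<bar> * \<bar>deriv g y\<bar>) \<partial>lborel)"
  proof (rule integral_mono[OF _ i])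
    show "integrable lborel (\<lambda>y. (2 * (deriv g y * g y)) * indicator {-?S..x} y)"
      using L2_mult_integrable[OF L(2,1)]
      by (intro integrable_mult_indicator[where f = "\<lambda>y. 2 * (deriv g y * g y)" and A = "{-?S..x}", unfolded real_scaleR_def, simplified mult.commute[of "indicator _ _"]]) auto
    show "(2 * (deriv g y * g y)) * indicator {-?S..x} y \<le> 2 * (\<bar>g y\<bar> * \<bar>deriv g y\<bar>)" for y
      using abs_ge_self[of "deriv g y * g y"] by (auto simp: indicator_def abs_mult mult.commute)
  qed
  also have "\<dots> = 2 * ip (\<lambda>y. \<bar>g y\<bar>) (\<lambda>y. \<bar>deriv g y\<bar>)" by (simp add: ip_def)
  also have "\<dots> \<le> 2 * (nrm (\<lambda>y. \<bar>g y\<bar>) * nrm (\<lambda>y. \<bar>deriv g y\<bar>))"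
    using Cauchy_Schwarz_ip[OF L2_abs[OF L(1)] L2_abs[OF L(2)]] by simp
  also have "\<dots> = 2 * (nrm g * nrm (deriv g))" by (simp add: nrm_def)
  also have "\<dots> \<le> (nrm g + nrm (deriv g))^2" by (simp add: power2_sum)
  finally have "\<bar>g x\<bar>^2 \<le> (nrm g + nrm (deriv g))^2" by simp
  then show ?thesis by (rule power2_le_imp_le) simp
qed

lemma L2_AE_subseq:
  assumes "\<And>n::nat. L2 (g n)" "L2 u" "(\<lambda>n. nrm (\<lambda>x. g n x - u x)) \<longlonglongrightarrow> 0"
  obtains r where "strict_mono r" "AE x in lborel. (\<lambda>n. g (r n) x) \<longlonglongrightarrow> u x"
proof -
  have "(\<lambda>n. (nrm (\<lambda>x. g n x - u x))^2) \<longlonglongrightarrow> 0^2" by (intro tendsto_intros assms)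
  then have "(\<lambda>n. \<integral>x. norm ((g n x - u x)^2) \<partial>lborel) \<longlonglongrightarrow> 0" by (simp add: nrm_sq)
  from tendsto_L1_AE_subseq[OF L2_sq_integrable[OF L2_diff[OF assms(1,2)]] this]
  obtain r :: "nat \<Rightarrow> nat" where r: "strict_mono r" "AE x in lborel. (\<lambda>n. (g (r n) x - u x)^2) \<longlonglongrightarrow> 0" by blast
  have "AE x in lborel. (\<lambda>n. g (r n) x) \<longlonglongrightarrow> u x"
    using r(2)
  proof eventually_elim
    case (elim x)
    from tendsto_real_sqrt[OF elim] have "(\<lambda>n. \<bar>g (r n) x - u x\<bar>) \<longlonglongrightarrow> 0" by simp
    then have "(\<lambda>n. g (r n) x - u x) \<longlonglongrightarrow> 0" by (rule tendsto_rabs_zero_cancel)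
    then show ?case by (rule LIM_zero_cancel)
  qed
  then show thesis using that r(1) by blast
qed

lemma W1_sup_bound:
  assumes "W1 u u1"
  shows "AE x in lborel. \<bar>u x\<bar> \<le> nrm u + nrm u1"
proof -
  obtain g where g: "\<And>n::nat. test_fun (g n)" "(\<lambda>n. nrm (\<lambda>x. g n x - u x)) \<longlonglongrightarrow> 0"
    "(\<lambda>n. nrm (\<lambda>x. deriv (g n) x - u1 x)) \<longlonglongrightarrow> 0"
    using W1_seq[OF assms] by blast
  have L: "L2 u" "L2 u1" "\<And>n. L2 (g n)" "\<And>n. L2 (deriv (g n))"
    using assms g(1) by (auto simp: W1_def intro: test_L2 test_deriv)
  obtain r where r: "strict_mono r" "AE x in lborel. (\<lambda>n. g (r n) x) \<longlonglongrightarrow> u x"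
    using L2_AE_subseq[OF L(3,1) g(2)] by blast
  have "(\<lambda>n. nrm (g n) + nrm (deriv (g n))) \<longlonglongrightarrow> nrm u + nrm u1"
    by (intro tendsto_add nrm_tendsto[OF L(3,1) g(2)] nrm_tendsto[OF L(4,2) g(3)])
  from LIMSEQ_subseq_LIMSEQ[OF this r(1)]
  have lim: "(\<lambda>n. nrm (g (r n)) + nrm (deriv (g (r n)))) \<longlonglongrightarrow> nrm u + nrm u1" by (simp add: o_def)
  show ?thesis using r(2)
  proof eventually_elim
    case (elim x)
    show ?case
      by (rule LIMSEQ_le[OF tendsto_rabs[OF elim] lim]) (use test_sup_bound[OF g(1)] in auto)
  qed
qed

text \<open>For a test function the L2 change is at most linear in the shift; density and
  translation invariance of the norm do the rest.\<close>

lemma L2_shift_continuous: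
  assumes u: "L2 u" and e: "e > 0"
  obtains d where "d > 0" "\<And>h. \<bar>h\<bar> < d \<Longrightarrow> nrm (\<lambda>x. u (x + h) - u x) < e"
proof -
  obtain \<theta> where t: "test_fun \<theta>" "nrm (\<lambda>x. \<theta> x - u x) < e / 4"
    using test_dense[of 0 "\<lambda>_. u" "e / 4"] u e by auto
  obtain C R where C: "C \<ge> 0" "\<And>x h. \<bar>h\<bar> \<le> 1 \<Longrightarrow>
     \<bar>\<theta> (x + h) - \<theta> x - h * deriv \<theta> x\<bar> \<le> C * h^2 * indicator {-R..R} x"
    using test_taylor2[OF t(1)] by blast
  let ?I = "indicator {-R..R} :: rfun"
  have Lt: "L2 \<theta>" "L2 (deriv \<theta>)" using t by (auto intro: test_L2 test_deriv)
  let ?M = "C * nrm ?I + nrm (deriv \<theta>) + 1"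
  have M: "?M > 0" using C(1) by (simp add: add_nonneg_pos)
  have b: "nrm (\<lambda>x. \<theta> (x + h) - \<theta> x) \<le> \<bar>h\<bar> * ?M" if h: "\<bar>h\<bar> \<le> 1" for h
  proof -
    have 1: "nrm (\<lambda>x. \<theta> (x + h) - \<theta> x - h * deriv \<theta> x) \<le> (C * h^2) * nrm ?I"
    proof (rule nrm_bound_AE[OF L2_indicator])
      show "(\<lambda>x. \<theta> (x + h) - \<theta> x - h * deriv \<theta> x) \<in> borel_measurable borel"
        by (intro L2_meas L2_intros L2_shift Lt)
    qed (use C h in auto)
    have "nrm (\<lambda>x. \<theta> (x + h) - \<theta> x) \<le> nrm (\<lambda>x. h * deriv \<theta> x) + nrm (\<lambda>x. \<theta> (x + h) - \<theta> x - h * deriv \<theta> x)"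
      by (rule nrm_le_diff) (intro L2_intros L2_shift Lt)+
    also have "\<dots> \<le> \<bar>h\<bar> * nrm (deriv \<theta>) + (C * h^2) * nrm ?I" using 1 by (simp add: nrm_scale)
    also have "\<dots> \<le> \<bar>h\<bar> * ?M"
    proof -
      have "h^2 \<le> \<bar>h\<bar> * 1" using mult_left_mono[OF h abs_ge_zero[of h]] by (simp add: power2_eq_square)
      then have "h^2 * (C * nrm ?I) \<le> (\<bar>h\<bar> * 1) * (C * nrm ?I)" using C(1) by (intro mult_right_mono) auto
      then show ?thesis by (simp add: algebra_simps)
    qed
    finally show ?thesis .
  qed
  show thesis
  proof (rule that[of "min 1 (e / (4 * ?M))"])
    show "0 < min 1 (e / (4 * ?M))" using e M by simp
    fix h assume h: "\<bar>h\<bar> < min 1 (e / (4 * ?M))"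
    have "\<bar>h\<bar> * ?M < e / 4" using h M by (simp add: field_simps)
    then have 1: "nrm (\<lambda>x. \<theta> (x + h) - \<theta> x) < e / 4" using b[of h] h by linarith
    have Lu: "L2 (\<lambda>x. u (x + h))" "L2 (\<lambda>x. \<theta> (x + h))" by (intro L2_shift u Lt)+
    have 2: "nrm (\<lambda>x. u (x + h) - \<theta> (x + h)) < e / 4"
      using t(2) nrm_shift[of "\<lambda>x. u x - \<theta> x" h] nrm_diff_commute[of \<theta> u] by simp
    have "nrm (\<lambda>x. u (x + h) - u x) \<le> nrm (\<lambda>x. u (x + h) - \<theta> (x + h)) + nrm (\<lambda>x. \<theta> (x + h) - u x)"
      by (rule nrm_diff_triangle[OF Lu u])
    moreover have "nrm (\<lambda>x. \<theta> (x + h) - u x) \<le> nrm (\<lambda>x. \<theta> (x + h) - \<theta> x) + nrm (\<lambda>x. \<theta> x - u x)"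
      by (rule nrm_diff_triangle[OF Lu(2) Lt(1) u])
    ultimately show "nrm (\<lambda>x. u (x + h) - u x) < e" using 1 2 t(2) e by linarith
  qed
qed

lemma shift_multiple_bound:
  assumes u: "L2 u"
  shows "nrm (\<lambda>x. u (x + real k * h) - u x) \<le> real k * nrm (\<lambda>x. u (x + h) - u x)"
proof (induction k)
  case (Suc k)
  have "nrm (\<lambda>x. u (x + (real k * h + h)) - u (x + real k * h)) = nrm (\<lambda>x. u (x + h) - u x)"
    using nrm_shift[of "\<lambda>x. u (x + h) - u x" "real k * h"] by (simp add: ac_simps)
  moreover have "nrm (\<lambda>x. u (x + (real k * h + h)) - u x) \<le> nrm (\<lambda>x. u (x + (real k * h + h)) - u (x + real k * h)) + nrm (\<lambda>x. u (x + real k * h) - u x)"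
    by (rule nrm_diff_triangle) (intro L2_shift u)+
  ultimately show ?case using Suc by (simp add: algebra_simps)
qed simp

text \<open>The bulk of the mass sits in a bounded interval, so large translates are far away; a small translation
  is iterated until it becomes a large one.\<close>
lemma shift_separation:
  assumes u: "L2 u" and nz: "nrm u > 0" and \<delta>: "\<delta> > 0"
  obtains e where "e > 0" "\<And>h. nrm (\<lambda>x. u (x + h) - u x) < e \<Longrightarrow> \<bar>h\<bar> < \<delta>"
proof -
  have um: "u \<in> borel_measurable borel" by (rule L2_meas[OF u])
  let ?a = "\<lambda>n x. indicator {-real n..real n} x * u x"
  have La: "L2 (?a n)" for n
    by (rule L2_mult_bounded[OF u, where C = 1]) (auto simp: indicator_def)
  have "(\<lambda>n. nrm (\<lambda>x. ?a n x - u x)) \<longlonglongrightarrow> 0"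
  proof (rule L2_dominated_convergence[OF L2_meas[OF La] um L2_abs[OF u]])
    show "AE x in lborel. (\<lambda>n. ?a n x) \<longlonglongrightarrow> u x"
    proof (rule AE_I2)
      fix x
      obtain N :: nat where N: "\<bar>x\<bar> < real N" using reals_Archimedean2 by blast
      have "\<forall>\<^sub>F n in sequentially. ?a n x = u x"
        using eventually_ge_at_top[of N]
      proof eventually_elim
        case (elim n)
        then have "\<bar>x\<bar> < real n" using N by linarith
        then show ?case by (auto simp: indicator_def)
      qed
      then show "(\<lambda>n. ?a n x) \<longlonglongrightarrow> u x" by (rule tendsto_eventually)
    qed
  qed (auto simp: indicator_def)
  then have "\<forall>\<^sub>F n in sequentially. nrm (\<lambda>x. ?a n x - u x) < nrm u / 4"
    by (rule order_tendstoD) (use nz in simp)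
  then obtain n where n: "nrm (\<lambda>x. ?a n x - u x) < nrm u / 4"
    by (meson eventually_sequentially order_refl)
  define a where "a = ?a n"
  have LA: "L2 a" and na: "nrm (\<lambda>x. a x - u x) < nrm u / 4" using La n by (auto simp: a_def)
  have far: "nrm u / 4 \<le> nrm (\<lambda>x. u (x + h) - u x)" if h: "2 * real n < \<bar>h\<bar>" for h
  proof -
    have Lah: "L2 (\<lambda>x. a (x + h))" and Luh: "L2 (\<lambda>x. u (x + h))" by (intro L2_shift LA u)+
    \<comment> \<open>Shifted by more than \<open>2 * real n\<close>, the interval carrying
      \<open>a\<close> misses itself.\<close>
    have "a (x + h) * a x = 0" for x
      using h by (auto simp: a_def indicator_def)
    then have "(\<lambda>x. a (x + h) * a x) = (\<lambda>x. 0)" by (intro ext)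
    then have z: "ip (\<lambda>x. a (x + h)) a = 0" unfolding ip_def by simp
    have "(nrm (\<lambda>x. a (x + h) - a x))^2 = ip (\<lambda>x. a (x + h)) (\<lambda>x. a (x + h)) + ip a a - 2 * ip (\<lambda>x. a (x + h)) a"
      by (simp add: nrm_sq_ip ip_simps L2_intros LA Lah ip_commute[of a "\<lambda>x. a (x + h)"])
    also have "\<dots> \<ge> (nrm a)^2" using z by (simp add: nrm_sq_ip ip_self_nonneg)
    finally have 1: "nrm a \<le> nrm (\<lambda>x. a (x + h) - a x)" by (rule power2_le_imp_le) simp
    have 2: "nrm u \<le> nrm a + nrm u / 4"
      using nrm_le_diff[OF u LA] na nrm_diff_commute[of a u] by simp
    have 3: "nrm (\<lambda>x. a (x + h) - u (x + h)) < nrm u / 4"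
      using nrm_shift[of "\<lambda>x. a x - u x" h] na by simp
    have "nrm (\<lambda>x. a (x + h) - a x) \<le> nrm (\<lambda>x. a (x + h) - u (x + h)) + nrm (\<lambda>x. u (x + h) - a x)"
      by (rule nrm_diff_triangle[OF Lah Luh LA])
    moreover have "nrm (\<lambda>x. u (x + h) - a x) \<le> nrm (\<lambda>x. u (x + h) - u x) + nrm (\<lambda>x. u x - a x)"
      by (rule nrm_diff_triangle[OF Luh u LA])
    ultimately show ?thesis using 1 2 3 na nrm_diff_commute[of a u] by simp
  qed
  \<comment> \<open>So many repetitions turn a shift by at least \<open>\<delta>\<close> into one by
    more than \<open>2 * real n\<close>.\<close>
  obtain k :: nat where k: "2 * real n / \<delta> < real k" using reals_Archimedean2 by blast
  have k0: "real k > 0" using k \<delta> by (smt (verit) divide_nonneg_pos of_nat_0_le_iff)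
  show thesis
  proof (rule that[of "nrm u / (4 * real k)"])
    show "nrm u / (4 * real k) > 0" using nz k0 by simp
    fix h assume h: "nrm (\<lambda>x. u (x + h) - u x) < nrm u / (4 * real k)"
    show "\<bar>h\<bar> < \<delta>"
    proof (rule ccontr)
      assume "\<not> \<bar>h\<bar> < \<delta>"
      then have "real k * \<delta> \<le> real k * \<bar>h\<bar>" by (intro mult_left_mono) auto
      then have "2 * real n < \<bar>real k * h\<bar>" using k \<delta> by (simp add: abs_mult field_simps)
      from far[OF this] have "nrm u / 4 \<le> real k * nrm (\<lambda>x. u (x + h) - u x)"
        using shift_multiple_bound[OF u, of k h] by linarith
      then show False using h k0 by (simp add: field_simps)
    qed
  qed
qed

section \<open>The nonlinearity\<close>

lemma Fprim_DERIV:
  assumes c: "continuous_on UNIV f"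
  shows "(Fprim f has_real_derivative f x) (at x)"
proof -
  \<comment> \<open>A base point to the left of both 0 and \<open>x\<close> turns the two branches
    of \<open>Fprim\<close> into one formula near \<open>x\<close>.\<close>
  let ?a = "min x 0 - 1" and ?b = "max x 0 + 1"
  have i: "f integrable_on {u..v}" for u v
    by (intro integrable_continuous_interval continuous_on_subset[OF c]) auto
  have eq: "Fprim f s = integral {?a..s} f - integral {?a..0} f" if "?a \<le> s" for s
  proof (cases "0 \<le> s")
    case True
    then have "integral {?a..0} f + integral {0..s} f = integral {?a..s} f"
      by (intro Henstock_Kurzweil_Integration.integral_combine i) auto
    then show ?thesis using True by (simp add: Fprim_def)
  next
    case False
    then have "integral {?a..s} f + integral {s..0} f = integral {?a..0} f"
      using that by (intro Henstock_Kurzweil_Integration.integral_combine i) auto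
    then show ?thesis using False by (simp add: Fprim_def)
  qed
  have "((\<lambda>u. integral {?a..u} f) has_vector_derivative f x) (at x within {?a..?b})"
    by (intro integral_has_vector_derivative continuous_on_subset[OF c]) auto
  then have "((\<lambda>u. integral {?a..u} f) has_real_derivative f x) (at x within {?a..?b})"
    by (simp add: has_real_derivative_iff_has_vector_derivative)
  then have d: "((\<lambda>u. integral {?a..u} f) has_real_derivative f x) (at x)"
    by (subst (asm) at_within_interior) auto
  have "((\<lambda>u. integral {?a..u} f - integral {?a..0} f) has_real_derivative f x) (at x)"
    using DERIV_diff[OF d DERIV_const] by simp
  moreover have "\<forall>\<^sub>F s in nhds x. Fprim f s = integral {?a..s} f - integral {?a..0} f"
  proof -
    have "\<forall>\<^sub>F s in nhds x. s \<in> {?a<..}" by (intro eventually_nhds_in_open) auto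
    then show ?thesis by eventually_elim (rule eq, simp)
  qed
  ultimately show ?thesis by (subst DERIV_cong_ev[OF refl _ refl]) auto
qed

text \<open>The two values at 0 are consequences of homogeneity. For bounded \<open>u\<close> they
  make \<open>f (u x)\<close> dominated by \<open>u x\<close> and \<open>Fprim f (u x)\<close> by
  its square, so that the potential energy of an H^1 function is finite.\<close>

locale nonlin =
  fixes f f1 f2 :: rfun
  assumes df: "\<And>x. (f has_real_derivative f1 x) (at x)"
    and df1: "\<And>x. (f1 has_real_derivative f2 x) (at x)"
    and cf2: "continuous_on UNIV f2"
    and f_0: "f 0 = 0" and f1_0: "f1 0 = 0"
begin

abbreviation F :: rfun where "F \<equiv> Fprim f"

lemma f_cont: "continuous_on A f" and f1_cont: "continuous_on A f1"
  using df df1 by (meson DERIV_isCont continuous_at_imp_continuous_on)+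

lemma dF: "(F has_real_derivative f x) (at x)"
  by (rule Fprim_DERIV[OF f_cont])

lemma F_cont: "continuous_on A F"
  using dF by (meson DERIV_isCont continuous_at_imp_continuous_on)

lemma F_0: "F 0 = 0"
  by (simp add: Fprim_def)

lemma deriv_f: "deriv f = f1"
  by (intro ext DERIV_imp_deriv df)

lemma meas_fF[measurable]: "f \<in> borel_measurable borel" "f1 \<in> borel_measurable borel" "F \<in> borel_measurable borel"
  using f_cont f1_cont F_cont by (auto intro: borel_measurable_continuous_onI)

text \<open>One constant for all estimates on \<open>[-R, R]\<close>. H^1 functions on the line are
  bounded, so composition with \<open>f\<close> becomes Lipschitz in L2 on those with a common
  bound. The factor \<open>\<bar>a\<bar> + \<bar>b\<bar>\<close> for \<open>F\<close> makes
  differences of potential energies integrable over the whole line.\<close>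

definition lbound :: "real \<Rightarrow> real \<Rightarrow> bool" where
  "lbound R C \<longleftrightarrow> 0 \<le> R \<and> 0 \<le> C \<and> (\<forall>a b. \<bar>a\<bar> \<le> R \<longrightarrow> \<bar>b\<bar> \<le> R \<longrightarrow>
     \<bar>f a - f b\<bar> \<le> C * \<bar>a - b\<bar> \<and> \<bar>f1 a - f1 b\<bar> \<le> C * \<bar>a - b\<bar> \<and>
     \<bar>F a - F b\<bar> \<le> C * ((\<bar>a\<bar> + \<bar>b\<bar>) * \<bar>a - b\<bar>) \<and>
     \<bar>F b - F a - f a * (b - a)\<bar> \<le> C * (b - a)^2 \<and>
     \<bar>F b - F a - f a * (b - a) - f1 a * (b - a)^2 / 2\<bar> \<le> C * (\<bar>b - a\<bar> * (b - a)^2))"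

lemma lbound_exists: assumes R: "R \<ge> 0" shows "\<exists>C. lbound R C"
proof -
  have "compact (f2 ` {-R..R})"
    by (intro compact_continuous_image continuous_on_subset[OF cf2]) auto
  then have "bounded (f2 ` {-R..R})" by (rule compact_imp_bounded)
  then obtain M where "\<forall>y\<in>f2 ` {-R..R}. norm y \<le> M" unfolding bounded_iff by blast
  then have M: "\<And>x. x \<in> {-R..R} \<Longrightarrow> \<bar>f2 x\<bar> \<le> M" by simp
  have M0: "M \<ge> 0" using order_trans[OF abs_ge_zero M[of 0]] R by simp
  have l1: "\<bar>f1 a - f1 b\<bar> \<le> M * \<bar>a - b\<bar>" if "a \<in> {-R..R}" "b \<in> {-R..R}" for a b
    by (rule lipschitz_of_deriv_bound[where S = "{-R..R}" and f' = f2])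
       (use M that in \<open>auto intro: DERIV_subset[OF df1]\<close>)
  have b1: "\<bar>f1 a\<bar> \<le> M * R" if "a \<in> {-R..R}" for a
  proof -
    have "M * \<bar>a\<bar> \<le> M * R" using that M0 by (intro mult_left_mono) auto
    then show ?thesis using l1[OF that, of 0] R f1_0 by simp
  qed
  have l0: "\<bar>f a - f b\<bar> \<le> (M * R) * \<bar>a - b\<bar>" if "a \<in> {-R..R}" "b \<in> {-R..R}" for a b
    by (rule lipschitz_of_deriv_bound[where S = "{-R..R}" and f' = f1])
       (use b1 that in \<open>auto intro: DERIV_subset[OF df]\<close>)
  have lF: "\<bar>F a - F b\<bar> \<le> ((M * R) * (\<bar>a\<bar> + \<bar>b\<bar>)) * \<bar>a - b\<bar>" if "a \<in> {-R..R}" "b \<in> {-R..R}" for a b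
  proof (rule lipschitz_of_deriv_bound[where S = "{-max \<bar>a\<bar> \<bar>b\<bar>..max \<bar>a\<bar> \<bar>b\<bar>}" and f' = f])
    fix x assume x: "x \<in> {-max \<bar>a\<bar> \<bar>b\<bar>..max \<bar>a\<bar> \<bar>b\<bar>}"
    have "\<bar>x\<bar> \<le> \<bar>a\<bar> + \<bar>b\<bar>" "x \<in> {-R..R}" using x that by auto
    then have "\<bar>f x\<bar> \<le> (M * R) * \<bar>x\<bar>" "(M * R) * \<bar>x\<bar> \<le> (M * R) * (\<bar>a\<bar> + \<bar>b\<bar>)"
      using l0[of x 0] R f_0 M0 by (auto intro!: mult_left_mono)
    then show "\<bar>f x\<bar> \<le> (M * R) * (\<bar>a\<bar> + \<bar>b\<bar>)" by linarith
  qed (auto intro: DERIV_subset[OF dF])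
  have F2: "\<bar>F b - F a - f a * (b - a)\<bar> \<le> (M * R) * (b - a)^2" if "a \<in> {-R..R}" "b \<in> {-R..R}" for a b
    using second_order_bound[where S = "{-R..R}" and f = F and f' = f and C = "M * R" and x = a and y = b] that l0 M0 R
    by (auto intro: DERIV_subset[OF dF] simp: mult.commute)
  have f2': "\<bar>f b - f a - f1 a * (b - a)\<bar> \<le> M * (b - a)^2" if "a \<in> {-R..R}" "b \<in> {-R..R}" for a b
    using second_order_bound[where S = "{-R..R}" and f = f and f' = f1 and C = "M" and x = a and y = b] that l1 M0
    by (auto intro: DERIV_subset[OF df] simp: mult.commute)
  have F3: "\<bar>F b - F a - f a * (b - a) - f1 a * (b - a)^2 / 2\<bar> \<le> M * (\<bar>b - a\<bar> * (b - a)^2)"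
    if ab: "a \<in> {-R..R}" "b \<in> {-R..R}" for a b
  proof -
    let ?S = "{-R..R} \<inter> cball a \<bar>b - a\<bar>"
    let ?G = "\<lambda>s. F s - f a * (s - a) - f1 a * (s - a)^2 / 2"
    have "\<bar>?G b - ?G a\<bar> \<le> (M * (b - a)^2) * \<bar>b - a\<bar>"
    proof (rule lipschitz_of_deriv_bound[where S = ?S and f' = "\<lambda>s. f s - f a - f1 a * (s - a)"])
      show "(?G has_real_derivative f s - f a - f1 a * (s - a)) (at s within ?S)" for s
        by (auto intro!: derivative_eq_intros DERIV_subset[OF dF])
      fix s assume s: "s \<in> ?S"
      have "\<bar>s - a\<bar> \<le> \<bar>b - a\<bar>" using s by (auto simp: dist_real_def)
      then have "(s - a)^2 \<le> (b - a)^2" by (simp add: abs_le_square_iff)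
      then have "M * (s - a)^2 \<le> M * (b - a)^2" using M0 by (intro mult_left_mono)
      then show "\<bar>f s - f a - f1 a * (s - a)\<bar> \<le> M * (b - a)^2" using f2'[of a s] s ab by auto
    qed (use ab in \<open>auto intro: convex_Int simp: dist_real_def abs_minus_commute\<close>)
    then show ?thesis by (simp add: algebra_simps)
  qed
  \<comment> \<open>\<open>M\<close> bounds \<open>f2\<close>; as \<open>f1\<close> vanishes at 0,
    the Lipschitz constant of \<open>f\<close> is \<open>M * R\<close>. The common constant
    dominates both.\<close>
  have C: "M \<le> M * (R + 1)" "M * R \<le> M * (R + 1)" using M0 R by (auto simp: algebra_simps)
  have "lbound R (M * (R + 1))"
    unfolding lbound_def
  proof (intro conjI allI impI)
    show "0 \<le> R" "0 \<le> M * (R + 1)" using M0 R by simp_all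
    fix a b :: real assume "\<bar>a\<bar> \<le> R" "\<bar>b\<bar> \<le> R"
    then have ab: "a \<in> {-R..R}" "b \<in> {-R..R}" by auto
    show "\<bar>f a - f b\<bar> \<le> M * (R + 1) * \<bar>a - b\<bar>"
      by (rule order_trans[OF l0[OF ab] mult_right_mono[OF C(2)]]) simp
    show "\<bar>f1 a - f1 b\<bar> \<le> M * (R + 1) * \<bar>a - b\<bar>"
      by (rule order_trans[OF l1[OF ab] mult_right_mono[OF C(1)]]) simp
    have "\<bar>F a - F b\<bar> \<le> (M * R) * ((\<bar>a\<bar> + \<bar>b\<bar>) * \<bar>a - b\<bar>)" using lF[OF ab] by (simp only: mult.assoc)
    also have "\<dots> \<le> (M * (R + 1)) * ((\<bar>a\<bar> + \<bar>b\<bar>) * \<bar>a - b\<bar>)" by (rule mult_right_mono[OF C(2)]) simp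
    finally show "\<bar>F a - F b\<bar> \<le> M * (R + 1) * ((\<bar>a\<bar> + \<bar>b\<bar>) * \<bar>a - b\<bar>)" .
    show "\<bar>F b - F a - f a * (b - a)\<bar> \<le> M * (R + 1) * (b - a)\<^sup>2"
      by (rule order_trans[OF F2[OF ab] mult_right_mono[OF C(2)]]) simp
    show "\<bar>F b - F a - f a * (b - a) - f1 a * (b - a)\<^sup>2 / 2\<bar> \<le> M * (R + 1) * (\<bar>b - a\<bar> * (b - a)\<^sup>2)"
      by (rule order_trans[OF F3[OF ab] mult_right_mono[OF C(1)]]) simp
  qed
  then show ?thesis by blast
qed

lemma lboundD:
  assumes "lbound R C" "\<bar>a\<bar> \<le> R" "\<bar>b\<bar> \<le> R"
  shows "\<bar>f a - f b\<bar> \<le> C * \<bar>a - b\<bar>" "\<bar>f1 a - f1 b\<bar> \<le> C * \<bar>a - b\<bar>"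
    "\<bar>F a - F b\<bar> \<le> C * ((\<bar>a\<bar> + \<bar>b\<bar>) * \<bar>a - b\<bar>)"
    "\<bar>F b - F a - f a * (b - a)\<bar> \<le> C * (b - a)^2"
    "\<bar>F b - F a - f a * (b - a) - f1 a * (b - a)^2 / 2\<bar> \<le> C * (\<bar>b - a\<bar> * (b - a)^2)"
  using assms unfolding lbound_def by blast+

lemma lbound_nonneg: "lbound R C \<Longrightarrow> 0 \<le> C"
  by (simp add: lbound_def)

lemma lbound_point:
  assumes "lbound R C" "\<bar>a\<bar> \<le> R"
  shows "\<bar>f a\<bar> \<le> C * \<bar>a\<bar>" "\<bar>f1 a\<bar> \<le> C * \<bar>a\<bar>" "\<bar>f1 a\<bar> \<le> C * R" "\<bar>F a\<bar> \<le> C * a^2"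
proof -
  have R: "\<bar>0::real\<bar> \<le> R" using assms(2) by linarith
  note b = lboundD[OF assms R]
  show "\<bar>f a\<bar> \<le> C * \<bar>a\<bar>" "\<bar>f1 a\<bar> \<le> C * \<bar>a\<bar>" using b(1,2) f_0 f1_0 by simp_all
  moreover have "C * \<bar>a\<bar> \<le> C * R" using assms lbound_nonneg by (intro mult_left_mono)
  ultimately show "\<bar>f1 a\<bar> \<le> C * R" by linarith
  show "\<bar>F a\<bar> \<le> C * a^2" using b(3) F_0 by (simp add: power2_eq_square)
qed

section \<open>The potential energy on bounded functions\<close>

definition Phi :: "rfun \<Rightarrow> real" where "Phi u = (\<integral>x. F (u x) \<partial>lborel)"

context
  fixes R C :: real
  assumes lb: "lbound R C"
begin

lemma L2_f: assumes "L2 u" "AE x in lborel. \<bar>u x\<bar> \<le> R" shows "L2 (\<lambda>x. f (u x))"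
proof (rule L2_bound[OF assms(1)])
  show "(\<lambda>x. f (u x)) \<in> borel_measurable borel" using L2_meas[OF assms(1)] by measurable
  show "AE x in lborel. \<bar>f (u x)\<bar> \<le> C * \<bar>u x\<bar>"
    using assms(2) by eventually_elim (rule lbound_point[OF lb])
qed

lemma L2_f1_mult:
  assumes "L2 u" "AE x in lborel. \<bar>u x\<bar> \<le> R" "L2 w"
  shows "L2 (\<lambda>x. f1 (u x) * w x)" "nrm (\<lambda>x. f1 (u x) * w x) \<le> (C * R) * nrm w"
proof -
  have m: "(\<lambda>x. f1 (u x) * w x) \<in> borel_measurable borel"
    using L2_meas[OF assms(1)] L2_meas[OF assms(3)] by measurable
  have b: "AE x in lborel. \<bar>f1 (u x) * w x\<bar> \<le> (C * R) * \<bar>w x\<bar>"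
    using assms(2) by eventually_elim (auto simp: abs_mult intro!: mult_right_mono lbound_point[OF lb])
  show "L2 (\<lambda>x. f1 (u x) * w x)" by (rule L2_bound[OF assms(3) m b])
  have "0 \<le> C * R" using lb by (simp add: lbound_def)
  then show "nrm (\<lambda>x. f1 (u x) * w x) \<le> (C * R) * nrm w" by (rule nrm_bound_AE[OF assms(3) m b])
qed

lemma nrm_f_diff:
  assumes "L2 u" "AE x in lborel. \<bar>u x\<bar> \<le> R" "L2 v" "AE x in lborel. \<bar>v x\<bar> \<le> R"
  shows "nrm (\<lambda>x. f (u x) - f (v x)) \<le> C * nrm (\<lambda>x. u x - v x)"
proof (rule nrm_bound_AE[OF L2_diff[OF assms(1,3)] _ _ lbound_nonneg[OF lb]])
  show "(\<lambda>x. f (u x) - f (v x)) \<in> borel_measurable borel"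
    using L2_meas[OF assms(1)] L2_meas[OF assms(3)] by measurable
  show "AE x in lborel. \<bar>f (u x) - f (v x)\<bar> \<le> C * \<bar>u x - v x\<bar>"
    using assms(2,4) by eventually_elim (rule lboundD[OF lb])
qed

lemma nrm_f1_diff_mult:
  assumes "L2 u" "AE x in lborel. \<bar>u x\<bar> \<le> R" "L2 v" "AE x in lborel. \<bar>v x\<bar> \<le> R"
    and "w \<in> borel_measurable borel" "\<And>x. \<bar>w x\<bar> \<le> B"
  shows "nrm (\<lambda>x. f1 (u x) * w x - f1 (v x) * w x) \<le> (C * B) * nrm (\<lambda>x. u x - v x)"
proof (rule nrm_bound_AE[OF L2_diff[OF assms(1,3)]])
  have B: "0 \<le> B" using order_trans[OF abs_ge_zero assms(6)[of 0]] .
  show "(\<lambda>x. f1 (u x) * w x - f1 (v x) * w x) \<in> borel_measurable borel"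
    using L2_meas[OF assms(1)] L2_meas[OF assms(3)] assms(5) by measurable
  show "AE x in lborel. \<bar>f1 (u x) * w x - f1 (v x) * w x\<bar> \<le> (C * B) * \<bar>u x - v x\<bar>"
    using assms(2,4)
  proof eventually_elim
    case (elim x)
    have "\<bar>f1 (u x) - f1 (v x)\<bar> * \<bar>w x\<bar> \<le> (C * \<bar>u x - v x\<bar>) * B"
      using lbound_nonneg[OF lb] by (intro mult_mono lboundD[OF lb] elim assms(6)) auto
    moreover have "f1 (u x) * w x - f1 (v x) * w x = (f1 (u x) - f1 (v x)) * w x"
      by (simp add: left_diff_distrib)
    ultimately show ?case by (simp only: abs_mult mult.assoc mult.commute[of B])
  qed
  show "0 \<le> C * B" using B lbound_nonneg[OF lb] by simp
qed

lemma F_integrable: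
  assumes "L2 u" "AE x in lborel. \<bar>u x\<bar> \<le> R"
  shows "integrable lborel (\<lambda>x. F (u x))"
proof (rule Bochner_Integration.integrable_bound)
  show "integrable lborel (\<lambda>x. C * (u x)^2)" using assms(1) by (simp add: L2_def)
  show "(\<lambda>x. F (u x)) \<in> borel_measurable lborel" using L2_meas[OF assms(1)] by measurable
  show "AE x in lborel. norm (F (u x)) \<le> norm (C * (u x)^2)"
    using assms(2)
  proof eventually_elim
    case (elim x)
    show ?case using lbound_point(4)[OF lb elim] by simp
  qed
qed

lemma Phi_diff_le:
  assumes u: "L2 u" "AE x in lborel. \<bar>u x\<bar> \<le> R" and v: "L2 v" "AE x in lborel. \<bar>v x\<bar> \<le> R"
  shows "\<bar>Phi u - Phi v\<bar> \<le> C * ((nrm u + nrm v) * nrm (\<lambda>x. u x - v x))"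
proof -
  let ?a = "\<lambda>x. \<bar>u x\<bar> + \<bar>v x\<bar>" and ?d = "\<lambda>x. \<bar>u x - v x\<bar>"
  have L: "L2 ?a" "L2 ?d" by (intro L2_intros u v)+
  have "Phi u - Phi v = (\<integral>x. F (u x) - F (v x) \<partial>lborel)"
    unfolding Phi_def using F_integrable[OF u] F_integrable[OF v] by simp
  also have "\<bar>\<dots>\<bar> \<le> (\<integral>x. C * (?a x * ?d x) \<partial>lborel)"
  proof (rule order_trans[OF integral_abs_bound integral_mono_AE])
    show "integrable lborel (\<lambda>x. \<bar>F (u x) - F (v x)\<bar>)"
      by (intro integrable_abs Bochner_Integration.integrable_diff F_integrable u v)
    show "integrable lborel (\<lambda>x. C * (?a x * ?d x))"
      by (intro Bochner_Integration.integrable_mult_right L2_mult_integrable L)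
    show "AE x in lborel. \<bar>F (u x) - F (v x)\<bar> \<le> C * (?a x * ?d x)"
      using u(2) v(2) by eventually_elim (rule lboundD[OF lb])
  qed
  also have "\<dots> = C * ip ?a ?d" by (simp add: ip_def)
  also have "\<dots> \<le> C * ((nrm u + nrm v) * nrm (\<lambda>x. u x - v x))"
  proof (rule mult_left_mono[OF _ lbound_nonneg[OF lb]])
    have "ip ?a ?d \<le> nrm ?a * nrm ?d" using Cauchy_Schwarz_ip[OF L] by simp
    also have "nrm ?d = nrm (\<lambda>x. u x - v x)" by (simp add: nrm_def)
    also have "nrm ?a * nrm (\<lambda>x. u x - v x) \<le> (nrm u + nrm v) * nrm (\<lambda>x. u x - v x)"
    proof (rule mult_right_mono)
      have "nrm ?a \<le> nrm (\<lambda>x. \<bar>u x\<bar>) + nrm (\<lambda>x. \<bar>v x\<bar>)" by (intro nrm_triangle L2_intros u v)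
      then show "nrm ?a \<le> nrm u + nrm v" by (simp add: nrm_def)
    qed simp
    finally show "ip ?a ?d \<le> (nrm u + nrm v) * nrm (\<lambda>x. u x - v x)" .
  qed
  finally show ?thesis .
qed

lemma Phi_first_order:
  assumes u: "L2 u" "AE x in lborel. \<bar>u x\<bar> \<le> R" and v: "L2 v" "AE x in lborel. \<bar>v x\<bar> \<le> R"
  shows "\<bar>Phi v - Phi u - ip (\<lambda>x. f (u x)) (\<lambda>x. v x - u x)\<bar> \<le> C * (nrm (\<lambda>x. v x - u x))^2"
proof -
  have i: "integrable lborel (\<lambda>x. f (u x) * (v x - u x))"
    by (intro L2_mult_integrable L2_f u L2_diff v)
  have "Phi v - Phi u - ip (\<lambda>x. f (u x)) (\<lambda>x. v x - u x) = (\<integral>x. F (v x) - F (u x) - f (u x) * (v x - u x) \<partial>lborel)"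
    unfolding Phi_def ip_def using F_integrable[OF u] F_integrable[OF v] i by simp
  also have "\<bar>\<dots>\<bar> \<le> (\<integral>x. C * (v x - u x)^2 \<partial>lborel)"
  proof (rule order_trans[OF integral_abs_bound integral_mono_AE])
    show "integrable lborel (\<lambda>x. \<bar>F (v x) - F (u x) - f (u x) * (v x - u x)\<bar>)"
      by (intro integrable_abs Bochner_Integration.integrable_diff F_integrable u v i)
    show "integrable lborel (\<lambda>x. C * (v x - u x)^2)"
      by (intro Bochner_Integration.integrable_mult_right L2_sq_integrable L2_diff u v)
    show "AE x in lborel. \<bar>F (v x) - F (u x) - f (u x) * (v x - u x)\<bar> \<le> C * (v x - u x)^2"
      using u(2) v(2) by eventually_elim (rule lboundD[OF lb])
  qed
  also have "\<dots> = C * (nrm (\<lambda>x. v x - u x))^2" by (simp add: nrm_sq)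
  finally show ?thesis .
qed

lemma f1_sq_integrable:
  assumes "L2 u" "AE x in lborel. \<bar>u x\<bar> \<le> R" "L2 h"
  shows "integrable lborel (\<lambda>x. f1 (u x) * (h x)^2)"
  using L2_mult_integrable[OF L2_f1_mult(1)[OF assms] assms(3)]
  by (simp add: power2_eq_square mult.assoc)

text \<open>The pointwise remainder is cubic in \<open>h\<close>; one factor is paid for by the sup
  bound \<open>B\<close>, the other two by the L2 norm.\<close>

lemma Phi_second_order:
  assumes u: "L2 u" "AE x in lborel. \<bar>u x\<bar> \<le> R" and h: "L2 h" "AE x in lborel. \<bar>h x\<bar> \<le> B"
    and v: "AE x in lborel. \<bar>u x + h x\<bar> \<le> R"
  shows "\<bar>Phi (\<lambda>x. u x + h x) - Phi u - ip (\<lambda>x. f (u x)) h - (\<integral>x. f1 (u x) * (h x)^2 \<partial>lborel) / 2\<bar>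
      \<le> C * B * (nrm h)^2"
proof -
  have i: "integrable lborel (\<lambda>x. f (u x) * h x)"
    by (intro L2_mult_integrable L2_f u h)
  have Lv: "L2 (\<lambda>x. u x + h x)" by (intro L2_add u h)
  have j: "integrable lborel (\<lambda>x. f1 (u x) * (h x)^2 / 2)"
    using f1_sq_integrable[OF u h(1)] by simp
  have 1: "Phi (\<lambda>x. u x + h x) - Phi u - ip (\<lambda>x. f (u x)) h - (\<integral>x. f1 (u x) * (h x)^2 \<partial>lborel) / 2
     = (\<integral>x. F (u x + h x) - F (u x) - f (u x) * h x - f1 (u x) * (h x)^2 / 2 \<partial>lborel)"
    unfolding Phi_def ip_def using F_integrable[OF u] F_integrable[OF Lv v] i j by simp
  have 2: "\<bar>\<integral>x. F (u x + h x) - F (u x) - f (u x) * h x - f1 (u x) * (h x)^2 / 2 \<partial>lborel\<bar>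
      \<le> (\<integral>x. (C * B) * (h x)^2 \<partial>lborel)"
  proof (rule order_trans[OF integral_abs_bound integral_mono_AE])
    show "integrable lborel (\<lambda>x. \<bar>F (u x + h x) - F (u x) - f (u x) * h x - f1 (u x) * (h x)^2 / 2\<bar>)"
      by (intro integrable_abs Bochner_Integration.integrable_diff F_integrable u Lv v i j)
    show "integrable lborel (\<lambda>x. (C * B) * (h x)^2)"
      by (intro Bochner_Integration.integrable_mult_right L2_sq_integrable h)
    show "AE x in lborel. \<bar>F (u x + h x) - F (u x) - f (u x) * h x - f1 (u x) * (h x)^2 / 2\<bar> \<le> (C * B) * (h x)^2"
      using u(2) v h(2)
    proof eventually_elim
      case (elim x)
      have "\<bar>h x\<bar> * (h x)^2 \<le> B * (h x)^2" using elim by (intro mult_right_mono) auto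
      then have "C * (\<bar>h x\<bar> * (h x)^2) \<le> C * (B * (h x)^2)"
        using lbound_nonneg[OF lb] by (rule mult_left_mono)
      then show ?case using lboundD(5)[OF lb elim(1,2)] by (simp add: mult.assoc)
    qed
  qed
  have 3: "(\<integral>x. (C * B) * (h x)^2 \<partial>lborel) = C * B * (nrm h)^2" unfolding nrm_sq by simp
  show ?thesis unfolding 1 using 2 unfolding 3 .
qed

lemma f1_sq_diff:
  assumes u: "L2 u" "AE x in lborel. \<bar>u x\<bar> \<le> R" and v: "L2 v" "AE x in lborel. \<bar>v x\<bar> \<le> R"
    and h: "L2 h" "\<And>x. \<bar>h x\<bar> \<le> B"
  shows "\<bar>(\<integral>x. f1 (u x) * (h x)^2 \<partial>lborel) - (\<integral>x. f1 (v x) * (h x)^2 \<partial>lborel)\<bar>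
     \<le> C * B * nrm h * nrm (\<lambda>x. u x - v x)"
proof -
  have hm: "h \<in> borel_measurable borel" by (rule L2_meas[OF h(1)])
  have L: "L2 (\<lambda>x. f1 (u x) * h x)" "L2 (\<lambda>x. f1 (v x) * h x)"
    by (rule L2_f1_mult[OF u h(1)], rule L2_f1_mult[OF v h(1)])
  have "(\<integral>x. f1 (u x) * (h x)^2 \<partial>lborel) - (\<integral>x. f1 (v x) * (h x)^2 \<partial>lborel)
      = ip (\<lambda>x. f1 (u x) * h x) h - ip (\<lambda>x. f1 (v x) * h x) h"
    by (simp add: ip_def power2_eq_square mult.assoc)
  also have "\<dots> = ip (\<lambda>x. f1 (u x) * h x - f1 (v x) * h x) h"
    by (rule ip_diff_left[symmetric, OF L h(1)])
  also have "\<bar>\<dots>\<bar> \<le> nrm (\<lambda>x. f1 (u x) * h x - f1 (v x) * h x) * nrm h"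
    by (rule Cauchy_Schwarz_ip[OF L2_diff[OF L] h(1)])
  also have "\<dots> \<le> ((C * B) * nrm (\<lambda>x. u x - v x)) * nrm h"
    by (rule mult_right_mono[OF nrm_f1_diff_mult[OF u v hm h(2)] nrm_nonneg])
  finally show ?thesis by (simp add: ac_simps)
qed

end

text \<open>A convergent sequence is bounded in norm, and the Sobolev inequality turns this into a
  sup bound shared by all approximants and \<open>u\<close>; one constant of the nonlinearity then
  serves them all.\<close>

lemma approx_bounded:
  assumes "W1 u u1"
  obtains g R C where "\<And>n::nat. test_fun (g n)" "(\<lambda>n. nrm (\<lambda>x. g n x - u x)) \<longlonglongrightarrow> 0"
    "(\<lambda>n. nrm (\<lambda>x. deriv (g n) x - u1 x)) \<longlonglongrightarrow> 0"
    "\<And>n x. \<bar>g n x\<bar> \<le> R" "AE x in lborel. \<bar>u x\<bar> \<le> R" "lbound R C"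
proof -
  obtain g where g: "\<And>n::nat. test_fun (g n)" "(\<lambda>n. nrm (\<lambda>x. g n x - u x)) \<longlonglongrightarrow> 0"
    "(\<lambda>n. nrm (\<lambda>x. deriv (g n) x - u1 x)) \<longlonglongrightarrow> 0"
    using W1_seq[OF assms] by blast
  have L: "L2 u" "L2 u1" "\<And>n. L2 (g n)" "\<And>n. L2 (deriv (g n))"
    using assms g(1) by (auto simp: W1_def intro: test_L2 test_deriv)
  have "(\<lambda>n. nrm (g n) + nrm (deriv (g n))) \<longlonglongrightarrow> nrm u + nrm u1"
    by (intro tendsto_add nrm_tendsto[OF L(3,1) g(2)] nrm_tendsto[OF L(4,2) g(3)])
  then have "Bseq (\<lambda>n. nrm (g n) + nrm (deriv (g n)))" by (intro convergent_imp_Bseq convergentI)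
  then obtain K where K: "\<And>n. \<bar>nrm (g n) + nrm (deriv (g n))\<bar> \<le> K" unfolding Bseq_def by auto
  let ?R = "max K (nrm u + nrm u1)"
  have R: "?R \<ge> 0" by (simp add: le_max_iff_disj)
  obtain C where C: "lbound ?R C" using lbound_exists[OF R] by blast
  show thesis
  proof (rule that[OF g _ _ C])
    show "\<bar>g n x\<bar> \<le> ?R" for n x
      using test_sup_bound[OF g(1), of n x] K[of n] by linarith
    show "AE x in lborel. \<bar>u x\<bar> \<le> ?R"
      using W1_sup_bound[OF assms] by eventually_elim simp
  qed
qed

lemma f_tendsto:
  assumes "\<And>n::nat. L2 (g n)" "\<And>n x. \<bar>g n x\<bar> \<le> R" "L2 u" "AE x in lborel. \<bar>u x\<bar> \<le> R" "lbound R C"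
    "(\<lambda>n. nrm (\<lambda>x. g n x - u x)) \<longlonglongrightarrow> 0"
  shows "(\<lambda>n. nrm (\<lambda>x. f (g n x) - f (u x))) \<longlonglongrightarrow> 0"
proof (rule Lim_null_comparison[OF always_eventually[OF allI]])
  show "norm (nrm (\<lambda>x. f (g n x) - f (u x))) \<le> C * nrm (\<lambda>x. g n x - u x)" for n
    using nrm_f_diff[OF assms(5), of "g n" u] assms by auto
  show "(\<lambda>n. C * nrm (\<lambda>x. g n x - u x)) \<longlonglongrightarrow> 0"
    using tendsto_mult_right_zero[OF assms(6)] by simp
qed

lemma W1_f:
  assumes "W1 u u1"
  shows "W1 (\<lambda>x. f (u x)) (\<lambda>x. f1 (u x) * u1 x)"
proof -
  obtain g R C where g: "\<And>n::nat. test_fun (g n)" "(\<lambda>n. nrm (\<lambda>x. g n x - u x)) \<longlonglongrightarrow> 0"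
    "(\<lambda>n. nrm (\<lambda>x. deriv (g n) x - u1 x)) \<longlonglongrightarrow> 0"
    "\<And>n x. \<bar>g n x\<bar> \<le> R" "AE x in lborel. \<bar>u x\<bar> \<le> R" "lbound R C"
    using approx_bounded[OF assms] by blast
  have L: "L2 u" "L2 u1" "\<And>n. L2 (g n)" "\<And>n. L2 (deriv (g n))"
    using assms g(1) by (auto simp: W1_def intro: test_L2 test_deriv)
  have gb: "AE x in lborel. \<bar>g n x\<bar> \<le> R" for n using g(4) by simp
  have Lf: "L2 (\<lambda>x. f (u x))" "\<And>n. L2 (\<lambda>x. f (g n x))"
    by (rule L2_f[OF g(6)], use L gb g(5) in auto)+
  have Lf1: "L2 (\<lambda>x. f1 (u x) * u1 x)" by (rule L2_f1_mult[OF g(6) L(1) g(5) L(2)])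
  have "ip (\<lambda>x. f (u x)) (deriv \<psi>) = - ip (\<lambda>x. f1 (u x) * u1 x) \<psi>" if t: "test_fun \<psi>" for \<psi>
  proof -
    have Lt: "L2 \<psi>" "L2 (deriv \<psi>)" using t by (auto intro: test_L2 test_deriv)
    obtain B where B: "\<And>x. \<bar>\<psi> x\<bar> \<le> B" using test_bounded[OF t] by blast
    have 1: "(\<lambda>n. ip (\<lambda>x. f (g n x)) (deriv \<psi>)) \<longlonglongrightarrow> ip (\<lambda>x. f (u x)) (deriv \<psi>)"
      by (rule ip_tendsto_left[OF Lf(2) Lf(1) Lt(2) f_tendsto[OF L(3) g(4) L(1) g(5,6,2)]])
    have LP: "L2 (\<lambda>x. f1 (u x) * \<psi> x)" "\<And>n. L2 (\<lambda>x. f1 (g n x) * \<psi> x)"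
      by (rule L2_f1_mult[OF g(6)], use L gb g(5) Lt in auto)+
    \<comment> \<open>The factor \<open>f1 (g n x)\<close> is moved onto the bounded
      \<open>\<psi>\<close>, where it converges in L2; what remains is a pairing of two sequences
      that both converge in L2.\<close>
    have "(\<lambda>n. nrm (\<lambda>x. f1 (g n x) * \<psi> x - f1 (u x) * \<psi> x)) \<longlonglongrightarrow> 0"
    proof (rule Lim_null_comparison[OF always_eventually[OF allI]])
      show "norm (nrm (\<lambda>x. f1 (g n x) * \<psi> x - f1 (u x) * \<psi> x)) \<le> (C * B) * nrm (\<lambda>x. g n x - u x)" for n
        using nrm_f1_diff_mult[OF g(6) L(3) gb L(1) g(5) L2_meas[OF Lt(1)] B, of n] by simp
      show "(\<lambda>n. C * B * nrm (\<lambda>x. g n x - u x)) \<longlonglongrightarrow> 0"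
        using tendsto_mult_right_zero[OF g(2)] by simp
    qed
    from ip_tendsto[OF L(4) LP(2) L(2) LP(1) g(3) this]
    have 2: "(\<lambda>n. ip (deriv (g n)) (\<lambda>x. f1 (g n x) * \<psi> x)) \<longlonglongrightarrow> ip u1 (\<lambda>x. f1 (u x) * \<psi> x)" .
    have "has_weak_deriv (\<lambda>x. f (g n x)) (\<lambda>x. f1 (g n x) * deriv (g n) x)" for n
    proof (rule C1_weak_deriv)
      show "((\<lambda>x. f (g n x)) has_real_derivative f1 (g n x) * deriv (g n) x) (at x)" for x
        by (rule DERIV_chain2[OF df test_DERIV[OF g(1)]])
      show "continuous_on UNIV (\<lambda>x. f1 (g n x) * deriv (g n) x)"
        by (intro continuous_intros continuous_on_compose2[OF f1_cont[of UNIV]] test_continuous test_deriv g) auto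
    qed
    then have "ip (\<lambda>x. f (g n x)) (deriv \<psi>) = - ip (deriv (g n)) (\<lambda>x. f1 (g n x) * \<psi> x)" for n
      using t by (simp add: weak_deriv_ip) (simp add: ip_def ac_simps)
    then have "(\<lambda>n. - ip (deriv (g n)) (\<lambda>x. f1 (g n x) * \<psi> x)) \<longlonglongrightarrow> ip (\<lambda>x. f (u x)) (deriv \<psi>)"
      using 1 by simp
    from LIMSEQ_unique[OF this tendsto_minus[OF 2]] show ?thesis by (simp add: ip_def ac_simps)
  qed
  then show ?thesis using Lf(1) Lf1 by (simp add: W1_def weak_deriv_ip)
qed

text \<open>The integrand is the derivative of \<open>F (u x)\<close>. For the approximating test
  functions this has bounded support, so its integral vanishes.\<close>

lemma ip_f_deriv_zero:
  assumes "W1 u u1"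
  shows "ip (\<lambda>x. f (u x)) u1 = 0"
proof -
  obtain g R C where g: "\<And>n::nat. test_fun (g n)" "(\<lambda>n. nrm (\<lambda>x. g n x - u x)) \<longlonglongrightarrow> 0"
    "(\<lambda>n. nrm (\<lambda>x. deriv (g n) x - u1 x)) \<longlonglongrightarrow> 0"
    "\<And>n x. \<bar>g n x\<bar> \<le> R" "AE x in lborel. \<bar>u x\<bar> \<le> R" "lbound R C"
    using approx_bounded[OF assms] by blast
  have L: "L2 u" "L2 u1" "\<And>n. L2 (g n)" "\<And>n. L2 (deriv (g n))"
    using assms g(1) by (auto simp: W1_def intro: test_L2 test_deriv)
  have gb: "AE x in lborel. \<bar>g n x\<bar> \<le> R" for n using g(4) by simp
  have Lf: "L2 (\<lambda>x. f (u x))" "\<And>n. L2 (\<lambda>x. f (g n x))"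
    by (rule L2_f[OF g(6)], use L gb g(5) in auto)+
  have 1: "(\<lambda>n. ip (\<lambda>x. f (g n x)) (deriv (g n))) \<longlonglongrightarrow> ip (\<lambda>x. f (u x)) u1"
    by (rule ip_tendsto[OF Lf(2) L(4) Lf(1) L(2) f_tendsto[OF L(3) g(4) L(1) g(5,6,2)] g(3)])
  have "ip (\<lambda>x. f (g n x)) (deriv (g n)) = 0" for n
  proof -
    obtain S where S: "\<And>x. S < \<bar>x\<bar> \<Longrightarrow> g n x = 0" using g(1)[of n] unfolding test_fun_iff by blast
    show ?thesis unfolding ip_def
    proof (rule integral_deriv_cs[where G = "\<lambda>x. F (g n x)" and R = S])
      show "((\<lambda>x. F (g n x)) has_real_derivative f (g n x) * deriv (g n) x) (at x)" for x
        by (rule DERIV_chain2[OF dF test_DERIV[OF g(1)]])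
      show "continuous_on UNIV (\<lambda>x. f (g n x) * deriv (g n) x)"
        by (intro continuous_intros continuous_on_compose2[OF f_cont[of UNIV]] test_continuous test_deriv g) auto
      show "F (g n x) = 0" if "S < \<bar>x\<bar>" for x using S[OF that] F_0 by simp
    qed
  qed
  then show ?thesis using 1 LIMSEQ_unique[OF _ tendsto_const] by fastforce
qed

text \<open>By parts this is the preceding integral. Up to sign it is the contribution of the
  nonlinearity to the time derivative of the momentum, the integral of \<open>u v\<close>.\<close>

lemma ip_f1_deriv_zero:
  assumes "W1 u u1"
  shows "ip u (\<lambda>x. f1 (u x) * u1 x) = 0"
  using W1_ip_parts[OF assms W1_f[OF assms]] ip_f_deriv_zero[OF assms] by (simp add: ip_commute)

end

section \<open>Ground states and the action\<close>

text \<open>\<open>Ifun\<close> with the weak derivatives as arguments; \<open>Bq\<close> below is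
  its polarisation. The Euler-Lagrange equation is stated with \<open>Bq\<close>, so that no fourth
  derivative of a ground state occurs.\<close>

definition Iq :: "real \<Rightarrow> real \<Rightarrow> rfun \<Rightarrow> rfun \<Rightarrow> rfun \<Rightarrow> real" where
  "Iq \<beta> c u u1 u2 = (nrm u2)^2 - \<beta> * (nrm u1)^2 + (1 - c^2) * (nrm u)^2"

definition Bq :: "real \<Rightarrow> real \<Rightarrow> rfun \<Rightarrow> rfun \<Rightarrow> rfun \<Rightarrow> rfun \<Rightarrow> rfun \<Rightarrow> rfun \<Rightarrow> real" where
  "Bq \<beta> c u u1 u2 h h1 h2 = ip u2 h2 - \<beta> * ip u1 h1 + (1 - c^2) * ip u h"

lemma nrm_sq_add_scale:
  assumes "L2 u" "L2 h"
  shows "(nrm (\<lambda>x. u x + s * h x))^2 = (nrm u)^2 + 2 * s * ip u h + s^2 * (nrm h)^2"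
proof -
  have "(nrm (\<lambda>x. u x + s * h x))^2 = ip u u + s * ip u h + (s * ip u h + s * (s * ip h h))"
    unfolding nrm_sq_ip using assms by (simp add: ip_simps L2_intros ip_commute[of h u] distrib_left)
  then show ?thesis by (simp add: nrm_sq_ip[of u] nrm_sq_ip[of h] power2_eq_square[of s])
qed

lemma Iq_add:
  assumes "W2 u u1 u2" "W2 h h1 h2"
  shows "Iq \<beta> c (\<lambda>x. u x + s * h x) (\<lambda>x. u1 x + s * h1 x) (\<lambda>x. u2 x + s * h2 x)
    = Iq \<beta> c u u1 u2 + 2 * s * Bq \<beta> c u u1 u2 h h1 h2 + s^2 * Iq \<beta> c h h1 h2"
  unfolding Iq_def Bq_def using assms[THEN W2D(3)] assms[THEN W2D(4)] assms[THEN W2D(5)]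
  by (simp add: nrm_sq_add_scale algebra_simps)

lemma W2_add_scale: "W2 u u1 u2 \<Longrightarrow> W2 h h1 h2 \<Longrightarrow>
   W2 (\<lambda>x. u x + s * h x) (\<lambda>x. u1 x + s * h1 x) (\<lambda>x. u2 x + s * h2 x)"
  by (intro W2_add W2_scale)

lemma Ifun_eq:
  assumes "W2 u u1 u2"
  shows "Ifun \<beta> c u = Iq \<beta> c u u1 u2"
proof -
  note L = W2D(3-5)[OF assms]
  note w = W2_wd[OF W2_H2(1)[OF assms]]
  have "Ifun \<beta> c u = (\<integral>x. (u2 x)^2 - \<beta> * (u1 x)^2 + (1 - c^2) * (u x)^2 \<partial>lborel)"
    unfolding Ifun_def
  proof (rule integral_cong_AE)
    show "AE x in lborel. (wd (wd u) x)\<^sup>2 - \<beta> * (wd u x)\<^sup>2 + (1 - c\<^sup>2) * (u x)\<^sup>2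
       = (u2 x)\<^sup>2 - \<beta> * (u1 x)\<^sup>2 + (1 - c\<^sup>2) * (u x)\<^sup>2"
      using W2_H2(2,3)[OF assms] by eventually_elim simp
  qed (use L2_meas[OF L(1)] L2_meas[OF L(2)] L2_meas[OF L(3)] L2_meas[OF W2D(4)[OF w]] L2_meas[OF W2D(5)[OF w]] in measurable)
  then show ?thesis
    unfolding Iq_def nrm_sq using L[THEN L2_sq_integrable] by simp
qed

text \<open>For positive \<open>\<beta>\<close>, integration by parts and Cauchy-Schwarz give
  \<open>(nrm u1)^2 \<le> nrm u * nrm u2\<close>; completing the square in \<open>nrm u2\<close>
  then leaves \<open>1 - c^2 - \<beta>^2 / 4\<close>, whose positivity is the condition on
  \<open>\<beta>\<close>. The maximum with 0 covers negative \<open>\<beta>\<close>, where the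
  middle term helps.\<close>

lemma Iq_coercive:
  assumes c: "c^2 < 1" and b: "\<beta> < 2 * sqrt (1 - c^2)" and u: "W2 u u1 u2"
  shows "min (1 - c^2) (1 - c^2 - (max \<beta> 0)^2 / 4) * (nrm u)^2 \<le> Iq \<beta> c u u1 u2"
    and "min (1 - c^2) (1 - c^2 - (max \<beta> 0)^2 / 4) > 0"
proof -
  note L = W2D(3-5)[OF u]
  have parts: "(nrm u1)^2 = - ip u u2"
    using W1_ip_parts[OF W2D(1)[OF u] W2D(2)[OF u]] by (simp add: nrm_sq_ip)
  have cs: "- ip u u2 \<le> nrm u * nrm u2" using Cauchy_Schwarz_ip[OF L(1,3)] by simp
  show "min (1 - c^2) (1 - c^2 - (max \<beta> 0)^2 / 4) * (nrm u)^2 \<le> Iq \<beta> c u u1 u2"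
  proof (cases "\<beta> \<le> 0")
    case True
    have "0 \<le> - \<beta> * (nrm u1)^2" using True by (intro mult_nonneg_nonneg) auto
    moreover have "0 \<le> (nrm u2)^2" by simp
    ultimately have "(1 - c^2) * (nrm u)^2 \<le> Iq \<beta> c u u1 u2" unfolding Iq_def by linarith
    then show ?thesis using True by simp
  next
    case False
    have "\<beta> * (nrm u1)^2 \<le> \<beta> * (nrm u * nrm u2)"
      using False cs unfolding parts by (intro mult_left_mono) auto
    moreover have "0 \<le> (nrm u2 - \<beta> / 2 * nrm u)^2" by simp
    ultimately have "(1 - c^2 - \<beta>^2 / 4) * (nrm u)^2 \<le> Iq \<beta> c u u1 u2"
      unfolding Iq_def by (simp add: power2_eq_square algebra_simps)
    then show ?thesis using False by (simp add: min_def)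
  qed
  have "(max \<beta> 0)^2 < (2 * sqrt (1 - c^2))^2"
    using b c by (intro power_strict_mono) (auto simp: max_def)
  then show "min (1 - c^2) (1 - c^2 - (max \<beta> 0)^2 / 4) > 0"
    using c by (simp add: power_mult_distrib)
qed

lemma Iq_nonneg:
  assumes "c^2 < 1" "\<beta> < 2 * sqrt (1 - c^2)" "W2 u u1 u2"
  shows "0 \<le> Iq \<beta> c u u1 u2"
proof -
  have "0 \<le> min (1 - c^2) (1 - c^2 - (max \<beta> 0)^2 / 4) * (nrm u)^2"
    using Iq_coercive(2)[OF assms] by (intro mult_nonneg_nonneg) auto
  then show ?thesis using Iq_coercive(1)[OF assms] by linarith
qed

text \<open>By \<open>m\<close> the power function \<open>m * y powr a\<close> has value
  \<open>k\<close> at \<open>k\<close>, hence slope \<open>a\<close> there. Along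
  \<open>k + e^2 * L + O(e^3)\<close> it equals \<open>k + a * e^2 * L + o(e^2)\<close>, to be
  compared with \<open>k + e^2 * Q\<close>. For \<open>a = 2 / (p + 1)\<close> this converts
  minimality of the quotient of I by a power of K into an inequality between second
  variations.\<close>

lemma power_curve_comparison:
  fixes a k m L Q D :: real and Kv :: "real \<Rightarrow> real"
  assumes k: "k > 0" and a: "a > 0" and m: "m * k powr a = k" and D: "D \<ge> 0"
    and K: "\<And>e. 0 < e \<Longrightarrow> e \<le> 1 \<Longrightarrow> \<bar>Kv e - k - e^2 * L\<bar> \<le> D * e^3"
    and le: "\<And>e. 0 < e \<Longrightarrow> e \<le> 1 \<Longrightarrow> Kv e > 0 \<Longrightarrow> m * (Kv e) powr a \<le> k + e^2 * Q"
  shows "a * L \<le> Q"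
proof (rule ccontr)
  assume "\<not> a * L \<le> Q"
  then have gap: "a * L - Q > 0" by simp
  \<comment> \<open>\<open>e^2 * M\<close> will bound the deviation of \<open>Kv e\<close> from
    \<open>k\<close> for \<open>e \<le> 1\<close>.\<close>
  define M where "M = \<bar>L\<bar> + D + 1"
  have M: "M > 0" using D by (simp add: M_def add_nonneg_pos)
  \<comment> \<open>\<open>\<eta> * M\<close>, the error of linearising the power, is a quarter of
    the gap; the last entry in the definition of \<open>e\<close> holds the cubic error to a quarter
    as well.\<close>
  define \<eta> where "\<eta> = (a * L - Q) / (4 * M)"
  have \<eta>: "\<eta> > 0" using gap M by (simp add: \<eta>_def)
  have "((\<lambda>y. m * y powr a) has_real_derivative m * (a * k powr (a - 1))) (at k)"
    using k by (auto intro!: derivative_eq_intros)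
  also have "m * (a * k powr (a - 1)) = a"
  proof -
    have "k powr (a - 1) = k powr a / k" using k by (simp add: powr_diff)
    then have "m * (a * k powr (a - 1)) = a * (m * k powr a) / k" by simp
    then show ?thesis using m k by simp
  qed
  finally have "((\<lambda>y. m * y powr a) has_derivative (\<lambda>h. a * h)) (at k within UNIV)"
    by (simp add: has_field_derivative_def)
  then obtain d where d: "d > 0" "\<And>y. \<bar>y - k\<bar> < d \<Longrightarrow> \<bar>m * y powr a - m * k powr a - a * (y - k)\<bar> \<le> \<eta> * \<bar>y - k\<bar>"
    using \<eta> unfolding has_derivative_within_alt real_norm_def by blast
  define e where "e = min (min 1 (d / (2 * M))) (min (k / (2 * M)) ((a * L - Q) / (4 * a * M)))"
  have e0: "e > 0" using d(1) M k gap a by (simp add: e_def)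
  have e1: "e \<le> 1" and ed: "e * (2 * M) \<le> d" and ek: "e * (2 * M) \<le> k" and eg: "e * (4 * a * M) \<le> a * L - Q"
  proof -
    show "e \<le> 1" by (simp add: e_def)
    have "e \<le> d / (2 * M)" "e \<le> k / (2 * M)" "e \<le> (a * L - Q) / (4 * a * M)" by (simp_all add: e_def)
    then show "e * (2 * M) \<le> d" "e * (2 * M) \<le> k" "e * (4 * a * M) \<le> a * L - Q"
      using M a by (simp_all add: pos_le_divide_eq)
  qed
  have e2: "e^2 \<le> e" using e0 e1 by (simp add: power2_eq_square mult_le_one mult_left_le)
  have e3: "e^3 = e^2 * e" by (simp add: power3_eq_cube power2_eq_square)
  have KL: "\<bar>Kv e - k - e^2 * L\<bar> \<le> e^2 * (D * e)" using K[OF e0 e1] by (simp add: e3 ac_simps)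
  have De: "D * e \<le> D" using D e1 e0 by (simp add: mult_left_le)
  have "\<bar>Kv e - k\<bar> \<le> e^2 * \<bar>L\<bar> + e^2 * (D * e)"
    using KL by (simp add: abs_le_iff abs_mult) (smt (verit, ccfv_SIG) abs_ge_self abs_mult abs_power2 minus_mult_right zero_le_power2 mult_left_mono abs_minus_cancel)
  also have "\<dots> \<le> e^2 * M" using mult_left_mono[OF De, of "e^2"] unfolding M_def by (simp add: distrib_left) (smt (verit) zero_le_power2)
  finally have Kk: "\<bar>Kv e - k\<bar> \<le> e^2 * M" .
  have "e^2 * M \<le> e * M" using e2 M by (intro mult_right_mono) auto
  moreover have "e * M < e * (2 * M)" using e0 M by simp
  ultimately have small: "e^2 * M < d" "e^2 * M < k" using ed ek by linarith+
  have Kpos: "Kv e > 0" using Kk small(2) by linarith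
  have "\<bar>m * Kv e powr a - k - a * (Kv e - k)\<bar> \<le> \<eta> * \<bar>Kv e - k\<bar>"
    using d(2)[of "Kv e"] Kk small(1) m by simp
  also have "\<dots> \<le> \<eta> * (e^2 * M)" using Kk \<eta> by (intro mult_left_mono) auto
  finally have 1: "k + a * (Kv e - k) - \<eta> * (e^2 * M) \<le> k + e^2 * Q"
    using le[OF e0 e1 Kpos] by linarith
  have "a * (e^2 * L - e^2 * (D * e)) \<le> a * (Kv e - k)"
    using KL a by (intro mult_left_mono) linarith+
  with 1 have "e^2 * (a * L - a * (D * e) - \<eta> * M) \<le> e^2 * Q"
    by (simp add: algebra_simps)
  then have 2: "a * L - a * (D * e) - \<eta> * M \<le> Q" using e0 by simp
  have "\<eta> * M = (a * L - Q) / 4" using M by (simp add: \<eta>_def)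
  moreover have "a * (D * e) \<le> (a * L - Q) / 4"
  proof -
    have "D * e \<le> M * e" using e0 by (intro mult_right_mono) (auto simp: M_def)
    then have "a * (D * e) \<le> a * (M * e)" using a by (intro mult_left_mono) auto
    then show ?thesis using eg by (simp add: algebra_simps)
  qed
  ultimately show False using 2 gap by argo
qed

locale ground = nonlin +
  fixes p \<beta> c :: real and \<phi> \<phi>1 \<phi>2 :: rfun
  assumes p: "p \<ge> 2" and c: "c^2 < 1" and \<beta>: "\<beta> < 2 * sqrt (1 - c^2)"
    and ground: "\<phi> \<in> ground_states f p \<beta> c" and W: "W2 \<phi> \<phi>1 \<phi>2"
    and K_pos: "Kfun f p \<phi> > 0"
begin

lemma Kfun_Phi: "Kfun f p u = (p + 1) * Phi u"
  by (simp add: Kfun_def Phi_def)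

abbreviation "k \<equiv> Kfun f p \<phi>"
abbreviation "m \<equiv> mval f p \<beta> c"

text \<open>Non-negativity of I bounds the set of quotients below, without which its
  \<open>Inf\<close> would be no lower bound.\<close>

lemma m_lower:
  assumes u: "W2 u u1 u2" and K: "Kfun f p u > 0"
  shows "m * (Kfun f p u) powr (2 / (p + 1)) \<le> Iq \<beta> c u u1 u2"
proof -
  let ?S = "{Ifun \<beta> c u / (Kfun f p u) powr (2 / (p + 1)) | u. H2 u \<and> Kfun f p u > 0}"
  have "0 \<le> x" if "x \<in> ?S" for x
    using that Iq_nonneg[OF c \<beta> W2_wd] by (auto simp: Ifun_eq[OF W2_wd])
  then have "bdd_below ?S" by (rule bdd_belowI)
  moreover have "Ifun \<beta> c u / (Kfun f p u) powr (2 / (p + 1)) \<in> ?S"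
    using W2_H2(1)[OF u] K by blast
  ultimately have "m \<le> Ifun \<beta> c u / (Kfun f p u) powr (2 / (p + 1))"
    unfolding mval_def by (intro cInf_lower)
  then show ?thesis using K by (simp add: Ifun_eq[OF u] field_simps)
qed

lemma m_nonneg: "m \<ge> 0"
  unfolding mval_def
proof (rule cInf_greatest)
  show "{Ifun \<beta> c u / (Kfun f p u) powr (2 / (p + 1)) | u. H2 u \<and> Kfun f p u > 0} \<noteq> {}"
    using W2_H2(1)[OF W] K_pos by blast
  show "0 \<le> x" if "x \<in> {Ifun \<beta> c u / (Kfun f p u) powr (2 / (p + 1)) | u. H2 u \<and> Kfun f p u > 0}" for x
    using that Iq_nonneg[OF c \<beta> W2_wd] by (auto simp: Ifun_eq[OF W2_wd])
qed

lemma k_eq: "k = m powr ((p + 1) / (p - 1))" and I_eq: "Iq \<beta> c \<phi> \<phi>1 \<phi>2 = k"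
  using ground by (auto simp: ground_states_def Ifun_eq[OF W])

text \<open>Since I and K both equal \<open>k\<close> at \<open>\<phi>\<close>, this says that
  \<open>\<phi>\<close> attains the infimum. The exponent in the definition of ground states fits
  because \<open>1 + 2 / (p - 1) = (p + 1) / (p - 1)\<close>.\<close>

lemma m_k: "m * k powr (2 / (p + 1)) = k"
proof -
  have "m \<noteq> 0" using k_eq K_pos by auto
  then have m: "m > 0" using m_nonneg by simp
  have "m * k powr (2 / (p + 1)) = m powr 1 * m powr ((p + 1) / (p - 1) * (2 / (p + 1)))"
    using m by (simp add: k_eq powr_powr)
  also have "\<dots> = m powr (1 + (p + 1) / (p - 1) * (2 / (p + 1)))" by (rule powr_add[symmetric])
  also have "1 + (p + 1) / (p - 1) * (2 / (p + 1)) = (p + 1) / (p - 1)"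
  proof -
    have "(p + 1) / (p - 1) * (2 / (p + 1)) = 2 / (p - 1)"
      using p by (simp add: divide_simps)
    then show ?thesis using p by (simp add: field_simps)
  qed
  finally show ?thesis using k_eq by simp
qed

lemma m_lower_k: "W2 u u1 u2 \<Longrightarrow> Kfun f p u = k \<Longrightarrow> k \<le> Iq \<beta> c u u1 u2"
  using m_lower[of u u1 u2] m_k K_pos by simp

lemma phi_bound: "AE x in lborel. \<bar>\<phi> x\<bar> \<le> nrm \<phi> + nrm \<phi>1"
  by (rule W1_sup_bound[OF W2D(1)[OF W]])

lemma Phi_line_DERIV:
  assumes u: "L2 u" "AE x in lborel. \<bar>u x\<bar> \<le> R" and h: "L2 h" "AE x in lborel. \<bar>h x\<bar> \<le> B"
  shows "((\<lambda>e. Phi (\<lambda>x. u x + e * h x)) has_real_derivative ip (\<lambda>x. f (u x)) h) (at 0)"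
proof -
  have "0 \<le> \<bar>R\<bar> + \<bar>B\<bar>" by simp
  then obtain C where C: "lbound (\<bar>R\<bar> + \<bar>B\<bar>) C" using lbound_exists by blast
  show ?thesis
  proof (rule DERIV_quadI[where K = "C * (nrm h)^2"])
    fix e :: real assume e: "\<bar>e\<bar> \<le> 1"
    have b1: "AE x in lborel. \<bar>u x\<bar> \<le> \<bar>R\<bar> + \<bar>B\<bar>" using u(2) by eventually_elim linarith
    have b2: "AE x in lborel. \<bar>u x + e * h x\<bar> \<le> \<bar>R\<bar> + \<bar>B\<bar>"
      using u(2) h(2)
    proof eventually_elim
      case (elim x)
      have "\<bar>e * h x\<bar> \<le> 1 * \<bar>h x\<bar>" unfolding abs_mult using e by (intro mult_right_mono) auto
      then show ?case using elim by linarith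
    qed
    have L: "L2 (\<lambda>x. u x + e * h x)" by (intro L2_intros u h)
    show "\<bar>Phi (\<lambda>x. u x + (0 + e) * h x) - Phi (\<lambda>x. u x + 0 * h x) - e * ip (\<lambda>x. f (u x)) h\<bar> \<le> C * (nrm h)\<^sup>2 * e\<^sup>2"
      using Phi_first_order[OF C u(1) b1 L b2] by (simp add: ip_scale_right nrm_scale power_mult_distrib ac_simps)
  qed
qed

text \<open>Near \<open>\<phi>\<close> the difference of I and \<open>m\<close> times the power of K
  is non-negative, and it is 0 at \<open>\<phi>\<close>, so its derivative along \<open>h\<close>
  vanishes. No Lagrange multiplier remains because of the normalisation I = K, which enters as
  \<open>m * k powr (2 / (p + 1) - 1) = 1\<close>.\<close>

lemma Euler_Lagrange:
  assumes h: "W2 h h1 h2"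
  shows "Bq \<beta> c \<phi> \<phi>1 \<phi>2 h h1 h2 = ip (\<lambda>x. f (\<phi> x)) h"
proof -
  let ?a = "2 / (p + 1)"
  let ?K = "\<lambda>e. (p + 1) * Phi (\<lambda>x. \<phi> x + e * h x)"
  let ?g = "\<lambda>e. (k + 2 * e * Bq \<beta> c \<phi> \<phi>1 \<phi>2 h h1 h2 + e^2 * Iq \<beta> c h h1 h2) - m * (?K e) powr ?a"
  have K0: "?K 0 = k" by (simp add: Kfun_Phi)
  have dK: "(?K has_real_derivative (p + 1) * ip (\<lambda>x. f (\<phi> x)) h) (at 0)"
    by (intro DERIV_cmult Phi_line_DERIV[OF W2D(3)[OF W] phi_bound W2D(3)[OF h] W1_sup_bound[OF W2D(1)[OF h]]])
  have dP: "((\<lambda>e. (?K e) powr ?a) has_real_derivative ?a * k powr (?a - 1) * ((p + 1) * ip (\<lambda>x. f (\<phi> x)) h)) (at 0)"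
  proof -
    have "?K 0 > 0" using K0 K_pos by simp
    from DERIV_chain2[OF has_real_derivative_powr[OF this] dK]
    show ?thesis unfolding K0 .
  qed
  have dg: "(?g has_real_derivative 2 * Bq \<beta> c \<phi> \<phi>1 \<phi>2 h h1 h2
      - m * (?a * k powr (?a - 1) * ((p + 1) * ip (\<lambda>x. f (\<phi> x)) h))) (at 0)"
    by (rule derivative_eq_intros dP refl)+ simp
  have "isCont ?K 0" using dK by (rule DERIV_isCont)
  then have "(?K \<longlongrightarrow> k) (at 0)" using K0 unfolding isCont_def by simp
  then have "\<forall>\<^sub>F e in at 0. ?K e > 0" by (rule order_tendstoD) (rule K_pos)
  then obtain d where d: "d > 0" "\<And>e. e \<noteq> 0 \<Longrightarrow> \<bar>e\<bar> < d \<Longrightarrow> ?K e > 0"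
    unfolding eventually_at by (auto simp: dist_real_def)
  have "2 * Bq \<beta> c \<phi> \<phi>1 \<phi>2 h h1 h2 - m * (?a * k powr (?a - 1) * ((p + 1) * ip (\<lambda>x. f (\<phi> x)) h)) = 0"
  proof (rule DERIV_local_min[OF dg d(1)], intro allI impI)
    fix e :: real assume e: "\<bar>0 - e\<bar> < d"
    have "?K e > 0" using d(2)[of e] e K0 K_pos by (cases "e = 0") auto
    then have "0 \<le> ?g e"
      using m_lower[OF W2_add_scale[OF W h, of e]] by (simp add: Kfun_Phi Iq_add[OF W h] I_eq)
    moreover have "?g 0 = 0" using m_k K0 by (simp add: Kfun_Phi)
    ultimately show "?g 0 \<le> ?g e" by simp
  qed
  moreover have "m * (?a * k powr (?a - 1) * ((p + 1) * ip (\<lambda>x. f (\<phi> x)) h)) = 2 * ip (\<lambda>x. f (\<phi> x)) h"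
  proof -
    have "m * k powr (?a - 1) = 1" using m_k K_pos by (simp add: powr_diff field_simps)
    note mk = this
    have "m * (?a * k powr (?a - 1) * ((p + 1) * ip (\<lambda>x. f (\<phi> x)) h)) = (m * k powr (?a - 1)) * ((?a * (p + 1)) * ip (\<lambda>x. f (\<phi> x)) h)"
      by (simp only: ac_simps)
    also have "?a * (p + 1) = 2" using p by (simp add: field_simps)
    finally show ?thesis unfolding mk by simp
  qed
  ultimately show ?thesis by simp
qed

text \<open>Along such a line K is constant to first order, so the minimality of I on the level set of K
  survives in the second-order terms.\<close>
lemma tangent_nonneg:
  assumes h: "W2 h h1 h2" and b: "\<And>x. \<bar>h x\<bar> \<le> B" and z: "ip (\<lambda>x. f (\<phi> x)) h = 0"
  shows "(\<integral>x. f1 (\<phi> x) * (h x)^2 \<partial>lborel) \<le> Iq \<beta> c h h1 h2"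
proof -
  have B: "0 \<le> B" using order_trans[OF abs_ge_zero b[of 0]] .
  let ?R = "nrm \<phi> + nrm \<phi>1 + B"
  have "0 \<le> ?R" using B by (simp add: add_nonneg_nonneg)
  then obtain C where C: "lbound ?R C" using lbound_exists by blast
  let ?J = "\<integral>x. f1 (\<phi> x) * (h x)^2 \<partial>lborel"
  \<comment> \<open>\<open>(p + 1) * (?J / 2)\<close> is the coefficient of \<open>e^2\<close> in K
    along the line, the linear term being absent by \<open>z\<close>; the exponent
    \<open>2 / (p + 1)\<close> reduces it to \<open>?J\<close>.\<close>
  have "2 / (p + 1) * ((p + 1) * (?J / 2)) \<le> Iq \<beta> c h h1 h2"
  proof (rule power_curve_comparison[OF K_pos _ m_k, where D = "(p + 1) * (C * B * (nrm h)^2)"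
        and Kv = "\<lambda>e. (p + 1) * Phi (\<lambda>x. \<phi> x + e * h x)"])
    show "2 / (p + 1) > 0" using p by simp
    show "0 \<le> (p + 1) * (C * B * (nrm h)\<^sup>2)" using p B lbound_nonneg[OF C] by simp
    fix e :: real assume e: "0 < e" "e \<le> 1"
    have "\<bar>Phi (\<lambda>x. \<phi> x + e * h x) - Phi \<phi> - ip (\<lambda>x. f (\<phi> x)) (\<lambda>x. e * h x)
       - (\<integral>x. f1 (\<phi> x) * (e * h x)^2 \<partial>lborel) / 2\<bar> \<le> C * (e * B) * (nrm (\<lambda>x. e * h x))^2"
    proof (rule Phi_second_order[OF C])
      show "AE x in lborel. \<bar>\<phi> x\<bar> \<le> ?R" using phi_bound by eventually_elim (use B in linarith)
      have eh: "\<bar>e * h x\<bar> \<le> e * B" for x using e b by (simp add: abs_mult mult_left_mono)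
      then show "AE x in lborel. \<bar>e * h x\<bar> \<le> e * B" by simp
      have eB: "e * B \<le> B" using e B by (simp add: mult_left_le_one_le)
      show "AE x in lborel. \<bar>\<phi> x + e * h x\<bar> \<le> ?R"
        using phi_bound
      proof eventually_elim
        case (elim x)
        show ?case using eh[of x] elim eB by linarith
      qed
    qed (intro L2_intros W2D(3)[OF W] W2D(3)[OF h])+
    then have "\<bar>Phi (\<lambda>x. \<phi> x + e * h x) - Phi \<phi> - e^2 * (?J / 2)\<bar> \<le> (C * B * (nrm h)^2) * e^3"
      using e by (simp add: ip_scale_right z nrm_scale power_mult_distrib mult.left_commute[of _ "e^2"])
        (simp add: power3_eq_cube power2_eq_square ac_simps)
    then have "(p + 1) * \<bar>Phi (\<lambda>x. \<phi> x + e * h x) - Phi \<phi> - e^2 * (?J / 2)\<bar> \<le> (p + 1) * ((C * B * (nrm h)^2) * e^3)"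
      using p by (intro mult_left_mono) auto
    moreover have "(p + 1) * \<bar>Phi (\<lambda>x. \<phi> x + e * h x) - Phi \<phi> - e^2 * (?J / 2)\<bar>
       = \<bar>(p + 1) * (Phi (\<lambda>x. \<phi> x + e * h x) - Phi \<phi> - e^2 * (?J / 2))\<bar>"
      using p by (simp add: abs_mult)
    ultimately show "\<bar>(p + 1) * Phi (\<lambda>x. \<phi> x + e * h x) - k - e\<^sup>2 * ((p + 1) * (?J / 2))\<bar>
        \<le> (p + 1) * (C * B * (nrm h)\<^sup>2) * e ^ 3"
      by (simp add: Kfun_Phi algebra_simps)
    show "m * ((p + 1) * Phi (\<lambda>x. \<phi> x + e * h x)) powr (2 / (p + 1)) \<le> k + e\<^sup>2 * Iq \<beta> c h h1 h2"
      if "0 < (p + 1) * Phi (\<lambda>x. \<phi> x + e * h x)"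
      using m_lower[OF W2_add_scale[OF W h, of e]] that
      by (simp add: Kfun_Phi Iq_add[OF W h] I_eq Euler_Lagrange[OF h] z)
  qed
  then show ?thesis using p by simp
qed

text \<open>This is \<open>E + c Q\<close> with the square completed in \<open>v\<close>: the cross
  term and \<open>v^2 / 2\<close> are absorbed into the square of \<open>c * u + v\<close>, which
  leaves the coefficient \<open>1 - c^2\<close> in I.\<close>

definition action :: "rfun \<Rightarrow> rfun \<Rightarrow> real" where
  "action u v = Ifun \<beta> c u / 2 + (nrm (\<lambda>x. c * u x + v x))^2 / 2 - Phi u"

definition dlevel :: real where "dlevel = k / 2 - k / (p + 1)"

lemma action_W2: "W2 u u1 u2 \<Longrightarrow> action u v = Iq \<beta> c u u1 u2 / 2 + (nrm (\<lambda>x. c * u x + v x))^2 / 2 - Phi u"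
  by (simp add: action_def Ifun_eq)

lemma action_lower:
  assumes "W2 u u1 u2" "Kfun f p u = k"
  shows "dlevel \<le> action u v"
proof -
  have "Phi u = k / (p + 1)" using assms(2) p by (simp add: Kfun_Phi field_simps)
  moreover have "0 \<le> (nrm (\<lambda>x. c * u x + v x))^2" by simp
  ultimately show ?thesis using m_lower_k[OF assms] unfolding action_W2[OF assms(1)] dlevel_def by linarith
qed

lemma action_ground: "action \<phi> (\<lambda>x. - c * \<phi> x) = dlevel"
proof -
  have "Phi \<phi> = k / (p + 1)" using p by (simp add: Kfun_Phi)
  then show ?thesis by (simp add: action_W2[OF W] dlevel_def I_eq)
qed

text \<open>The derivative of the action at \<open>(u, v)\<close> in the direction
  \<open>(h, g)\<close>.\<close>

definition daction :: "rfun \<Rightarrow> rfun \<Rightarrow> rfun \<Rightarrow> rfun \<Rightarrow> rfun \<Rightarrow> rfun \<Rightarrow> rfun \<Rightarrow> rfun \<Rightarrow> real" where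
  "daction u u1 u2 v h h1 h2 g =
     Bq \<beta> c u u1 u2 h h1 h2 + ip (\<lambda>x. c * u x + v x) (\<lambda>x. c * h x + g x) - ip (\<lambda>x. f (u x)) h"

text \<open>The second derivative of the action in the direction \<open>(h, g)\<close>; the base
  point enters only through its first component \<open>w\<close>. At \<open>\<phi>\<close> it is the
  quadratic form of H.\<close>

definition hess :: "rfun \<Rightarrow> rfun \<Rightarrow> rfun \<Rightarrow> rfun \<Rightarrow> rfun \<Rightarrow> real" where
  "hess w h h1 h2 g = Iq \<beta> c h h1 h2 + (nrm (\<lambda>x. c * h x + g x))^2 - (\<integral>x. f1 (w x) * (h x)^2 \<partial>lborel)"

text \<open>The second-order coefficient is taken at a reference \<open>w\<close> near
  \<open>u\<close>, where its sign is known, at the cost of the term in the distance of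
  \<open>u\<close> and \<open>w\<close>. An upper bound is enough for the concavity used
  later.\<close>

lemma action_expansion:
  assumes u: "W2 u u1 u2" "AE x in lborel. \<bar>u x\<bar> \<le> R" and v: "L2 v"
    and h: "W2 h h1 h2" "\<And>x. \<bar>h x\<bar> \<le> B" and g: "L2 g"
    and us: "AE x in lborel. \<bar>u x + s * h x\<bar> \<le> R"
    and w: "L2 w" "AE x in lborel. \<bar>w x\<bar> \<le> R" and lb: "lbound R C"
  shows "action (\<lambda>x. u x + s * h x) (\<lambda>x. v x + s * g x) \<le> action u v + s * daction u u1 u2 v h h1 h2 g
     + s^2 * (hess w h h1 h2 g / 2 + (C * B * nrm h * nrm (\<lambda>x. u x - w x) / 2 + C * B * \<bar>s\<bar> * (nrm h)^2))"
proof -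
  note Lu = W2D(3)[OF u(1)] note Lh = W2D(3)[OF h(1)]
  have "action (\<lambda>x. u x + s * h x) (\<lambda>x. v x + s * g x) =
     (Iq \<beta> c u u1 u2 + 2 * s * Bq \<beta> c u u1 u2 h h1 h2 + s^2 * Iq \<beta> c h h1 h2) / 2
     + (nrm (\<lambda>x. (c * u x + v x) + s * (c * h x + g x)))^2 / 2 - Phi (\<lambda>x. u x + s * h x)"
    unfolding action_W2[OF W2_add_scale[OF u(1) h(1)]] Iq_add[OF u(1) h(1)]
    by (simp add: algebra_simps)
  also have "(nrm (\<lambda>x. (c * u x + v x) + s * (c * h x + g x)))^2 =
     (nrm (\<lambda>x. c * u x + v x))^2 + 2 * s * ip (\<lambda>x. c * u x + v x) (\<lambda>x. c * h x + g x) + s^2 * (nrm (\<lambda>x. c * h x + g x))^2"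
    by (intro nrm_sq_add_scale L2_intros Lu Lh v g)
  finally have 1: "action (\<lambda>x. u x + s * h x) (\<lambda>x. v x + s * g x) = action u v + s * daction u u1 u2 v h h1 h2 g
     + s^2 * (Iq \<beta> c h h1 h2 + (nrm (\<lambda>x. c * h x + g x))^2) / 2
     - (Phi (\<lambda>x. u x + s * h x) - Phi u - s * ip (\<lambda>x. f (u x)) h)"
    unfolding action_W2[OF u(1)] daction_def by (simp add: field_simps)
  have "\<bar>Phi (\<lambda>x. u x + s * h x) - Phi u - ip (\<lambda>x. f (u x)) (\<lambda>x. s * h x)
       - (\<integral>x. f1 (u x) * (s * h x)^2 \<partial>lborel) / 2\<bar> \<le> C * (\<bar>s\<bar> * B) * (nrm (\<lambda>x. s * h x))^2"
    using h(2) by (intro Phi_second_order[OF lb Lu u(2) L2_scale[OF Lh] _ us]) (simp add: abs_mult mult_left_mono)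
  then have 2: "\<bar>Phi (\<lambda>x. u x + s * h x) - Phi u - s * ip (\<lambda>x. f (u x)) h
       - s^2 * (\<integral>x. f1 (u x) * (h x)^2 \<partial>lborel) / 2\<bar> \<le> s^2 * (C * B * \<bar>s\<bar> * (nrm h)^2)"
    by (simp add: ip_scale_right nrm_scale power_mult_distrib mult.left_commute[of _ "s^2"])
       (simp add: ac_simps)
  have "\<bar>(\<integral>x. f1 (u x) * (h x)^2 \<partial>lborel) - (\<integral>x. f1 (w x) * (h x)^2 \<partial>lborel)\<bar>
     \<le> C * B * nrm h * nrm (\<lambda>x. u x - w x)"
    by (rule f1_sq_diff[OF lb Lu u(2) w Lh h(2)])
  then have "s^2 * ((\<integral>x. f1 (w x) * (h x)^2 \<partial>lborel) - (\<integral>x. f1 (u x) * (h x)^2 \<partial>lborel))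
     \<le> s^2 * (C * B * nrm h * nrm (\<lambda>x. u x - w x))"
    by (intro mult_left_mono) auto
  then have 3: "s^2 * (\<integral>x. f1 (w x) * (h x)^2 \<partial>lborel) / 2 - s^2 * (\<integral>x. f1 (u x) * (h x)^2 \<partial>lborel) / 2
     \<le> s^2 * (C * B * nrm h * nrm (\<lambda>x. u x - w x)) / 2"
    by (simp add: algebra_simps)
  have 4: "s^2 * (hess w h h1 h2 g / 2 + (C * B * nrm h * nrm (\<lambda>x. u x - w x) / 2 + C * B * \<bar>s\<bar> * (nrm h)^2))
     = s^2 * (Iq \<beta> c h h1 h2 + (nrm (\<lambda>x. c * h x + g x))^2) / 2 - s^2 * (\<integral>x. f1 (w x) * (h x)^2 \<partial>lborel) / 2
       + s^2 * (C * B * nrm h * nrm (\<lambda>x. u x - w x)) / 2 + s^2 * (C * B * \<bar>s\<bar> * (nrm h)^2)"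
    unfolding hess_def by (simp add: field_simps)
  show ?thesis unfolding 1 4 using 2 3 by linarith
qed

lemma Phi_shift: "Phi (\<lambda>x. u (x + r)) = Phi u"
  unfolding Phi_def using lborel_integral_shift[of "\<lambda>x. F (u x)" r] by simp

lemma hess_shift: "hess (\<lambda>x. w (x + r)) (\<lambda>x. h (x + r)) (\<lambda>x. h1 (x + r)) (\<lambda>x. h2 (x + r)) (\<lambda>x. g (x + r)) = hess w h h1 h2 g"
  unfolding hess_def Iq_def nrm_shift
  using lborel_integral_shift[of "\<lambda>x. f1 (w x) * (h x)^2" r] nrm_shift[of "\<lambda>x. c * h x + g x" r] by simp

text \<open>Moving along the negative direction, one meets the level set of K on which the action is at
  least the ground state level; by concavity along the line the slope of the action must make up for the deficit.\<close>
lemma slope_bound: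
  assumes h: "W2 h h1 h2" "\<And>x. \<bar>h x\<bar> \<le> B" and g: "L2 g" and neg: "hess \<phi> h h1 h2 g < 0"
  obtains \<epsilon> where "\<epsilon> > 0" "\<And>u u1 u2 v r. W2 u u1 u2 \<Longrightarrow> L2 v \<Longrightarrow>
      nrm (\<lambda>x. u x - \<phi> (x + r)) \<le> \<epsilon> \<Longrightarrow> nrm (\<lambda>x. u1 x - \<phi>1 (x + r)) \<le> \<epsilon> \<Longrightarrow>
      \<exists>s. \<bar>s\<bar> \<le> 1 \<and> dlevel \<le> action u v + s * daction u u1 u2 v
        (\<lambda>x. h (x + r)) (\<lambda>x. h1 (x + r)) (\<lambda>x. h2 (x + r)) (\<lambda>x. g (x + r))"
proof -
  have B: "0 \<le> B" using order_trans[OF abs_ge_zero h(2)[of 0]] .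
  note Lh = W2D(3)[OF h(1)] note L\<phi> = W2D(3)[OF W] note L\<phi>1 = W2D(4)[OF W]
  define R where "R = nrm \<phi> + nrm \<phi>1 + 2 + B"
  have R0: "0 \<le> R" using B by (simp add: R_def add_nonneg_nonneg)
  obtain C where C: "lbound R C" using lbound_exists[OF R0] by blast
  have C0: "0 \<le> C" by (rule lbound_nonneg[OF C])
  let ?\<kappa> = "ip (\<lambda>x. f (\<phi> x)) h"
  \<comment> \<open>\<open>?\<kappa>\<close> is the derivative of \<open>Phi\<close> along
    \<open>h\<close> at the ground state; were it 0, minimality would make the second variation
    non-negative.\<close>
  have nz: "?\<kappa> \<noteq> 0"
  proof
    assume "?\<kappa> = 0"
    from tangent_nonneg[OF h this] have "0 \<le> hess \<phi> h h1 h2 g"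
      unfolding hess_def using zero_le_power2[of "nrm (\<lambda>x. c * h x + g x)"] by linarith
    then show False using neg by simp
  qed
  define n where "n = nrm h"
  have n0: "n \<ge> 0" by (simp add: n_def)
  \<comment> \<open>Small enough that the cubic term of the action stays below a quarter of
    \<open>- hess\<close>, and that over a step of length \<open>s0\<close> the first-order change
    of \<open>Phi\<close> dominates the second-order one with room to spare.\<close>
  define s0 where "s0 = min 1 (min (- hess \<phi> h h1 h2 g / (4 * (C * B * n^2 + 1))) (\<bar>?\<kappa>\<bar> / (2 * (C * n^2 + 1))))"
  have X: "C * B * n^2 + 1 > 0" "C * n^2 + 1 > 0" using C0 B by (simp_all add: add_nonneg_pos)
  have s0: "s0 > 0" "s0 \<le> 1"
    using divide_pos_pos[of "- hess \<phi> h h1 h2 g" "4 * (C * B * n^2 + 1)"]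
      divide_pos_pos[of "\<bar>?\<kappa>\<bar>" "2 * (C * n^2 + 1)"] neg nz X
    by (simp_all only: s0_def min_less_iff_conj min.cobounded1) simp_all
  have s0a: "C * B * s0 * n^2 \<le> - hess \<phi> h h1 h2 g / 4"
  proof -
    have "s0 \<le> - hess \<phi> h h1 h2 g / (4 * (C * B * n^2 + 1))" by (simp add: s0_def)
    then have "s0 * (C * B * n^2 + 1) \<le> - hess \<phi> h h1 h2 g / 4" using X by (simp add: field_simps)
    then show ?thesis using s0(1) by (simp add: algebra_simps)
  qed
  have s0b: "2 * (C * n^2 * s0) + 2 * s0 \<le> \<bar>?\<kappa>\<bar>"
  proof -
    have "s0 \<le> \<bar>?\<kappa>\<bar> / (2 * (C * n^2 + 1))" by (simp add: s0_def)
    then show ?thesis using X by (simp add: field_simps)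
  qed
  define M where "M = 2 * nrm \<phi> + 2 * n + 1"
  have M0: "M > 0" using n0 by (simp add: M_def add_nonneg_pos)
  \<comment> \<open>The last entry makes replacing \<open>u\<close> by the translate of
    \<open>\<phi>\<close> change \<open>Phi\<close> by less than \<open>s0^2\<close>; the one before
    it keeps the error of taking the second variation at that translate below a quarter of
    \<open>- hess\<close>.\<close>
  define \<epsilon> where "\<epsilon> = min 1 (min (- hess \<phi> h h1 h2 g / (4 * (C * B * n + 1))) (s0^2 / (C * M + 1)))"
  have Y: "C * B * n + 1 > 0" "C * M + 1 > 0" using C0 B n0 M0 by (simp_all add: add_nonneg_pos)
  have \<epsilon>: "\<epsilon> > 0" "\<epsilon> \<le> 1"
    using divide_pos_pos[of "- hess \<phi> h h1 h2 g" "4 * (C * B * n + 1)"]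
      divide_pos_pos[of "s0^2" "C * M + 1"] neg Y s0
    by (simp_all only: \<epsilon>_def min_less_iff_conj min.cobounded1) simp_all
  have \<epsilon>a: "C * B * n * \<epsilon> \<le> - hess \<phi> h h1 h2 g / 4"
  proof -
    have "\<epsilon> \<le> - hess \<phi> h h1 h2 g / (4 * (C * B * n + 1))" by (simp add: \<epsilon>_def)
    then have "\<epsilon> * (C * B * n + 1) \<le> - hess \<phi> h h1 h2 g / 4" using Y by (simp add: field_simps)
    then show ?thesis using \<epsilon>(1) by (simp add: algebra_simps)
  qed
  have \<epsilon>b: "C * M * \<epsilon> < s0^2"
  proof -
    have "\<epsilon> \<le> s0^2 / (C * M + 1)" by (simp add: \<epsilon>_def)
    then have "\<epsilon> * (C * M + 1) \<le> s0^2" using Y by (simp add: field_simps)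
    then show ?thesis using \<epsilon>(1) by (simp add: algebra_simps)
  qed
  show thesis
  proof (rule that[OF \<epsilon>(1)])
    fix u u1 u2 v r
    assume u: "W2 u u1 u2" and v: "L2 v" and d0: "nrm (\<lambda>x. u x - \<phi> (x + r)) \<le> \<epsilon>"
      and d1: "nrm (\<lambda>x. u1 x - \<phi>1 (x + r)) \<le> \<epsilon>"
    let ?w = "\<lambda>x. \<phi> (x + r)" and ?h = "\<lambda>x. h (x + r)" and ?h1 = "\<lambda>x. h1 (x + r)"
      and ?h2 = "\<lambda>x. h2 (x + r)" and ?g = "\<lambda>x. g (x + r)"
    note Lu = W2D(3)[OF u] note Lu1 = W2D(4)[OF u]
    have Lw: "L2 ?w" "L2 (\<lambda>x. \<phi>1 (x + r))" and Lhr: "L2 ?h" by (intro L2_shift L\<phi> L\<phi>1 Lh)+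
    have Wh: "W2 ?h ?h1 ?h2" by (rule W2_shift[OF h(1)])
    have nu: "nrm u \<le> nrm \<phi> + \<epsilon>" "nrm u1 \<le> nrm \<phi>1 + \<epsilon>"
      using nrm_le_diff[OF Lu Lw(1)] nrm_le_diff[OF Lu1 Lw(2)] d0 d1 by (simp_all add: nrm_shift)
    have wb: "AE x in lborel. \<bar>?w x\<bar> \<le> nrm \<phi> + nrm \<phi>1" by (rule lborel_AE_shift[OF phi_bound])
    have ub: "AE x in lborel. \<bar>u x\<bar> \<le> nrm \<phi> + nrm \<phi>1 + 2"
      using W1_sup_bound[OF W2D(1)[OF u]] by eventually_elim (use nu \<epsilon>(2) in linarith)
    have sh: "\<bar>s * ?h x\<bar> \<le> B" if "\<bar>s\<bar> \<le> 1" for s x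
      using mult_mono[OF that h(2)[of "x + r"]] by (simp add: abs_mult)
    have uR: "AE x in lborel. \<bar>u x + s * ?h x\<bar> \<le> R" if "\<bar>s\<bar> \<le> 1" for s
      using ub
    proof eventually_elim
      case (elim x) then show ?case using sh[OF that, of x] by (simp add: R_def)
    qed
    have wR: "AE x in lborel. \<bar>?w x + s * ?h x\<bar> \<le> R" if "\<bar>s\<bar> \<le> 1" for s
      using wb
    proof eventually_elim
      case (elim x) then show ?case using sh[OF that, of x] by (simp add: R_def)
    qed
    have Lus: "L2 (\<lambda>x. u x + s * ?h x)" "L2 (\<lambda>x. ?w x + s * ?h x)" for s
      by (intro L2_intros Lu Lhr Lw)+
    have nh: "nrm ?h = n" by (simp add: nrm_shift n_def)
    have nus: "nrm (\<lambda>x. u x + s * ?h x) \<le> nrm \<phi> + 1 + n" "nrm (\<lambda>x. ?w x + s * ?h x) \<le> nrm \<phi> + n" if s: "\<bar>s\<bar> \<le> 1" for s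
    proof -
      have "\<bar>s\<bar> * n \<le> n" using s n0 by (simp add: mult_left_le_one_le)
      then show "nrm (\<lambda>x. u x + s * ?h x) \<le> nrm \<phi> + 1 + n" "nrm (\<lambda>x. ?w x + s * ?h x) \<le> nrm \<phi> + n"
        using nrm_triangle[OF Lu L2_scale[OF Lhr, of s]] nrm_triangle[OF Lw(1) L2_scale[OF Lhr, of s]] nu \<epsilon>(2)
        by (simp_all add: nrm_scale nh nrm_shift)
    qed
    let ?P = "\<lambda>s. Phi (\<lambda>x. u x + s * ?h x) - Phi \<phi>"
    have close: "\<bar>?P s - s * ?\<kappa>\<bar> < s0^2 + C * n^2 * s^2" if s: "\<bar>s\<bar> \<le> 1" for s
    proof -
      have "\<bar>Phi (\<lambda>x. u x + s * ?h x) - Phi (\<lambda>x. ?w x + s * ?h x)\<bar>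
        \<le> C * ((nrm (\<lambda>x. u x + s * ?h x) + nrm (\<lambda>x. ?w x + s * ?h x)) * nrm (\<lambda>x. (u x + s * ?h x) - (?w x + s * ?h x)))"
        by (rule Phi_diff_le[OF C Lus(1) uR[OF s] Lus(2) wR[OF s]])
      also have "\<dots> \<le> C * (M * \<epsilon>)"
        using nus[OF s] d0 M0 by (intro mult_left_mono mult_mono C0) (auto simp: M_def)
      finally have 1: "\<bar>Phi (\<lambda>x. u x + s * ?h x) - Phi (\<lambda>x. ?w x + s * ?h x)\<bar> < s0^2"
        using \<epsilon>b by simp
      have wR0: "AE x in lborel. \<bar>?w x\<bar> \<le> R" using wR[of 0] by simp
      have "\<bar>Phi (\<lambda>x. ?w x + s * ?h x) - Phi ?w - ip (\<lambda>x. f (?w x)) (\<lambda>x. (?w x + s * ?h x) - ?w x)\<bar>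
        \<le> C * (nrm (\<lambda>x. (?w x + s * ?h x) - ?w x))^2"
        by (rule Phi_first_order[OF C Lw(1) wR0 Lus(2) wR[OF s]])
      then have "\<bar>Phi (\<lambda>x. ?w x + s * ?h x) - Phi \<phi> - s * ?\<kappa>\<bar> \<le> C * n^2 * s^2"
        using ip_shift[of "\<lambda>x. f (\<phi> x)" r h]
        by (simp add: Phi_shift ip_scale_right nrm_scale nh power_mult_distrib ac_simps)
      then show ?thesis using 1 by linarith
    qed
    have sq: "s0^2 + C * n^2 * s0^2 \<le> s0 * \<bar>?\<kappa>\<bar>"
    proof -
      have "s0 * (C * n^2 * s0 + s0) \<le> s0 * \<bar>?\<kappa>\<bar>"
        using s0b s0 C0 by (intro mult_left_mono) (auto intro: order_trans[OF _ s0b] simp: add_nonneg_nonneg)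
      then show ?thesis by (simp add: power2_eq_square algebra_simps)
    qed
    \<comment> \<open>At the two ends of the segment \<open>?P\<close> has opposite signs, whatever
      the sign of \<open>?\<kappa>\<close>; the level set is crossed in between.\<close>
    have c1: "\<bar>?P s0 - s0 * ?\<kappa>\<bar> < s0 * \<bar>?\<kappa>\<bar>" "\<bar>?P (- s0) + s0 * ?\<kappa>\<bar> < s0 * \<bar>?\<kappa>\<bar>"
      using close[of s0] close[of "- s0"] s0 sq by auto
    have cont: "continuous_on {- s0..s0} ?P"
    proof (rule continuous_onI)
      fix s e :: real assume s: "s \<in> {- s0..s0}" and e: "0 < e"
      let ?L = "C * (2 * (nrm \<phi> + 1 + n)) * n + 1"
      have L: "?L > 0" using C0 n0 by (simp add: add_nonneg_pos)
      show "\<exists>d>0. \<forall>s'\<in>{- s0..s0}. dist s' s < d \<longrightarrow> dist (?P s') (?P s) \<le> e"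
      proof (intro exI[of _ "e / ?L"] conjI ballI impI)
        show "0 < e / ?L" using e L by simp
        fix s' assume s': "s' \<in> {- s0..s0}" and dd: "dist s' s < e / ?L"
        have a: "\<bar>s\<bar> \<le> 1" "\<bar>s'\<bar> \<le> 1" using s s' s0 by auto
        have "\<bar>Phi (\<lambda>x. u x + s' * ?h x) - Phi (\<lambda>x. u x + s * ?h x)\<bar>
          \<le> C * ((nrm (\<lambda>x. u x + s' * ?h x) + nrm (\<lambda>x. u x + s * ?h x)) * nrm (\<lambda>x. (u x + s' * ?h x) - (u x + s * ?h x)))"
          by (rule Phi_diff_le[OF C Lus(1) uR[OF a(2)] Lus(1) uR[OF a(1)]])
        also have "(\<lambda>x. (u x + s' * ?h x) - (u x + s * ?h x)) = (\<lambda>x. (s' - s) * ?h x)"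
          by (auto simp: algebra_simps)
        also have "C * ((nrm (\<lambda>x. u x + s' * ?h x) + nrm (\<lambda>x. u x + s * ?h x)) * nrm (\<lambda>x. (s' - s) * ?h x))
           \<le> C * ((2 * (nrm \<phi> + 1 + n)) * (\<bar>s' - s\<bar> * n))"
          unfolding nrm_scale nh using nus(1)[OF a(1)] nus(1)[OF a(2)] n0
          by (intro mult_left_mono mult_mono C0) auto
        also have "\<dots> \<le> ?L * \<bar>s' - s\<bar>" by (simp add: algebra_simps)
        also have "\<dots> \<le> e" using dd L by (simp add: dist_real_def field_simps)
        finally show "dist (?P s') (?P s) \<le> e" by (simp add: dist_real_def)
      qed
    qed
    have "\<exists>s. \<bar>s\<bar> \<le> s0 \<and> ?P s = 0"
    proof (cases "?\<kappa> > 0")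
      case True
      then have "?P (- s0) \<le> 0" "0 \<le> ?P s0" using c1 by auto
      then show ?thesis using IVT'[of ?P "- s0" 0 s0] cont s0 by (fastforce simp: abs_le_iff)
    next
      case False
      then have "\<bar>?\<kappa>\<bar> = - ?\<kappa>" by simp
      then have "?P s0 \<le> 0" "0 \<le> ?P (- s0)" using c1 by auto
      then show ?thesis using IVT2'[of ?P s0 0 "- s0"] cont s0 by (fastforce simp: abs_le_iff)
    qed
    then obtain s where s: "\<bar>s\<bar> \<le> s0" "?P s = 0" by blast
    have s1: "\<bar>s\<bar> \<le> 1" using s s0 by simp
    have "Kfun f p (\<lambda>x. u x + s * ?h x) = k" using s(2) by (simp add: Kfun_Phi)
    then have low: "dlevel \<le> action (\<lambda>x. u x + s * ?h x) (\<lambda>x. v x + s * ?g x)"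
      by (rule action_lower[OF W2_add_scale[OF u Wh]])
    have exp: "action (\<lambda>x. u x + s * ?h x) (\<lambda>x. v x + s * ?g x) \<le> action u v + s * daction u u1 u2 v ?h ?h1 ?h2 ?g
     + s^2 * (hess ?w ?h ?h1 ?h2 ?g / 2 + (C * B * nrm ?h * nrm (\<lambda>x. u x - ?w x) / 2 + C * B * \<bar>s\<bar> * (nrm ?h)^2))"
      using uR[of 0] wR[of 0] h(2) by (intro action_expansion[OF u _ v Wh _ L2_shift[OF g] uR[OF s1] Lw(1) _ C]) auto
    have "C * B * n * nrm (\<lambda>x. u x - ?w x) \<le> C * B * n * \<epsilon>"
      using d0 C0 B n0 by (intro mult_left_mono) auto
    moreover have "C * B * \<bar>s\<bar> * n^2 \<le> C * B * s0 * n^2"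
      using s(1) C0 B by (intro mult_right_mono mult_left_mono) auto
    ultimately have "hess ?w ?h ?h1 ?h2 ?g / 2 + (C * B * nrm ?h * nrm (\<lambda>x. u x - ?w x) / 2 + C * B * \<bar>s\<bar> * (nrm ?h)^2) \<le> 0"
      unfolding hess_shift nh using s0a \<epsilon>a neg by linarith
    then have "s^2 * (hess ?w ?h ?h1 ?h2 ?g / 2 + (C * B * nrm ?h * nrm (\<lambda>x. u x - ?w x) / 2 + C * B * \<bar>s\<bar> * (nrm ?h)^2)) \<le> 0"
      by (intro mult_nonneg_nonpos) auto
    then show "\<exists>s. \<bar>s\<bar> \<le> 1 \<and> dlevel \<le> action u v + s * daction u u1 u2 v ?h ?h1 ?h2 ?g"
      using low exp s1 by (intro exI[of _ s]) linarith
  qed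
qed

end

section \<open>Weak solutions and their regularisation\<close>

lemma H2norm_sq_eq:
  assumes "W2 u u1 u2"
  shows "H2norm_sq u = (nrm u)^2 + (nrm u1)^2 + (nrm u2)^2"
proof -
  note L = W2D(3-5)[OF assms]
  note w = W2_wd[OF W2_H2(1)[OF assms]]
  have "H2norm_sq u = (\<integral>x. (u x)^2 + (u1 x)^2 + (u2 x)^2 \<partial>lborel)"
    unfolding H2norm_sq_def
  proof (rule integral_cong_AE)
    show "AE x in lborel. (u x)\<^sup>2 + (wd u x)\<^sup>2 + (wd (wd u) x)\<^sup>2 = (u x)\<^sup>2 + (u1 x)\<^sup>2 + (u2 x)\<^sup>2"
      using W2_H2(2,3)[OF assms] by eventually_elim simp
  qed (use L2_meas[OF L(1)] L2_meas[OF L(2)] L2_meas[OF L(3)] L2_meas[OF W2D(4)[OF w]] L2_meas[OF W2D(5)[OF w]] in measurable)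
  then show ?thesis unfolding nrm_sq using L[THEN L2_sq_integrable] by simp
qed

lemma Xdist_eq:
  assumes "W2 u u1 u2" "W2 z z1 z2"
  shows "Xdist (u, v) (z, y) = sqrt ((nrm (\<lambda>x. u x - z x))^2 + (nrm (\<lambda>x. u1 x - z1 x))^2
     + (nrm (\<lambda>x. u2 x - z2 x))^2 + (nrm (\<lambda>x. v x - y x))^2)"
  unfolding Xdist_def L2norm_sq_def by (simp add: H2norm_sq_eq[OF W2_diff[OF assms]] nrm_sq)

lemma Xdist_lower:
  assumes "W2 u u1 u2" "W2 z z1 z2"
  shows "nrm (\<lambda>x. u x - z x) \<le> Xdist (u, v) (z, y)" "nrm (\<lambda>x. u1 x - z1 x) \<le> Xdist (u, v) (z, y)"
    "nrm (\<lambda>x. u2 x - z2 x) \<le> Xdist (u, v) (z, y)" "nrm (\<lambda>x. v x - y x) \<le> Xdist (u, v) (z, y)"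
  unfolding Xdist_eq[OF assms] by (rule real_le_rsqrt; simp)+

lemma Xdist_upper:
  assumes "W2 u u1 u2" "W2 z z1 z2"
  shows "Xdist (u, v) (z, y) \<le> nrm (\<lambda>x. u x - z x) + nrm (\<lambda>x. u1 x - z1 x) + nrm (\<lambda>x. u2 x - z2 x) + nrm (\<lambda>x. v x - y x)"
proof -
  have "a^2 + b^2 + d^2 + e^2 \<le> (a + b + d + e)^2" if "a \<ge> 0" "b \<ge> 0" "d \<ge> 0" "e \<ge> 0" for a b d e :: real
  proof -
    have "(a + b + d + e)^2 = a^2 + b^2 + d^2 + e^2 + 2 * (a * b + a * d + a * e + b * d + b * e + d * e)"
      by (simp add: power2_eq_square algebra_simps)
    moreover have "0 \<le> 2 * (a * b + a * d + a * e + b * d + b * e + d * e)" using that by simp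
    ultimately show ?thesis by linarith
  qed
  then show ?thesis unfolding Xdist_eq[OF assms] by (intro real_le_lsqrt) auto
qed

text \<open>Differentiability of a curve in L2, one-sided at time 0 because only
  \<open>s \<ge> 0\<close> counts.\<close>

definition L2deriv :: "(real \<Rightarrow> rfun) \<Rightarrow> rfun \<Rightarrow> real \<Rightarrow> bool" where
  "L2deriv X D t \<longleftrightarrow> (\<forall>s\<ge>0. L2 (X s)) \<and> L2 D \<and> (\<forall>e>0. \<exists>d>0. \<forall>s\<ge>0. \<bar>s - t\<bar> < d \<longrightarrow>
      nrm (\<lambda>x. X s x - X t x - (s - t) * D x) \<le> e * \<bar>s - t\<bar>)"

lemma has_real_derivative_half_lineI:
  fixes h :: rfun
  assumes "\<And>e. e > 0 \<Longrightarrow> \<exists>d>0. \<forall>s\<ge>0. \<bar>s - t\<bar> < d \<longrightarrow> \<bar>h s - h t - (s - t) * D\<bar> \<le> e * \<bar>s - t\<bar>"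
  shows "(h has_real_derivative D) (at t within {0..})"
  unfolding has_field_derivative_def has_derivative_within_alt
proof (intro conjI allI impI)
  show "bounded_linear ((*) D)" by (rule bounded_linear_mult_right)
  fix e :: real assume "0 < e"
  then show "\<exists>d>0. \<forall>y\<in>{0..}. norm (y - t) < d \<longrightarrow> norm (h y - h t - D * (y - t)) \<le> e * norm (y - t)"
    using assms[of e] by (simp add: mult.commute[of D] Ball_def)
qed

lemma nrm_sq_three:
  assumes "L2 x" "L2 d" "L2 r"
  shows "(nrm (\<lambda>z. x z + (a * d z + r z)))^2 = (nrm x)^2 + 2 * (a * ip x d) + 2 * ip x r
    + a^2 * (nrm d)^2 + 2 * (a * ip d r) + (nrm r)^2"
proof -
  have "(nrm (\<lambda>z. x z + (a * d z + r z)))^2 = ip x x + (a * ip x d + ip x r)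
    + (a * (ip x d + (a * ip d d + ip d r)) + (ip x r + (a * ip d r + ip r r)))"
    unfolding nrm_sq_ip using assms
    by (simp add: ip_simps L2_intros ip_commute[of d x] ip_commute[of r x] ip_commute[of r d] distrib_left)
  then show ?thesis unfolding nrm_sq_ip by (simp add: power2_eq_square distrib_left)
qed

lemma L2deriv_nrm_sq:
  assumes X: "L2deriv X D t" and t: "t \<ge> 0"
  shows "((\<lambda>s. (nrm (X s))^2) has_real_derivative 2 * ip (X t) D) (at t within {0..})"
proof (rule has_real_derivative_half_lineI)
  have L: "\<And>s. s \<ge> 0 \<Longrightarrow> L2 (X s)" and LD: "L2 D" using X by (auto simp: L2deriv_def)
  fix e :: real assume e: "e > 0"
  \<comment> \<open>The total coefficient with which the norm of the remainder enters the
    error.\<close>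
  let ?N = "2 * nrm (X t) + 2 * nrm D + 2"
  have N: "?N > 0" by (simp add: add_nonneg_pos)
  let ?e = "min 1 (e / (2 * ?N))"
  have e': "?e > 0" using e N by simp
  obtain d where d: "d > 0" "\<And>s. s \<ge> 0 \<Longrightarrow> \<bar>s - t\<bar> < d \<Longrightarrow> nrm (\<lambda>x. X s x - X t x - (s - t) * D x) \<le> ?e * \<bar>s - t\<bar>"
    using X e' unfolding L2deriv_def by meson
  let ?d = "min d (min 1 (e / (2 * ((nrm D)^2 + 1))))"
  show "\<exists>d>0. \<forall>s\<ge>0. \<bar>s - t\<bar> < d \<longrightarrow> \<bar>(nrm (X s))\<^sup>2 - (nrm (X t))\<^sup>2 - (s - t) * (2 * ip (X t) D)\<bar> \<le> e * \<bar>s - t\<bar>"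
  proof (intro exI[of _ ?d] conjI allI impI)
    have "(nrm D)^2 + 1 > 0" by (simp add: add_nonneg_pos)
    then show "?d > 0" using d(1) e by simp
    fix s assume s: "0 \<le> s" "\<bar>s - t\<bar> < ?d"
    let ?R = "\<lambda>x. X s x - X t x - (s - t) * D x"
    have LR: "L2 ?R" by (intro L2_intros L LD s t)
    have nR: "nrm ?R \<le> ?e * \<bar>s - t\<bar>" using d(2)[OF s(1)] s(2) by simp
    have "(nrm (\<lambda>x. X s x))^2 = (nrm (\<lambda>x. X t x + ((s - t) * D x + ?R x)))^2"
    proof -
      have "X s x = X t x + ((s - t) * D x + ?R x)" for x by simp
      then show ?thesis by presburger
    qed
    then have eq: "(nrm (X s))\<^sup>2 - (nrm (X t))\<^sup>2 - (s - t) * (2 * ip (X t) D)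
       = 2 * ip (X t) ?R + (s - t)^2 * (nrm D)^2 + 2 * ((s - t) * ip D ?R) + (nrm ?R)^2"
      unfolding nrm_sq_three[OF L[OF t] LD LR] by simp
    let ?a = "\<bar>s - t\<bar>"
    have a: "0 \<le> ?a" "?a \<le> 1" using s by auto
    have "?e * ?a \<le> 1 * ?a" using a(1) by (intro mult_right_mono) auto
    from order_trans[OF nR this] have R1: "nrm ?R \<le> ?a" by simp
    have b1: "\<bar>2 * ip (X t) ?R\<bar> \<le> 2 * (nrm (X t) * nrm ?R)"
      using Cauchy_Schwarz_ip[OF L[OF t] LR] by simp
    have b2: "\<bar>2 * ((s - t) * ip D ?R)\<bar> \<le> 2 * (nrm D * nrm ?R)"
    proof -
      have "\<bar>s - t\<bar> * \<bar>ip D ?R\<bar> \<le> 1 * (nrm D * nrm ?R)"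
        using Cauchy_Schwarz_ip[OF LD LR] a by (intro mult_mono) auto
      then show ?thesis by (simp add: abs_mult)
    qed
    have b3: "(nrm ?R)^2 \<le> 2 * nrm ?R"
      using R1 a nrm_nonneg[of ?R] unfolding power2_eq_square by (intro mult_right_mono) auto
    have b4: "(s - t)^2 * (nrm D)^2 \<le> e / 2 * ?a"
    proof -
      have "?a < e / (2 * ((nrm D)^2 + 1))" using s by simp
      then have "?a * (2 * ((nrm D)^2 + 1)) < e" by (simp add: pos_less_divide_eq add_nonneg_pos)
      moreover have "x * y \<le> e / 2" if "x * (2 * (y + 1)) < e" "0 \<le> x" for x y :: real
        using that by (simp add: distrib_left)
      ultimately have "?a * (nrm D)^2 \<le> e / 2" using a(1) by blast
      then have "?a * (?a * (nrm D)^2) \<le> ?a * (e / 2)" using a by (intro mult_left_mono) auto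
      moreover have "(s - t)^2 * (nrm D)^2 = ?a * (?a * (nrm D)^2)"
        by (simp only: mult.assoc[symmetric] abs_mult_self_eq power2_eq_square[of "s - t"])
      ultimately show ?thesis by (simp only: mult.commute)
    qed
    have b5: "?N * nrm ?R \<le> e / 2 * ?a"
    proof -
      have "?N * nrm ?R \<le> ?N * (?e * ?a)" using nR N by (intro mult_left_mono) auto
      also have "\<dots> \<le> ?N * (e / (2 * ?N) * ?a)" using N a by (intro mult_left_mono mult_right_mono) auto
      also have "\<dots> = e / 2 * ?a"
      proof -
        have "n * (e / (2 * n) * a) = e / 2 * a" if "n > 0" for n a :: real using that by simp
        then show ?thesis using N by blast
      qed
      finally show ?thesis .
    qed
    have b6: "?N * nrm ?R = 2 * (nrm (X t) * nrm ?R) + 2 * (nrm D * nrm ?R) + 2 * nrm ?R"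
      by (simp add: algebra_simps)
    have b7: "0 \<le> (s - t)^2 * (nrm D)^2" "0 \<le> (nrm ?R)^2" by simp_all
    show "\<bar>(nrm (X s))\<^sup>2 - (nrm (X t))\<^sup>2 - (s - t) * (2 * ip (X t) D)\<bar> \<le> e * \<bar>s - t\<bar>"
      unfolding eq using b1 b2 b3 b4 b5 b6 b7 by linarith
  qed
qed

lemma L2deriv_lin:
  assumes X: "L2deriv X D t" and Y: "L2deriv Y E t" and t: "t \<ge> 0"
  shows "L2deriv (\<lambda>s x. c * X s x + Y s x) (\<lambda>x. c * D x + E x) t"
  unfolding L2deriv_def
proof (intro conjI allI impI)
  have L: "\<And>s. s \<ge> 0 \<Longrightarrow> L2 (X s)" "L2 D" "\<And>s. s \<ge> 0 \<Longrightarrow> L2 (Y s)" "L2 E"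
    using X Y by (auto simp: L2deriv_def)
  show "L2 (\<lambda>x. c * X s x + Y s x)" if "0 \<le> s" for s by (intro L2_intros L that)
  show "L2 (\<lambda>x. c * D x + E x)" by (intro L2_intros L)
  fix e :: real assume e: "e > 0"
  let ?e = "e / (\<bar>c\<bar> + 1)"
  have c: "\<bar>c\<bar> + 1 > 0" by simp
  have e': "?e > 0" using e c by simp
  obtain d1 where d1: "d1 > 0" "\<And>s. s \<ge> 0 \<Longrightarrow> \<bar>s - t\<bar> < d1 \<Longrightarrow> nrm (\<lambda>x. X s x - X t x - (s - t) * D x) \<le> ?e * \<bar>s - t\<bar>"
    using X e' unfolding L2deriv_def by meson
  obtain d2 where d2: "d2 > 0" "\<And>s. s \<ge> 0 \<Longrightarrow> \<bar>s - t\<bar> < d2 \<Longrightarrow> nrm (\<lambda>x. Y s x - Y t x - (s - t) * E x) \<le> ?e * \<bar>s - t\<bar>"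
    using Y e' unfolding L2deriv_def by meson
  show "\<exists>d>0. \<forall>s\<ge>0. \<bar>s - t\<bar> < d \<longrightarrow> nrm (\<lambda>x. (c * X s x + Y s x) - (c * X t x + Y t x) - (s - t) * (c * D x + E x)) \<le> e * \<bar>s - t\<bar>"
  proof (intro exI[of _ "min d1 d2"] conjI allI impI)
    fix s assume s: "0 \<le> s" "\<bar>s - t\<bar> < min d1 d2"
    let ?A = "\<lambda>x. X s x - X t x - (s - t) * D x" and ?B = "\<lambda>x. Y s x - Y t x - (s - t) * E x"
    have "(\<lambda>x. (c * X s x + Y s x) - (c * X t x + Y t x) - (s - t) * (c * D x + E x)) = (\<lambda>x. c * ?A x + ?B x)"
      by (auto simp: algebra_simps)
    moreover have "nrm (\<lambda>x. c * ?A x + ?B x) \<le> nrm (\<lambda>x. c * ?A x) + nrm ?B"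
      by (intro nrm_triangle L2_intros L s t)
    moreover have "nrm (\<lambda>x. c * ?A x) \<le> \<bar>c\<bar> * (?e * \<bar>s - t\<bar>)"
      unfolding nrm_scale using d1(2)[OF s(1)] s(2) by (intro mult_left_mono) auto
    moreover have "nrm ?B \<le> ?e * \<bar>s - t\<bar>" using d2(2)[OF s(1)] s(2) by simp
    moreover have "\<bar>c\<bar> * (?e * \<bar>s - t\<bar>) + ?e * \<bar>s - t\<bar> = e * \<bar>s - t\<bar>"
    proof -
      have "\<bar>c\<bar> * (?e * \<bar>s - t\<bar>) + ?e * \<bar>s - t\<bar> = ((\<bar>c\<bar> + 1) * ?e) * \<bar>s - t\<bar>"
        by (simp only: distrib_right mult.assoc mult_1)
      then show ?thesis using c by simp
    qed
    ultimately show "nrm (\<lambda>x. (c * X s x + Y s x) - (c * X t x + Y t x) - (s - t) * (c * D x + E x)) \<le> e * \<bar>s - t\<bar>"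
      by simp
  qed (use d1 d2 in simp)
qed

lemma deriv_n_reflect:
  assumes "test_fun \<kappa>"
  shows "(deriv ^^ n) (\<lambda>z. \<kappa> (- z)) = (\<lambda>z. (-1) ^ n * (deriv ^^ n) \<kappa> (- z))"
proof (induction n)
  case (Suc n)
  have "((\<lambda>z. (-1) ^ n * (deriv ^^ n) \<kappa> (- z)) has_real_derivative (-1) ^ n * (- deriv ((deriv ^^ n) \<kappa>) (- z))) (at z)" for z
  proof (rule DERIV_cmult)
    show "((\<lambda>z. (deriv ^^ n) \<kappa> (- z)) has_real_derivative - deriv ((deriv ^^ n) \<kappa>) (- z)) (at z)"
      using deriv_affine[of "(deriv ^^ n) \<kappa>" "-1" 0 z] assms by (simp add: test_fun_def)
  qed
  then have "deriv (\<lambda>z. (-1) ^ n * (deriv ^^ n) \<kappa> (- z)) = (\<lambda>z. (-1) ^ n * (- deriv ((deriv ^^ n) \<kappa>) (- z)))"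
    by (intro ext DERIV_imp_deriv)
  then show ?case using Suc by simp
qed simp

text \<open>Testing a derivative of the mollified function amounts to testing the function with the
  derivative of a new test function, mollified by the reflected kernel; one sign arises per
  derivative. This connects the mollified solution with the weak formulation.\<close>

lemma conv_deriv_adjoint:
  assumes k: "test_fun \<kappa>" and v: "L2 v" and t: "test_fun \<theta>"
  shows "ip (conv ((deriv ^^ n) \<kappa>) v) \<theta> = (-1) ^ n * ip v ((deriv ^^ n) (conv (\<lambda>z. \<kappa> (- z)) \<theta>))"
proof -
  have kr: "test_fun (\<lambda>z. \<kappa> (- z))" using test_reflect[OF k, of 0] by simp
  have "ip (conv ((deriv ^^ n) \<kappa>) v) \<theta> = ip v (conv (\<lambda>z. (deriv ^^ n) \<kappa> (- z)) \<theta>)"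
    by (rule conv_adjoint[OF test_deriv_n[OF k] v test_L2[OF t]])
  moreover have "(deriv ^^ n) (conv (\<lambda>z. \<kappa> (- z)) \<theta>) = (\<lambda>x. (-1) ^ n * conv (\<lambda>z. (deriv ^^ n) \<kappa> (- z)) \<theta> x)"
    unfolding conv_deriv_n[OF kr test_L2[OF t]] deriv_n_reflect[OF k]
    by (intro ext) (simp add: conv_def mult.assoc)
  ultimately show ?thesis by (simp add: ip_scale_right flip: power_mult_distrib mult.assoc)
qed

lemma conv_W2: "W2 u u1 u2 \<Longrightarrow> test_fun \<kappa> \<Longrightarrow> conv \<kappa> u2 = conv (deriv (deriv \<kappa>)) u"
  by (metis W1D(3) W2D(1,2) conv_weak_deriv test_deriv)

locale soln = nonlin +
  fixes \<beta> :: real and w0 :: state and w :: "real \<Rightarrow> state"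
  assumes sol: "global_solution f \<beta> w0 w"
begin

abbreviation "u t \<equiv> fst (w t)"
abbreviation "v t \<equiv> snd (w t)"
abbreviation "u1 t \<equiv> wd (u t)"
abbreviation "u2 t \<equiv> wd (wd (u t))"

text \<open>The part of the flux in the equation for \<open>v\<close> that is a function. The
  contribution of \<open>u_xxxx\<close> is kept apart as \<open>u2\<close> paired with the third
  derivative of the test function.\<close>

definition G :: "real \<Rightarrow> rfun" where "G t x = u t x + \<beta> * u2 t x - f (u t x)"

lemma sol_at:
  assumes "t \<ge> 0"
  shows "W2 (u t) (u1 t) (u2 t)" "L2 (v t)"
proof -
  have "is_solution f \<beta> w0 (t + 1) w" using sol assms by (simp add: global_solution_def)
  then have "inX (w t)" using assms unfolding is_solution_def by (elim conjE) (erule ballE[of _ _ t], auto)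
  then show "W2 (u t) (u1 t) (u2 t)" "L2 (v t)" by (auto simp: inX_def intro: W2_wd)
qed

lemma sol_L2: "t \<ge> 0 \<Longrightarrow> L2 (u t)" "t \<ge> 0 \<Longrightarrow> L2 (u1 t)" "t \<ge> 0 \<Longrightarrow> L2 (u2 t)"
  using sol_at W2D by blast+

text \<open>Solutions are given on \<open>[0, T)\<close> for every \<open>T\<close>; with
  \<open>T = t + 1\<close>, differentiability at \<open>t\<close> becomes a statement on the
  half-line.\<close>

lemma within_eq: "t \<ge> 0 \<Longrightarrow> at t within {0..<t + 1} = at t within {0::real..}"
  by (rule at_within_nhd[of _ "{..<t + 1}"]) auto

lemma sol_cont:
  assumes t: "t \<ge> 0" and e: "e > 0"
  shows "\<exists>d>0. \<forall>s\<ge>0. \<bar>s - t\<bar> < d \<longrightarrow> nrm (\<lambda>x. u s x - u t x) < e \<and> nrm (\<lambda>x. u1 s x - u1 t x) < e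
     \<and> nrm (\<lambda>x. u2 s x - u2 t x) < e \<and> nrm (\<lambda>x. v s x - v t x) < e"
proof -
  have "is_solution f \<beta> w0 (t + 1) w" using sol t by (simp add: global_solution_def)
  then have "((\<lambda>s. Xdist (w s) (w t)) \<longlongrightarrow> 0) (at t within {0..<t + 1})"
    using t unfolding is_solution_def by auto
  then have "((\<lambda>s. Xdist (w s) (w t)) \<longlongrightarrow> 0) (at t within {0..})" by (simp add: within_eq[OF t])
  then have "\<forall>\<^sub>F s in at t within {0..}. Xdist (w s) (w t) < e"
    by (rule order_tendstoD) (rule e)
  then obtain d where d: "d > 0" "\<And>s. s \<ge> 0 \<Longrightarrow> s \<noteq> t \<Longrightarrow> \<bar>s - t\<bar> < d \<Longrightarrow> Xdist (w s) (w t) < e"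
    unfolding eventually_at by (auto simp: dist_real_def)
  show ?thesis
  proof (intro exI[of _ d] conjI[OF d(1)] allI impI)
    fix s assume s: "0 \<le> s" "\<bar>s - t\<bar> < d"
    show "nrm (\<lambda>x. u s x - u t x) < e \<and> nrm (\<lambda>x. u1 s x - u1 t x) < e
     \<and> nrm (\<lambda>x. u2 s x - u2 t x) < e \<and> nrm (\<lambda>x. v s x - v t x) < e"
    proof (cases "s = t")
      case True then show ?thesis using e by simp
    next
      case False
      have "Xdist (u s, v s) (u t, v t) < e" using d(2)[OF s(1) False s(2)] by simp
      then show ?thesis
        using Xdist_lower[OF sol_at(1)[OF s(1)] sol_at(1)[OF t], of "v s" "v t"] by linarith
    qed
  qed
qed

lemma sol_eq_u:
  assumes "test_fun \<psi>" "t \<ge> 0"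
  shows "((\<lambda>s. ip (u s) \<psi>) has_real_derivative (- ip (v t) (deriv \<psi>))) (at t within {0..})"
proof -
  have "is_solution f \<beta> w0 (t + 1) w" using sol assms by (simp add: global_solution_def)
  then have "((\<lambda>s. ip (u s) \<psi>) has_real_derivative (- ip (v t) (deriv \<psi>))) (at t within {0..<t + 1})"
    using assms unfolding is_solution_def ip_def by (elim conjE) auto
  then show ?thesis by (simp add: within_eq[OF assms(2)])
qed

lemma sol_eq_v:
  assumes "test_fun \<psi>" "t \<ge> 0"
  shows "((\<lambda>s. ip (v s) \<psi>) has_real_derivative (- ip (G t) (deriv \<psi>) - ip (u2 t) ((deriv ^^ 3) \<psi>))) (at t within {0..})"
proof -
  have "is_solution f \<beta> w0 (t + 1) w" using sol assms by (simp add: global_solution_def)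
  then have "((\<lambda>s. ip (v s) \<psi>) has_real_derivative (- ip (G t) (deriv \<psi>) - ip (u2 t) ((deriv ^^ 3) \<psi>))) (at t within {0..<t + 1})"
    using assms unfolding is_solution_def ip_def G_def by (elim conjE) auto
  then show ?thesis by (simp add: within_eq[OF assms(2)])
qed

text \<open>The Sobolev inequality and continuity in time give one sup bound for all times near
  \<open>t\<close>, hence one constant of the nonlinearity; the 2 in the bound allows for the two
  increments below 1.\<close>

lemma sol_bounded:
  assumes t: "t \<ge> 0"
  obtains R C where "lbound R C" "nrm (u t) + nrm (u1 t) \<le> R"
    "\<And>s. s \<ge> 0 \<Longrightarrow> nrm (\<lambda>x. u s x - u t x) < 1 \<Longrightarrow> nrm (\<lambda>x. u1 s x - u1 t x) < 1 \<Longrightarrow> AE x in lborel. \<bar>u s x\<bar> \<le> R"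
proof -
  let ?R = "nrm (u t) + nrm (u1 t) + 2"
  have "0 \<le> ?R" by (simp add: add_nonneg_nonneg)
  then obtain C where C: "lbound ?R C" using lbound_exists by blast
  show thesis
  proof (rule that[OF C])
    fix s assume s: "s \<ge> 0" "nrm (\<lambda>x. u s x - u t x) < 1" "nrm (\<lambda>x. u1 s x - u1 t x) < 1"
    have "nrm (u s) + nrm (u1 s) \<le> ?R"
      using nrm_le_diff[OF sol_L2(1)[OF s(1)] sol_L2(1)[OF t]] nrm_le_diff[OF sol_L2(2)[OF s(1)] sol_L2(2)[OF t]] s by simp
    then show "AE x in lborel. \<bar>u s x\<bar> \<le> ?R"
      using W1_sup_bound[OF W2D(1)[OF sol_at(1)[OF s(1)]]] by (auto elim: eventually_mono)
  qed simp
qed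

lemma sol_f_L2: assumes t: "t \<ge> 0" shows "L2 (\<lambda>x. f (u t x))" "L2 (\<lambda>x. f1 (u t x) * u1 t x)"
  using W1_f[OF W2D(1)[OF sol_at(1)[OF t]]] by (auto simp: W1_def)

lemma G_L2: "t \<ge> 0 \<Longrightarrow> L2 (G t)"
  unfolding G_def[abs_def] by (intro L2_intros sol_L2 sol_f_L2)

lemma G_cont:
  assumes t: "t \<ge> 0" and e: "e > 0"
  shows "\<exists>d>0. \<forall>s\<ge>0. \<bar>s - t\<bar> < d \<longrightarrow> nrm (\<lambda>x. G s x - G t x) < e"
proof -
  obtain R C where R: "lbound R C" "nrm (u t) + nrm (u1 t) \<le> R"
    "\<And>s. s \<ge> 0 \<Longrightarrow> nrm (\<lambda>x. u s x - u t x) < 1 \<Longrightarrow> nrm (\<lambda>x. u1 s x - u1 t x) < 1 \<Longrightarrow> AE x in lborel. \<bar>u s x\<bar> \<le> R"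
    using sol_bounded[OF t] by blast
  have C: "0 \<le> C" using lbound_nonneg[OF R(1)] .
  let ?N = "1 + \<bar>\<beta>\<bar> + C"
  have N: "?N > 0" using C by simp
  have "min 1 (e / ?N) > 0" using e N by simp
  from sol_cont[OF t this] obtain d where d: "d > 0"
    "\<And>s. s \<ge> 0 \<Longrightarrow> \<bar>s - t\<bar> < d \<Longrightarrow> nrm (\<lambda>x. u s x - u t x) < min 1 (e / ?N) \<and> nrm (\<lambda>x. u1 s x - u1 t x) < min 1 (e / ?N)
     \<and> nrm (\<lambda>x. u2 s x - u2 t x) < min 1 (e / ?N)" by blast
  show ?thesis
  proof (intro exI[of _ d] conjI[OF d(1)] allI impI)
    fix s assume s: "0 \<le> s" "\<bar>s - t\<bar> < d"
    have b: "nrm (\<lambda>x. u s x - u t x) < 1" "nrm (\<lambda>x. u1 s x - u1 t x) < 1"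
      "nrm (\<lambda>x. u s x - u t x) < e / ?N" "nrm (\<lambda>x. u2 s x - u2 t x) < e / ?N" using d(2)[OF s] by auto
    let ?a = "\<lambda>x. u s x - u t x" and ?b = "\<lambda>x. u2 s x - u2 t x" and ?f = "\<lambda>x. f (u s x) - f (u t x)"
    have L: "L2 ?a" "L2 ?b" "L2 ?f" by (intro L2_intros sol_L2 sol_f_L2 s t)+
    have "AE x in lborel. \<bar>u s x\<bar> \<le> R" using R(3)[OF s(1)] b by blast
    moreover have "AE x in lborel. \<bar>u t x\<bar> \<le> R" using R(3)[OF t] by simp
    ultimately have f: "nrm ?f \<le> C * nrm ?a" by (intro nrm_f_diff[OF R(1)] sol_L2 s t)
    have "nrm (\<lambda>x. G s x - G t x) = nrm (\<lambda>x. (?a x + \<beta> * ?b x) - ?f x)"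
      by (intro arg_cong[where f = nrm] ext) (simp add: G_def algebra_simps)
    moreover have "nrm (\<lambda>x. (?a x + \<beta> * ?b x) - ?f x) \<le> nrm (\<lambda>x. ?a x + \<beta> * ?b x) + nrm ?f"
      by (intro nrm_diff_le L2_intros L)
    moreover have "nrm (\<lambda>x. ?a x + \<beta> * ?b x) \<le> nrm ?a + \<bar>\<beta>\<bar> * nrm ?b"
      using nrm_triangle[OF L(1) L2_scale[OF L(2), of \<beta>]] by (simp add: nrm_scale)
    moreover have "\<bar>\<beta>\<bar> * nrm ?b \<le> \<bar>\<beta>\<bar> * (e / ?N)" "C * nrm ?a \<le> C * (e / ?N)"
      using b C mult_left_mono[of "nrm ?b" "e / ?N" "\<bar>\<beta>\<bar>"] mult_left_mono[of "nrm ?a" "e / ?N" C] by linarith+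
    ultimately have "nrm (\<lambda>x. G s x - G t x) < e / ?N + \<bar>\<beta>\<bar> * (e / ?N) + C * (e / ?N)" using b f by linarith
    also have "\<dots> = ?N * (e / ?N)" by (simp only: distrib_right mult_1)
    also have "\<dots> = e" using N by simp
    finally show "nrm (\<lambda>x. G s x - G t x) < e" .
  qed
qed

lemma convex_slice: "convex ({0..} \<inter> ball (t::real) d)"
  by (intro convex_Int) auto

text \<open>The mean value estimate for the tested equation. Continuity of \<open>v\<close> in norm
  makes \<open>d\<close> independent of \<open>\<psi>\<close>, and this uniformity is what permits
  passing to norms by duality.\<close>

lemma u_increment:
  assumes t: "t \<ge> 0" and e: "e > 0"
  obtains d where "d > 0" "\<And>s \<psi>. s \<ge> 0 \<Longrightarrow> \<bar>s - t\<bar> < d \<Longrightarrow> test_fun \<psi> \<Longrightarrow>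
     \<bar>ip (u s) \<psi> - ip (u t) \<psi> + (s - t) * ip (v t) (deriv \<psi>)\<bar> \<le> e * nrm (deriv \<psi>) * \<bar>s - t\<bar>"
proof -
  obtain d where d: "d > 0" "\<And>s. s \<ge> 0 \<Longrightarrow> \<bar>s - t\<bar> < d \<Longrightarrow> nrm (\<lambda>x. v s x - v t x) < e"
    using sol_cont[OF t e] by blast
  show thesis
  proof (rule that[OF d(1)])
    fix s \<psi> assume s: "s \<ge> 0" "\<bar>s - t\<bar> < d" and \<psi>: "test_fun \<psi>"
    have L: "L2 (deriv \<psi>)" by (intro test_L2 test_deriv \<psi>)
    let ?h = "\<lambda>s. ip (u s) \<psi> + s * ip (v t) (deriv \<psi>)"
    have "\<bar>?h s - ?h t\<bar> \<le> (e * nrm (deriv \<psi>)) * \<bar>s - t\<bar>"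
    proof (rule lipschitz_of_deriv_bound[OF _ _ convex_slice[of t d]])
      fix \<sigma> assume \<sigma>: "\<sigma> \<in> {0..} \<inter> ball t d"
      then have \<sigma>': "\<sigma> \<ge> 0" "\<bar>\<sigma> - t\<bar> < d" by (auto simp: dist_real_def)
      have "(?h has_real_derivative (- ip (v \<sigma>) (deriv \<psi>)) + ip (v t) (deriv \<psi>)) (at \<sigma> within {0..})"
        by (auto intro!: derivative_eq_intros sol_eq_u \<psi> \<sigma>')
      then show "(?h has_real_derivative (- ip (v \<sigma>) (deriv \<psi>)) + ip (v t) (deriv \<psi>)) (at \<sigma> within {0..} \<inter> ball t d)"
        by (rule DERIV_subset) auto
      have "- ip (v \<sigma>) (deriv \<psi>) + ip (v t) (deriv \<psi>) = - ip (\<lambda>x. v \<sigma> x - v t x) (deriv \<psi>)"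
        by (simp add: ip_diff_left sol_at(2) \<sigma>' t L)
      also have "\<bar>\<dots>\<bar> \<le> nrm (\<lambda>x. v \<sigma> x - v t x) * nrm (deriv \<psi>)"
        using Cauchy_Schwarz_ip[OF L2_diff[OF sol_at(2)[OF \<sigma>'(1)] sol_at(2)[OF t]] L] by simp
      also have "\<dots> \<le> e * nrm (deriv \<psi>)" using d(2)[OF \<sigma>'] by (intro mult_right_mono) auto
      finally show "\<bar>- ip (v \<sigma>) (deriv \<psi>) + ip (v t) (deriv \<psi>)\<bar> \<le> e * nrm (deriv \<psi>)" .
    qed (use s t d(1) in \<open>auto simp: dist_real_def\<close>)
    then show "\<bar>ip (u s) \<psi> - ip (u t) \<psi> + (s - t) * ip (v t) (deriv \<psi>)\<bar> \<le> e * nrm (deriv \<psi>) * \<bar>s - t\<bar>"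
      by (simp add: algebra_simps)
  qed
qed

lemma v_increment:
  assumes t: "t \<ge> 0" and e: "e > 0"
  obtains d where "d > 0" "\<And>s \<psi>. s \<ge> 0 \<Longrightarrow> \<bar>s - t\<bar> < d \<Longrightarrow> test_fun \<psi> \<Longrightarrow>
     \<bar>ip (v s) \<psi> - ip (v t) \<psi> + (s - t) * (ip (G t) (deriv \<psi>) + ip (u2 t) ((deriv ^^ 3) \<psi>))\<bar>
        \<le> e * (nrm (deriv \<psi>) + nrm ((deriv ^^ 3) \<psi>)) * \<bar>s - t\<bar>"
proof -
  obtain d1 where d1: "d1 > 0" "\<And>s. s \<ge> 0 \<Longrightarrow> \<bar>s - t\<bar> < d1 \<Longrightarrow> nrm (\<lambda>x. G s x - G t x) < e"
    using G_cont[OF t e] by blast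
  obtain d2 where d2: "d2 > 0" "\<And>s. s \<ge> 0 \<Longrightarrow> \<bar>s - t\<bar> < d2 \<Longrightarrow> nrm (\<lambda>x. u2 s x - u2 t x) < e"
    using sol_cont[OF t e] by blast
  define d where "d = min d1 d2"
  have d: "d > 0" "\<And>s. s \<ge> 0 \<Longrightarrow> \<bar>s - t\<bar> < d \<Longrightarrow> nrm (\<lambda>x. G s x - G t x) < e"
    "\<And>s. s \<ge> 0 \<Longrightarrow> \<bar>s - t\<bar> < d \<Longrightarrow> nrm (\<lambda>x. u2 s x - u2 t x) < e"
    using d1 d2 by (auto simp: d_def)
  show thesis
  proof (rule that[OF d(1)])
    fix s \<psi> assume s: "s \<ge> 0" "\<bar>s - t\<bar> < d" and \<psi>: "test_fun \<psi>"
    let ?\<psi>3 = "(deriv ^^ 3) \<psi>"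
    have L: "L2 (deriv \<psi>)" "L2 ?\<psi>3" using test_L2[OF test_deriv[OF \<psi>]] test_L2[OF test_deriv_n[OF \<psi>]] by auto
    let ?h = "\<lambda>s. ip (v s) \<psi> + s * (ip (G t) (deriv \<psi>) + ip (u2 t) ?\<psi>3)"
    have "\<bar>?h s - ?h t\<bar> \<le> (e * (nrm (deriv \<psi>) + nrm ?\<psi>3)) * \<bar>s - t\<bar>"
    proof (rule lipschitz_of_deriv_bound[OF _ _ convex_slice[of t d]])
      fix \<sigma> assume \<sigma>: "\<sigma> \<in> {0..} \<inter> ball t d"
      then have \<sigma>': "\<sigma> \<ge> 0" "\<bar>\<sigma> - t\<bar> < d" by (auto simp: dist_real_def)
      let ?D = "(- ip (G \<sigma>) (deriv \<psi>) - ip (u2 \<sigma>) ?\<psi>3) + (ip (G t) (deriv \<psi>) + ip (u2 t) ?\<psi>3)"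
      have "(?h has_real_derivative ?D) (at \<sigma> within {0..})"
        by (rule derivative_eq_intros sol_eq_v \<psi> \<sigma>' refl)+ simp
      then show "(?h has_real_derivative ?D) (at \<sigma> within {0..} \<inter> ball t d)"
        by (rule DERIV_subset) auto
      have "?D = - (ip (\<lambda>x. G \<sigma> x - G t x) (deriv \<psi>) + ip (\<lambda>x. u2 \<sigma> x - u2 t x) ?\<psi>3)"
        by (simp add: ip_diff_left sol_L2 G_L2 \<sigma>' t L)
      moreover have "\<bar>ip (\<lambda>x. G \<sigma> x - G t x) (deriv \<psi>)\<bar> \<le> nrm (\<lambda>x. G \<sigma> x - G t x) * nrm (deriv \<psi>)"
        by (intro Cauchy_Schwarz_ip L2_diff G_L2 \<sigma>' t L)
      moreover have "\<bar>ip (\<lambda>x. u2 \<sigma> x - u2 t x) ?\<psi>3\<bar> \<le> nrm (\<lambda>x. u2 \<sigma> x - u2 t x) * nrm ?\<psi>3"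
        by (intro Cauchy_Schwarz_ip L2_diff sol_L2 \<sigma>' t L)
      moreover have "nrm (\<lambda>x. G \<sigma> x - G t x) * nrm (deriv \<psi>) \<le> e * nrm (deriv \<psi>)"
        "nrm (\<lambda>x. u2 \<sigma> x - u2 t x) * nrm ?\<psi>3 \<le> e * nrm ?\<psi>3"
        using d(2,3)[OF \<sigma>'] by (auto intro!: mult_right_mono)
      ultimately show "\<bar>?D\<bar> \<le> e * (nrm (deriv \<psi>) + nrm ?\<psi>3)" unfolding distrib_left by linarith
    qed (use s t d(1) in \<open>auto simp: dist_real_def\<close>)
    then show "\<bar>ip (v s) \<psi> - ip (v t) \<psi> + (s - t) * (ip (G t) (deriv \<psi>) + ip (u2 t) ?\<psi>3)\<bar>
        \<le> e * (nrm (deriv \<psi>) + nrm ?\<psi>3) * \<bar>s - t\<bar>"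
      by (simp add: algebra_simps)
  qed
qed

text \<open>Tested with \<open>\<theta>\<close>, the mollified increment is the increment tested
  with the mollified \<open>\<theta>\<close>. The derivative lost in the weak equation falls on the
  kernel, Young's inequality bounds the result by the L2 norm of \<open>\<theta>\<close>, and
  \<open>nrm_dual\<close> concludes.\<close>

lemma mollified_u_deriv:
  assumes k: "test_fun \<kappa>" and t: "t \<ge> 0"
  shows "L2deriv (\<lambda>s. conv \<kappa> (u s)) (conv (deriv \<kappa>) (v t)) t"
  unfolding L2deriv_def
proof (intro conjI allI impI)
  show Lu: "L2 (conv \<kappa> (u s))" if "0 \<le> s" for s by (intro conv_L2 k sol_L2 that)
  show Lv: "L2 (conv (deriv \<kappa>) (v t))" by (intro conv_L2 test_deriv k sol_at t)
  fix e :: real assume e: "e > 0"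
  let ?\<kappa> = "\<lambda>z. \<kappa> (- z)"
  have kr: "test_fun ?\<kappa>" using test_reflect[OF k, of 0] by simp
  let ?N = "\<integral>z. \<bar>deriv ?\<kappa> z\<bar> \<partial>lborel"
  have N: "?N + 1 > 0" by (simp add: add_nonneg_pos)
  have "e / (?N + 1) > 0" using e N by simp
  from u_increment[OF t this] obtain d where d: "d > 0" "\<And>s \<psi>. s \<ge> 0 \<Longrightarrow> \<bar>s - t\<bar> < d \<Longrightarrow> test_fun \<psi> \<Longrightarrow>
     \<bar>ip (u s) \<psi> - ip (u t) \<psi> + (s - t) * ip (v t) (deriv \<psi>)\<bar> \<le> e / (?N + 1) * nrm (deriv \<psi>) * \<bar>s - t\<bar>" by blast
  show "\<exists>d>0. \<forall>s\<ge>0. \<bar>s - t\<bar> < d \<longrightarrow> nrm (\<lambda>x. conv \<kappa> (u s) x - conv \<kappa> (u t) x - (s - t) * conv (deriv \<kappa>) (v t) x) \<le> e * \<bar>s - t\<bar>"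
  proof (intro exI[of _ d] conjI[OF d(1)] allI impI)
    fix s assume s: "0 \<le> s" "\<bar>s - t\<bar> < d"
    show "nrm (\<lambda>x. conv \<kappa> (u s) x - conv \<kappa> (u t) x - (s - t) * conv (deriv \<kappa>) (v t) x) \<le> e * \<bar>s - t\<bar>"
    proof (rule nrm_dual)
      show "L2 (\<lambda>x. conv \<kappa> (u s) x - conv \<kappa> (u t) x - (s - t) * conv (deriv \<kappa>) (v t) x)"
        by (intro L2_intros Lu Lv s t)
      fix \<theta> assume \<theta>: "test_fun \<theta>"
      let ?\<psi> = "conv ?\<kappa> \<theta>"
      have \<psi>: "test_fun ?\<psi>" by (rule conv_test[OF kr \<theta>])
      have "ip (\<lambda>x. conv \<kappa> (u s) x - conv \<kappa> (u t) x - (s - t) * conv (deriv \<kappa>) (v t) x) \<theta>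
          = ip (conv \<kappa> (u s)) \<theta> - ip (conv \<kappa> (u t)) \<theta> - (s - t) * ip (conv (deriv \<kappa>) (v t)) \<theta>"
        by (simp add: ip_simps L2_intros Lu Lv s t test_L2[OF \<theta>])
      also have "\<dots> = ip (u s) ?\<psi> - ip (u t) ?\<psi> + (s - t) * ip (v t) (deriv ?\<psi>)"
        using conv_deriv_adjoint[OF k sol_L2(1)[OF s(1)] \<theta>, of 0] conv_deriv_adjoint[OF k sol_L2(1)[OF t] \<theta>, of 0]
          conv_deriv_adjoint[OF k sol_at(2)[OF t] \<theta>, of 1] by simp
      finally have 1: "\<bar>ip (\<lambda>x. conv \<kappa> (u s) x - conv \<kappa> (u t) x - (s - t) * conv (deriv \<kappa>) (v t) x) \<theta>\<bar>
         \<le> e / (?N + 1) * nrm (deriv ?\<psi>) * \<bar>s - t\<bar>" using d(2)[OF s \<psi>] by simp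
      have "nrm (deriv ?\<psi>) \<le> ?N * nrm \<theta>"
        using Young_conv[OF test_deriv[OF kr] test_L2[OF \<theta>]] unfolding conv_deriv[OF kr test_L2[OF \<theta>]] .
      then have "nrm (deriv ?\<psi>) \<le> (?N + 1) * nrm \<theta>"
        unfolding distrib_right using nrm_nonneg[of \<theta>] by linarith
      then have 2: "e / (?N + 1) * nrm (deriv ?\<psi>) * \<bar>s - t\<bar> \<le> e / (?N + 1) * ((?N + 1) * nrm \<theta>) * \<bar>s - t\<bar>"
        using e N by (intro mult_right_mono mult_left_mono) auto
      have 3: "e / (?N + 1) * ((?N + 1) * nrm \<theta>) * \<bar>s - t\<bar> = e * \<bar>s - t\<bar> * nrm \<theta>" using N by simp
      show "\<bar>ip (\<lambda>x. conv \<kappa> (u s) x - conv \<kappa> (u t) x - (s - t) * conv (deriv \<kappa>) (v t) x) \<theta>\<bar> \<le> e * \<bar>s - t\<bar> * nrm \<theta>"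
        using 1 2 unfolding 3 by (rule order_trans)
    qed (use e in simp)
  qed
qed

lemma mollified_v_deriv:
  assumes k: "test_fun \<kappa>" and t: "t \<ge> 0"
  shows "L2deriv (\<lambda>s. conv \<kappa> (v s)) (\<lambda>x. conv (deriv \<kappa>) (G t) x + conv ((deriv ^^ 3) \<kappa>) (u2 t) x) t"
  unfolding L2deriv_def
proof (intro conjI allI impI)
  let ?D = "\<lambda>x. conv (deriv \<kappa>) (G t) x + conv ((deriv ^^ 3) \<kappa>) (u2 t) x"
  show Lv: "L2 (conv \<kappa> (v s))" if "0 \<le> s" for s by (intro conv_L2 k sol_at that)
  have L1: "L2 (conv (deriv \<kappa>) (G t))" "L2 (conv ((deriv ^^ 3) \<kappa>) (u2 t))"
    by (intro conv_L2 test_deriv test_deriv_n k sol_L2 G_L2 t)+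
  show LD: "L2 ?D" by (intro L2_add L1)
  fix e :: real assume e: "e > 0"
  let ?\<kappa> = "\<lambda>z. \<kappa> (- z)"
  have kr: "test_fun ?\<kappa>" using test_reflect[OF k, of 0] by simp
  let ?N1 = "\<integral>z. \<bar>deriv ?\<kappa> z\<bar> \<partial>lborel" and ?N3 = "\<integral>z. \<bar>(deriv ^^ 3) ?\<kappa> z\<bar> \<partial>lborel"
  let ?N = "?N1 + ?N3"
  have N: "?N + 1 > 0" by (simp add: add_nonneg_pos)
  have "e / (?N + 1) > 0" using e N by simp
  from v_increment[OF t this] obtain d where d: "d > 0" "\<And>s \<psi>. s \<ge> 0 \<Longrightarrow> \<bar>s - t\<bar> < d \<Longrightarrow> test_fun \<psi> \<Longrightarrow>
     \<bar>ip (v s) \<psi> - ip (v t) \<psi> + (s - t) * (ip (G t) (deriv \<psi>) + ip (u2 t) ((deriv ^^ 3) \<psi>))\<bar>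
        \<le> e / (?N + 1) * (nrm (deriv \<psi>) + nrm ((deriv ^^ 3) \<psi>)) * \<bar>s - t\<bar>" by blast
  show "\<exists>d>0. \<forall>s\<ge>0. \<bar>s - t\<bar> < d \<longrightarrow> nrm (\<lambda>x. conv \<kappa> (v s) x - conv \<kappa> (v t) x - (s - t) * ?D x) \<le> e * \<bar>s - t\<bar>"
  proof (intro exI[of _ d] conjI[OF d(1)] allI impI)
    fix s assume s: "0 \<le> s" "\<bar>s - t\<bar> < d"
    show "nrm (\<lambda>x. conv \<kappa> (v s) x - conv \<kappa> (v t) x - (s - t) * ?D x) \<le> e * \<bar>s - t\<bar>"
    proof (rule nrm_dual)
      show "L2 (\<lambda>x. conv \<kappa> (v s) x - conv \<kappa> (v t) x - (s - t) * ?D x)"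
        by (intro L2_diff L2_scale LD Lv s t)
      fix \<theta> assume \<theta>: "test_fun \<theta>"
      let ?\<psi> = "conv ?\<kappa> \<theta>"
      have \<psi>: "test_fun ?\<psi>" by (rule conv_test[OF kr \<theta>])
      have "ip (\<lambda>x. conv \<kappa> (v s) x - conv \<kappa> (v t) x - (s - t) * ?D x) \<theta>
          = ip (conv \<kappa> (v s)) \<theta> - ip (conv \<kappa> (v t)) \<theta> - (s - t) * (ip (conv (deriv \<kappa>) (G t)) \<theta> + ip (conv ((deriv ^^ 3) \<kappa>) (u2 t)) \<theta>)"
        by (simp only: ip_diff_left ip_scale_left ip_add_left L2_diff L2_scale LD L1 Lv s t test_L2[OF \<theta>])
      also have "\<dots> = ip (v s) ?\<psi> - ip (v t) ?\<psi> + (s - t) * (ip (G t) (deriv ?\<psi>) + ip (u2 t) ((deriv ^^ 3) ?\<psi>))"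
        using conv_deriv_adjoint[OF k sol_at(2)[OF s(1)] \<theta>, of 0] conv_deriv_adjoint[OF k sol_at(2)[OF t] \<theta>, of 0]
          conv_deriv_adjoint[OF k G_L2[OF t] \<theta>, of 1] conv_deriv_adjoint[OF k sol_L2(3)[OF t] \<theta>, of 3]
        by (simp add: algebra_simps)
      finally have 1: "\<bar>ip (\<lambda>x. conv \<kappa> (v s) x - conv \<kappa> (v t) x - (s - t) * ?D x) \<theta>\<bar>
         \<le> e / (?N + 1) * (nrm (deriv ?\<psi>) + nrm ((deriv ^^ 3) ?\<psi>)) * \<bar>s - t\<bar>" using d(2)[OF s \<psi>] by simp
      have "nrm (deriv ?\<psi>) \<le> ?N1 * nrm \<theta>" "nrm ((deriv ^^ 3) ?\<psi>) \<le> ?N3 * nrm \<theta>"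
        using Young_conv[OF test_deriv[OF kr] test_L2[OF \<theta>]] Young_conv[OF test_deriv_n[OF kr, of 3] test_L2[OF \<theta>]]
        unfolding conv_deriv[OF kr test_L2[OF \<theta>]] conv_deriv_n[OF kr test_L2[OF \<theta>]] by auto
      then have "nrm (deriv ?\<psi>) + nrm ((deriv ^^ 3) ?\<psi>) \<le> (?N + 1) * nrm \<theta>"
        unfolding distrib_right using nrm_nonneg[of \<theta>] by linarith
      then have 2: "e / (?N + 1) * (nrm (deriv ?\<psi>) + nrm ((deriv ^^ 3) ?\<psi>)) * \<bar>s - t\<bar> \<le> e / (?N + 1) * ((?N + 1) * nrm \<theta>) * \<bar>s - t\<bar>"
        using e N by (intro mult_right_mono mult_left_mono) auto
      have 3: "e / (?N + 1) * ((?N + 1) * nrm \<theta>) * \<bar>s - t\<bar> = e * \<bar>s - t\<bar> * nrm \<theta>" using N by simp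
      show "\<bar>ip (\<lambda>x. conv \<kappa> (v s) x - conv \<kappa> (v t) x - (s - t) * ?D x) \<theta>\<bar> \<le> e * \<bar>s - t\<bar> * nrm \<theta>"
        using 1 2 unfolding 3 by (rule order_trans)
    qed (use e in simp)
  qed
qed

end

section \<open>Conservation of the action\<close>

context soln
begin

text \<open>Density extends the uniform estimate to H^1 tests, so that increments of
  \<open>u\<close> and the function \<open>f (u t x)\<close> become admissible.\<close>

lemma u_increment_W1:
  assumes t: "t \<ge> 0" and e: "e > 0"
  obtains d where "d > 0" "\<And>s \<psi> \<psi>1. s \<ge> 0 \<Longrightarrow> \<bar>s - t\<bar> < d \<Longrightarrow> W1 \<psi> \<psi>1 \<Longrightarrow>
     \<bar>ip (\<lambda>x. u s x - u t x) \<psi> + (s - t) * ip (v t) \<psi>1\<bar> \<le> e * nrm \<psi>1 * \<bar>s - t\<bar>"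
proof -
  obtain d where d: "d > 0" "\<And>s \<psi>. s \<ge> 0 \<Longrightarrow> \<bar>s - t\<bar> < d \<Longrightarrow> test_fun \<psi> \<Longrightarrow>
     \<bar>ip (u s) \<psi> - ip (u t) \<psi> + (s - t) * ip (v t) (deriv \<psi>)\<bar> \<le> e * nrm (deriv \<psi>) * \<bar>s - t\<bar>"
    using u_increment[OF t e] by blast
  show thesis
  proof (rule that[OF d(1)])
    fix s \<psi> \<psi>1 assume s: "s \<ge> 0" "\<bar>s - t\<bar> < d" and \<psi>: "W1 \<psi> \<psi>1"
    obtain g where g: "\<And>n::nat. test_fun (g n)" "(\<lambda>n. nrm (\<lambda>x. g n x - \<psi> x)) \<longlonglongrightarrow> 0"
      "(\<lambda>n. nrm (\<lambda>x. deriv (g n) x - \<psi>1 x)) \<longlonglongrightarrow> 0"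
      using W1_seq[OF \<psi>] by blast
    have L: "L2 \<psi>" "L2 \<psi>1" "\<And>n. L2 (g n)" "\<And>n. L2 (deriv (g n))"
      using \<psi> g(1) by (auto simp: W1_def intro: test_L2 test_deriv)
    have Lu: "L2 (\<lambda>x. u s x - u t x)" by (intro L2_diff sol_L2 s t)
    have l1: "(\<lambda>n. ip (g n) (\<lambda>x. u s x - u t x)) \<longlonglongrightarrow> ip \<psi> (\<lambda>x. u s x - u t x)"
      by (rule ip_tendsto_left[OF L(3) L(1) Lu g(2)])
    have l2: "(\<lambda>n. ip (deriv (g n)) (v t)) \<longlonglongrightarrow> ip \<psi>1 (v t)"
      by (rule ip_tendsto_left[OF L(4) L(2) sol_at(2)[OF t] g(3)])
    have l3: "(\<lambda>n. e * nrm (deriv (g n)) * \<bar>s - t\<bar>) \<longlonglongrightarrow> e * nrm \<psi>1 * \<bar>s - t\<bar>"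
      by (intro tendsto_intros nrm_tendsto[OF L(4) L(2) g(3)])
    have l4: "(\<lambda>n. \<bar>ip (g n) (\<lambda>x. u s x - u t x) + (s - t) * ip (deriv (g n)) (v t)\<bar>)
       \<longlonglongrightarrow> \<bar>ip \<psi> (\<lambda>x. u s x - u t x) + (s - t) * ip \<psi>1 (v t)\<bar>"
      by (intro tendsto_intros l1 l2)
    have "\<bar>ip (g n) (\<lambda>x. u s x - u t x) + (s - t) * ip (deriv (g n)) (v t)\<bar> \<le> e * nrm (deriv (g n)) * \<bar>s - t\<bar>" for n
      using d(2)[OF s g(1), of n] by (simp add: ip_diff_left sol_L2 s t L ip_commute[of "g n"] ip_commute[of "deriv (g n)"])
    then have "\<bar>ip \<psi> (\<lambda>x. u s x - u t x) + (s - t) * ip \<psi>1 (v t)\<bar> \<le> e * nrm \<psi>1 * \<bar>s - t\<bar>"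
      by (intro LIMSEQ_le[OF l4 l3]) auto
    then show "\<bar>ip (\<lambda>x. u s x - u t x) \<psi> + (s - t) * ip (v t) \<psi>1\<bar> \<le> e * nrm \<psi>1 * \<bar>s - t\<bar>"
      by (simp add: ip_commute[of \<psi>] ip_commute[of \<psi>1])
  qed
qed

text \<open>No mollification is needed for the potential energy: testing the first equation with the increment
  of \<open>u\<close> itself shows that the squared L2 increment is of lower order than the time increment.\<close>
lemma potential_deriv:
  assumes t: "t \<ge> 0"
  shows "((\<lambda>s. Phi (u s)) has_real_derivative - ip (v t) (\<lambda>x. f1 (u t x) * u1 t x)) (at t within {0..})"
proof (rule has_real_derivative_half_lineI)
  fix e :: real assume e: "e > 0"
  let ?h = "\<lambda>x. f1 (u t x) * u1 t x"
  obtain R C where R: "lbound R C" "nrm (u t) + nrm (u1 t) \<le> R"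
    "\<And>s. s \<ge> 0 \<Longrightarrow> nrm (\<lambda>x. u s x - u t x) < 1 \<Longrightarrow> nrm (\<lambda>x. u1 s x - u1 t x) < 1 \<Longrightarrow> AE x in lborel. \<bar>u s x\<bar> \<le> R"
    using sol_bounded[OF t] by blast
  have C: "0 \<le> C" using lbound_nonneg[OF R(1)] .
  let ?e = "e / (2 * (nrm ?h + 1))"
  have "nrm ?h + 1 > 0" by (simp add: add_nonneg_pos)
  then have e': "?e > 0" using e by simp
  obtain d1 where d1: "d1 > 0" "\<And>s \<psi> \<psi>1. s \<ge> 0 \<Longrightarrow> \<bar>s - t\<bar> < d1 \<Longrightarrow> W1 \<psi> \<psi>1 \<Longrightarrow>
     \<bar>ip (\<lambda>x. u s x - u t x) \<psi> + (s - t) * ip (v t) \<psi>1\<bar> \<le> ?e * nrm \<psi>1 * \<bar>s - t\<bar>"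
    using u_increment_W1[OF t e'] by blast
  let ?M = "C * (nrm (v t) + ?e)"
  have M: "?M \<ge> 0" using C e' by (simp add: add_nonneg_nonneg)
  let ?\<eta> = "min 1 (e / (2 * (?M + 1)))"
  have "?M + 1 > 0" using M by linarith
  then have "?\<eta> > 0" using e by simp
  from sol_cont[OF t this] obtain d2 where d2: "d2 > 0" "\<And>s. s \<ge> 0 \<Longrightarrow> \<bar>s - t\<bar> < d2 \<Longrightarrow>
     nrm (\<lambda>x. u s x - u t x) < ?\<eta> \<and> nrm (\<lambda>x. u1 s x - u1 t x) < ?\<eta>" by blast
  show "\<exists>d>0. \<forall>s\<ge>0. \<bar>s - t\<bar> < d \<longrightarrow> \<bar>Phi (u s) - Phi (u t) - (s - t) * - ip (v t) ?h\<bar> \<le> e * \<bar>s - t\<bar>"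
  proof (intro exI[of _ "min d1 d2"] conjI allI impI)
    show "min d1 d2 > 0" using d1 d2 by simp
    fix s assume s: "0 \<le> s" "\<bar>s - t\<bar> < min d1 d2"
    have s1: "\<bar>s - t\<bar> < d1" and s2: "\<bar>s - t\<bar> < d2" using s by auto
    let ?w = "\<lambda>x. u s x - u t x" and ?w1 = "\<lambda>x. u1 s x - u1 t x" and ?a = "\<bar>s - t\<bar>"
    have b: "nrm ?w < 1" "nrm ?w1 < 1" "nrm ?w1 \<le> e / (2 * (?M + 1))" using d2(2)[OF s(1) s2] by auto
    have us: "AE x in lborel. \<bar>u s x\<bar> \<le> R" by (rule R(3)[OF s(1) b(1,2)])
    have ut: "AE x in lborel. \<bar>u t x\<bar> \<le> R" using R(3)[OF t] by simp
    have W: "W1 ?w ?w1" by (intro W1_diff W2D(1)[OF sol_at(1)] s t)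
    have Lw: "L2 ?w" "L2 ?w1" using W by (auto simp: W1_def)
    have "\<bar>ip ?w ?w + (s - t) * ip (v t) ?w1\<bar> \<le> ?e * nrm ?w1 * ?a" by (rule d1(2)[OF s(1) s1 W])
    moreover have "\<bar>(s - t) * ip (v t) ?w1\<bar> \<le> ?a * (nrm (v t) * nrm ?w1)"
      unfolding abs_mult by (intro mult_left_mono Cauchy_Schwarz_ip sol_at t Lw) auto
    moreover have "?e * nrm ?w1 * ?a + ?a * (nrm (v t) * nrm ?w1) = (nrm (v t) + ?e) * nrm ?w1 * ?a"
      by (simp only: distrib_right distrib_left mult.commute mult.left_commute add.commute)
    ultimately have "(nrm ?w)^2 \<le> (nrm (v t) + ?e) * nrm ?w1 * ?a" unfolding nrm_sq_ip by linarith
    then have "C * (nrm ?w)^2 \<le> C * ((nrm (v t) + ?e) * nrm ?w1 * ?a)" using C by (rule mult_left_mono)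
    also have "\<dots> = (?M * nrm ?w1) * ?a" by (simp only: mult.assoc)
    also have "\<dots> \<le> (e / 2) * ?a"
    proof (rule mult_right_mono)
      have "?M * nrm ?w1 \<le> (?M + 1) * (e / (2 * (?M + 1)))"
        using b(3) M by (intro mult_mono) auto
      also have "\<dots> = e / 2"
      proof -
        have "n * (e / (2 * n)) = e / 2" if "n > 0" for n :: real using that by simp
        then show ?thesis using \<open>?M + 1 > 0\<close> by blast
      qed
      finally show "?M * nrm ?w1 \<le> e / 2" .
    qed simp
    finally have 1: "C * (nrm ?w)^2 \<le> (e / 2) * ?a" .
    have 2: "\<bar>Phi (u s) - Phi (u t) - ip (\<lambda>x. f (u t x)) ?w\<bar> \<le> C * (nrm ?w)^2"
      by (rule Phi_first_order[OF R(1) sol_L2(1)[OF t] ut sol_L2(1)[OF s(1)] us])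
    have 3: "\<bar>ip ?w (\<lambda>x. f (u t x)) + (s - t) * ip (v t) ?h\<bar> \<le> ?e * nrm ?h * ?a"
      by (rule d1(2)[OF s(1) s1 W1_f[OF W2D(1)[OF sol_at(1)[OF t]]]])
    have "?e * nrm ?h \<le> e / 2"
    proof -
      have "?e * nrm ?h \<le> ?e * (nrm ?h + 1)" using e' by (intro mult_left_mono) auto
      also have "\<dots> = e / 2"
      proof -
        have "e / (2 * n) * n = e / 2" if "n > 0" for n :: real using that by simp
        then show ?thesis using \<open>nrm ?h + 1 > 0\<close> by blast
      qed
      finally show ?thesis .
    qed
    then have 4: "?e * nrm ?h * ?a \<le> (e / 2) * ?a" by (rule mult_right_mono) simp
    have 5: "(e / 2) * ?a + (e / 2) * ?a = e * ?a" by simp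
    have 6: "ip ?w (\<lambda>x. f (u t x)) = ip (\<lambda>x. f (u t x)) ?w" by (rule ip_commute)
    show "\<bar>Phi (u s) - Phi (u t) - (s - t) * - ip (v t) ?h\<bar> \<le> e * \<bar>s - t\<bar>"
      using 1 2 3 4 unfolding 6 mult_minus_right 5[symmetric] by linarith
  qed
qed

text \<open>The quadratic part of the action at the mollified solution. The potential is left out,
  as it is differentiated without mollification.\<close>

definition Smol :: "real \<Rightarrow> rfun \<Rightarrow> real \<Rightarrow> real" where
  "Smol c \<kappa> s = Iq \<beta> c (conv \<kappa> (u s)) (conv (deriv \<kappa>) (u s)) (conv (deriv (deriv \<kappa>)) (u s)) / 2
     + (nrm (\<lambda>x. c * conv \<kappa> (u s) x + conv \<kappa> (v s) x))^2 / 2"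

text \<open>The linear part of the flow commutes with mollification and preserves the quadratic part
  of the action, so that every term cancels except the pairing with the mollified derivative of
  \<open>f (u t x)\<close>.\<close>

lemma Smol_deriv:
  assumes k: "test_fun \<kappa>" and t: "t \<ge> 0"
  shows "(Smol c \<kappa> has_real_derivative
     - ip (\<lambda>x. c * conv \<kappa> (u t) x + conv \<kappa> (v t) x) (conv \<kappa> (\<lambda>x. f1 (u t x) * u1 t x))) (at t within {0..})"
proof -
  define K where "K j = (deriv ^^ j) \<kappa>" for j
  have tK: "test_fun (K j)" for j unfolding K_def by (rule test_deriv_n[OF k])
  have dK: "deriv (K j) = K (Suc j)" for j by (simp add: K_def)
  have K0: "\<kappa> = K 0" by (simp add: K_def)
  define U where "U j = conv (K j) (u t)" for j
  define V where "V j = conv (K j) (v t)" for j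
  let ?g = "conv \<kappa> (\<lambda>x. f1 (u t x) * u1 t x)"
  note Lu = sol_L2[OF t] and Lv = sol_at(2)[OF t]
  have WU: "W1 (U j) (U (Suc j))" and WV: "W1 (V j) (V (Suc j))" for j
    using W1_conv[OF tK Lu(1), of j] W1_conv[OF tK Lv, of j] by (simp_all add: U_def V_def dK)
  have LU: "L2 (U j)" and LV: "L2 (V j)" for j using WU WV by (auto simp: W1_def)
  have g: "conv (deriv \<kappa>) (\<lambda>x. f (u t x)) = ?g"
    by (rule conv_weak_deriv[OF W1D(3)[OF W1_f[OF W2D(1)[OF sol_at(1)[OF t]]]] k])
  have Lg: "L2 ?g" by (intro conv_L2 k sol_f_L2 t)
  have c2: "conv (K j) (u2 t) = U (Suc (Suc j))" for j
    using conv_W2[OF sol_at(1)[OF t] tK[of j]] by (simp add: dK U_def)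
  have GV: "conv (deriv \<kappa>) (G t) = (\<lambda>x. U 1 x + \<beta> * U 3 x - ?g x)"
  proof -
    have "conv (deriv \<kappa>) (G t) = conv (K 1) (\<lambda>x. (u t x + \<beta> * u2 t x) - f (u t x))"
      by (simp add: K_def G_def[abs_def])
    also have "\<dots> = (\<lambda>x. (conv (K 1) (u t) x + \<beta> * conv (K 1) (u2 t) x) - conv (K 1) (\<lambda>x. f (u t x)) x)"
      by (simp only: conv_diff[OF tK L2_add[OF Lu(1) L2_scale[OF Lu(3)]] sol_f_L2(1)[OF t]]
          conv_add[OF tK Lu(1) L2_scale[OF Lu(3)]] conv_scale)
    also have "\<dots> = (\<lambda>x. U 1 x + \<beta> * U 3 x - ?g x)"
      using g c2[of 1] by (simp add: U_def K_def numeral_3_eq_3)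
    finally show ?thesis .
  qed
  have dU: "L2deriv (\<lambda>s. conv (K j) (u s)) (V (Suc j)) t" for j
    using mollified_u_deriv[OF tK t, of j] by (simp add: dK V_def)
  have dV: "L2deriv (\<lambda>s. conv \<kappa> (v s)) (\<lambda>x. (U 1 x + \<beta> * U 3 x - ?g x) + U 5 x) t"
    using mollified_v_deriv[OF k t] c2[of 3] by (simp add: GV K_def eval_nat_numeral)
  have dW: "L2deriv (\<lambda>s x. c * conv \<kappa> (u s) x + conv \<kappa> (v s) x)
     (\<lambda>x. c * V 1 x + ((U 1 x + \<beta> * U 3 x - ?g x) + U 5 x)) t"
    using L2deriv_lin[OF _ dV t] dU[of 0] by (simp add: K_def)
  let ?D = "(2 * ip (U 2) (V 3) - \<beta> * (2 * ip (U 1) (V 2)) + (1 - c^2) * (2 * ip (U 0) (V 1))) / 2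
     + 2 * ip (\<lambda>x. c * U 0 x + V 0 x) (\<lambda>x. c * V 1 x + ((U 1 x + \<beta> * U 3 x - ?g x) + U 5 x)) / 2"
  have e2: "((\<lambda>s. (nrm (conv (deriv (deriv \<kappa>)) (u s)))^2) has_real_derivative 2 * ip (U 2) (V 3)) (at t within {0..})"
    using L2deriv_nrm_sq[OF dU[of 2] t] by (simp add: K_def U_def eval_nat_numeral)
  have e1: "((\<lambda>s. (nrm (conv (deriv \<kappa>) (u s)))^2) has_real_derivative 2 * ip (U 1) (V 2)) (at t within {0..})"
    using L2deriv_nrm_sq[OF dU[of 1] t] by (simp add: K_def U_def eval_nat_numeral)
  have e0: "((\<lambda>s. (nrm (conv \<kappa> (u s)))^2) has_real_derivative 2 * ip (U 0) (V 1)) (at t within {0..})"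
    using L2deriv_nrm_sq[OF dU[of 0] t] by (simp add: K_def U_def)
  have e3: "((\<lambda>s. (nrm (\<lambda>x. c * conv \<kappa> (u s) x + conv \<kappa> (v s) x))^2) has_real_derivative
      2 * ip (\<lambda>x. c * U 0 x + V 0 x) (\<lambda>x. c * V 1 x + ((U 1 x + \<beta> * U 3 x - ?g x) + U 5 x))) (at t within {0..})"
    using L2deriv_nrm_sq[OF dW t] by (simp add: K_def U_def V_def)
  have "(Smol c \<kappa> has_real_derivative ?D) (at t within {0..})"
    unfolding Smol_def[abs_def] Iq_def
    by (intro DERIV_add DERIV_diff DERIV_cdivide DERIV_cmult e0 e1 e2 e3)
  moreover have "?D = - ip (\<lambda>x. c * conv \<kappa> (u t) x + conv \<kappa> (v t) x) ?g"
  proof -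
    \<comment> \<open>\<open>U j\<close> and \<open>V j\<close> are the \<open>j\<close>-th
      derivatives of the mollified \<open>u\<close> and \<open>v\<close>, and these identities move
      one derivative at a time. The pairing of a function with an odd derivative of itself is
      0.\<close>
    have pUV: "ip (U i) (V (Suc j)) = - ip (U (Suc i)) (V j)" for i j by (rule W1_ip_parts[OF WU WV])
    have pUU: "ip (U i) (U (Suc j)) = - ip (U (Suc i)) (U j)" for i j by (rule W1_ip_parts[OF WU WU])
    have pVV: "ip (V 0) (V 1) = - ip (V 1) (V 0)" using W1_ip_parts[OF WV WV, of 0 0] by simp
    have a1: "ip (U 2) (V 3) = - ip (U 5) (V 0)"
      using pUV[of 2 2] pUV[of 3 1] pUV[of 4 0] by (simp add: eval_nat_numeral)
    have a2: "ip (U 1) (V 2) = ip (U 3) (V 0)"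
      using pUV[of 1 1] pUV[of 2 0] by (simp add: eval_nat_numeral)
    have a3: "ip (U 0) (V 1) = - ip (U 1) (V 0)" using pUV[of 0 0] by simp
    have a4: "ip (V 0) (V 1) = 0" using pVV ip_commute[of "V 0" "V 1"] by simp
    have a5: "ip (U 0) (U 1) = 0" using pUU[of 0 0] ip_commute[of "U 1" "U 0"] by simp
    have a6: "ip (U 0) (U 3) = 0"
      using pUU[of 0 2] pUU[of 1 1] ip_commute[of "U 2" "U 1"] by (simp add: eval_nat_numeral)
    have a7: "ip (U 0) (U 5) = 0"
      using pUU[of 0 4] pUU[of 1 3] pUU[of 2 2] ip_commute[of "U 3" "U 2"] by (simp add: eval_nat_numeral)
    let ?A = "\<lambda>x. c * U 0 x + V 0 x"
    have LA: "L2 ?A" by (intro L2_intros LU LV)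
    have "ip ?A (\<lambda>x. c * V 1 x + ((U 1 x + \<beta> * U 3 x - ?g x) + U 5 x))
      = c * ip ?A (V 1) + ((ip ?A (U 1) + \<beta> * ip ?A (U 3) - ip ?A ?g) + ip ?A (U 5))"
      by (simp only: ip_add_right ip_diff_right ip_scale_right L2_add L2_diff L2_scale LA LU LV Lg)
    also have "\<dots> = c * (c * ip (U 0) (V 1) + ip (V 0) (V 1))
       + ((c * ip (U 0) (U 1) + ip (V 0) (U 1)) + \<beta> * (c * ip (U 0) (U 3) + ip (V 0) (U 3)) - ip ?A ?g
         + (c * ip (U 0) (U 5) + ip (V 0) (U 5)))"
      by (simp only: ip_add_left ip_scale_left L2_scale LU LV)
    also have "\<dots> = - (c^2) * ip (U 1) (V 0) + ip (U 1) (V 0) + \<beta> * ip (U 3) (V 0) - ip ?A ?g + ip (U 5) (V 0)"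
      using a4 by (simp add: a3 a5 a6 a7 ip_commute[of "V 0"] power2_eq_square del: One_nat_def)
    finally have "?D = - ip ?A ?g" by (simp add: a1 a2 a3 field_simps del: One_nat_def)
    then show ?thesis by (simp add: U_def V_def K_def)
  qed
  ultimately show ?thesis by simp
qed

lemma conv_mol_tendsto:
  assumes "L2 h" "L2 h'"
  shows "(\<lambda>n. ip (conv (mol n) h) (conv (mol n) h')) \<longlonglongrightarrow> ip h h'"
  by (rule ip_tendsto[OF conv_L2[OF mol_test assms(1)] conv_L2[OF mol_test assms(2)] assms
      mol_conv_tendsto[OF assms(1)] mol_conv_tendsto[OF assms(2)]])

definition Smom :: "real \<Rightarrow> real \<Rightarrow> real" where
  "Smom c s = Iq \<beta> c (u s) (u1 s) (u2 s) / 2 + (nrm (\<lambda>x. c * u s x + v s x))^2 / 2"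

lemma conv_lin: "L2 a \<Longrightarrow> L2 b \<Longrightarrow> test_fun \<kappa> \<Longrightarrow>
   (\<lambda>x. c * conv \<kappa> a x + conv \<kappa> b x) = conv \<kappa> (\<lambda>x. c * a x + b x)"
  by (simp only: conv_add[OF _ L2_scale] conv_scale)

lemma Smol_tendsto:
  assumes t: "t \<ge> 0"
  shows "(\<lambda>n. Smol c (mol n) t) \<longlonglongrightarrow> Smom c t"
proof -
  have d: "conv (deriv (mol n)) (u t) = conv (mol n) (u1 t)" "conv (deriv (deriv (mol n))) (u t) = conv (mol n) (u2 t)" for n
    using conv_weak_deriv[OF W1D(3)[OF W2D(1)[OF sol_at(1)[OF t]]] mol_test]
      conv_W2[OF sol_at(1)[OF t] mol_test] by auto
  have n: "(\<lambda>n. nrm (conv (mol n) h)) \<longlonglongrightarrow> nrm h" if "L2 h" for h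
    by (rule nrm_tendsto[OF conv_L2[OF mol_test that] that mol_conv_tendsto[OF that]])
  show ?thesis
    unfolding Smol_def Smom_def Iq_def d conv_lin[OF sol_L2(1)[OF t] sol_at(2)[OF t] mol_test]
    by (intro tendsto_intros n sol_L2 sol_at L2_intros t) simp_all
qed

text \<open>Continuity on a compact time interval; the bound depends on \<open>T\<close> and serves
  only as a dominating constant.\<close>

lemma sol_norm_bounded:
  obtains K where "\<And>t. t \<in> {0..T} \<Longrightarrow> nrm (u t) + nrm (u1 t) + nrm (v t) \<le> K"
proof -
  let ?b = "\<lambda>t. nrm (u t) + nrm (u1 t) + nrm (v t)"
  have "continuous_on {0..T} ?b"
    unfolding continuous_on_iff
  proof (intro ballI allI impI)
    fix t e :: real assume t: "t \<in> {0..T}" and e: "0 < e"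
    then have t0: "t \<ge> 0" and "e / 3 > 0" by auto
    from sol_cont[OF this] obtain d where d: "d > 0" "\<And>s. s \<ge> 0 \<Longrightarrow> \<bar>s - t\<bar> < d \<Longrightarrow>
       nrm (\<lambda>x. u s x - u t x) < e / 3 \<and> nrm (\<lambda>x. u1 s x - u1 t x) < e / 3 \<and> nrm (\<lambda>x. v s x - v t x) < e / 3" by blast
    show "\<exists>d>0. \<forall>x'\<in>{0..T}. dist x' t < d \<longrightarrow> dist (?b x') (?b t) < e"
    proof (intro exI[of _ d] conjI[OF d(1)] ballI impI)
      fix s assume s: "s \<in> {0..T}" "dist s t < d"
      then have s0: "s \<ge> 0" by simp
      have b: "nrm (\<lambda>x. u s x - u t x) < e / 3" "nrm (\<lambda>x. u1 s x - u1 t x) < e / 3" "nrm (\<lambda>x. v s x - v t x) < e / 3"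
        using d(2)[OF s0] s(2) by (auto simp: dist_real_def)
      have c: "\<bar>nrm (u s) - nrm (u t)\<bar> < e / 3" "\<bar>nrm (u1 s) - nrm (u1 t)\<bar> < e / 3" "\<bar>nrm (v s) - nrm (v t)\<bar> < e / 3"
        using le_less_trans[OF nrm_diff_abs b(1)] le_less_trans[OF nrm_diff_abs b(2)] le_less_trans[OF nrm_diff_abs b(3)]
        by (simp_all add: sol_L2 sol_at s0 t0)
      show "dist (?b s) (?b t) < e" unfolding dist_real_def using c by linarith
    qed
  qed
  then have "bounded (?b ` {0..T})"
    by (intro compact_imp_bounded compact_continuous_image) auto
  then obtain K where K: "\<forall>y\<in>?b ` {0..T}. norm y \<le> K" unfolding bounded_iff by blast
  have "?b t \<le> K" if "t \<in> {0..T}" for t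
  proof -
    have "norm (?b t) \<le> K" using K that by blast
    then show ?thesis by (simp add: abs_le_iff)
  qed
  then show thesis using that by blast
qed

text \<open>The derivative \<open>?D n t\<close> compares a mollified pairing with the unmollified
  one coming from the potential. At each time it tends to 0: the terms in \<open>v\<close> cancel
  and the term with \<open>c\<close> vanishes by \<open>ip_f1_deriv_zero\<close>. Its bound on
  \<open>[0, T]\<close> is independent of \<open>n\<close>, so its time integral tends to 0.\<close>

lemma action_conserved:
  assumes T: "T \<ge> 0"
  shows "Smom c T - Phi (u T) = Smom c 0 - Phi (u 0)"
proof -
  let ?h = "\<lambda>t x. f1 (u t x) * u1 t x"
  let ?D = "\<lambda>n t. - ip (\<lambda>x. c * conv (mol n) (u t) x + conv (mol n) (v t) x) (conv (mol n) (?h t)) - (- ip (v t) (?h t))"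
  let ?e = "\<lambda>n t. Smol c (mol n) t - Phi (u t)"
  obtain K where K: "\<And>t. t \<in> {0..T} \<Longrightarrow> nrm (u t) + nrm (u1 t) + nrm (v t) \<le> K"
    using sol_norm_bounded[of T] by blast
  have K0: "K \<ge> 0" using order_trans[OF _ K[of 0]] T by (simp add: add_nonneg_nonneg)
  obtain C where C: "lbound K C" using lbound_exists[OF K0] by blast
  have C0: "0 \<le> C" by (rule lbound_nonneg[OF C])
  \<comment> \<open>\<open>C * K * K\<close> bounds the derivative of \<open>f (u t x)\<close> in
    L2; mollification does not increase norms, so no \<open>n\<close> enters.\<close>
  let ?B = "(\<bar>c\<bar> + 1) * K * (C * K * K) + K * (C * K * K)"
  have hi: "(?D n has_integral (?e n T - ?e n 0)) {0..T}" for n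
  proof (rule fundamental_theorem_of_calculus[OF T])
    fix t assume t: "t \<in> {0..T}"
    then have t0: "t \<ge> 0" by simp
    have "(?e n has_real_derivative ?D n t) (at t within {0..})"
      by (rule DERIV_diff[OF Smol_deriv[OF mol_test t0] potential_deriv[OF t0]])
    then have "(?e n has_real_derivative ?D n t) (at t within {0..T})" by (rule DERIV_subset) auto
    then show "(?e n has_vector_derivative ?D n t) (at t within {0..T})"
      by (simp only: has_real_derivative_iff_has_vector_derivative)
  qed
  have bd: "norm (?D n t) \<le> ?B" if t: "t \<in> {0..T}" for n t
  proof -
    have t0: "t \<ge> 0" using t by simp
    note Lu = sol_L2(1)[OF t0] and Lv = sol_at(2)[OF t0] and Lh = sol_f_L2(2)[OF t0]
    have n: "nrm (u t) \<le> K" "nrm (u1 t) \<le> K" "nrm (v t) \<le> K" "nrm (u t) + nrm (u1 t) \<le> K"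
      using K[OF t] nrm_nonneg[of "u t"] nrm_nonneg[of "u1 t"] nrm_nonneg[of "v t"] by linarith+
    have ub: "AE x in lborel. \<bar>u t x\<bar> \<le> K"
      using W1_sup_bound[OF W2D(1)[OF sol_at(1)[OF t0]]] n(4) by (auto elim: eventually_mono)
    have "nrm (?h t) \<le> (C * K) * nrm (u1 t)" by (rule L2_f1_mult(2)[OF C Lu ub sol_L2(2)[OF t0]])
    also have "\<dots> \<le> C * K * K" using n(2) C0 K0 by (intro mult_left_mono) auto
    finally have nh: "nrm (?h t) \<le> C * K * K" .
    have LA: "L2 (\<lambda>x. c * u t x + v t x)" by (intro L2_intros Lu Lv)
    have nA: "nrm (\<lambda>x. c * u t x + v t x) \<le> (\<bar>c\<bar> + 1) * K"
    proof -
      have "nrm (\<lambda>x. c * u t x + v t x) \<le> \<bar>c\<bar> * nrm (u t) + nrm (v t)"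
        using nrm_triangle[OF L2_scale[OF Lu, of c] Lv] by (simp add: nrm_scale)
      moreover have "\<bar>c\<bar> * nrm (u t) \<le> \<bar>c\<bar> * K" using n(1) by (intro mult_left_mono) auto
      ultimately show ?thesis using n(3) by (simp add: distrib_right)
    qed
    have "\<bar>ip (conv (mol n) (\<lambda>x. c * u t x + v t x)) (conv (mol n) (?h t))\<bar>
       \<le> nrm (conv (mol n) (\<lambda>x. c * u t x + v t x)) * nrm (conv (mol n) (?h t))"
      by (intro Cauchy_Schwarz_ip conv_L2 mol_test LA Lh)
    also have "\<dots> \<le> ((\<bar>c\<bar> + 1) * K) * (C * K * K)"
      using order_trans[OF Young_mol[OF LA] nA] order_trans[OF Young_mol[OF Lh] nh] K0 by (intro mult_mono) auto
    finally have 1: "\<bar>ip (conv (mol n) (\<lambda>x. c * u t x + v t x)) (conv (mol n) (?h t))\<bar> \<le> ((\<bar>c\<bar> + 1) * K) * (C * K * K)" .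
    have "\<bar>ip (v t) (?h t)\<bar> \<le> nrm (v t) * nrm (?h t)" by (rule Cauchy_Schwarz_ip[OF Lv Lh])
    also have "\<dots> \<le> K * (C * K * K)" using n(3) nh K0 by (intro mult_mono) auto
    finally have 2: "\<bar>ip (v t) (?h t)\<bar> \<le> K * (C * K * K)" .
    show ?thesis unfolding conv_lin[OF Lu Lv mol_test] real_norm_def using 1 2 by linarith
  qed
  have lim: "(\<lambda>n. ?D n t) \<longlonglongrightarrow> 0" if t: "t \<in> {0..T}" for t
  proof -
    have t0: "t \<ge> 0" using t by simp
    note Lu = sol_L2(1)[OF t0] and Lv = sol_at(2)[OF t0] and Lh = sol_f_L2(2)[OF t0]
    have LA: "L2 (\<lambda>x. c * u t x + v t x)" by (intro L2_intros Lu Lv)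
    have "(\<lambda>n. ?D n t) \<longlonglongrightarrow> - ip (\<lambda>x. c * u t x + v t x) (?h t) - (- ip (v t) (?h t))"
      unfolding conv_lin[OF Lu Lv mol_test] by (intro tendsto_intros conv_mol_tendsto LA Lh)
    moreover have "- ip (\<lambda>x. c * u t x + v t x) (?h t) - (- ip (v t) (?h t)) = 0"
      using ip_f1_deriv_zero[OF W2D(1)[OF sol_at(1)[OF t0]]]
      by (simp add: ip_add_left ip_scale_left L2_scale Lu Lv Lh)
    ultimately show ?thesis by simp
  qed
  have "(\<lambda>n. integral {0..T} (?D n)) \<longlonglongrightarrow> integral {0..T} (\<lambda>t. 0)"
  proof (rule dominated_convergence(2))
    show "?D n integrable_on {0..T}" for n using hi by (rule has_integral_integrable)
    show "(\<lambda>t. ?B) integrable_on {0..T}" by (rule integrable_const_ivl)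
  qed (use bd lim in auto)
  then have "(\<lambda>n. ?e n T - ?e n 0) \<longlonglongrightarrow> 0" by (simp only: integral_unique[OF hi] integral_0)
  moreover have "(\<lambda>n. ?e n T - ?e n 0) \<longlonglongrightarrow> (Smom c T - Phi (u T)) - (Smom c 0 - Phi (u 0))"
    by (intro tendsto_intros Smol_tendsto T) simp
  ultimately show ?thesis using LIMSEQ_unique by fastforce
qed

end

section \<open>Test profiles\<close>

text \<open>If the derivative vanished, every mollification of \<open>u\<close> would be constant,
  and a square integrable constant on the line is 0.\<close>

lemma nrm_pos_of_deriv:
  assumes W: "W1 u u1" and pos: "nrm u > 0"
  shows "nrm u1 > 0"
proof (rule ccontr)
  assume "\<not> nrm u1 > 0"
  then have z: "nrm u1 = 0" using nrm_nonneg[of u1] by linarith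
  note L = W1D(1,2)[OF W]
  have "nrm (conv (mol n) u) = 0" for n
  proof -
    have "nrm (conv (mol n) u1) = 0" using Young_mol[OF L(2), of n] z nrm_nonneg[of "conv (mol n) u1"] by linarith
    then have zero: "conv (deriv (mol n)) u x = 0" for x
    proof -
      have "conv (deriv (mol n)) u = conv (mol n) u1" by (rule conv_weak_deriv[OF W1D(3)[OF W] mol_test])
      moreover have "\<bar>conv (mol n) u1 x\<bar> \<le> nrm u1 * nrm (\<lambda>y. mol n (x - y))"
        unfolding conv_ip by (intro Cauchy_Schwarz_ip L L2_reflect test_L2 mol_test)
      ultimately show ?thesis using z by simp
    qed
    have "conv (mol n) u x = conv (mol n) u 0" for x
      by (rule DERIV_isconst_all) (use conv_DERIV[OF mol_test L(1), of n] zero in simp)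
    then have c: "conv (mol n) u = (\<lambda>x. conv (mol n) u 0)" by (intro ext)
    have "integrable lborel (\<lambda>x::real. (conv (mol n) u 0)^2)"
      using L2_sq_integrable[OF conv_L2[OF mol_test[of n] L(1)]] by (subst (asm) c)
    then have "conv (mol n) u 0 = 0"
      by (simp add: integrable_iff_bounded ennreal_mult_less_top)
    then have "conv (mol n) u = (\<lambda>x. 0)" using c by simp
    then show ?thesis by simp
  qed
  moreover have "(\<lambda>n. nrm (conv (mol n) u)) \<longlonglongrightarrow> nrm u"
    by (rule nrm_tendsto[OF conv_L2[OF mol_test L(1)] L(1) mol_conv_tendsto[OF L(1)]])
  ultimately have "nrm u = 0" using LIMSEQ_unique[OF _ tendsto_const] by fastforce
  then show False using pos by simp
qed

context ground
begin

lemma phi_pos: "nrm \<phi> > 0"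
proof (rule ccontr)
  assume "\<not> nrm \<phi> > 0"
  then have z: "nrm \<phi> = 0" using nrm_nonneg[of \<phi>] by linarith
  have "0 \<le> nrm \<phi> + nrm \<phi>1" by (simp add: add_nonneg_nonneg)
  then obtain C where C: "lbound (nrm \<phi> + nrm \<phi>1) C" using lbound_exists by blast
  have "\<bar>Phi \<phi> - Phi (\<lambda>x. 0)\<bar> \<le> C * ((nrm \<phi> + nrm (\<lambda>x. 0)) * nrm (\<lambda>x. \<phi> x - 0))"
    by (rule Phi_diff_le[OF C W2D(3)[OF W] phi_bound L2_zero]) (simp add: add_nonneg_nonneg)
  then have "Phi \<phi> = 0" using z by (simp add: Phi_def F_0)
  then show False using K_pos by (simp add: Kfun_Phi)
qed

text \<open>L2 convergence of the direction suffices even for the term with \<open>f1\<close>,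
  because \<open>\<phi>\<close>, and with it \<open>f1 (\<phi> x)\<close>, is bounded.\<close>

lemma hess_tendsto:
  assumes h: "\<And>n::nat. L2 (h n)" "\<And>n. L2 (h1 n)" "\<And>n. L2 (h2 n)" "\<And>n. L2 (g n)"
    and L: "L2 A" "L2 A1" "L2 A2" "L2 G"
    and lim: "(\<lambda>n. nrm (\<lambda>x. h n x - A x)) \<longlonglongrightarrow> 0" "(\<lambda>n. nrm (\<lambda>x. h1 n x - A1 x)) \<longlonglongrightarrow> 0"
      "(\<lambda>n. nrm (\<lambda>x. h2 n x - A2 x)) \<longlonglongrightarrow> 0" "(\<lambda>n. nrm (\<lambda>x. g n x - G x)) \<longlonglongrightarrow> 0"
  shows "(\<lambda>n. hess \<phi> (h n) (h1 n) (h2 n) (g n)) \<longlonglongrightarrow> hess \<phi> A A1 A2 G"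
proof -
  let ?R = "nrm \<phi> + nrm \<phi>1"
  have "0 \<le> ?R" by (simp add: add_nonneg_nonneg)
  then obtain C where C: "lbound ?R C" using lbound_exists by blast
  have hs: "hess \<phi> a a1 a2 b = Iq \<beta> c a a1 a2 + (nrm (\<lambda>x. c * a x + b x))^2 - ip (\<lambda>x. f1 (\<phi> x) * a x) a" for a a1 a2 b
    by (simp add: hess_def ip_def power2_eq_square mult.assoc)
  have LF: "L2 (\<lambda>x. f1 (\<phi> x) * a x)" if "L2 a" for a
    by (rule L2_f1_mult(1)[OF C W2D(3)[OF W] phi_bound that])
  have l1: "(\<lambda>n. nrm (\<lambda>x. f1 (\<phi> x) * h n x - f1 (\<phi> x) * A x)) \<longlonglongrightarrow> 0"
  proof (rule Lim_null_comparison[OF always_eventually[OF allI]])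
    show "norm (nrm (\<lambda>x. f1 (\<phi> x) * h n x - f1 (\<phi> x) * A x)) \<le> (C * ?R) * nrm (\<lambda>x. h n x - A x)" for n
      using L2_f1_mult(2)[OF C W2D(3)[OF W] phi_bound L2_diff[OF h(1)[of n] L(1)]] by (simp add: right_diff_distrib)
    show "(\<lambda>n. C * ?R * nrm (\<lambda>x. h n x - A x)) \<longlonglongrightarrow> 0"
      using tendsto_mult_right_zero[OF lim(1)] by simp
  qed
  have l2: "(\<lambda>n. nrm (\<lambda>x. (c * h n x + g n x) - (c * A x + G x))) \<longlonglongrightarrow> 0"
  proof (rule Lim_null_comparison[OF always_eventually[OF allI]])
    show "norm (nrm (\<lambda>x. (c * h n x + g n x) - (c * A x + G x))) \<le> \<bar>c\<bar> * nrm (\<lambda>x. h n x - A x) + nrm (\<lambda>x. g n x - G x)" for n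
    proof -
      have "nrm (\<lambda>x. c * (h n x - A x) + (g n x - G x)) \<le> nrm (\<lambda>x. c * (h n x - A x)) + nrm (\<lambda>x. g n x - G x)"
        by (intro nrm_triangle L2_intros h L)
      moreover have "(\<lambda>x. (c * h n x + g n x) - (c * A x + G x)) = (\<lambda>x. c * (h n x - A x) + (g n x - G x))"
        by (simp add: algebra_simps)
      ultimately show ?thesis unfolding nrm_scale by simp
    qed
    have "(\<lambda>n. \<bar>c\<bar> * nrm (\<lambda>x. h n x - A x) + nrm (\<lambda>x. g n x - G x)) \<longlonglongrightarrow> \<bar>c\<bar> * 0 + 0"
      by (intro tendsto_intros lim)
    then show "(\<lambda>n. \<bar>c\<bar> * nrm (\<lambda>x. h n x - A x) + nrm (\<lambda>x. g n x - G x)) \<longlonglongrightarrow> 0" by simp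
  qed
  have n: "(\<lambda>n. nrm (h n)) \<longlonglongrightarrow> nrm A" "(\<lambda>n. nrm (h1 n)) \<longlonglongrightarrow> nrm A1" "(\<lambda>n. nrm (h2 n)) \<longlonglongrightarrow> nrm A2"
    by (rule nrm_tendsto[OF h(1) L(1) lim(1)], rule nrm_tendsto[OF h(2) L(2) lim(2)], rule nrm_tendsto[OF h(3) L(3) lim(3)])
  have n2: "(\<lambda>n. nrm (\<lambda>x. c * h n x + g n x)) \<longlonglongrightarrow> nrm (\<lambda>x. c * A x + G x)"
    by (rule nrm_tendsto[OF _ _ l2]) (intro L2_intros h L)+
  have i: "(\<lambda>n. ip (\<lambda>x. f1 (\<phi> x) * h n x) (h n)) \<longlonglongrightarrow> ip (\<lambda>x. f1 (\<phi> x) * A x) A"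
    by (rule ip_tendsto[OF LF[OF h(1)] h(1) LF[OF L(1)] L(1) l1 lim(1)])
  show ?thesis unfolding hs Iq_def by (intro tendsto_intros n n2 i)
qed

text \<open>The given direction is perturbed to the derivative of a pair of test functions: then every
  quantity differentiated in time is a pairing allowed by the weak formulation. A small multiple of
  \<open>\<phi>\<close> makes the last expression non-zero, which is what the modulation argument needs.\<close>
lemma test_profile:
  assumes W3: "W1 \<psi>1 y1" "W2 y1 y11 y12" and W2': "W2 \<psi>2 y2 y21"
    and orth: "ip \<phi> y2 - c * ip \<phi> y1 = 0" and neg: "hess \<phi> y1 y11 y12 y2 < 0"
  obtains Y1 Y2 where "test_fun Y1" "test_fun Y2" "ip \<phi> (deriv Y2) - c * ip \<phi> (deriv Y1) = 0"
    "hess \<phi> (deriv Y1) (deriv (deriv Y1)) (deriv (deriv (deriv Y1))) (deriv Y2) < 0"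
    "ip \<phi> (deriv (deriv Y2)) - c * ip \<phi> (deriv (deriv Y1)) > 0"
proof -
  note L\<phi> = W2D(3-5)[OF W]
  have L: "L2 \<psi>1" "L2 y1" "L2 y11" "L2 y12" "L2 \<psi>2" "L2 y2" "L2 y21"
    using W3 W2' by (auto simp: W1_def W2_def)
  have n1: "nrm \<phi>1 > 0" by (rule nrm_pos_of_deriv[OF W2D(1)[OF W] phi_pos])
  have \<phi>\<phi>1: "ip \<phi> \<phi>1 = 0"
    using W1_ip_parts[OF W2D(1)[OF W] W2D(1)[OF W]] ip_commute[of \<phi>1 \<phi>] by simp
  have \<phi>\<phi>2: "ip \<phi> \<phi>2 = - ((nrm \<phi>1)^2)"
    using W1_ip_parts[OF W2D(1)[OF W] W2D(2)[OF W]] by (simp add: nrm_sq_ip)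
  define z where "z = ip \<phi> y21 - c * ip \<phi> y11"
  \<comment> \<open>Adding \<open>\<epsilon> * \<phi>\<close> to \<open>\<psi>2\<close> keeps the
    orthogonality, since \<open>\<phi>\<close> and \<open>\<phi>1\<close> are orthogonal, and
    changes \<open>z\<close> by \<open>- \<epsilon> * (nrm \<phi>1)^2\<close>.\<close>
  let ?H = "\<lambda>\<epsilon>. hess \<phi> y1 y11 y12 (\<lambda>x. y2 x + \<epsilon> * \<phi>1 x)"
  have Heq: "?H \<epsilon> = hess \<phi> y1 y11 y12 y2 + 2 * \<epsilon> * ip (\<lambda>x. c * y1 x + y2 x) \<phi>1 + \<epsilon>^2 * (nrm \<phi>1)^2" for \<epsilon>
  proof -
    have "(nrm (\<lambda>x. c * y1 x + (y2 x + \<epsilon> * \<phi>1 x)))^2 = (nrm (\<lambda>x. (c * y1 x + y2 x) + \<epsilon> * \<phi>1 x))^2"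
      by (simp add: add.assoc)
    also have "\<dots> = (nrm (\<lambda>x. c * y1 x + y2 x))^2 + 2 * \<epsilon> * ip (\<lambda>x. c * y1 x + y2 x) \<phi>1 + \<epsilon>^2 * (nrm \<phi>1)^2"
      by (intro nrm_sq_add_scale L2_intros L L\<phi>)
    finally show ?thesis by (simp add: hess_def)
  qed
  have "((\<lambda>\<epsilon>. hess \<phi> y1 y11 y12 y2 + 2 * \<epsilon> * ip (\<lambda>x. c * y1 x + y2 x) \<phi>1 + \<epsilon>^2 * (nrm \<phi>1)^2)
     \<longlongrightarrow> hess \<phi> y1 y11 y12 y2 + 2 * 0 * ip (\<lambda>x. c * y1 x + y2 x) \<phi>1 + 0^2 * (nrm \<phi>1)^2) (at 0)"
    by (intro tendsto_intros)
  then have "(?H \<longlongrightarrow> hess \<phi> y1 y11 y12 y2) (at 0)" unfolding Heq by simp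
  then have "\<forall>\<^sub>F \<epsilon> in at 0. ?H \<epsilon> < 0" by (rule order_tendstoD) (rule neg)
  then obtain d where d: "d > 0" "\<And>\<epsilon>. \<epsilon> \<noteq> 0 \<Longrightarrow> \<bar>\<epsilon>\<bar> < d \<Longrightarrow> ?H \<epsilon> < 0"
    unfolding eventually_at by (auto simp: dist_real_def)
  \<comment> \<open>The last expression is affine and non-constant in \<open>\<epsilon>\<close>, so
    one of \<open>d / 2\<close> and \<open>d / 3\<close> is not its zero.\<close>
  have "\<exists>\<epsilon>. \<epsilon> \<noteq> 0 \<and> \<bar>\<epsilon>\<bar> < d \<and> z - \<epsilon> * (nrm \<phi>1)^2 \<noteq> 0"
  proof (cases "z - d / 2 * (nrm \<phi>1)^2 = 0")
    case True
    moreover have "d * (nrm \<phi>1)^2 > 0" using n1 d(1) by simp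
    ultimately have "z - d / 3 * (nrm \<phi>1)^2 \<noteq> 0" by simp
    then show ?thesis using d(1) by (intro exI[of _ "d / 3"]) auto
  next
    case False then show ?thesis using d(1) by (intro exI[of _ "d / 2"]) auto
  qed
  then obtain \<epsilon> where \<epsilon>: "?H \<epsilon> < 0" "z - \<epsilon> * (nrm \<phi>1)^2 \<noteq> 0" using d(2) by blast
  \<comment> \<open>The aim is a test function \<open>\<theta>\<close> whose derivative is not
    orthogonal to \<open>\<phi>\<close>. Approximation preserves the orthogonality only in the
    limit; subtracting the multiple \<open>\<tau> n\<close> of \<open>\<theta>\<close>, which tends
    to 0, restores it exactly.\<close>
  obtain \<theta>s where \<theta>s: "\<And>n::nat. test_fun (\<theta>s n)" "(\<lambda>n. nrm (\<lambda>x. \<theta>s n x - \<phi>1 x)) \<longlonglongrightarrow> 0"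
    using L2_seq[OF L\<phi>(2)] by blast
  have "(\<lambda>n. ip (\<theta>s n) \<phi>1) \<longlonglongrightarrow> ip \<phi>1 \<phi>1"
    by (rule ip_tendsto_left[OF test_L2[OF \<theta>s(1)] L\<phi>(2) L\<phi>(2) \<theta>s(2)])
  then have "\<forall>\<^sub>F n in sequentially. ip (\<theta>s n) \<phi>1 > 0"
    by (rule order_tendstoD) (use n1 in \<open>simp add: nrm_sq_ip[symmetric]\<close>)
  then obtain n0 where "ip (\<theta>s n0) \<phi>1 > 0" using eventually_happens'[OF sequentially_bot] by blast
  then obtain \<theta> where \<theta>: "test_fun \<theta>" "ip \<phi>1 \<theta> > 0" using \<theta>s(1) by (metis ip_commute)
  have \<theta>': "ip \<phi> (deriv \<theta>) \<noteq> 0"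
    using W1D(3)[OF W2D(1)[OF W]] \<theta> unfolding weak_deriv_ip by auto
  let ?UP = "\<lambda>j::nat. if j = 0 then \<psi>1 else if j = 1 then y1 else if j = 2 then y11 else y12"
  obtain P where P: "\<And>n::nat. test_fun (P n)" "\<And>j. j \<le> 3 \<Longrightarrow> (\<lambda>n. nrm (\<lambda>x. (deriv ^^ j) (P n) x - ?UP j x)) \<longlonglongrightarrow> 0"
  proof -
    have a: "L2 (?UP j)" for j using L by simp
    have b: "has_weak_deriv (?UP j) (?UP (Suc j))" if "j < 3" for j
    proof -
      have "j = 0 \<or> j = 1 \<or> j = 2" using that by auto
      then show ?thesis using W3 by (auto simp: W1_def W2_def)
    qed
    show thesis using test_seq[of 3 ?UP, OF a b] that by blast
  qed
  let ?\<psi> = "\<lambda>x. \<psi>2 x + \<epsilon> * \<phi> x" and ?y2 = "\<lambda>x. y2 x + \<epsilon> * \<phi>1 x" and ?y21 = "\<lambda>x. y21 x + \<epsilon> * \<phi>2 x"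
  have WQ: "W2 ?\<psi> ?y2 ?y21" by (rule W2_add_scale[OF W2' W])
  let ?UQ = "\<lambda>j::nat. if j = 0 then ?\<psi> else if j = 1 then ?y2 else ?y21"
  obtain Q where Q: "\<And>n::nat. test_fun (Q n)" "\<And>j. j \<le> 2 \<Longrightarrow> (\<lambda>n. nrm (\<lambda>x. (deriv ^^ j) (Q n) x - ?UQ j x)) \<longlonglongrightarrow> 0"
  proof -
    have a: "L2 (?UQ j)" for j using WQ by (simp add: W1_def W2_def)
    have b: "has_weak_deriv (?UQ j) (?UQ (Suc j))" if "j < 2" for j
    proof -
      have "j = 0 \<or> j = 1" using that by auto
      then show ?thesis using WQ by (auto simp: W1_def W2_def)
    qed
    show thesis using test_seq[of 2 ?UQ, OF a b] that by blast
  qed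
  have P1: "(\<lambda>n. nrm (\<lambda>x. deriv (P n) x - y1 x)) \<longlonglongrightarrow> 0"
    and P2: "(\<lambda>n. nrm (\<lambda>x. deriv (deriv (P n)) x - y11 x)) \<longlonglongrightarrow> 0"
    and P3: "(\<lambda>n. nrm (\<lambda>x. deriv (deriv (deriv (P n))) x - y12 x)) \<longlonglongrightarrow> 0"
    and Q1: "(\<lambda>n. nrm (\<lambda>x. deriv (Q n) x - ?y2 x)) \<longlonglongrightarrow> 0"
    and Q2: "(\<lambda>n. nrm (\<lambda>x. deriv (deriv (Q n)) x - ?y21 x)) \<longlonglongrightarrow> 0"
    using P(2)[of 1] P(2)[of 2] P(2)[of 3] Q(2)[of 1] Q(2)[of 2] by (simp_all add: eval_nat_numeral)
  have LP: "L2 (deriv (P n))" "L2 (deriv (deriv (P n)))" "L2 (deriv (deriv (deriv (P n))))"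
    "L2 (deriv (Q n))" "L2 (deriv (deriv (Q n)))" for n
    by (intro test_L2 test_deriv P Q)+
  have L\<theta>: "L2 (deriv \<theta>)" "L2 (deriv (deriv \<theta>))" by (intro test_L2 test_deriv \<theta>)+
  have Ly: "L2 ?y2" "L2 ?y21" by (intro L2_intros L L\<phi>)+
  define \<tau> where "\<tau> n = (ip \<phi> (deriv (Q n)) - c * ip \<phi> (deriv (P n))) / ip \<phi> (deriv \<theta>)" for n
  have il: "(\<lambda>n. ip \<phi> (X n)) \<longlonglongrightarrow> ip \<phi> Z" if "\<And>n. L2 (X n)" "L2 Z" "(\<lambda>n. nrm (\<lambda>x. X n x - Z x)) \<longlonglongrightarrow> 0" for X Z
    using ip_tendsto_left[OF that(1,2) L\<phi>(1) that(3)] by (simp add: ip_commute[of \<phi>])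
  have "\<tau> \<longlonglongrightarrow> (ip \<phi> ?y2 - c * ip \<phi> y1) / ip \<phi> (deriv \<theta>)"
    unfolding \<tau>_def[abs_def]
    by (intro tendsto_intros il[OF LP(4) Ly(1) Q1] il[OF LP(1) L(2) P1] \<theta>')
  moreover have "ip \<phi> ?y2 - c * ip \<phi> y1 = 0"
    using orth \<phi>\<phi>1 by (simp add: ip_add_right ip_scale_right L L\<phi> L2_scale)
  ultimately have \<tau>0: "\<tau> \<longlonglongrightarrow> 0" by simp
  let ?Y = "\<lambda>n x. Q n x + (- \<tau> n) * \<theta> x"
  have dY: "deriv (?Y n) = (\<lambda>x. deriv (Q n) x + (- \<tau> n) * deriv \<theta> x)" for n
    by (intro ext DERIV_imp_deriv DERIV_add DERIV_cmult test_DERIV Q \<theta>)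
  have ddY: "deriv (deriv (?Y n)) = (\<lambda>x. deriv (deriv (Q n)) x + (- \<tau> n) * deriv (deriv \<theta>) x)" for n
    unfolding dY by (intro ext DERIV_imp_deriv DERIV_add DERIV_cmult test_DERIV test_deriv Q \<theta>)
  have tY: "test_fun (?Y n)" for n by (intro test_add test_scale Q \<theta>)
  have o: "ip \<phi> (deriv (?Y n)) - c * ip \<phi> (deriv (P n)) = 0" for n
  proof -
    have "ip \<phi> (deriv (?Y n)) = ip \<phi> (deriv (Q n)) - \<tau> n * ip \<phi> (deriv \<theta>)"
      unfolding dY by (simp only: ip_add_right ip_scale_right L2_scale LP L\<theta> L\<phi>)
    then show ?thesis using \<theta>' by (simp add: \<tau>_def)
  qed
  have Ylim: "(\<lambda>n. nrm (\<lambda>x. deriv (?Y n) x - ?y2 x)) \<longlonglongrightarrow> 0"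
  proof (rule Lim_null_comparison[OF always_eventually[OF allI]])
    show "norm (nrm (\<lambda>x. deriv (?Y n) x - ?y2 x)) \<le> nrm (\<lambda>x. deriv (Q n) x - ?y2 x) + \<bar>\<tau> n\<bar> * nrm (deriv \<theta>)" for n
    proof -
      have "nrm (\<lambda>x. (deriv (Q n) x - ?y2 x) + (- \<tau> n) * deriv \<theta> x) \<le> nrm (\<lambda>x. deriv (Q n) x - ?y2 x) + nrm (\<lambda>x. (- \<tau> n) * deriv \<theta> x)"
        by (intro nrm_triangle L2_intros LP L\<theta> L L\<phi>)
      moreover have "(\<lambda>x. deriv (?Y n) x - ?y2 x) = (\<lambda>x. (deriv (Q n) x - ?y2 x) + (- \<tau> n) * deriv \<theta> x)"
        unfolding dY by (simp add: algebra_simps)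
      ultimately show ?thesis unfolding nrm_scale by simp
    qed
    have "(\<lambda>n. nrm (\<lambda>x. deriv (Q n) x - ?y2 x) + \<bar>\<tau> n\<bar> * nrm (deriv \<theta>)) \<longlonglongrightarrow> 0 + \<bar>0\<bar> * nrm (deriv \<theta>)"
      by (intro tendsto_intros Q1 \<tau>0)
    then show "(\<lambda>n. nrm (\<lambda>x. deriv (Q n) x - ?y2 x) + \<bar>\<tau> n\<bar> * nrm (deriv \<theta>)) \<longlonglongrightarrow> 0" by simp
  qed
  have h: "(\<lambda>n. hess \<phi> (deriv (P n)) (deriv (deriv (P n))) (deriv (deriv (deriv (P n)))) (deriv (?Y n))) \<longlonglongrightarrow> ?H \<epsilon>"
    by (rule hess_tendsto[OF LP(1-3) test_L2[OF test_deriv[OF tY]] L(2-4) Ly(1) P1 P2 P3 Ylim])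
  have g: "(\<lambda>n. ip \<phi> (deriv (deriv (?Y n))) - c * ip \<phi> (deriv (deriv (P n)))) \<longlonglongrightarrow> z - \<epsilon> * (nrm \<phi>1)^2"
  proof -
    have e: "ip \<phi> (deriv (deriv (?Y n))) = ip \<phi> (deriv (deriv (Q n))) - \<tau> n * ip \<phi> (deriv (deriv \<theta>))" for n
      unfolding ddY by (simp only: ip_add_right ip_scale_right L2_scale LP L\<theta> L\<phi>)
    have "(\<lambda>n. (ip \<phi> (deriv (deriv (Q n))) - \<tau> n * ip \<phi> (deriv (deriv \<theta>))) - c * ip \<phi> (deriv (deriv (P n))))
      \<longlonglongrightarrow> (ip \<phi> ?y21 - 0 * ip \<phi> (deriv (deriv \<theta>))) - c * ip \<phi> y11"
      by (intro tendsto_intros il[OF LP(5) Ly(2) Q2] il[OF LP(2) L(3) P2] \<tau>0)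
    moreover have "(ip \<phi> ?y21 - 0 * ip \<phi> (deriv (deriv \<theta>))) - c * ip \<phi> y11 = z - \<epsilon> * (nrm \<phi>1)^2"
      using \<phi>\<phi>2 by (simp add: z_def ip_add_right ip_scale_right L L\<phi> L2_scale)
    ultimately show ?thesis unfolding e by simp
  qed
  have "\<forall>\<^sub>F n in sequentially. hess \<phi> (deriv (P n)) (deriv (deriv (P n))) (deriv (deriv (deriv (P n)))) (deriv (?Y n)) < 0"
    by (rule order_tendstoD(2)[OF h \<epsilon>(1)])
  moreover have "\<forall>\<^sub>F n in sequentially. ip \<phi> (deriv (deriv (?Y n))) - c * ip \<phi> (deriv (deriv (P n))) \<noteq> 0"
    by (rule tendsto_imp_eventually_ne[OF g \<epsilon>(2)])
  ultimately have "\<forall>\<^sub>F n in sequentially. hess \<phi> (deriv (P n)) (deriv (deriv (P n))) (deriv (deriv (deriv (P n)))) (deriv (?Y n)) < 0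
     \<and> ip \<phi> (deriv (deriv (?Y n))) - c * ip \<phi> (deriv (deriv (P n))) \<noteq> 0" by (rule eventually_conj)
  then obtain n where n: "hess \<phi> (deriv (P n)) (deriv (deriv (P n))) (deriv (deriv (deriv (P n)))) (deriv (?Y n)) < 0"
     "ip \<phi> (deriv (deriv (?Y n))) - c * ip \<phi> (deriv (deriv (P n))) \<noteq> 0"
    using eventually_happens'[OF sequentially_bot] by blast
  define A B where "A = P n" and "B = ?Y n"
  have AB: "test_fun A" "test_fun B" "ip \<phi> (deriv B) - c * ip \<phi> (deriv A) = 0"
    "hess \<phi> (deriv A) (deriv (deriv A)) (deriv (deriv (deriv A))) (deriv B) < 0"
    "ip \<phi> (deriv (deriv B)) - c * ip \<phi> (deriv (deriv A)) \<noteq> 0"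
    unfolding A_def B_def by (rule P(1), rule tY, rule o, rule n(1), rule n(2))
  show thesis
  proof (cases "ip \<phi> (deriv (deriv B)) - c * ip \<phi> (deriv (deriv A)) > 0")
    case True then show thesis using that[OF AB(1-4)] by blast
  next
    case False
    \<comment> \<open>Changing the sign of both profiles leaves the orthogonality and the quadratic
      form as they are and reverses the last expression.\<close>
    have m: "deriv (\<lambda>x. - X x) = (\<lambda>x. - deriv X x)" if "test_fun X" for X
      by (intro ext DERIV_imp_deriv DERIV_minus test_DERIV that)
    have tm: "test_fun (\<lambda>x. - X x)" if "test_fun X" for X using test_scale[OF that, of "-1"] by simp
    have nm: "nrm (\<lambda>x. - (c * deriv A x) - deriv B x) = nrm (\<lambda>x. c * deriv A x + deriv B x)"
      using nrm_minus[of "\<lambda>x. c * deriv A x + deriv B x"] by simp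
    have d: "deriv (\<lambda>x. - A x) = (\<lambda>x. - deriv A x)" "deriv (\<lambda>x. - deriv A x) = (\<lambda>x. - deriv (deriv A) x)"
      "deriv (\<lambda>x. - deriv (deriv A) x) = (\<lambda>x. - deriv (deriv (deriv A)) x)"
      "deriv (\<lambda>x. - B x) = (\<lambda>x. - deriv B x)" "deriv (\<lambda>x. - deriv B x) = (\<lambda>x. - deriv (deriv B) x)"
      by (intro m test_deriv AB)+
    have hm: "hess \<phi> (\<lambda>x. - deriv A x) (\<lambda>x. - deriv (deriv A) x) (\<lambda>x. - deriv (deriv (deriv A)) x) (\<lambda>x. - deriv B x)
       = hess \<phi> (deriv A) (deriv (deriv A)) (deriv (deriv (deriv A))) (deriv B)"
      by (simp add: hess_def Iq_def nrm_minus nm)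
    show thesis
      by (rule that[OF tm[OF AB(1)] tm[OF AB(2)]]; unfold d hm ip_minus_right; use AB False in linarith)
  qed
qed

end

section \<open>Modulation\<close>

lemma steep_lower:
  fixes G G2 :: rfun
  assumes d: "\<And>x. (G has_real_derivative G2 x) (at x)"
    and s: "\<And>x. \<bar>x - r\<bar> \<le> \<delta> \<Longrightarrow> \<kappa> \<le> G2 x" and xy: "x \<le> y" "\<bar>x - r\<bar> \<le> \<delta>" "\<bar>y - r\<bar> \<le> \<delta>"
  shows "G x + \<kappa> * (y - x) \<le> G y"
proof -
  have "G x - \<kappa> * x \<le> G y - \<kappa> * y"
  proof (rule DERIV_nonneg_imp_nondecreasing[OF xy(1)])
    fix z assume z: "x \<le> z" "z \<le> y"
    have "((\<lambda>x. G x - \<kappa> * x) has_real_derivative G2 z - \<kappa>) (at z)"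
      by (auto intro!: derivative_eq_intros d)
    moreover have "0 \<le> G2 z - \<kappa>" using s[of z] z xy by (simp add: abs_le_iff)
    ultimately show "\<exists>y. ((\<lambda>x. G x - \<kappa> * x) has_real_derivative y) (at z) \<and> 0 \<le> y" by blast
  qed
  then show ?thesis by (simp add: algebra_simps)
qed

text \<open>In place of an implicit function theorem: with slope at least \<open>\<kappa>\<close>
  the function reaches 0 within \<open>\<bar>G r\<bar> / \<kappa>\<close>, and the hypothesis on
  \<open>G r\<close> keeps this inside the zone where the slope is known. The explicit distance
  later bounds the motion of the translation parameter.\<close>

lemma steep_zero:
  fixes G G2 :: rfun
  assumes d: "\<And>x. (G has_real_derivative G2 x) (at x)"
    and s: "\<And>x. \<bar>x - r\<bar> \<le> \<delta> \<Longrightarrow> \<kappa> \<le> G2 x" and \<kappa>: "\<kappa> > 0" and G: "\<bar>G r\<bar> \<le> \<kappa> * \<delta>"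
  shows "\<exists>x. \<bar>x - r\<bar> \<le> \<bar>G r\<bar> / \<kappa> \<and> G x = 0"
proof -
  define e where "e = \<bar>G r\<bar> / \<kappa>"
  have e: "0 \<le> e" "e \<le> \<delta>" "\<kappa> * e = \<bar>G r\<bar>"
    using \<kappa> G by (simp_all add: e_def pos_divide_le_eq mult.commute)
  have "G r + \<kappa> * (r + e - r) \<le> G (r + e)"
    by (rule steep_lower[OF d s]) (use e in auto)
  moreover have "G (r - e) + \<kappa> * (r - (r - e)) \<le> G r"
    by (rule steep_lower[OF d s]) (use e in auto)
  ultimately have "G (r - e) \<le> 0" "0 \<le> G (r + e)" using e(3) by auto
  moreover have "continuous_on {r - e..r + e} G"
    using d by (meson DERIV_isCont continuous_at_imp_continuous_on)
  ultimately obtain x where "x \<ge> r - e" "x \<le> r + e" "G x = 0"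
    using IVT'[of G "r - e" 0 "r + e"] e by auto
  then show ?thesis unfolding e_def[symmetric] by (intro exI[of _ x]) (auto simp: abs_le_iff)
qed

lemma steep_unique:
  fixes G G2 :: rfun
  assumes d: "\<And>x. (G has_real_derivative G2 x) (at x)"
    and s: "\<And>x. \<bar>x - r\<bar> \<le> \<delta> \<Longrightarrow> \<kappa> \<le> G2 x" and \<kappa>: "\<kappa> > 0"
    and x: "\<bar>x - r\<bar> \<le> \<delta>" "\<bar>y - r\<bar> \<le> \<delta>" "G x = 0" "G y = 0"
  shows "x = y"
proof (rule ccontr)
  have *: False if "a < b" "\<bar>a - r\<bar> \<le> \<delta>" "\<bar>b - r\<bar> \<le> \<delta>" "G a = 0" "G b = 0" for a b
  proof -
    have "G a + \<kappa> * (b - a) \<le> G b" by (rule steep_lower[OF d s]) (use that in auto)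
    moreover have "\<kappa> * (b - a) > 0" using that \<kappa> by simp
    ultimately show False using that by simp
  qed
  assume "x \<noteq> y"
  then have "x < y \<or> y < x" by linarith
  then show False using *[of x y] *[of y x] x by auto
qed

definition pr :: "rfun \<Rightarrow> rfun \<Rightarrow> real \<Rightarrow> real" where
  "pr \<theta> a r = ip a (\<lambda>x. \<theta> (x + r))"

lemma pr_bound: "test_fun \<theta> \<Longrightarrow> L2 a \<Longrightarrow> \<bar>pr \<theta> a r\<bar> \<le> nrm a * nrm \<theta>"
  unfolding pr_def using Cauchy_Schwarz_ip[of a "\<lambda>x. \<theta> (x + r)"] by (simp add: L2_shift test_L2 nrm_shift)

lemma pr_diff: "test_fun \<theta> \<Longrightarrow> L2 a \<Longrightarrow> L2 b \<Longrightarrow> pr \<theta> (\<lambda>x. a x - b x) r = pr \<theta> a r - pr \<theta> b r"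
  unfolding pr_def by (simp add: ip_diff_left L2_shift test_L2)

text \<open>As a function of the translation the pairing is a convolution with the reflected test
  function, read at \<open>- r\<close>; so it is differentiable for every square integrable
  \<open>a\<close>.\<close>

lemma pr_DERIV:
  assumes t: "test_fun \<theta>" and a: "L2 a"
  shows "(pr \<theta> a has_real_derivative pr (deriv \<theta>) a r) (at r)"
proof -
  let ?\<kappa> = "\<lambda>z. \<theta> (0 - z)"
  have k: "test_fun ?\<kappa>" by (rule test_reflect[OF t])
  have e: "pr \<theta> a = (\<lambda>r. conv ?\<kappa> a (- r))"
    by (intro ext) (simp add: pr_def conv_ip add.commute)
  have "((\<lambda>r. conv ?\<kappa> a (- r)) has_real_derivative conv (deriv ?\<kappa>) a (- r) * (- 1)) (at r)"
    by (rule DERIV_chain2[OF conv_DERIV[OF k a]]) (auto intro!: derivative_eq_intros)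
  moreover have "conv (deriv ?\<kappa>) a (- r) * (- 1) = pr (deriv \<theta>) a r"
    unfolding deriv_reflect[OF t] by (simp add: pr_def conv_ip ip_minus_right add.commute)
  ultimately show ?thesis unfolding e by simp
qed

lemma deriv_n_shift:
  "test_fun \<theta> \<Longrightarrow> (deriv ^^ n) (\<lambda>x. \<theta> (x + r)) = (\<lambda>x. (deriv ^^ n) \<theta> (x + r))"
  by (induction n) (simp_all add: deriv_shift test_deriv_n)

text \<open>By \<open>orth\<close> the ground state at translation 0 is a critical point of its
  pairing as a function of the translation, and by \<open>nondeg\<close> a non-degenerate
  one.\<close>

locale modul = ground +
  fixes Y1 Y2 :: rfun
  assumes tY1: "test_fun Y1" and tY2: "test_fun Y2"
    and orth: "ip \<phi> (deriv Y2) - c * ip \<phi> (deriv Y1) = 0"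
    and neg: "hess \<phi> (deriv Y1) (deriv (deriv Y1)) (deriv (deriv (deriv Y1))) (deriv Y2) < 0"
    and nondeg: "ip \<phi> (deriv (deriv Y2)) - c * ip \<phi> (deriv (deriv Y1)) > 0"
begin

definition "\<gamma> = ip \<phi> (deriv (deriv Y2)) - c * ip \<phi> (deriv (deriv Y1))"

lemma \<gamma>_pos: "\<gamma> > 0" using nondeg by (simp add: \<gamma>_def)

text \<open>\<open>Lf 0\<close> is the pairing called \<open>A\<close> at the top, and \<open>Lf j\<close> its \<open>j\<close>-th derivative in the translation parameter.\<close>
definition Lf :: "nat \<Rightarrow> rfun \<Rightarrow> rfun \<Rightarrow> real \<Rightarrow> real" where
  "Lf j a b r = pr ((deriv ^^ j) Y2) a r + pr ((deriv ^^ j) Y1) b r"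

lemma tY: "test_fun ((deriv ^^ j) Y1)" "test_fun ((deriv ^^ j) Y2)"
  by (intro test_deriv_n tY1 tY2)+

lemma Lf_DERIV: "L2 a \<Longrightarrow> L2 b \<Longrightarrow> (Lf j a b has_real_derivative Lf (Suc j) a b r) (at r)"
  unfolding Lf_def[abs_def] using pr_DERIV[OF tY(2), of a j r] pr_DERIV[OF tY(1), of b j r]
  by (auto intro: DERIV_add)

definition "nY j = nrm ((deriv ^^ j) Y1) + nrm ((deriv ^^ j) Y2)"

lemma nY_nonneg: "0 \<le> nY j" by (simp add: nY_def add_nonneg_nonneg)

lemma Lf_bound:
  assumes "L2 a" "L2 b"
  shows "\<bar>Lf j a b r\<bar> \<le> (nrm a + nrm b) * nY j"
proof -
  have "\<bar>Lf j a b r\<bar> \<le> nrm a * nrm ((deriv ^^ j) Y2) + nrm b * nrm ((deriv ^^ j) Y1)"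
    unfolding Lf_def using pr_bound[OF tY(2) assms(1), of j r] pr_bound[OF tY(1) assms(2), of j r] by linarith
  also have "\<dots> \<le> (nrm a + nrm b) * nY j"
    by (simp add: nY_def algebra_simps)
  finally show ?thesis .
qed

lemma Lf_diff:
  assumes "L2 a" "L2 b" "L2 a'" "L2 b'"
  shows "Lf j (\<lambda>x. a x - a' x) (\<lambda>x. b x - b' x) r = Lf j a b r - Lf j a' b' r"
  using assms by (simp add: Lf_def pr_diff tY)

abbreviation "phr r \<equiv> (\<lambda>x. \<phi> (x + r))"
abbreviation "phv r \<equiv> (\<lambda>x. - c * \<phi> (x + r))"

lemma L2_phr: "L2 (phr r)" "L2 (\<lambda>x. \<phi>1 (x + r))" "L2 (phv r)"
  by (intro L2_shift L2_scale W2D[OF W])+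

text \<open>State and profile are translated together, so the value does not depend on
  \<open>r\<close>; this is why the constants below are uniform along the orbit.\<close>

lemma Lf_base: "Lf j (phr r) (phv r) r = ip \<phi> ((deriv ^^ j) Y2) - c * ip \<phi> ((deriv ^^ j) Y1)"
proof -
  have "pr ((deriv ^^ j) Y2) (phr r) r = ip \<phi> ((deriv ^^ j) Y2)" "pr ((deriv ^^ j) Y1) (phv r) r = - c * ip \<phi> ((deriv ^^ j) Y1)"
    unfolding pr_def ip_scale_left ip_shift by simp_all
  then show ?thesis by (simp add: Lf_def)
qed

lemma Lf_base1: "Lf 1 (phr r) (phv r) r = 0" and Lf_base2: "Lf 2 (phr r) (phv r) r = \<gamma>"
  unfolding Lf_base using orth by (simp_all add: \<gamma>_def eval_nat_numeral)

text \<open>Second derivatives are not compared: the sup norm, the potential and the pairings are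
  all controlled by these three distances.\<close>

definition cl :: "real \<Rightarrow> rfun \<Rightarrow> rfun \<Rightarrow> rfun \<Rightarrow> real \<Rightarrow> bool" where
  "cl \<epsilon> a a1 b r \<longleftrightarrow> nrm (\<lambda>x. a x - \<phi> (x + r)) < \<epsilon> \<and> nrm (\<lambda>x. a1 x - \<phi>1 (x + r)) < \<epsilon>
     \<and> nrm (\<lambda>x. b x - - c * \<phi> (x + r)) < \<epsilon>"

text \<open>What a neighbourhood of the orbit has to provide: the comparison of the action with its
  slope, strict convexity of the pairing in the translation over a distance \<open>\<delta>\<close>,
  and separation of translates. The factor 2 arises because two translates close to one state are
  within \<open>2 * \<epsilon>\<close> of each other.\<close>

definition tube :: "real \<Rightarrow> real \<Rightarrow> bool" where
  "tube \<epsilon> \<delta> \<longleftrightarrow> 0 < \<epsilon> \<and> \<epsilon> \<le> 1 \<and> 0 < \<delta> \<and>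
    (\<forall>a a1 a2 b r. W2 a a1 a2 \<longrightarrow> L2 b \<longrightarrow> cl \<epsilon> a a1 b r \<longrightarrow>
       (\<exists>s. \<bar>s\<bar> \<le> 1 \<and> dlevel \<le> action a b + s * daction a a1 a2 b
          (\<lambda>x. deriv Y1 (x + r)) (\<lambda>x. deriv (deriv Y1) (x + r)) (\<lambda>x. deriv (deriv (deriv Y1)) (x + r)) (\<lambda>x. deriv Y2 (x + r)))) \<and>
    (\<forall>a a1 b r r'. L2 a \<longrightarrow> L2 b \<longrightarrow> cl \<epsilon> a a1 b r \<longrightarrow> \<bar>r' - r\<bar> \<le> \<delta> \<longrightarrow> \<gamma> / 2 \<le> Lf 2 a b r') \<and>
    (\<forall>r r'. nrm (\<lambda>x. \<phi> (x + r) - \<phi> (x + r')) < 2 * \<epsilon> \<longrightarrow> \<bar>r - r'\<bar> < \<delta>)"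

lemma cl_mono: "cl \<epsilon> a a1 b r \<Longrightarrow> \<epsilon> \<le> \<epsilon>' \<Longrightarrow> cl \<epsilon>' a a1 b r"
  by (auto simp: cl_def)

lemma cl_norms:
  assumes "cl \<epsilon> a a1 b r" "\<epsilon> \<le> 1" "L2 a" "L2 b"
  shows "nrm a + nrm b \<le> (1 + \<bar>c\<bar>) * nrm \<phi> + 2"
proof -
  have "nrm (phv r) = \<bar>c\<bar> * nrm \<phi>" using nrm_scale[of "- c" "phr r"] by (simp add: nrm_shift)
  moreover have "nrm (phr r) = nrm \<phi>" by (rule nrm_shift)
  ultimately show ?thesis
    using nrm_le_diff[OF assms(3) L2_phr(1)[of r]] nrm_le_diff[OF assms(4) L2_phr(3)[of r]] assms(1,2)
    by (simp add: cl_def algebra_simps)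
qed

lemma tube_exists: "\<exists>\<epsilon> \<delta>. tube \<epsilon> \<delta>"
proof -
  obtain B where B: "\<And>x. \<bar>deriv Y1 x\<bar> \<le> B" using test_bounded[OF test_deriv[OF tY1]] by blast
  obtain \<epsilon>s where \<epsilon>s: "\<epsilon>s > 0" "\<And>u u1 u2 v r. W2 u u1 u2 \<Longrightarrow> L2 v \<Longrightarrow>
      nrm (\<lambda>x. u x - \<phi> (x + r)) \<le> \<epsilon>s \<Longrightarrow> nrm (\<lambda>x. u1 x - \<phi>1 (x + r)) \<le> \<epsilon>s \<Longrightarrow>
      \<exists>s. \<bar>s\<bar> \<le> 1 \<and> dlevel \<le> action u v + s * daction u u1 u2 v
        (\<lambda>x. deriv Y1 (x + r)) (\<lambda>x. deriv (deriv Y1) (x + r)) (\<lambda>x. deriv (deriv (deriv Y1)) (x + r)) (\<lambda>x. deriv Y2 (x + r))"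
    using slope_bound[OF W2_test[OF test_deriv[OF tY1]] B test_L2[OF test_deriv[OF tY2]] neg] by blast
  define M where "M = (1 + \<bar>c\<bar>) * nrm \<phi> + 2"
  have M: "M > 0" by (simp add: M_def add_nonneg_pos)
  \<comment> \<open>\<open>M * nY 3\<close> is a Lipschitz constant of \<open>Lf 2\<close> in the
    translation, so that over a distance \<open>\<delta>\<close> it loses at most
    \<open>\<gamma> / 4\<close>; the bound on \<open>\<epsilon>\<close> allows for another
    \<open>\<gamma> / 4\<close>.\<close>
  define \<delta> where "\<delta> = \<gamma> / (4 * (M * nY 3 + 1))"
  have d0: "M * nY 3 + 1 > 0" using M nY_nonneg[of 3] by (simp add: add_nonneg_pos)
  have \<delta>: "\<delta> > 0" using \<gamma>_pos d0 by (simp add: \<delta>_def)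
  obtain es where es: "es > 0" "\<And>h. nrm (\<lambda>x. \<phi> (x + h) - \<phi> x) < es \<Longrightarrow> \<bar>h\<bar> < \<delta>"
    using shift_separation[OF W2D(3)[OF W] phi_pos \<delta>] by blast
  define \<epsilon> where "\<epsilon> = min (min 1 \<epsilon>s) (min (es / 2) (\<gamma> / (8 * (nY 2 + 1))))"
  have n2: "nY 2 + 1 > 0" using nY_nonneg[of 2] by simp
  have \<epsilon>: "\<epsilon> > 0" "\<epsilon> \<le> 1" "\<epsilon> \<le> \<epsilon>s" "2 * \<epsilon> \<le> es" "\<epsilon> \<le> \<gamma> / (8 * (nY 2 + 1))"
    using \<epsilon>s(1) es(1) \<gamma>_pos n2 by (simp_all add: \<epsilon>_def)
  have zone: "\<gamma> / 2 \<le> Lf 2 a b r'" if L: "L2 a" "L2 b" and a: "cl \<epsilon> a a1 b r" and r: "\<bar>r' - r\<bar> \<le> \<delta>" for a a1 b r r'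
  proof -
    let ?a = "\<lambda>x. a x - phr r x" and ?b = "\<lambda>x. b x - phv r x"
    have "\<bar>Lf 2 a b r - \<gamma>\<bar> = \<bar>Lf 2 ?a ?b r\<bar>" using Lf_diff[OF L L2_phr(1,3), of 2 r r] Lf_base2[of r] by simp
    also have "\<dots> \<le> (nrm ?a + nrm ?b) * nY 2" by (intro Lf_bound L2_diff L L2_phr)
    also have "\<dots> \<le> (2 * \<epsilon>) * nY 2" using a nY_nonneg by (intro mult_right_mono) (auto simp: cl_def)
    also have "\<dots> \<le> (2 * \<epsilon>) * (nY 2 + 1)" using \<epsilon>(1) by (intro mult_left_mono) auto
    also have "\<dots> \<le> \<gamma> / 4" using \<epsilon>(5) n2 by (simp add: pos_le_divide_eq algebra_simps)
    finally have 1: "\<bar>Lf 2 a b r - \<gamma>\<bar> \<le> \<gamma> / 4" .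
    have "\<bar>Lf 2 a b r' - Lf 2 a b r\<bar> \<le> (M * nY 3) * \<bar>r' - r\<bar>"
    proof (rule lipschitz_of_deriv_bound[where S = UNIV and f' = "Lf 3 a b"])
      show "(Lf 2 a b has_real_derivative Lf 3 a b x) (at x within UNIV)" for x
        using Lf_DERIV[OF L, of 2 x] by (simp add: eval_nat_numeral)
      have "nrm a + nrm b \<le> M" using cl_norms[OF a \<epsilon>(2) L] by (simp add: M_def)
      then have "(nrm a + nrm b) * nY 3 \<le> M * nY 3" using nY_nonneg by (intro mult_right_mono)
      then show "\<bar>Lf 3 a b x\<bar> \<le> M * nY 3" for x using Lf_bound[OF L, of 3 x] by linarith
    qed auto
    also have "\<dots> \<le> (M * nY 3 + 1) * \<delta>" using r M nY_nonneg[of 3] by (intro mult_mono) auto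
    also have "\<dots> = \<gamma> / 4"
    proof -
      have "n * (\<gamma> / (4 * n)) = \<gamma> / 4" if "n > 0" for n :: real using that by simp
      then show ?thesis unfolding \<delta>_def using d0 by blast
    qed
    finally show ?thesis using 1 by linarith
  qed
  have sep: "\<bar>r - r'\<bar> < \<delta>" if "nrm (\<lambda>x. \<phi> (x + r) - \<phi> (x + r')) < 2 * \<epsilon>" for r r'
  proof (rule es(2))
    have "nrm (\<lambda>x. \<phi> (x + (r - r')) - \<phi> x) = nrm (\<lambda>x. \<phi> (x + r) - \<phi> (x + r'))"
      using nrm_shift[of "\<lambda>x. \<phi> (x + (r - r')) - \<phi> x" r'] by simp
    then show "nrm (\<lambda>x. \<phi> (x + (r - r')) - \<phi> x) < es" using that \<epsilon>(4) by simp
  qed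
  have "tube \<epsilon> \<delta>"
    unfolding tube_def
  proof (intro conjI allI impI)
    fix a a1 a2 b r assume "W2 a a1 a2" "L2 b" "cl \<epsilon> a a1 b r"
    then show "\<exists>s. \<bar>s\<bar> \<le> 1 \<and> dlevel \<le> action a b + s * daction a a1 a2 b
          (\<lambda>x. deriv Y1 (x + r)) (\<lambda>x. deriv (deriv Y1) (x + r)) (\<lambda>x. deriv (deriv (deriv Y1)) (x + r)) (\<lambda>x. deriv Y2 (x + r))"
      using \<epsilon>(3) by (intro \<epsilon>s(2)) (auto simp: cl_def)
  qed (use \<epsilon> \<delta> zone sep in auto)
  then show ?thesis by blast
qed

lemma phr_close:
  assumes "\<eta> > 0"
  obtains d where "d > 0" "\<And>r r'. \<bar>r - r'\<bar> < d \<Longrightarrow> cl \<eta> (phr r) (\<lambda>x. \<phi>1 (x + r)) (phv r) r'"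
proof -
  let ?e = "\<eta> / (1 + \<bar>c\<bar>)"
  have e: "?e > 0" "?e \<le> \<eta>" using assms by (simp_all add: pos_divide_le_eq add_pos_nonneg algebra_simps)
  obtain d1 where d1: "d1 > 0" "\<And>h. \<bar>h\<bar> < d1 \<Longrightarrow> nrm (\<lambda>x. \<phi> (x + h) - \<phi> x) < ?e"
    using L2_shift_continuous[OF W2D(3)[OF W] e(1)] by blast
  obtain d2 where d2: "d2 > 0" "\<And>h. \<bar>h\<bar> < d2 \<Longrightarrow> nrm (\<lambda>x. \<phi>1 (x + h) - \<phi>1 x) < ?e"
    using L2_shift_continuous[OF W2D(4)[OF W] e(1)] by blast
  show thesis
  proof (rule that[of "min d1 d2"])
    fix r r' assume r: "\<bar>r - r'\<bar> < min d1 d2"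
    have a: "nrm (\<lambda>x. \<phi> (x + r) - \<phi> (x + r')) < ?e"
      using nrm_shift[of "\<lambda>x. \<phi> (x + (r - r')) - \<phi> x" r'] d1(2)[of "r - r'"] r by simp
    have b: "nrm (\<lambda>x. \<phi>1 (x + r) - \<phi>1 (x + r')) < ?e"
      using nrm_shift[of "\<lambda>x. \<phi>1 (x + (r - r')) - \<phi>1 x" r'] d2(2)[of "r - r'"] r by simp
    have "(\<lambda>x. - c * \<phi> (x + r) - - c * \<phi> (x + r')) = (\<lambda>x. (- c) * (\<phi> (x + r) - \<phi> (x + r')))"
      by (simp add: algebra_simps)
    then have "nrm (\<lambda>x. - c * \<phi> (x + r) - - c * \<phi> (x + r')) = \<bar>c\<bar> * nrm (\<lambda>x. \<phi> (x + r) - \<phi> (x + r'))"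
      using nrm_scale[of "- c" "\<lambda>x. \<phi> (x + r) - \<phi> (x + r')"] by simp
    also have "\<dots> \<le> \<bar>c\<bar> * ?e" using a by (intro mult_left_mono) auto
    also have "\<dots> < \<eta>"
    proof -
      have "\<bar>c\<bar> * \<eta> < \<eta> * (1 + \<bar>c\<bar>)" using assms by (simp add: algebra_simps)
      then show ?thesis by (simp add: pos_divide_less_eq add_pos_nonneg)
    qed
    finally have c: "nrm (\<lambda>x. - c * \<phi> (x + r) - - c * \<phi> (x + r')) < \<eta>" .
    show "cl \<eta> (phr r) (\<lambda>x. \<phi>1 (x + r)) (phv r) r'"
      unfolding cl_def using a b c e(2) by linarith
  qed (use d1 d2 in simp)
qed

lemma cl_triangle:
  assumes "cl \<epsilon> a a1 b r" "cl \<eta> (phr r) (\<lambda>x. \<phi>1 (x + r)) (phv r) r'" "L2 a" "L2 a1" "L2 b"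
  shows "cl (\<epsilon> + \<eta>) a a1 b r'"
  unfolding cl_def
  using nrm_diff_triangle[OF assms(3) L2_phr(1)[of r] L2_phr(1)[of r']]
    nrm_diff_triangle[OF assms(4) L2_phr(2)[of r] L2_phr(2)[of r']]
    nrm_diff_triangle[OF assms(5) L2_phr(3)[of r] L2_phr(3)[of r']] assms(1,2)
  unfolding cl_def by linarith

lemma cl_near:
  assumes "cl \<epsilon> a a1 b r" "nrm (\<lambda>x. a' x - a x) < \<eta>" "nrm (\<lambda>x. a1' x - a1 x) < \<eta>" "nrm (\<lambda>x. b' x - b x) < \<eta>"
    "L2 a" "L2 a1" "L2 b" "L2 a'" "L2 a1'" "L2 b'"
  shows "cl (\<eta> + \<epsilon>) a' a1' b' r"
  unfolding cl_def
  using nrm_diff_triangle[OF assms(8,5) L2_phr(1)[of r]]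
    nrm_diff_triangle[OF assms(9,6) L2_phr(2)[of r]]
    nrm_diff_triangle[OF assms(10,7) L2_phr(3)[of r]] assms(1-4)
  unfolding cl_def by linarith

text \<open>Closeness is a strict inequality, and the room it leaves lets it persist at nearby times
  and nearby translations.\<close>

lemma cl_slack:
  assumes "cl \<epsilon> a a1 b r"
  obtains \<eta> where "\<eta> > 0" "cl (\<epsilon> - \<eta>) a a1 b r"
proof -
  let ?m = "max (nrm (\<lambda>x. a x - \<phi> (x + r))) (max (nrm (\<lambda>x. a1 x - \<phi>1 (x + r))) (nrm (\<lambda>x. b x - - c * \<phi> (x + r))))"
  have "?m < \<epsilon>" using assms by (simp add: cl_def)
  then have "(\<epsilon> - ?m) / 2 > 0" "?m < \<epsilon> - (\<epsilon> - ?m) / 2" by (simp_all add: field_simps)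
  then show thesis using that[of "(\<epsilon> - ?m) / 2"] unfolding cl_def by (simp only: max_less_iff_conj)
qed

lemma tubeD:
  assumes "tube \<epsilon> \<delta>"
  shows "0 < \<epsilon>" "\<epsilon> \<le> 1" "0 < \<delta>"
    "\<And>a a1 a2 b r. W2 a a1 a2 \<Longrightarrow> L2 b \<Longrightarrow> cl \<epsilon> a a1 b r \<Longrightarrow>
       (\<exists>s. \<bar>s\<bar> \<le> 1 \<and> dlevel \<le> action a b + s * daction a a1 a2 b
          (\<lambda>x. deriv Y1 (x + r)) (\<lambda>x. deriv (deriv Y1) (x + r)) (\<lambda>x. deriv (deriv (deriv Y1)) (x + r)) (\<lambda>x. deriv Y2 (x + r)))"
    "\<And>a a1 b r r'. L2 a \<Longrightarrow> L2 b \<Longrightarrow> cl \<epsilon> a a1 b r \<Longrightarrow> \<bar>r' - r\<bar> \<le> \<delta> \<Longrightarrow> \<gamma> / 2 \<le> Lf 2 a b r'"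
    "\<And>r r'. nrm (\<lambda>x. \<phi> (x + r) - \<phi> (x + r')) < 2 * \<epsilon> \<Longrightarrow> \<bar>r - r'\<bar> < \<delta>"
  using assms unfolding tube_def by blast+

text \<open>On the orbit \<open>Lf 1\<close> vanishes, so for a nearby state it is small at
  \<open>\<rho>\<close>, while its slope is at least \<open>\<gamma> / 2\<close>. The zero lies so
  near to \<open>\<rho>\<close> that closeness survives with \<open>\<epsilon>\<close> in place of
  \<open>\<epsilon>2\<close>.\<close>

lemma modulation_exists:
  assumes T: "tube \<epsilon> \<delta>"
  obtains \<epsilon>2 where "\<epsilon>2 > 0" "\<And>a a1 b \<rho>. L2 a \<Longrightarrow> L2 a1 \<Longrightarrow> L2 b \<Longrightarrow> cl \<epsilon>2 a a1 b \<rho> \<Longrightarrow>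
     \<exists>r. Lf 1 a b r = 0 \<and> cl \<epsilon> a a1 b r"
proof -
  note t = tubeD[OF T]
  have "\<epsilon> / 2 > 0" using t(1) by simp
  then obtain d where d: "d > 0" "\<And>r r'. \<bar>r - r'\<bar> < d \<Longrightarrow> cl (\<epsilon> / 2) (phr r) (\<lambda>x. \<phi>1 (x + r)) (phv r) r'"
    using phr_close by blast
  \<comment> \<open>\<open>\<bar>Lf 1 a b \<rho>\<bar> \<le> q\<close> puts the zero within
    \<open>\<delta>\<close> and within \<open>d / 2\<close>; half of \<open>d\<close> because a
    distance strictly below \<open>d\<close> is wanted.\<close>
  define q where "q = \<gamma> / 2 * min \<delta> (d / 2)"
  have q: "q > 0" using \<gamma>_pos t(3) d(1) by (simp add: q_def)
  define \<epsilon>2 where "\<epsilon>2 = min (\<epsilon> / 2) (q / (2 * (nY 1 + 1)))"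
  have n1: "nY 1 + 1 > 0" using nY_nonneg[of 1] by simp
  have \<epsilon>2: "\<epsilon>2 > 0" "\<epsilon>2 \<le> \<epsilon> / 2" "\<epsilon>2 \<le> q / (2 * (nY 1 + 1))"
    using t(1) q n1 unfolding \<epsilon>2_def by (simp_all only: min.cobounded1 min.cobounded2 min_less_iff_conj) simp
  show thesis
  proof (rule that[OF \<epsilon>2(1)])
    fix a a1 b \<rho> assume L: "L2 a" "L2 a1" "L2 b" and cl: "cl \<epsilon>2 a a1 b \<rho>"
    let ?a = "\<lambda>x. a x - phr \<rho> x" and ?b = "\<lambda>x. b x - phv \<rho> x"
    have "\<bar>Lf 1 a b \<rho>\<bar> = \<bar>Lf 1 ?a ?b \<rho>\<bar>" using Lf_diff[OF L(1,3) L2_phr(1,3), of 1 \<rho> \<rho>] Lf_base1[of \<rho>] by simp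
    also have "\<dots> \<le> (nrm ?a + nrm ?b) * nY 1" by (intro Lf_bound L2_diff L L2_phr)
    also have "\<dots> \<le> (2 * \<epsilon>2) * nY 1" using cl nY_nonneg by (intro mult_right_mono) (auto simp: cl_def)
    also have "\<dots> \<le> (2 * \<epsilon>2) * (nY 1 + 1)" using \<epsilon>2(1) by (intro mult_left_mono) auto
    also have "\<dots> \<le> q" using \<epsilon>2(3) n1 by (simp add: pos_le_divide_eq algebra_simps)
    finally have G: "\<bar>Lf 1 a b \<rho>\<bar> \<le> \<gamma> / 2 * min \<delta> (d / 2)" by (simp add: q_def)
    have cl': "cl \<epsilon> a a1 b \<rho>" using cl_mono[OF cl] \<epsilon>2(2) t(1) by simp
    have "\<exists>r. \<bar>r - \<rho>\<bar> \<le> \<bar>Lf 1 a b \<rho>\<bar> / (\<gamma> / 2) \<and> Lf 1 a b r = 0"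
    proof (rule steep_zero[where G = "Lf 1 a b" and \<delta> = "min \<delta> (d / 2)" and ?G2.0 = "Lf 2 a b"])
      show "\<bar>Lf 1 a b \<rho>\<bar> \<le> \<gamma> / 2 * min \<delta> (d / 2)" by (rule G)
      show "(Lf 1 a b has_real_derivative Lf 2 a b x) (at x)" for x
        using Lf_DERIV[OF L(1,3), of 1 x] by (simp add: eval_nat_numeral)
      show "\<gamma> / 2 \<le> Lf 2 a b x" if "\<bar>x - \<rho>\<bar> \<le> min \<delta> (d / 2)" for x
        using t(5)[OF L(1,3) cl', of x] that by simp
    qed (use \<gamma>_pos in simp)
    then obtain r where r: "\<bar>r - \<rho>\<bar> \<le> \<bar>Lf 1 a b \<rho>\<bar> / (\<gamma> / 2)" "Lf 1 a b r = 0" by blast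
    have "\<bar>Lf 1 a b \<rho>\<bar> / (\<gamma> / 2) \<le> min \<delta> (d / 2)"
    proof -
      have "x / g \<le> y" if "x \<le> g * y" "g > 0" for x g y :: real
        using that by (simp add: pos_divide_le_eq mult.commute)
      from this[OF G] show ?thesis using \<gamma>_pos by simp
    qed
    moreover have "min \<delta> (d / 2) < d" using d(1) by (simp add: min_less_iff_disj)
    ultimately have "\<bar>\<rho> - r\<bar> < d" using r(1) by (simp only: abs_minus_commute[of \<rho> r])
    from cl_triangle[OF cl d(2)[OF this] L] have "cl \<epsilon> a a1 b r" by (rule cl_mono) (use \<epsilon>2(2) in simp)
    then show "\<exists>r. Lf 1 a b r = 0 \<and> cl \<epsilon> a a1 b r" using r(2) by blast
  qed
qed

text \<open>Two translates of \<open>\<phi>\<close> close to the same \<open>a\<close> are close to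
  each other, so the two parameters are less than \<open>\<delta>\<close> apart, and over that
  distance \<open>Lf 1\<close> is strictly increasing.\<close>

lemma modulation_unique:
  assumes T: "tube \<epsilon> \<delta>" and L: "L2 a" "L2 b" and z: "Lf 1 a b r = 0" "Lf 1 a b r' = 0"
    and cl: "cl \<epsilon> a a1 b r" "cl \<epsilon> a a1 b r'"
  shows "r' = r"
proof -
  note t = tubeD[OF T]
  have "nrm (\<lambda>x. \<phi> (x + r') - \<phi> (x + r)) \<le> nrm (\<lambda>x. phr r' x - a x) + nrm (\<lambda>x. a x - phr r x)"
    by (rule nrm_diff_triangle[OF L2_phr(1) L(1) L2_phr(1)])
  also have "\<dots> < 2 * \<epsilon>" using cl nrm_diff_commute[of "phr r'" a] by (simp add: cl_def)
  finally have "\<bar>r' - r\<bar> < \<delta>" by (rule t(6))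
  note r' = this
  show ?thesis
  proof (rule steep_unique[where G = "Lf 1 a b" and ?G2.0 = "Lf 2 a b" and r = r and \<delta> = \<delta> and \<kappa> = "\<gamma> / 2"])
    show "(Lf 1 a b has_real_derivative Lf 2 a b x) (at x)" for x
      using Lf_DERIV[OF L, of 1 x] by (simp add: eval_nat_numeral)
    show "\<gamma> / 2 \<le> Lf 2 a b x" if "\<bar>x - r\<bar> \<le> \<delta>" for x by (rule t(5)[OF L cl(1) that])
  qed (use r' t(3) z \<gamma>_pos in auto)
qed

end

section \<open>Instability\<close>

context nonlin
begin

lemma Hform_eq:
  assumes W: "W1 \<phi> \<phi>1" and h: "W2 h (wd h) (wd (wd h))" and g: "L2 g"
  shows "Hform f \<beta> c \<phi> h g = Iq \<beta> c h (wd h) (wd (wd h)) + (nrm (\<lambda>x. c * h x + g x))^2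
     - (\<integral>x. f1 (\<phi> x) * (h x)^2 \<partial>lborel)"
proof -
  have "0 \<le> nrm \<phi> + nrm \<phi>1" by (simp add: add_nonneg_nonneg)
  then obtain C where C: "lbound (nrm \<phi> + nrm \<phi>1) C" using lbound_exists by blast
  note L = W2D(3-5)[OF h]
  have i: "integrable lborel (\<lambda>x. f1 (\<phi> x) * (h x)^2)"
    by (rule f1_sq_integrable[OF C W1D(1)[OF W] W1_sup_bound[OF W] L(1)])
  have j: "integrable lborel (\<lambda>x. (c * h x + g x)^2)" by (intro L2_sq_integrable L2_intros L g)
  show ?thesis unfolding Hform_def Iq_def nrm_sq deriv_f
    using L[THEN L2_sq_integrable] i j by simp
qed

text \<open>If \<open>K(\<phi>)\<close> vanished, so would \<open>\<phi>\<close>, and the quadratic form would be non-negative.\<close>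
lemma ground_K_pos:
  assumes c: "c^2 < 1" and \<beta>: "\<beta> < 2 * sqrt (1 - c^2)"
    and ground: "\<phi> \<in> ground_states f p \<beta> c"
    and h: "H2 h" and g: "L2 g" and neg: "Hform f \<beta> c \<phi> h g < 0"
  shows "Kfun f p \<phi> > 0"
proof (rule ccontr)
  assume "\<not> Kfun f p \<phi> > 0"
  then have I: "Ifun \<beta> c \<phi> = 0" using ground by (simp add: ground_states_def)
  have W: "W2 \<phi> (wd \<phi>) (wd (wd \<phi>))" using ground by (intro W2_wd) (simp add: ground_states_def)
  let ?q = "min (1 - c^2) (1 - c^2 - (max \<beta> 0)^2 / 4)"
  have "?q * (nrm \<phi>)^2 \<le> 0" using Iq_coercive(1)[OF c \<beta> W] I Ifun_eq[OF W] by simp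
  then have "nrm \<phi> = 0" using Iq_coercive(2)[OF c \<beta> W] by (simp only: mult_le_0_iff) auto
  from nrm_eq_0_AE[OF W2D(3)[OF W] this] have z: "AE x in lborel. \<phi> x = 0" .
  have "(\<integral>x. f1 (\<phi> x) * (h x)^2 \<partial>lborel) = (\<integral>x. 0 \<partial>(lborel :: real measure))"
  proof (rule integral_cong_AE)
    show "(\<lambda>x. f1 (\<phi> x) * (h x)^2) \<in> borel_measurable lborel"
      using L2_meas[OF W2D(3)[OF W]] L2_meas[OF W2D(3)[OF W2_wd[OF h]]] by measurable
    show "AE x in lborel. f1 (\<phi> x) * (h x)\<^sup>2 = 0" using z by eventually_elim (simp add: f1_0)
  qed simp
  moreover have "0 \<le> Iq \<beta> c h (wd h) (wd (wd h))" by (rule Iq_nonneg[OF c \<beta> W2_wd[OF h]])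
  moreover have "0 \<le> (nrm (\<lambda>x. c * h x + g x))^2" by simp
  ultimately have "0 \<le> Hform f \<beta> c \<phi> h g" unfolding Hform_eq[OF W2D(1)[OF W] W2_wd[OF h] g] by simp
  then show False using neg by simp
qed

end

context ground
begin

text \<open>A solution attains its data only up to distance 0, that is, almost everywhere; the
  action does not notice the difference.\<close>

lemma action_cong:
  assumes u: "W2 u u1 u2" "L2 v" and z: "W2 z z1 z2" "L2 y" and d: "Xdist (u, v) (z, y) = 0"
  shows "action u v = action z y"
proof -
  have n0: "nrm (\<lambda>x. u x - z x) = 0" "nrm (\<lambda>x. u1 x - z1 x) = 0" "nrm (\<lambda>x. u2 x - z2 x) = 0" "nrm (\<lambda>x. v x - y x) = 0"
    using Xdist_lower[OF u(1) z(1), of v y] d nrm_nonneg by (metis antisym)+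
  note Lu = W2D(3-5)[OF u(1)] and Lz = W2D(3-5)[OF z(1)]
  have e: "nrm a = nrm b" if "L2 a" "L2 b" "nrm (\<lambda>x. a x - b x) = 0" for a b
    using nrm_diff_abs[OF that(1,2)] that(3) by simp
  have 1: "Iq \<beta> c u u1 u2 = Iq \<beta> c z z1 z2"
    unfolding Iq_def using e[OF Lu(1) Lz(1) n0(1)] e[OF Lu(2) Lz(2) n0(2)] e[OF Lu(3) Lz(3) n0(3)] by simp
  have 2: "nrm (\<lambda>x. c * u x + v x) = nrm (\<lambda>x. c * z x + y x)"
  proof (rule e)
    have "nrm (\<lambda>x. c * (u x - z x) + (v x - y x)) \<le> nrm (\<lambda>x. c * (u x - z x)) + nrm (\<lambda>x. v x - y x)"
      by (intro nrm_triangle L2_intros Lu Lz u z)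
    also have "\<dots> = 0" unfolding nrm_scale n0 by simp
    finally have "nrm (\<lambda>x. c * (u x - z x) + (v x - y x)) = 0" using nrm_nonneg by (metis antisym)
    moreover have "(\<lambda>x. c * u x + v x - (c * z x + y x)) = (\<lambda>x. c * (u x - z x) + (v x - y x))"
      by (simp add: algebra_simps)
    ultimately show "nrm (\<lambda>x. c * u x + v x - (c * z x + y x)) = 0" by simp
  qed (intro L2_intros Lu Lz u z)+
  let ?R = "max (nrm u + nrm u1) (nrm z + nrm z1)"
  have "0 \<le> ?R" by (simp add: le_max_iff_disj add_nonneg_nonneg)
  then obtain C where C: "lbound ?R C" using lbound_exists by blast
  have "AE x in lborel. \<bar>u x\<bar> \<le> ?R" using W1_sup_bound[OF W2D(1)[OF u(1)]] by eventually_elim simp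
  moreover have "AE x in lborel. \<bar>z x\<bar> \<le> ?R" using W1_sup_bound[OF W2D(1)[OF z(1)]] by eventually_elim simp
  ultimately have "\<bar>Phi u - Phi z\<bar> \<le> C * ((nrm u + nrm z) * nrm (\<lambda>x. u x - z x))"
    by (rule Phi_diff_le[OF C Lu(1) _ Lz(1)])
  then have "Phi u = Phi z" unfolding n0 by simp
  then show ?thesis unfolding action_W2[OF u(1)] action_W2[OF z(1)] 1 2 by simp
qed

end

context modul
begin

text \<open>At the ground state the first-order term of the action vanishes by the Euler-Lagrange
  equation, so along the profile the negative second variation decides.\<close>

lemma initial_data:
  assumes d: "d > 0"
  obtains s where "action (\<lambda>x. \<phi> x + s * deriv Y1 x) (\<lambda>x. - c * \<phi> x + s * deriv Y2 x) < dlevel"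
    "Xdist (\<lambda>x. \<phi> x + s * deriv Y1 x, \<lambda>x. - c * \<phi> x + s * deriv Y2 x) (\<phi>, \<lambda>x. - c * \<phi> x) < d"
proof -
  let ?h = "deriv Y1" and ?h1 = "deriv (deriv Y1)" and ?h2 = "deriv (deriv (deriv Y1))" and ?g = "deriv Y2"
  have Wh: "W2 ?h ?h1 ?h2" by (rule W2_test[OF test_deriv[OF tY1]])
  have Lg: "L2 ?g" by (rule test_L2[OF test_deriv[OF tY2]])
  have Lv: "L2 (\<lambda>x. - c * \<phi> x)" by (rule L2_scale[OF W2D(3)[OF W]])
  obtain B where B: "B \<ge> 0" "\<And>x. \<bar>?h x\<bar> \<le> B" using test_bounded[OF test_deriv[OF tY1]] by blast
  let ?R = "nrm \<phi> + nrm \<phi>1 + B"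
  have "0 \<le> ?R" using B by (simp add: add_nonneg_nonneg)
  then obtain C where C: "lbound ?R C" using lbound_exists by blast
  have C0: "0 \<le> C" by (rule lbound_nonneg[OF C])
  define H where "H = hess \<phi> ?h ?h1 ?h2 ?g"
  have H: "H < 0" using neg by (simp add: H_def)
  define N where "N = C * B * (nrm ?h)^2 + 1"
  have N: "N > 0" using C0 B by (simp add: N_def add_nonneg_pos)
  define M where "M = nrm ?h + nrm ?h1 + nrm ?h2 + nrm ?g + 1"
  have M: "M > 0" by (simp add: M_def add_nonneg_pos)
  \<comment> \<open>The middle entry keeps the cubic term below a quarter of \<open>- H\<close>, the
    last one keeps the distance below \<open>d / 2\<close>.\<close>
  define s where "s = min 1 (min (- H / (4 * N)) (d / (2 * M)))"
  have s: "s > 0" "s \<le> 1" "s \<le> - H / (4 * N)" "s \<le> d / (2 * M)"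
    using divide_pos_pos[of "- H" "4 * N"] divide_pos_pos[of d "2 * M"] H N M d
    unfolding s_def by (simp_all only: min_less_iff_conj min.cobounded1 min_le_iff_disj order_refl) simp_all
  have sB: "\<bar>s * ?h x\<bar> \<le> B" for x
    using mult_mono[OF s(2) B(2)[of x]] s(1) by (simp add: abs_mult)
  have pb: "AE x in lborel. \<bar>\<phi> x\<bar> \<le> ?R" using phi_bound by eventually_elim (use B(1) in linarith)
  have ps: "AE x in lborel. \<bar>\<phi> x + s * ?h x\<bar> \<le> ?R"
    using phi_bound
  proof eventually_elim
    case (elim x) then show ?case using sB[of x] by linarith
  qed
  have d0: "daction \<phi> \<phi>1 \<phi>2 (\<lambda>x. - c * \<phi> x) ?h ?h1 ?h2 ?g = 0"
    unfolding daction_def using Euler_Lagrange[OF Wh] by (simp add: ip_def)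
  have "action (\<lambda>x. \<phi> x + s * ?h x) (\<lambda>x. - c * \<phi> x + s * ?g x) \<le> action \<phi> (\<lambda>x. - c * \<phi> x)
     + s * daction \<phi> \<phi>1 \<phi>2 (\<lambda>x. - c * \<phi> x) ?h ?h1 ?h2 ?g
     + s^2 * (hess \<phi> ?h ?h1 ?h2 ?g / 2 + (C * B * nrm ?h * nrm (\<lambda>x. \<phi> x - \<phi> x) / 2 + C * B * \<bar>s\<bar> * (nrm ?h)^2))"
    by (rule action_expansion[OF W pb Lv Wh B(2) Lg ps W2D(3)[OF W] pb C])
  then have 1: "action (\<lambda>x. \<phi> x + s * ?h x) (\<lambda>x. - c * \<phi> x + s * ?g x) \<le> dlevel + s^2 * (H / 2 + C * B * s * (nrm ?h)^2)"
    unfolding action_ground d0 using s(1) by (simp add: H_def)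
  have "s * (4 * N) \<le> - H" using s(3) pos_le_divide_eq[of "4 * N" s "- H"] N by linarith
  then have "4 * (C * B * s * (nrm ?h)^2) + 4 * s \<le> - H" by (simp add: N_def algebra_simps)
  then have "H / 2 + C * B * s * (nrm ?h)^2 < 0" using H s(1) by linarith
  then have "s^2 * (H / 2 + C * B * s * (nrm ?h)^2) < 0" using s(1) by (intro mult_pos_neg) auto
  then have a: "action (\<lambda>x. \<phi> x + s * ?h x) (\<lambda>x. - c * \<phi> x + s * ?g x) < dlevel" using 1 by linarith
  have "Xdist (\<lambda>x. \<phi> x + s * ?h x, \<lambda>x. - c * \<phi> x + s * ?g x) (\<phi>, \<lambda>x. - c * \<phi> x)
    \<le> nrm (\<lambda>x. \<phi> x + s * ?h x - \<phi> x) + nrm (\<lambda>x. \<phi>1 x + s * ?h1 x - \<phi>1 x) + nrm (\<lambda>x. \<phi>2 x + s * ?h2 x - \<phi>2 x)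
      + nrm (\<lambda>x. - c * \<phi> x + s * ?g x - - c * \<phi> x)"
    by (rule Xdist_upper[OF W2_add_scale[OF W Wh] W])
  also have "\<dots> = s * (nrm ?h + nrm ?h1 + nrm ?h2 + nrm ?g)"
    using s(1) by (simp add: nrm_scale distrib_left)
  also have "\<dots> < s * M" using s(1) by (intro mult_strict_left_mono) (auto simp: M_def)
  also have "\<dots> \<le> d / 2" using s(4) M by (simp add: pos_le_divide_eq)
  also have "\<dots> < d" using d by simp
  finally show thesis using that a by blast
qed

end

locale modul_soln = modul f f1 f2 p \<beta> c \<phi> \<phi>1 \<phi>2 Y1 Y2 + soln f f1 f2 \<beta> w0 w
  for f f1 f2 p \<beta> c \<phi> \<phi>1 \<phi>2 Y1 Y2 w0 w
begin

lemma Lf_time_DERIV: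
  assumes t: "t \<ge> 0"
  shows "((\<lambda>s. Lf j (u s) (v s) r) has_real_derivative
     - ip (v t) (\<lambda>x. (deriv ^^ Suc j) Y2 (x + r)) + (- ip (G t) (\<lambda>x. (deriv ^^ Suc j) Y1 (x + r))
       - ip (u2 t) (\<lambda>x. (deriv ^^ (3 + j)) Y1 (x + r)))) (at t within {0..})"
proof -
  have 1: "((\<lambda>s. pr ((deriv ^^ j) Y2) (u s) r) has_real_derivative - ip (v t) (\<lambda>x. (deriv ^^ Suc j) Y2 (x + r))) (at t within {0..})"
    using sol_eq_u[OF test_shift[OF tY(2)[of j]] t, of r] by (simp add: pr_def deriv_shift[OF tY(2)])
  have 2: "((\<lambda>s. pr ((deriv ^^ j) Y1) (v s) r) has_real_derivative (- ip (G t) (\<lambda>x. (deriv ^^ Suc j) Y1 (x + r))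
       - ip (u2 t) (\<lambda>x. (deriv ^^ (3 + j)) Y1 (x + r)))) (at t within {0..})"
    using sol_eq_v[OF test_shift[OF tY(1)[of j]] t, of r]
    by (simp add: pr_def deriv_shift[OF tY(1)] deriv_n_shift[OF tY(1)] funpow_add del: funpow.simps(2)) (simp add: funpow_add eval_nat_numeral)
  show ?thesis unfolding Lf_def by (rule DERIV_add[OF 1 2])
qed

abbreviation slope :: "real \<Rightarrow> real \<Rightarrow> real" where
  "slope t r \<equiv> daction (u t) (u1 t) (u2 t) (v t) (\<lambda>x. deriv Y1 (x + r)) (\<lambda>x. deriv (deriv Y1) (x + r))
     (\<lambda>x. deriv (deriv (deriv Y1)) (x + r)) (\<lambda>x. deriv Y2 (x + r))"

text \<open>The criticality condition \<open>Lf 1 = 0\<close> says that the direction is tangent to the level set of the momentum;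
  it turns the pairing with the gradient of the energy into one with the gradient of the action.\<close>
lemma slope_eq:
  assumes t: "t \<ge> 0" and z: "Lf 1 (u t) (v t) r = 0"
  shows "- ip (v t) (\<lambda>x. (deriv ^^ Suc 0) Y2 (x + r)) + (- ip (G t) (\<lambda>x. (deriv ^^ Suc 0) Y1 (x + r))
       - ip (u2 t) (\<lambda>x. (deriv ^^ (3 + 0)) Y1 (x + r))) = - slope t r"
proof -
  let ?h = "\<lambda>x. deriv Y1 (x + r)" and ?h1 = "\<lambda>x. deriv (deriv Y1) (x + r)"
    and ?h2 = "\<lambda>x. deriv (deriv (deriv Y1)) (x + r)" and ?g = "\<lambda>x. deriv Y2 (x + r)"
  have th: "test_fun ?h" by (rule test_shift[OF test_deriv[OF tY1]])
  have L: "L2 ?h" "L2 ?h1" "L2 ?h2" "L2 ?g"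
    by (intro L2_shift test_L2 test_deriv tY1 tY2)+
  note Lu = sol_L2[OF t] and Lv = sol_at(2)[OF t] and Lf' = sol_f_L2(1)[OF t]
  have dh: "deriv ?h = ?h1" by (rule deriv_shift[OF test_deriv[OF tY1]])
  have "ip (u1 t) (deriv ?h) = - ip (u2 t) ?h"
    using W1D(3)[OF W2D(2)[OF sol_at(1)[OF t]]] th unfolding weak_deriv_ip by blast
  then have i1: "ip (u1 t) ?h1 = - ip (u2 t) ?h" unfolding dh .
  have "ip (u t) ?g + ip (v t) ?h = 0" using z by (simp add: Lf_def pr_def)
  then have zz: "c * ip (u t) ?g + c * ip (v t) ?h = 0" by (simp flip: distrib_left)
  have G: "ip (G t) ?h = ip (u t) ?h + \<beta> * ip (u2 t) ?h - ip (\<lambda>x. f (u t x)) ?h"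
    unfolding G_def[abs_def] by (simp only: ip_diff_left ip_add_left ip_scale_left L2_add L2_scale Lu Lf' L)
  have A: "ip (\<lambda>x. c * u t x + v t x) (\<lambda>x. c * ?h x + ?g x)
     = c^2 * ip (u t) ?h + c * ip (u t) ?g + c * ip (v t) ?h + ip (v t) ?g"
    by (simp only: ip_add_left ip_add_right ip_scale_left ip_scale_right L2_add L2_scale Lu Lv L)
       (simp add: power2_eq_square algebra_simps)
  show ?thesis
    unfolding daction_def Bq_def A i1 using zz by (simp add: G eval_nat_numeral algebra_simps)
qed

section \<open>The translation parameter along a solution\<close>

definition adm :: "real \<Rightarrow> real \<Rightarrow> real \<Rightarrow> bool" where
  "adm \<epsilon> t r \<longleftrightarrow> Lf 1 (u t) (v t) r = 0 \<and> cl \<epsilon> (u t) (u1 t) (v t) r"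

text \<open>The old parameter \<open>r0\<close> fails to be a zero of \<open>Lf 1\<close> at time
  \<open>s\<close> by at most a multiple of \<open>\<bar>s - t\<bar>\<close>, since the pairing is
  differentiable in time; \<open>steep_zero\<close> converts this into the distance of the new
  zero.\<close>

lemma adm_persist:
  assumes T: "tube \<epsilon> \<delta>" and t: "t \<ge> 0" and a: "adm \<epsilon> t r0"
  shows "\<exists>K\<ge>0. \<exists>d>0. \<forall>s\<ge>0. \<bar>s - t\<bar> < d \<longrightarrow> (\<exists>r. adm \<epsilon> s r \<and> \<bar>r - r0\<bar> \<le> K * \<bar>s - t\<bar>)"
proof -
  note tu = tubeD[OF T]
  have z0: "Lf 1 (u t) (v t) r0 = 0" and cl0: "cl \<epsilon> (u t) (u1 t) (v t) r0" using a by (auto simp: adm_def)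
  obtain \<eta> where \<eta>: "\<eta> > 0" "cl (\<epsilon> - \<eta>) (u t) (u1 t) (v t) r0" using cl_slack[OF cl0] by blast
  have e2: "\<eta> / 2 > 0" using \<eta>(1) by simp
  obtain d1 where d1: "d1 > 0" "\<And>s. s \<ge> 0 \<Longrightarrow> \<bar>s - t\<bar> < d1 \<Longrightarrow> nrm (\<lambda>x. u s x - u t x) < \<eta> / 2 \<and> nrm (\<lambda>x. u1 s x - u1 t x) < \<eta> / 2
     \<and> nrm (\<lambda>x. v s x - v t x) < \<eta> / 2" using sol_cont[OF t e2] by blast
  obtain d2 where d2: "d2 > 0" "\<And>r r'. \<bar>r - r'\<bar> < d2 \<Longrightarrow> cl (\<eta> / 2) (phr r) (\<lambda>x. \<phi>1 (x + r)) (phv r) r'"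
    using phr_close[OF e2] by blast
  obtain D where "((\<lambda>s. Lf 1 (u s) (v s) r0) has_real_derivative D) (at t within {0..})"
    using Lf_time_DERIV[OF t] by blast
  then have "((\<lambda>s. Lf 1 (u s) (v s) r0) has_derivative (\<lambda>x. D * x)) (at t within {0..})"
    by (simp add: has_field_derivative_def)
  then obtain d3 where d3: "d3 > 0" "\<And>s. s \<ge> 0 \<Longrightarrow> \<bar>s - t\<bar> < d3 \<Longrightarrow> \<bar>Lf 1 (u s) (v s) r0 - Lf 1 (u t) (v t) r0 - D * (s - t)\<bar> \<le> 1 * \<bar>s - t\<bar>"
    unfolding has_derivative_within_alt real_norm_def by (meson atLeast_iff zero_less_one)
  \<comment> \<open>\<open>\<bar>D\<bar> + 1\<close> bounds the rate at which \<open>Lf 1\<close>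
    changes in time at \<open>r0\<close>, and \<open>\<gamma> / 2\<close> bounds its slope in the
    translation from below.\<close>
  define K where "K = (\<bar>D\<bar> + 1) / (\<gamma> / 2)"
  have K: "K > 0" using \<gamma>_pos by (simp add: K_def add_nonneg_pos)
  define d where "d = min (min d1 d3) (min (\<delta> / (2 * K)) (d2 / (2 * K)))"
  have d: "d > 0" "d \<le> d1" "d \<le> d3" "d \<le> \<delta> / (2 * K)" "d \<le> d2 / (2 * K)"
    using d1 d2 d3 tu(3) K unfolding d_def by (simp_all only: min_less_iff_conj min_le_iff_disj order_refl) simp_all
  show ?thesis
  proof (rule exI[of _ K], rule conjI[OF less_imp_le[OF K]], rule exI[of _ d], rule conjI[OF d(1)], intro allI impI)
    fix s assume s: "0 \<le> s" "\<bar>s - t\<bar> < d"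
    note b = d1(2)[OF s(1)]
    note Ls = sol_L2[OF s(1)] sol_at(2)[OF s(1)] and Lt = sol_L2[OF t] sol_at(2)[OF t]
    have "\<bar>s - t\<bar> < d1" using s(2) d(2) by linarith
    then have cls0: "cl (\<eta> / 2 + (\<epsilon> - \<eta>)) (u s) (u1 s) (v s) r0"
      by (intro cl_near[OF \<eta>(2)] Ls Lt) (use b in auto)
    then have cls: "cl (\<epsilon> - \<eta> / 2) (u s) (u1 s) (v s) r0" by (rule cl_mono) simp
    have cls': "cl \<epsilon> (u s) (u1 s) (v s) r0" by (rule cl_mono[OF cls]) (use \<eta>(1) in simp)
    let ?L = "Lf 1 (u s) (v s) r0"
    have "\<bar>s - t\<bar> < d3" using s(2) d(3) by linarith
    then have "\<bar>?L - D * (s - t)\<bar> \<le> \<bar>s - t\<bar>" using d3(2)[OF s(1)] z0 by simp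
    then have "\<bar>?L\<bar> \<le> \<bar>D * (s - t)\<bar> + \<bar>s - t\<bar>" by linarith
    then have Lb: "\<bar>?L\<bar> \<le> (\<bar>D\<bar> + 1) * \<bar>s - t\<bar>" by (simp add: abs_mult distrib_right)
    have KL: "\<bar>?L\<bar> / (\<gamma> / 2) \<le> K * \<bar>s - t\<bar>"
      using divide_right_mono[OF Lb, of "\<gamma> / 2"] \<gamma>_pos unfolding K_def by (simp only: times_divide_eq_left)
    have "K * \<bar>s - t\<bar> < K * d" using s(2) K by simp
    moreover have "K * d \<le> \<delta> / 2" "K * d \<le> d2 / 2"
      using mult_left_mono[OF d(4), of K] mult_left_mono[OF d(5), of K] K by simp_all
    ultimately have Ks: "K * \<bar>s - t\<bar> < \<delta>" "K * \<bar>s - t\<bar> < d2" using tu(3) d2(1) by linarith+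
    have G: "\<bar>?L\<bar> \<le> \<gamma> / 2 * \<delta>"
    proof -
      have "\<bar>?L\<bar> / (\<gamma> / 2) \<le> \<delta>" using KL Ks(1) by linarith
      then show ?thesis using \<gamma>_pos by (simp add: pos_divide_le_eq mult.commute)
    qed
    have "\<exists>r. \<bar>r - r0\<bar> \<le> \<bar>Lf 1 (u s) (v s) r0\<bar> / (\<gamma> / 2) \<and> Lf 1 (u s) (v s) r = 0"
    proof (rule steep_zero[where G = "Lf 1 (u s) (v s)" and ?G2.0 = "Lf 2 (u s) (v s)" and \<delta> = \<delta>])
      show "(Lf 1 (u s) (v s) has_real_derivative Lf 2 (u s) (v s) x) (at x)" for x
        using Lf_DERIV[OF Ls(1,4), of 1 x] by (simp add: eval_nat_numeral)
      show "\<gamma> / 2 \<le> Lf 2 (u s) (v s) x" if "\<bar>x - r0\<bar> \<le> \<delta>" for x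
        by (rule tu(5)[OF Ls(1,4) cls' that])
      show "\<bar>?L\<bar> \<le> \<gamma> / 2 * \<delta>" by (rule G)
    qed (use \<gamma>_pos in simp)
    then obtain r where r: "\<bar>r - r0\<bar> \<le> \<bar>?L\<bar> / (\<gamma> / 2)" "Lf 1 (u s) (v s) r = 0" by blast
    have rK: "\<bar>r - r0\<bar> \<le> K * \<bar>s - t\<bar>" using r(1) KL by linarith
    have "\<bar>r0 - r\<bar> < d2" using rK Ks(2) by linarith
    from cl_triangle[OF cls d2(2)[OF this] Ls(1,2,4)] have "cl \<epsilon> (u s) (u1 s) (v s) r" by simp
    then show "\<exists>r. adm \<epsilon> s r \<and> \<bar>r - r0\<bar> \<le> K * \<bar>s - t\<bar>" using r(2) rK unfolding adm_def by blast
  qed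
qed

lemma Lf0_critical:
  assumes L: "L2 a" "L2 b" and z: "Lf 1 a b r = 0"
  shows "\<bar>Lf 0 a b r' - Lf 0 a b r\<bar> \<le> ((nrm a + nrm b) * nY 2) * (r' - r)^2"
proof -
  have "\<bar>Lf 0 a b r' - Lf 0 a b r - (r' - r) * Lf 1 a b r\<bar> \<le> ((nrm a + nrm b) * nY 2) * (r' - r)^2"
  proof (rule second_order_bound[where S = UNIV])
    show "(Lf 0 a b has_real_derivative Lf 1 a b x) (at x within UNIV)" for x
      using Lf_DERIV[OF L, of 0 x] by simp
    show "\<bar>Lf 1 a b x - Lf 1 a b r\<bar> \<le> ((nrm a + nrm b) * nY 2) * \<bar>x - r\<bar>" for x
    proof (rule lipschitz_of_deriv_bound[where S = UNIV and f' = "Lf 2 a b"])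
      show "(Lf 1 a b has_real_derivative Lf 2 a b y) (at y within UNIV)" for y
        using Lf_DERIV[OF L, of 1 y] by (simp add: eval_nat_numeral)
      show "\<bar>Lf 2 a b y\<bar> \<le> (nrm a + nrm b) * nY 2" for y by (rule Lf_bound[OF L])
    qed auto
  qed (auto simp: nY_nonneg add_nonneg_nonneg)
  then show ?thesis using z by simp
qed

text \<open>The envelope argument, with no derivative of \<open>R\<close> involved. The pairing at
  time \<open>s\<close> is critical at \<open>R s\<close>, and \<open>R s - R t\<close> is at most
  linear in \<open>s - t\<close>, so freezing the parameter at \<open>R t\<close> costs a quadratic
  error; what remains is the derivative at fixed translation.\<close>

lemma envelope_DERIV:
  assumes T: "tube \<epsilon> \<delta>" and R: "\<And>t. t > 0 \<Longrightarrow> adm \<epsilon> t (R t)" and t: "t > 0"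
  shows "((\<lambda>s. Lf 0 (u s) (v s) (R s)) has_real_derivative - slope t (R t)) (at t)"
proof -
  have t0: "t \<ge> 0" using t by simp
  note tu = tubeD[OF T]
  define M where "M = (1 + \<bar>c\<bar>) * nrm \<phi> + 2"
  have M: "M \<ge> 0" by (simp add: M_def add_nonneg_nonneg)
  let ?E = "\<lambda>s. Lf 0 (u s) (v s) (R s) - Lf 0 (u s) (v s) (R t)"
  have "(?E has_real_derivative 0) (at t within {0..})"
  proof (rule has_real_derivative_half_lineI)
    fix e :: real assume e: "e > 0"
    obtain K d where K: "K \<ge> 0" "d > 0" "\<And>s. s \<ge> 0 \<Longrightarrow> \<bar>s - t\<bar> < d \<Longrightarrow> \<exists>r. adm \<epsilon> s r \<and> \<bar>r - R t\<bar> \<le> K * \<bar>s - t\<bar>"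
      using adm_persist[OF T t0 R[OF t]] by blast
    define N where "N = M * nY 2 * K^2 + 1"
    have N: "N > 0" using M nY_nonneg[of 2] by (simp add: N_def add_nonneg_pos)
    show "\<exists>d>0. \<forall>s\<ge>0. \<bar>s - t\<bar> < d \<longrightarrow> \<bar>?E s - ?E t - (s - t) * 0\<bar> \<le> e * \<bar>s - t\<bar>"
    proof (intro exI[of _ "min (min d t) (e / N)"] conjI allI impI)
      show "0 < min (min d t) (e / N)" using K(2) t e N by simp
      fix s assume s: "0 \<le> s" "\<bar>s - t\<bar> < min (min d t) (e / N)"
      have s1: "\<bar>s - t\<bar> < d" "\<bar>s - t\<bar> < t" "\<bar>s - t\<bar> < e / N" using s(2) by auto
      have s0: "s > 0" using s1(2) by linarith
      obtain r where r: "adm \<epsilon> s r" "\<bar>r - R t\<bar> \<le> K * \<bar>s - t\<bar>" using K(3)[OF s(1) s1(1)] by blast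
      note Ls = sol_L2[OF s(1)] sol_at(2)[OF s(1)]
      \<comment> \<open>\<open>R\<close> is an arbitrary choice at each time; uniqueness identifies
        \<open>R s\<close> with the parameter found near \<open>R t\<close>.\<close>
      have "r = R s"
        using modulation_unique[OF T Ls(1,4)] r(1) R[OF s0] unfolding adm_def by blast
      then have rr: "\<bar>R t - R s\<bar> \<le> K * \<bar>s - t\<bar>" using r(2) by (simp add: abs_minus_commute)
      have nM: "nrm (u s) + nrm (v s) \<le> M"
        unfolding M_def using cl_norms[OF _ tu(2) Ls(1,4)] R[OF s0] unfolding adm_def by blast
      have "\<bar>Lf 0 (u s) (v s) (R t) - Lf 0 (u s) (v s) (R s)\<bar> \<le> ((nrm (u s) + nrm (v s)) * nY 2) * (R t - R s)^2"
        by (rule Lf0_critical[OF Ls(1,4)]) (use R[OF s0] in \<open>simp add: adm_def\<close>)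
      also have "\<dots> \<le> (M * nY 2) * (K * \<bar>s - t\<bar>)^2"
        using nM nY_nonneg[of 2] M power_mono[OF rr abs_ge_zero, of 2] by (intro mult_mono mult_right_mono) auto
      also have "\<dots> = (M * nY 2 * K^2) * \<bar>s - t\<bar> * \<bar>s - t\<bar>"
        by (simp only: power2_eq_square mult.assoc mult.left_commute mult.commute)
      also have "\<dots> \<le> N * \<bar>s - t\<bar> * \<bar>s - t\<bar>" by (intro mult_right_mono) (auto simp: N_def)
      also have "\<dots> \<le> e * \<bar>s - t\<bar>"
      proof (rule mult_right_mono)
        show "N * \<bar>s - t\<bar> \<le> e" using s1(3) N by (simp add: pos_less_divide_eq mult.commute)
      qed simp
      finally show "\<bar>?E s - ?E t - (s - t) * 0\<bar> \<le> e * \<bar>s - t\<bar>" by (simp add: abs_minus_commute)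
    qed
  qed
  moreover have z: "Lf 1 (u t) (v t) (R t) = 0" using R[OF t] by (simp add: adm_def)
  have "((\<lambda>s. Lf 0 (u s) (v s) (R t)) has_real_derivative - slope t (R t)) (at t within {0..})"
    using Lf_time_DERIV[OF t0, of 0 "R t"] unfolding slope_eq[OF t0 z] .
  ultimately have "((\<lambda>s. ?E s + Lf 0 (u s) (v s) (R t)) has_real_derivative 0 + - slope t (R t)) (at t within {0..})"
    by (rule DERIV_add)
  then have "((\<lambda>s. Lf 0 (u s) (v s) (R s)) has_real_derivative - slope t (R t)) (at t within {0..})" by simp
  moreover have "at t within {0..} = at t" using t by (intro at_within_interior) simp
  ultimately show ?thesis by simp
qed

lemma escape:
  assumes T: "tube \<epsilon> \<delta>" and ad: "\<And>t. t > 0 \<Longrightarrow> \<exists>r. adm \<epsilon> t r" and low: "action (u 0) (v 0) < dlevel"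
  shows False
proof -
  note tu = tubeD[OF T]
  obtain R where R: "\<And>t. t > 0 \<Longrightarrow> adm \<epsilon> t (R t)" using ad by metis
  define \<kappa> where "\<kappa> = dlevel - action (u 0) (v 0)"
  have \<kappa>: "\<kappa> > 0" using low by (simp add: \<kappa>_def)
  have act: "action (u t) (v t) = action (u 0) (v 0)" if "t \<ge> 0" for t
  proof -
    have "action (u t) (v t) = Smom c t - Phi (u t)" if "t \<ge> 0" for t
      unfolding action_W2[OF sol_at(1)[OF that]] Smom_def by simp
    then show ?thesis using action_conserved[OF that] that by simp
  qed
  have sl: "\<kappa> \<le> \<bar>slope t (R t)\<bar>" if t: "t > 0" for t
  proof -
    have t0: "t \<ge> 0" using t by simp
    have "cl \<epsilon> (u t) (u1 t) (v t) (R t)" using R[OF t] by (simp add: adm_def)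
    from tu(4)[OF sol_at(1)[OF t0] sol_at(2)[OF t0] this]
    obtain s where s: "\<bar>s\<bar> \<le> 1" "dlevel \<le> action (u t) (v t) + s * slope t (R t)" by blast
    have "s * slope t (R t) \<le> \<bar>s\<bar> * \<bar>slope t (R t)\<bar>" using abs_ge_self[of "s * slope t (R t)"] by (simp add: abs_mult)
    also have "\<dots> \<le> 1 * \<bar>slope t (R t)\<bar>" using s(1) by (intro mult_right_mono) auto
    finally show ?thesis using s(2) act[OF t0] by (simp add: \<kappa>_def)
  qed
  define B where "B = ((1 + \<bar>c\<bar>) * nrm \<phi> + 2) * nY 0"
  have bd: "\<bar>Lf 0 (u t) (v t) (R t)\<bar> \<le> B" if t: "t > 0" for t
  proof -
    have t0: "t \<ge> 0" using t by simp
    have "nrm (u t) + nrm (v t) \<le> (1 + \<bar>c\<bar>) * nrm \<phi> + 2"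
      using cl_norms[OF _ tu(2) sol_L2(1)[OF t0] sol_at(2)[OF t0]] R[OF t] unfolding adm_def by blast
    then have "(nrm (u t) + nrm (v t)) * nY 0 \<le> B" unfolding B_def using nY_nonneg by (rule mult_right_mono)
    then show ?thesis using Lf_bound[OF sol_L2(1)[OF t0] sol_at(2)[OF t0], of 0 "R t"] by linarith
  qed
  have B0: "B \<ge> 0" using order_trans[OF abs_ge_zero bd[of 1]] by simp
  \<comment> \<open>Over this length a slope of absolute value at least \<open>\<kappa>\<close>
    forces a change of at least \<open>2 * B + 1\<close>, more than a quantity bounded by
    \<open>B\<close> admits. The start is at time 1 because \<open>R\<close> is available at
    positive times only.\<close>
  let ?T = "1 + (2 * B + 1) / \<kappa>"
  have T1: "1 < ?T" using \<kappa> B0 by simp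
  have "\<exists>z>1. z < ?T \<and> Lf 0 (u ?T) (v ?T) (R ?T) - Lf 0 (u 1) (v 1) (R 1) = (?T - 1) * - slope z (R z)"
    by (rule MVT2[OF T1, of "\<lambda>t. Lf 0 (u t) (v t) (R t)"]) (rule envelope_DERIV[OF T R], simp_all)
  then obtain z where z: "z > 1" "Lf 0 (u ?T) (v ?T) (R ?T) - Lf 0 (u 1) (v 1) (R 1) = (?T - 1) * - slope z (R z)" by blast
  have "2 * B + 1 = (?T - 1) * \<kappa>" using \<kappa> by simp
  also have "\<dots> \<le> (?T - 1) * \<bar>slope z (R z)\<bar>" using sl[of z] z(1) T1 by (intro mult_left_mono) auto
  also have "\<dots> = \<bar>(?T - 1) * - slope z (R z)\<bar>"
  proof -
    have "x * \<bar>y\<bar> = \<bar>x * - y\<bar>" if "x > 0" for x y :: real using that by (simp add: abs_mult)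
    moreover have "?T - 1 > 0" using T1 by (simp only: diff_gt_0_iff_gt)
    ultimately show ?thesis by blast
  qed
  also have "\<dots> = \<bar>Lf 0 (u ?T) (v ?T) (R ?T) - Lf 0 (u 1) (v 1) (R 1)\<bar>" using z(2) by simp
  also have "\<dots> \<le> B + B" using bd[of ?T] bd[of 1] T1 by (intro order_trans[OF abs_triangle_ineq4 add_mono]) auto
  finally show False by simp
qed

end

theorem mainTheorem11:
  fixes f :: "real \<Rightarrow> real" and p \<beta> c :: real and \<phi> \<psi>1 \<psi>2 :: "real \<Rightarrow> real"
  assumes "p \<ge> 2"
    and "C2 f"
    and "\<forall>l>0. \<forall>s. f (l * s) = l powr p * f s"
    and "\<exists>s. Fprim f s > 0"
    and "c^2 < 1"
    and "\<beta> < 2 * sqrt (1 - c^2)"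
    and "\<phi> \<in> ground_states f p \<beta> c"
    and "H2 \<psi>1" and "H2 \<psi>2"
    and "L1 (wd \<psi>1)" and "L1 (wd \<psi>2)"
    and "(\<integral>x. (- c * \<phi> x) * wd \<psi>1 x + \<phi> x * wd \<psi>2 x \<partial>lborel) = 0"
    and "H2 (wd \<psi>1)"
    and "Hform f \<beta> c \<phi> (wd \<psi>1) (wd \<psi>2) < 0"
  shows "\<not> X_stable f \<beta> (orbit (\<phi>, \<lambda>x. - c * \<phi> x))"
proof
  assume stable: "X_stable f \<beta> (orbit (\<phi>, \<lambda>x. - c * \<phi> x))"
  obtain f1 f2 where df: "\<And>x. (f has_real_derivative f1 x) (at x)" "\<And>x. (f1 has_real_derivative f2 x) (at x)"
    "continuous_on UNIV f2" using assms(2) unfolding C2_def by blast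
  \<comment> \<open>The dilation by 2 gives both values at 0, through
    \<open>f 0 = 2 powr p * f 0\<close> and \<open>2 * f1 0 = 2 powr p * f1 0\<close>; the factor
    \<open>2 powr p\<close> is neither 1 nor 2.\<close>
  have p2: "2 powr p \<ge> 4" using powr_mono[OF assms(1), of 2] by simp
  have hom: "f (2 * s) = 2 powr p * f s" for s using assms(3) by simp
  have f0: "f 0 = 0" using hom[of 0] assms(1) by simp
  have f10: "f1 0 = 0"
  proof -
    have "((\<lambda>s. f (2 * s)) has_real_derivative f1 (2 * 0) * 2) (at 0)"
      by (rule DERIV_chain2[OF df(1)]) (auto intro!: derivative_eq_intros)
    moreover have "((\<lambda>s. f (2 * s)) has_real_derivative 2 powr p * f1 0) (at 0)"
      unfolding hom by (intro DERIV_cmult df(1))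
    ultimately have "f1 (2 * 0) * 2 = 2 powr p * f1 0" by (rule DERIV_unique)
    then show ?thesis using p2 by auto
  qed
  interpret nonlin f f1 f2 by unfold_locales (use df f0 f10 in auto)
  have H\<phi>: "W2 \<phi> (wd \<phi>) (wd (wd \<phi>))" using assms(7) by (intro W2_wd) (simp add: ground_states_def)
  have W\<psi>2: "W2 \<psi>2 (wd \<psi>2) (wd (wd \<psi>2))" by (rule W2_wd[OF assms(9)])
  note Wy = W2_wd[OF assms(13)]
  have Ly: "L2 (wd \<psi>1)" "L2 (wd \<psi>2)" using W2D(3)[OF Wy] W2D(4)[OF W\<psi>2] by auto
  have K: "Kfun f p \<phi> > 0" by (rule ground_K_pos[OF assms(5-7,13) Ly(2) assms(14)])
  interpret ground f f1 f2 p \<beta> c \<phi> "wd \<phi>" "wd (wd \<phi>)"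
    by unfold_locales (use assms(1,5-7) H\<phi> K in auto)
  have orth: "ip \<phi> (wd \<psi>2) - c * ip \<phi> (wd \<psi>1) = 0"
  proof -
    have i: "integrable lborel (\<lambda>x. (- c * \<phi> x) * wd \<psi>1 x)" "integrable lborel (\<lambda>x. \<phi> x * wd \<psi>2 x)"
      by (intro L2_mult_integrable L2_scale W2D(3)[OF H\<phi>] Ly)+
    have "ip (\<lambda>x. - c * \<phi> x) (wd \<psi>1) + ip \<phi> (wd \<psi>2) = 0"
      using assms(12) Bochner_Integration.integral_add[OF i] by (simp add: ip_def)
    then show ?thesis unfolding ip_scale_left by simp
  qed
  have neg: "hess \<phi> (wd \<psi>1) (wd (wd \<psi>1)) (wd (wd (wd \<psi>1))) (wd \<psi>2) < 0"
    using assms(14) unfolding Hform_eq[OF W2D(1)[OF H\<phi>] Wy Ly(2)] hess_def .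
  obtain Y1 Y2 where Y: "test_fun Y1" "test_fun Y2" "ip \<phi> (deriv Y2) - c * ip \<phi> (deriv Y1) = 0"
    "hess \<phi> (deriv Y1) (deriv (deriv Y1)) (deriv (deriv (deriv Y1))) (deriv Y2) < 0"
    "ip \<phi> (deriv (deriv Y2)) - c * ip \<phi> (deriv (deriv Y1)) > 0"
    using test_profile[OF W2D(1)[OF W2_wd[OF assms(8)]] Wy W\<psi>2 orth neg] by blast
  interpret modul f f1 f2 p \<beta> c \<phi> "wd \<phi>" "wd (wd \<phi>)" Y1 Y2
    by unfold_locales (rule Y)+
  obtain \<epsilon> \<delta> where T: "tube \<epsilon> \<delta>" using tube_exists by blast
  \<comment> \<open>Stability is invoked with this radius: closeness within
    \<open>\<epsilon>2\<close> to some translate yields a critical translation at which the state is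
    close within \<open>\<epsilon>\<close>.\<close>
  obtain \<epsilon>2 where \<epsilon>2: "\<epsilon>2 > 0" "\<And>a a1 b \<rho>. L2 a \<Longrightarrow> L2 a1 \<Longrightarrow> L2 b \<Longrightarrow> cl \<epsilon>2 a a1 b \<rho> \<Longrightarrow>
     \<exists>r. Lf 1 a b r = 0 \<and> cl \<epsilon> a a1 b r" using modulation_exists[OF T] by blast
  let ?\<phi> = "(\<phi>, \<lambda>x. - c * \<phi> x)"
  obtain d where d: "d > 0" "\<forall>w0. inX w0 \<and> (INF z\<in>orbit ?\<phi>. Xdist w0 z) < d \<longrightarrow>
      (\<exists>w. global_solution f \<beta> w0 w \<and> (\<exists>\<eta><\<epsilon>2. \<forall>t>0. (INF z\<in>orbit ?\<phi>. Xdist (w t) z) \<le> \<eta>))"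
    using stable[unfolded X_stable_def, THEN spec, THEN mp, OF \<epsilon>2(1)] by (elim exE conjE) (rule that)
  obtain s where s: "action (\<lambda>x. \<phi> x + s * deriv Y1 x) (\<lambda>x. - c * \<phi> x + s * deriv Y2 x) < dlevel"
    "Xdist (\<lambda>x. \<phi> x + s * deriv Y1 x, \<lambda>x. - c * \<phi> x + s * deriv Y2 x) ?\<phi> < d"
    using initial_data[OF d(1)] by blast
  let ?a = "\<lambda>x. \<phi> x + s * deriv Y1 x" and ?b = "\<lambda>x. - c * \<phi> x + s * deriv Y2 x"
  have Wa: "W2 ?a (\<lambda>x. wd \<phi> x + s * deriv (deriv Y1) x) (\<lambda>x. wd (wd \<phi>) x + s * deriv (deriv (deriv Y1)) x)"
    by (rule W2_add_scale[OF H\<phi> W2_test[OF test_deriv[OF Y(1)]]])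
  have Lb: "L2 ?b" by (intro L2_add L2_scale W2D(3)[OF H\<phi>] test_L2 test_deriv Y)
  have X: "inX (?a, ?b)" unfolding inX_def using W2_H2(1)[OF Wa] Lb by simp
  have Xdist_nonneg: "0 \<le> Xdist x z" for x z
    unfolding Xdist_def H2norm_sq_def L2norm_sq_def by (intro real_sqrt_ge_zero add_nonneg_nonneg integral_nonneg_AE) auto
  have "(INF z\<in>orbit ?\<phi>. Xdist (?a, ?b) z) \<le> Xdist (?a, ?b) ?\<phi>"
  proof (rule cINF_lower)
    show "bdd_below ((Xdist (?a, ?b)) ` orbit ?\<phi>)" using Xdist_nonneg by (intro bdd_belowI[of _ 0]) auto
    have "?\<phi> = shift 0 ?\<phi>" by (simp add: shift_def)
    then show "?\<phi> \<in> orbit ?\<phi>" unfolding orbit_def by (rule range_eqI)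
  qed
  then have "(INF z\<in>orbit ?\<phi>. Xdist (?a, ?b) z) < d" using s(2) by linarith
  from d(2)[THEN spec, THEN mp, OF conjI[OF X this]]
  obtain w \<eta> where w: "global_solution f \<beta> (?a, ?b) w" "\<eta> < \<epsilon>2"
    "\<forall>t>0. (INF z\<in>orbit ?\<phi>. Xdist (w t) z) \<le> \<eta>" by (elim exE conjE) (rule that)
  interpret modul_soln f f1 f2 p \<beta> c \<phi> "wd \<phi>" "wd (wd \<phi>)" Y1 Y2 "(?a, ?b)" w
    by unfold_locales (rule w(1))
  have "\<exists>r. adm \<epsilon> t r" if t: "t > 0" for t
  proof -
    have t0: "t \<ge> 0" using t by simp
    \<comment> \<open>The infimum may fail to be attained, but the strict bound, due to
      \<open>\<eta> < \<epsilon>2\<close>, gives an element of the orbit within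
      \<open>\<epsilon>2\<close>.\<close>
    have "(INF z\<in>orbit ?\<phi>. Xdist (w t) z) < \<epsilon>2" using le_less_trans[OF w(3)[rule_format, OF t] w(2)] .
    moreover have "(\<lambda>z. Xdist (w t) z) ` orbit ?\<phi> \<noteq> {}" by (simp add: orbit_def)
    ultimately obtain \<rho> where "Xdist (w t) (shift \<rho> ?\<phi>) < \<epsilon>2"
      using cInf_lessD[of "(\<lambda>z. Xdist (w t) z) ` orbit ?\<phi>" \<epsilon>2] by (auto simp: orbit_def)
    then have "Xdist (u t, v t) (\<lambda>x. \<phi> (x + \<rho>), \<lambda>x. - c * \<phi> (x + \<rho>)) < \<epsilon>2" by (simp add: shift_def)
    then have "cl \<epsilon>2 (u t) (u1 t) (v t) \<rho>"
      unfolding cl_def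
      using Xdist_lower[OF sol_at(1)[OF t0] W2_shift[OF H\<phi>, of \<rho>], of "v t" "\<lambda>x. - c * \<phi> (x + \<rho>)"] by linarith
    from \<epsilon>2(2)[OF sol_L2(1,2)[OF t0] sol_at(2)[OF t0] this] show ?thesis unfolding adm_def by blast
  qed
  moreover have "action (u 0) (v 0) < dlevel"
  proof -
    have "is_solution f \<beta> (?a, ?b) 1 w" using w(1) by (simp add: global_solution_def)
    then have "Xdist (u 0, v 0) (?a, ?b) = 0" unfolding is_solution_def by simp
    then have "action (u 0) (v 0) = action ?a ?b"
      by (rule action_cong[OF sol_at(1)[OF order_refl] sol_at(2)[OF order_refl] Wa Lb])
    then show ?thesis using s(1) by simp
  qed
  ultimately show False by (rule escape[OF T])
qed

end
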